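(* Let $0<\alpha<n$, $1<p\le q<\infty$, let $m\ge1$ be an integer and $b\in CMO(\mathbb R^n)$. Suppose $s\in[p,q]$ and $\delta>0$, and $(u,v)$ is a pair of weights satisfying $$\sup_Q|Q|^{\frac\alpha n+\frac1q-\frac1p}\|u^{\frac1q}\|_{L^q(\log L)^{(m+\frac1{s'})q+\delta},Q}\,\|v^{-\frac1p}\|_{L^{p'}(\log L)^{(m+\frac1s)p'+\delta},Q}<\infty$$ (supremum over all cubes $Q$). Then $(I_\alpha)^m_b:L^p(v)\to L^q(u)$ is a compact operator.
   Context: A weight is a nonnegative locally integrable function; for a pair $(u,v)$, $u$ is positive on a set of positive measure and $v$ is positive a.e. For a Young function $A$ and cube $Q$, $\|f\|_{A,Q}=\inf\{\lambda>0:\frac1{|Q|}\int_QA(|f|/\lambda)\le1\}$; $\|f\|_{L^r(\log L)^a,Q}$ denotes this with $A(t)=t^r\log(e+t)^a$; $r'=r/(r-1)$. $CMO$ is the closure of $C_c^\infty(\mathbb R^n)$ in the $BMO$ norm $\|b\|_{BMO}=\sup_Q\frac1{|Q|}\int_Q|b-b_Q|$. $I_\alpha f(x)=\int\frac{f(y)}{|x-y|^{n-\alpha}}dy$ and $(I_\alpha)^m_bf(x)=\int(b(x)-b(y))^m\frac{f(y)}{|x-y|^{n-\alpha}}dy$ (the $m$-th iterated commutator of $I_\alpha$ with $b$). *)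

theory Defs
  imports "HOL-Analysis.Analysis"
begin

text \<open>Cubes in R^n with sides parallel to the axes (closed; boundary is null).\<close>
definition cube :: "(real^'n) set \<Rightarrow> bool" where
  "cube Q \<longleftrightarrow> (\<exists>a l. l > 0 \<and> Q = cbox a (a + l *\<^sub>R One))"

definition conj_exp :: "real \<Rightarrow> real" where
  "conj_exp r = r / (r - 1)"

definition locally_integrable :: "(real^'n \<Rightarrow> real) \<Rightarrow> bool" where
  "locally_integrable w \<longleftrightarrow> (\<forall>K. compact K \<longrightarrow> set_integrable lebesgue K w)"

definition weight :: "(real^'n \<Rightarrow> real) \<Rightarrow> bool" where
  "weight w \<longleftrightarrow> (\<forall>x. w x \<ge> 0) \<and> locally_integrable w"

definition lux_norm :: "real \<Rightarrow> real \<Rightarrow> (real^'n \<Rightarrow> real) \<Rightarrow> (real^'n) set \<Rightarrow> ennreal" where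
  "lux_norm r a f Q = Inf {ennreal lam | lam. lam > 0 \<and>
     (\<integral>\<^sup>+ x\<in>Q. ennreal ((\<bar>f x\<bar> / lam) powr r * ln (exp 1 + \<bar>f x\<bar> / lam) powr a) \<partial>lebesgue)
        \<le> ennreal (measure lebesgue Q)}"

definition avg :: "(real^'n \<Rightarrow> real) \<Rightarrow> (real^'n) set \<Rightarrow> real" where
  "avg b Q = (1 / measure lebesgue Q) * (LINT x:Q|lebesgue. b x)"

definition bmo_norm :: "(real^'n \<Rightarrow> real) \<Rightarrow> ennreal" where
  "bmo_norm b = (SUP Q\<in>{Q. cube Q}.
      ennreal ((1 / measure lebesgue Q) * (LINT x:Q|lebesgue. \<bar>b x - avg b Q\<bar>)))"

definition BMO :: "(real^'n \<Rightarrow> real) set" where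
  "BMO = {b. locally_integrable b \<and> bmo_norm b < \<infinity>}"

fun pd_iter :: "'n list \<Rightarrow> (real^'n \<Rightarrow> real) \<Rightarrow> (real^'n \<Rightarrow> real)" where
  "pd_iter [] f = f"
| "pd_iter (i # is) f = (\<lambda>x. deriv (\<lambda>t. pd_iter is f (x + t *\<^sub>R axis i 1)) 0)"

definition smooth :: "(real^'n \<Rightarrow> real) \<Rightarrow> bool" where
  "smooth f \<longleftrightarrow> (\<forall>is. continuous_on UNIV (pd_iter is f) \<and>
      (\<forall>i x. (\<lambda>t. pd_iter is f (x + t *\<^sub>R axis i 1)) differentiable (at 0)))"

definition Cc_infty :: "(real^'n \<Rightarrow> real) set" where
  "Cc_infty = {f. smooth f \<and> compact (closure {x. f x \<noteq> 0})}"

definition CMO :: "(real^'n \<Rightarrow> real) set" where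
  "CMO = {b. b \<in> BMO \<and> (\<forall>e>0. \<exists>\<phi>\<in>Cc_infty. bmo_norm (\<lambda>x. b x - \<phi> x) < ennreal e)}"

definition frac_comm :: "real \<Rightarrow> nat \<Rightarrow> (real^'n \<Rightarrow> real) \<Rightarrow> (real^'n \<Rightarrow> real) \<Rightarrow> (real^'n \<Rightarrow> real)" where
  "frac_comm \<alpha> m b f = (\<lambda>x. LINT y|lebesgue.
      (b x - b y) ^ m * f y / norm (x - y) powr (real CARD('n) - \<alpha>))"

definition wLp :: "real \<Rightarrow> (real^'n \<Rightarrow> real) \<Rightarrow> (real^'n \<Rightarrow> real) set" where
  "wLp p w = {f. f \<in> borel_measurable lebesgue \<and>
      (\<integral>\<^sup>+ x. ennreal (\<bar>f x\<bar> powr p * w x) \<partial>lebesgue) < \<infinity>}"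

definition wnorm :: "real \<Rightarrow> (real^'n \<Rightarrow> real) \<Rightarrow> (real^'n \<Rightarrow> real) \<Rightarrow> real" where
  "wnorm p w f = (LINT x|lebesgue. \<bar>f x\<bar> powr p * w x) powr (1 / p)"

definition compact_op :: "((real^'n \<Rightarrow> real) \<Rightarrow> (real^'n \<Rightarrow> real)) \<Rightarrow> real \<Rightarrow> (real^'n \<Rightarrow> real)
    \<Rightarrow> real \<Rightarrow> (real^'n \<Rightarrow> real) \<Rightarrow> bool" where
  "compact_op T p v q u \<longleftrightarrow>
     (\<forall>f\<in>wLp p v. T f \<in> wLp q u) \<and>
     (\<forall>F::nat \<Rightarrow> (real^'n \<Rightarrow> real). (\<forall>k. F k \<in> wLp p v) \<and> bounded (range (\<lambda>k. wnorm p v (F k)))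
        \<longrightarrow> (\<exists>r g. strict_mono r \<and> g \<in> wLp q u \<and>
               (\<lambda>k. wnorm q u (\<lambda>x. T (F (r k)) x - g x)) \<longlonglongrightarrow> 0))"

end

theory Submission
  imports Defs "HOL-Library.Diagonal_Subsequence"
begin

text \<open>
  The commutator kernel is dominated by a sum over boundedly many shifted dyadic grids of
  \<open>|Q|\<^bsup>\<alpha>/n-1\<^esup> \<Phi>\<^sub>Q(x) \<Phi>\<^sub>Q(y)\<close>, where \<open>\<Phi>\<^sub>Q = (1 + |b - b\<^sub>Q|)\<^sup>m\<close>. Passing from a cell to a subcell
  \<open>k\<close> generations below changes \<open>\<Phi>\<close> by a factor polynomial in \<open>k\<close>, which the geometric decay of
  \<open>|Q|\<^bsup>\<alpha>/n\<^esup>\<close> absorbs, so a stopping time argument reduces the bilinear form to a sparse family of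
  cells. On one cell the weight is cut at the levels \<open>log(e + w/\<lambda>) \<approx> 2\<^sup>i\<close>, and Hoelder's inequality
  is applied with exponents that differ from \<open>p\<close> and \<open>p'\<close> by a multiple of \<open>2\<^bsup>-i\<^esup>\<close>: the moments
  of \<open>\<Phi>\<close> (John--Nirenberg) cost \<open>2\<^bsup>im\<^esup>\<close>, the Carleson embedding costs \<open>2\<^bsup>i/s\<^esup>\<close>, and the logarithmic bump
  pays for both, with \<open>\<delta>\<close> left over for summability. Compactness follows because \<open>b\<close> may be
  replaced by a continuous function with compact support, after which the kernel is cut off near
  the diagonal and at infinity and approximated by kernels of finite rank.
\<close>


section \<open>Lebesgue measure and Hoelder's inequality\<close>

text \<open>A fixed change of exponents in Hoelder's inequality would require power bumps. A
  logarithmic bump only tolerates a change inversely proportional to log(e + w/lam), because then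
  the surplus power of w stays bounded; this forces the decomposition into levels. The exponents
  degenerate as i grows, so everything hinges on constants: with \<epsilon> =
  \<open>bump_eps\<close>, the moments of Phi may cost a factor \<epsilon>^(-m) and the Carleson
  embedding a factor 1/\<epsilon>, but no more. The second loss is shared by the two weights through
  Hoelder's inequality for sums over cells with exponents s and s'; one side pays 2^(i/s), the other
  2^(i/s'), and p \<le> s, q' \<le> s' is where s in [p,q] enters. Compactness also needs decay of
  both weights at infinity. It is no hypothesis but is extracted from boundedness, by testing
  I_\<alpha> on functions supported in a ball or in annuli. Generations are natural numbers, so each
  grid has a coarsest side h. The bounds do not depend on h, and h tends to infinity at the end of
  the bilinear estimate.\<close>

lemma sigma_finite_lebesgue: "sigma_finite_measure (lebesgue :: 'a::euclidean_space measure)"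
proof -
  obtain A :: "nat \<Rightarrow> 'a set" where A: "range A \<subseteq> sets lborel" "(\<Union>i. A i) = space lborel" "\<And>i. emeasure lborel (A i) \<noteq> \<infinity>"
    using lborel.sigma_finite by blast
  have "\<And>i. A i \<in> sets lborel" using A(1) by auto
  then have "range A \<subseteq> sets lebesgue" "\<And>i. emeasure lebesgue (A i) \<noteq> \<infinity>"
    using A by (auto simp: emeasure_completion)
  moreover have "(\<Union>i. A i) = space (lebesgue :: 'a measure)" using A(2) by simp
  ultimately show ?thesis
    by unfold_locales (rule exI[of _ "range A"], auto)
qed

text \<open>\<open>b\<close> and the weights are merely Lebesgue measurable, so kernels live on a
  product of two completed measures. Sigma-finiteness is what makes their partial integrals
  measurable there.\<close>

interpretation lebesgue: sigma_finite_measure "lebesgue :: 'a::euclidean_space measure"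
  by (rule sigma_finite_lebesgue)

interpretation lebesgue_pair: pair_sigma_finite
  "lebesgue :: 'a::euclidean_space measure" "lebesgue :: 'b::euclidean_space measure" ..

lemma measurable_ident_lebesgue [measurable]: "(\<lambda>x. x) \<in> lebesgue \<rightarrow>\<^sub>M (borel :: 'a::euclidean_space measure)"
  using id_borel_measurable_lebesgue by (simp add: id_def)

lemma measurable_fst_lebesgue [measurable]:
  "fst \<in> (lebesgue :: 'a::euclidean_space measure) \<Otimes>\<^sub>M N \<rightarrow>\<^sub>M (borel :: 'a measure)"
  using measurable_compose[OF measurable_fst measurable_ident_lebesgue] by simp

lemma measurable_snd_lebesgue [measurable]:
  "snd \<in> N \<Otimes>\<^sub>M (lebesgue :: 'a::euclidean_space measure) \<rightarrow>\<^sub>M (borel :: 'a measure)"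
  using measurable_compose[OF measurable_snd measurable_ident_lebesgue] by simp

text \<open>The hypotheses are upper bounds \<open>A\<close>, \<open>B\<close> and not the integrals
  themselves, so no infinite value has to be converted to a real number. If a bound is 0, one factor
  vanishes almost everywhere; otherwise both factors are normalised and Young's inequality is
  integrated.\<close>

lemma nn_integral_Hoelder:
  fixes f g :: "'a \<Rightarrow> real"
  assumes [measurable]: "f \<in> borel_measurable M" "g \<in> borel_measurable M"
    and pq: "p > 1" "q > 1" "1/p + 1/q = 1"
    and A: "A \<ge> 0" "(\<integral>\<^sup>+x. ennreal (\<bar>f x\<bar> powr p) \<partial>M) \<le> ennreal A"
    and B: "B \<ge> 0" "(\<integral>\<^sup>+x. ennreal (\<bar>g x\<bar> powr q) \<partial>M) \<le> ennreal B"
  shows "(\<integral>\<^sup>+x. ennreal (\<bar>f x\<bar> * \<bar>g x\<bar>) \<partial>M) \<le> ennreal (A powr (1/p) * B powr (1/q))"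
proof -
  have zero: "(\<integral>\<^sup>+x. ennreal (\<bar>f x\<bar> * \<bar>g x\<bar>) \<partial>M) = 0"
    if "(\<integral>\<^sup>+x. ennreal (\<bar>f x\<bar> powr p) \<partial>M) = 0 \<or> (\<integral>\<^sup>+x. ennreal (\<bar>g x\<bar> powr q) \<partial>M) = 0"
  proof -
    from that have "(AE x in M. ennreal (\<bar>f x\<bar> powr p) = 0) \<or> (AE x in M. ennreal (\<bar>g x\<bar> powr q) = 0)"
      by (subst (asm) (1 2) nn_integral_0_iff_AE) auto
    then have "AE x in M. ennreal (\<bar>f x\<bar> * \<bar>g x\<bar>) = 0"
      by (elim disjE) (auto elim!: eventually_mono simp: ennreal_eq_0_iff)
    then show ?thesis by (subst nn_integral_0_iff_AE) auto
  qed
  show ?thesis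
  proof (cases "A = 0 \<or> B = 0")
    case True
    then show ?thesis using zero A B by (metis ennreal_0 le_zero_eq zero_le)
  next
    case False
    define a where "a = A powr (1/p)"
    define b where "b = B powr (1/q)"
    have ab: "a > 0" "b > 0" using False A B by (auto simp: a_def b_def)
    have ap: "a powr p = A" "b powr q = B" using pq A B False by (auto simp: a_def b_def powr_powr)
    have Y: "\<bar>f x\<bar> * \<bar>g x\<bar> \<le> a * b * (\<bar>f x\<bar> powr p / A / p + \<bar>g x\<bar> powr q / B / q)" for x
    proof -
      have "(\<bar>f x\<bar>/a) * (\<bar>g x\<bar>/b) \<le> (\<bar>f x\<bar>/a) powr p / p + (\<bar>g x\<bar>/b) powr q / q"
        using ab pq by (intro Youngs_inequality) auto
      also have "\<dots> = \<bar>f x\<bar> powr p / A / p + \<bar>g x\<bar> powr q / B / q"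
        using ab by (simp add: powr_divide ap)
      finally show ?thesis using ab by (simp add: field_simps)
    qed
    have "(\<integral>\<^sup>+x. ennreal (\<bar>f x\<bar> * \<bar>g x\<bar>) \<partial>M) \<le>
      (\<integral>\<^sup>+x. ennreal (a*b/A/p) * ennreal (\<bar>f x\<bar> powr p) + ennreal (a*b/B/q) * ennreal (\<bar>g x\<bar> powr q) \<partial>M)"
    proof (rule nn_integral_mono)
      fix x
      have "ennreal (\<bar>f x\<bar> * \<bar>g x\<bar>) \<le> ennreal (a*b/A/p * \<bar>f x\<bar> powr p + a*b/B/q * \<bar>g x\<bar> powr q)"
        using Y[of x] by (intro ennreal_leI) (simp add: field_simps)
      also have "\<dots> = ennreal (a*b/A/p) * ennreal (\<bar>f x\<bar> powr p) + ennreal (a*b/B/q) * ennreal (\<bar>g x\<bar> powr q)"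
        using ab A B pq by (simp add: ennreal_mult'[symmetric] ennreal_plus[symmetric] del: ennreal_plus)
      finally show "ennreal (\<bar>f x\<bar> * \<bar>g x\<bar>) \<le> ennreal (a*b/A/p) * ennreal (\<bar>f x\<bar> powr p) + ennreal (a*b/B/q) * ennreal (\<bar>g x\<bar> powr q)" .
    qed
    also have "\<dots> = ennreal (a*b/A/p) * (\<integral>\<^sup>+x. ennreal (\<bar>f x\<bar> powr p) \<partial>M) + ennreal (a*b/B/q) * (\<integral>\<^sup>+x. ennreal (\<bar>g x\<bar> powr q) \<partial>M)"
      by (simp add: nn_integral_add nn_integral_cmult)
    also have "\<dots> \<le> ennreal (a*b/A/p) * ennreal A + ennreal (a*b/B/q) * ennreal B"
      using A B by (intro add_mono mult_left_mono) auto
    also have "\<dots> = ennreal (a*b/A/p * A + a*b/B/q * B)"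
      using A B ab pq by (simp add: ennreal_mult'[symmetric] ennreal_plus[symmetric] del: ennreal_plus)
    also have "a*b/A/p * A + a*b/B/q * B = a * b * (1/p + 1/q)"
      using False by (simp add: field_simps)
    finally show ?thesis using pq by (simp add: a_def b_def)
  qed
qed

lemma nn_integral_Hoelder3:
  fixes f g h :: "'a \<Rightarrow> real"
  assumes [measurable]: "f \<in> borel_measurable M" "g \<in> borel_measurable M" "h \<in> borel_measurable M"
    and pq: "a > 0" "b > 0" "c > 0" "1/a + 1/b + 1/c = 1"
    and A: "A \<ge> 0" "(\<integral>\<^sup>+x. ennreal (\<bar>f x\<bar> powr a) \<partial>M) \<le> ennreal A"
    and B: "B \<ge> 0" "(\<integral>\<^sup>+x. ennreal (\<bar>g x\<bar> powr b) \<partial>M) \<le> ennreal B"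
    and C: "C \<ge> 0" "(\<integral>\<^sup>+x. ennreal (\<bar>h x\<bar> powr c) \<partial>M) \<le> ennreal C"
  shows "(\<integral>\<^sup>+x. ennreal (\<bar>f x\<bar> * \<bar>g x\<bar> * \<bar>h x\<bar>) \<partial>M) \<le> ennreal (A powr (1/a) * B powr (1/b) * C powr (1/c))"
proof -
  \<comment> \<open>The exponents \<open>b\<close> and \<open>c\<close> are merged:
    \<open>g * h\<close> is estimated in the space of exponent \<open>t\<close> and then paired with
    \<open>f\<close>.\<close>
  define t where "t = 1 / (1/b + 1/c)"
  have it: "1/t = 1/b + 1/c" using pq by (simp add: t_def)
  have t0: "t > 0" using pq by (simp add: t_def add_pos_pos)
  have "1/a < 1" "1/t < 1" using pq it by (smt (verit) divide_pos_pos)+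
  then have at: "a > 1" "t > 1" using pq t0 by (auto simp: field_simps)
  have "1/b < 1/t" "1/c < 1/t" using pq it by auto
  then have bt: "t < b" "t < c" using pq t0 by (auto simp: field_simps)
  have sum1: "1/(b/t) + 1/(c/t) = 1"
  proof -
    have "1/(b/t) + 1/(c/t) = t * (1/b + 1/c)" by (simp add: field_simps)
    also have "\<dots> = 1" using it t0 by (metis nonzero_eq_divide_eq mult.commute order_less_irrefl)
    finally show ?thesis .
  qed
  have pw: "(\<bar>y\<bar> powr t) powr (z/t) = \<bar>y\<bar> powr z" for y z :: real
    using t0 by (simp add: powr_powr)
  have "(\<integral>\<^sup>+x. ennreal (\<bar>\<bar>g x\<bar> powr t\<bar> * \<bar>\<bar>h x\<bar> powr t\<bar>) \<partial>M) \<le> ennreal (B powr (1/(b/t)) * C powr (1/(c/t)))"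
    using bt t0 sum1 B C pw by (intro nn_integral_Hoelder) (auto simp: pw)
  then have gh: "(\<integral>\<^sup>+x. ennreal (\<bar>g x * h x\<bar> powr t) \<partial>M) \<le> ennreal (B powr (t/b) * C powr (t/c))"
    by (simp add: abs_mult powr_mult)
  have "(\<integral>\<^sup>+x. ennreal (\<bar>f x\<bar> * \<bar>g x * h x\<bar>) \<partial>M) \<le> ennreal (A powr (1/a) * (B powr (t/b) * C powr (t/c)) powr (1/t))"
    using at it pq A gh by (intro nn_integral_Hoelder) auto
  also have "(B powr (t/b) * C powr (t/c)) powr (1/t) = B powr (1/b) * C powr (1/c)"
    using t0 by (simp add: powr_mult powr_powr)
  finally show ?thesis by (simp add: abs_mult mult.assoc)
qed

lemma sum_Hoelder:
  fixes f g :: "'a \<Rightarrow> real"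
  assumes fin: "finite S" and pos: "\<And>x. x \<in> S \<Longrightarrow> f x \<ge> 0" "\<And>x. x \<in> S \<Longrightarrow> g x \<ge> 0"
    and pq: "p > 1" "q > 1" "1/p + 1/q = 1"
    and A: "A \<ge> 0" "(\<Sum>x\<in>S. f x powr p) \<le> A"
    and B: "B \<ge> 0" "(\<Sum>x\<in>S. g x powr q) \<le> B"
  shows "(\<Sum>x\<in>S. f x * g x) \<le> A powr (1/p) * B powr (1/q)"
proof -
  have "(\<integral>\<^sup>+x. ennreal (\<bar>f x\<bar> * \<bar>g x\<bar>) \<partial>count_space S) \<le> ennreal (A powr (1/p) * B powr (1/q))"
    using pq A B fin pos
    by (intro nn_integral_Hoelder) (auto simp: nn_integral_count_space_finite intro!: ennreal_leI)
  then have "ennreal (\<Sum>x\<in>S. f x * g x) \<le> ennreal (A powr (1/p) * B powr (1/q))"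
    using fin pos by (simp add: nn_integral_count_space_finite sum_ennreal)
  then show ?thesis by (subst (asm) ennreal_le_iff) auto
qed

lemma sum_nn_integral_disjoint_le:
  assumes fin: "finite F" and dis: "disjoint_family_on D F"
    and sub: "\<And>Q. Q \<in> F \<Longrightarrow> D Q \<subseteq> P" and D[measurable]: "\<And>Q. Q \<in> F \<Longrightarrow> D Q \<in> sets M"
    and f[measurable]: "f \<in> borel_measurable M"
  shows "(\<Sum>Q\<in>F. \<integral>\<^sup>+x\<in>D Q. f x \<partial>M) \<le> (\<integral>\<^sup>+x\<in>P. f x \<partial>M)"
proof -
  have "(\<Sum>Q\<in>F. \<integral>\<^sup>+x\<in>D Q. f x \<partial>M) = (\<integral>\<^sup>+x. (\<Sum>Q\<in>F. f x * indicator (D Q) x) \<partial>M)"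
    by (subst nn_integral_sum) auto
  also have "\<dots> = (\<integral>\<^sup>+x. f x * indicator (\<Union>Q\<in>F. D Q) x \<partial>M)"
    using fin dis by (simp add: sum_distrib_left[symmetric] indicator_UN_disjoint)
  also have "\<dots> \<le> (\<integral>\<^sup>+x\<in>P. f x \<partial>M)"
    using sub by (intro nn_integral_mono mult_left_mono) (auto simp: indicator_def)
  finally show ?thesis .
qed

section \<open>Dyadic grids\<close>

lemma cart_One [simp]: "(\<Sum>x\<in>Basis. (x :: real^'n) $ i) = 1"
proof -
  have "(\<Sum>x\<in>Basis. (x :: real^'n) $ i) = (One :: real^'n) \<bullet> axis i 1"
    by (simp add: inner_axis)
  also have "\<dots> = 1" by (simp add: inner_sum_left_Basis axis_in_Basis_iff)
  finally show ?thesis .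
qed

text \<open>Cells carry a generation in \<open>nat\<close>, so \<open>h\<close> is the coarsest side
  and every cell has finitely many ancestors; stopping-time selections always have a starting point.
  The vector \<open>a\<close> shifts the grid.\<close>

locale dyadic_grid =
  fixes a :: "real^'n" and h :: real
  assumes h_pos: "h > 0"
begin

definition idx :: "nat \<Rightarrow> real^'n \<Rightarrow> int^'n" where
  "idx k x = (\<chi> i. \<lfloor>2^k * (x$i + a$i) / h\<rfloor>)"

definition cell :: "nat \<times> (int^'n) \<Rightarrow> (real^'n) set" where
  "cell c = {x. idx (fst c) x = snd c}"

definition side :: "nat \<times> (int^'n) \<Rightarrow> real" where
  "side c = h / 2 ^ fst c"

definition vol :: "nat \<times> (int^'n) \<Rightarrow> real" where
  "vol c = side c ^ CARD('n)"

definition corner :: "nat \<times> (int^'n) \<Rightarrow> real^'n" where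
  "corner c = (\<chi> i. side c * of_int (snd c $ i) - a $ i)"

definition hull_cube :: "nat \<times> (int^'n) \<Rightarrow> (real^'n) set" where
  "hull_cube c = cbox (corner c) (corner c + side c *\<^sub>R One)"

definition anc :: "nat \<Rightarrow> nat \<times> (int^'n) \<Rightarrow> nat \<times> (int^'n)" where
  "anc k c = (k, idx k (corner c))"

lemma side_pos [simp]: "side c > 0"
  using h_pos by (simp add: side_def)

lemma vol_pos [simp]: "vol c > 0"
  by (simp add: vol_def)

lemma side_scale: "fst d = fst c + k \<Longrightarrow> side d = side c / 2^k"
  by (simp add: side_def power_add)

lemma vol_scale: assumes "fst d = fst c + k" shows "vol c = 2^(k * CARD('n)) * vol d"
proof -
  have "side c = 2^k * side d" using side_scale[OF assms] by simp
  then show ?thesis by (simp add: vol_def power_mult_distrib power_mult)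
qed

text \<open>The floor at generation \<open>j\<close> is the integer quotient of the floor at
  generation \<open>k\<close> by 2^(k-j), so the finer index determines the coarser one. This is the
  nesting of the grid.\<close>

lemma idx_coarsen:
  assumes "j \<le> k" "idx k x = idx k y"
  shows "idx j x = idx j y"
proof -
  have "\<lfloor>2^j * t / h\<rfloor> = \<lfloor>2^k * t / h\<rfloor> div 2^(k-j)" for t
  proof -
    have "2^k = (2^j * 2^(k-j) :: real)" using assms(1) by (simp flip: power_add)
    then have "2^j * t / h = (2^k * t / h) / real_of_int (2^(k-j))" by simp
    then show ?thesis using floor_divide_real_eq_div[of "2^(k-j)" "2^k * t / h"] by simp
  qed
  then show ?thesis using assms(2) by (simp add: idx_def vec_eq_iff)
qed

lemma mem_cell_iff:
  "x \<in> cell c \<longleftrightarrow> (\<forall>i. corner c $ i \<le> x $ i \<and> x $ i < corner c $ i + side c)"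
proof -
  have "\<lfloor>2^k * (t + s) / h\<rfloor> = j \<longleftrightarrow> h / 2^k * of_int j - s \<le> t \<and> t < h / 2^k * of_int j - s + h / 2^k"
    for t s j k
  proof -
    define S where "S = h / 2^k"
    have S: "S > 0" using h_pos by (simp add: S_def)
    have "2^k * (t + s) / h = (t + s) / S" by (simp add: S_def)
    then have "\<lfloor>2^k * (t + s) / h\<rfloor> = j \<longleftrightarrow> of_int j * S \<le> t + s \<and> t + s < (of_int j + 1) * S"
      using S by (simp add: floor_eq_iff pos_le_divide_eq pos_divide_less_eq)
    also have "\<dots> \<longleftrightarrow> S * of_int j - s \<le> t \<and> t < S * of_int j - s + S"
      by (auto simp: algebra_simps)
    finally show ?thesis by (simp add: S_def)
  qed
  then show ?thesis by (simp add: cell_def idx_def vec_eq_iff corner_def side_def)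
qed

lemma cell_sub_hull: "cell c \<subseteq> hull_cube c"
  by (auto simp: mem_cell_iff hull_cube_def mem_box_cart less_imp_le)

lemma box_sub_cell: "box (corner c) (corner c + side c *\<^sub>R One) \<subseteq> cell c"
  by (auto simp: mem_cell_iff mem_box_cart less_imp_le)

lemma cube_hull_cube: "cube (hull_cube c)"
  unfolding cube_def hull_cube_def using side_pos by blast

lemma corner_in_cell [simp]: "corner c \<in> cell c"
  by (simp add: mem_cell_iff)

lemma idx_measurable [measurable]: "idx k \<in> borel \<rightarrow>\<^sub>M count_space UNIV"
proof -
  have "idx k -` {j} \<inter> space borel \<in> sets borel" for j
  proof -
    have "idx k -` {j} \<inter> space borel = (\<Inter>i. {x. \<lfloor>2^k * (x$i + a$i) / h\<rfloor> = j $ i})"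
      by (auto simp: idx_def vec_eq_iff)
    also have "\<dots> \<in> sets borel"
      by (rule sets.finite_INT) (auto intro!: borel_measurable_continuous_onI continuous_intros)
    finally show ?thesis .
  qed
  then show ?thesis by (intro measurable_count_space_eq2_countable[THEN iffD2]) auto
qed

lemma cell_borel [measurable]: "cell c \<in> sets borel"
proof -
  have "cell c = idx (fst c) -` {snd c} \<inter> space borel" by (auto simp: cell_def)
  then show ?thesis using measurable_sets[OF idx_measurable, of "{snd c}" "fst c"] by simp
qed

lemma cell_lebesgue [measurable]: "cell c \<in> sets lebesgue"
  by simp

lemma emeasure_hull: "emeasure lebesgue (hull_cube c) = ennreal (vol c)"
proof -
  have "emeasure lborel (hull_cube c) = (\<Prod>b\<in>Basis. (side c *\<^sub>R One) \<bullet> (b::real^'n))"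
    unfolding hull_cube_def
    by (subst emeasure_lborel_cbox) (auto simp: less_imp_le inner_add_left)
  also have "\<dots> = ennreal (vol c)"
    by (simp add: vol_def)
  finally show ?thesis by (simp add: hull_cube_def)
qed

lemma AE_hull: "AE x in lebesgue. x \<in> cell c \<longleftrightarrow> x \<in> hull_cube c"
proof -
  have "hull_cube c - box (corner c) (corner c + side c *\<^sub>R One) \<in> null_sets lborel"
  proof (rule null_setsI)
    have "emeasure lborel (box (corner c) (corner c + side c *\<^sub>R One)) = emeasure lborel (hull_cube c)"
      unfolding hull_cube_def
      by (subst emeasure_lborel_cbox, simp add: inner_add_left less_imp_le,
          subst emeasure_lborel_box, simp_all add: inner_add_left less_imp_le)
    then show "emeasure lborel (hull_cube c - box (corner c) (corner c + side c *\<^sub>R One)) = 0"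
      by (subst emeasure_Diff)
         (use box_subset_cbox emeasure_hull in \<open>auto simp: hull_cube_def\<close>)
  qed (auto simp: hull_cube_def)
  then have "hull_cube c - box (corner c) (corner c + side c *\<^sub>R One) \<in> null_sets lebesgue"
    by (rule null_sets_completionI)
  then have "AE x in lebesgue. x \<notin> hull_cube c - box (corner c) (corner c + side c *\<^sub>R One)"
    by (rule AE_not_in)
  then show ?thesis
    by eventually_elim (use cell_sub_hull box_sub_cell in blast)
qed

lemma emeasure_cell: "emeasure lebesgue (cell c) = ennreal (vol c)"
proof -
  have "emeasure lebesgue (cell c) = emeasure lebesgue (hull_cube c)"
    using AE_hull by (intro emeasure_eq_AE) (auto simp: hull_cube_def)
  then show ?thesis by (simp add: emeasure_hull)
qed

lemma measure_cell: "measure lebesgue (cell c) = vol c"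
  by (simp add: measure_def emeasure_cell less_imp_le)

lemma measure_hull: "measure lebesgue (hull_cube c) = vol c"
  by (simp add: measure_def emeasure_hull less_imp_le)

lemma fst_anc [simp]: "fst (anc k c) = k"
  by (simp add: anc_def)

lemma cell_sub_anc:
  assumes "k \<le> fst c" shows "cell c \<subseteq> cell (anc k c)"
proof
  fix x assume "x \<in> cell c"
  then have "idx (fst c) x = idx (fst c) (corner c)"
    using corner_in_cell[of c] by (simp add: cell_def)
  from idx_coarsen[OF assms this] show "x \<in> cell (anc k c)"
    by (simp add: cell_def anc_def)
qed

lemma cell_unique: "x \<in> cell c \<Longrightarrow> x \<in> cell d \<Longrightarrow> fst c = fst d \<Longrightarrow> c = d"
  by (simp add: cell_def prod_eq_iff)

lemma anc_unique:
  assumes "x \<in> cell c" "x \<in> cell d" "fst d \<le> fst c" shows "d = anc (fst d) c"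
  using cell_unique[of x d "anc (fst d) c"] assms cell_sub_anc[of "fst d" c] by auto

lemma cell_nested:
  assumes "x \<in> cell c" "x \<in> cell d" "fst d \<le> fst c" shows "cell c \<subseteq> cell d"
  using anc_unique[OF assms] cell_sub_anc[OF assms(3)] by simp

text \<open>A set inclusion remembers the generations, because a cell of smaller generation has
  strictly larger volume.\<close>

lemma cell_subset_fst: assumes "cell c \<subseteq> cell d" shows "fst d \<le> fst c"
proof (rule ccontr)
  assume "\<not> fst d \<le> fst c"
  then obtain k where k: "fst d = fst c + k" "k > 0"
    by (metis less_imp_add_positive not_le)
  have "ennreal (vol c) \<le> ennreal (vol d)"
    using emeasure_mono[OF assms, of lebesgue] by (simp add: emeasure_cell)
  then have "vol c \<le> vol d" by (subst (asm) ennreal_le_iff) (auto simp: less_imp_le)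
  then have "2^(k * CARD('n)) * vol d \<le> 1 * vol d" using vol_scale[OF k(1)] by simp
  then have "(2::real)^(k * CARD('n)) \<le> 1" by (subst (asm) mult_le_cancel_right_pos) auto
  moreover have "(1::real) < 2^(k * CARD('n))" using k by (intro one_less_power) auto
  ultimately show False by linarith
qed

lemma cell_subset_antisym: "cell c \<subseteq> cell d \<Longrightarrow> fst c = fst d \<Longrightarrow> c = d"
  using cell_unique corner_in_cell by blast

lemma anc_anc: "j \<le> k \<Longrightarrow> k \<le> fst c \<Longrightarrow> anc j (anc k c) = anc j c"
proof -
  assume jk: "j \<le> k" "k \<le> fst c"
  have "corner c \<in> cell (anc k c)" using cell_sub_anc[OF jk(2)] corner_in_cell[of c] by blast
  moreover from this have "corner c \<in> cell (anc j (anc k c))" using cell_sub_anc[of j "anc k c"] jk by auto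
  moreover have "corner c \<in> cell (anc j c)" using cell_sub_anc[of j c] corner_in_cell[of c] jk by auto
  ultimately show ?thesis using cell_unique by simp
qed

lemma anc_self [simp]: "anc (fst c) c = c"
  using anc_unique[OF corner_in_cell corner_in_cell, of c] by simp


lemma finite_cells_meeting:
  assumes "bounded B" shows "finite {c. fst c = k \<and> cell c \<inter> B \<noteq> {}}"
proof -
  obtain R where R: "\<And>x. x \<in> B \<Longrightarrow> norm x \<le> R" using assms bounded_iff by blast
  define A where "A i = {\<lfloor>2^k * (-R + a$i) / h\<rfloor>..\<lfloor>2^k * (R + a$i) / h\<rfloor>}" for i
  have "idx k x $ i \<in> A i" if "x \<in> B" for x i
  proof -
    have "\<bar>x $ i\<bar> \<le> R" using R[OF that] component_le_norm_cart[of x i] by linarith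
    then show ?thesis using h_pos
      by (auto simp: A_def idx_def intro!: floor_mono divide_right_mono mult_left_mono)
  qed
  then have sub: "{c. fst c = k \<and> cell c \<inter> B \<noteq> {}} \<subseteq> Pair k ` {v. \<forall>i. v $ i \<in> A i}"
    by (force simp: cell_def)
  have "vec_nth ` {v. \<forall>i. v $ i \<in> A i} \<subseteq> PiE UNIV A" by auto
  moreover have "finite (PiE UNIV A)" by (intro finite_PiE) (auto simp: A_def)
  ultimately have "finite (vec_nth ` {v. \<forall>i. v $ i \<in> A i})" by (rule finite_subset)
  then have "finite {v. \<forall>i. v $ i \<in> A i}"
    by (rule finite_imageD) (auto simp: inj_on_def vec_nth_inject)
  then show ?thesis using finite_subset[OF sub] by blast
qed

lemma bounded_cell: "bounded (cell c)"
  using bounded_subset[OF bounded_cbox cell_sub_hull[unfolded hull_cube_def]] .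

lemma dist_cell: assumes "x \<in> cell c" "y \<in> cell c" shows "norm (x - y) \<le> CARD('n) * side c"
proof -
  have "\<bar>(x - y) $ i\<bar> \<le> side c" for i
  proof -
    have "corner c $ i \<le> x $ i" "x $ i < corner c $ i + side c" "corner c $ i \<le> y $ i" "y $ i < corner c $ i + side c"
      using assms by (auto simp: mem_cell_iff)
    then show ?thesis by simp
  qed
  then have "(\<Sum>i\<in>UNIV. \<bar>(x - y) $ i\<bar>) \<le> (\<Sum>i\<in>(UNIV::'n set). side c)" by (intro sum_mono) auto
  then show ?thesis using norm_le_l1_cart[of "x - y"] by simp
qed

lemma finite_subcells: "finite {d. cell d \<subseteq> cell c \<and> fst d \<le> N}"
proof (rule finite_subset)
  show "{d. cell d \<subseteq> cell c \<and> fst d \<le> N} \<subseteq> (\<Union>k\<le>N. {d. fst d = k \<and> cell d \<inter> cell c \<noteq> {}})"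
    using corner_in_cell by fastforce
qed (simp add: finite_cells_meeting bounded_cell)

lemma disjoint_cells:
  assumes "\<And>c. c \<in> F \<Longrightarrow> fst c = k" shows "disjoint_family_on cell F"
  unfolding disjoint_family_on_def using assms cell_unique by blast

end

section \<open>The John--Nirenberg inequality on a dyadic grid\<close>

context dyadic_grid
begin

lemma idx_measurable_lebesgue [measurable]: "idx k \<in> lebesgue \<rightarrow>\<^sub>M count_space UNIV"
  using measurable_compose[OF measurable_ident_lebesgue idx_measurable] by simp

definition mean :: "(real^'n \<Rightarrow> real) \<Rightarrow> nat \<times> (int^'n) \<Rightarrow> real" where
  "mean b c = (LINT x:cell c|lebesgue. b x) / vol c"

abbreviation cell_at :: "nat \<Rightarrow> real^'n \<Rightarrow> nat \<times> (int^'n)" where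
  "cell_at k x \<equiv> (k, idx k x)"

lemma mem_cell_at [simp]: "x \<in> cell (cell_at k x)"
  by (simp add: cell_def)

lemma cell_at_eq: "x \<in> cell c \<Longrightarrow> cell_at (fst c) x = c"
  using cell_unique[of x c "cell_at (fst c) x"] by simp

lemma anc_cell_at: "x \<in> cell c \<Longrightarrow> k \<le> fst c \<Longrightarrow> anc k c = cell_at k x"
  using anc_unique[of x c "cell_at k x"] by simp

lemma idx_constant_measurable:
  fixes s :: "real^'n \<Rightarrow> real"
  assumes "\<And>x y. idx N x = idx N y \<Longrightarrow> s x = s y"
  shows "s \<in> borel_measurable lebesgue"
proof -
  have "s x = s (corner (cell_at N x))" for x
  proof (rule assms)
    show "idx N x = idx N (corner (cell_at N x))"
      using corner_in_cell[of "cell_at N x"] by (simp add: cell_def)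
  qed
  then have "s = (\<lambda>x. (\<lambda>j. s (corner (N, j))) (idx N x))" by auto
  also have "\<dots> \<in> borel_measurable lebesgue"
    by (rule measurable_compose[OF idx_measurable_lebesgue]) simp
  finally show ?thesis .
qed

lemma open_inner_cells:
  assumes "open T" "x \<in> T"
  shows "\<exists>N. cell (cell_at N x) \<subseteq> T"
proof -
  obtain e where e: "e > 0" "ball x e \<subseteq> T" using assms openE by blast
  obtain N where "real CARD('n) * h / e < 2^N" using real_arch_pow[of 2] by auto
  then have N: "real CARD('n) * (h / 2^N) < e" using e by (simp add: field_simps)
  have "dist x y < e" if "y \<in> cell (cell_at N x)" for y
    using dist_cell[OF mem_cell_at that] N by (simp add: dist_norm side_def)
  then show ?thesis using e by (intro exI[of _ N]) auto
qed

text \<open>Functions that are constant on the cells of some generation are dense in \<open>L\<^sup>1\<close>;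
  this replaces Lebesgue's differentiation theorem.\<close>

lemma L1_approx_cells:
  assumes "integrable lebesgue g" "e > 0"
  shows "\<exists>N s. (\<forall>x y. idx N x = idx N y \<longrightarrow> s x = (s y :: real)) \<and>
    (\<integral>\<^sup>+x\<in>cell c. ennreal \<bar>g x - s x\<bar> \<partial>lebesgue) \<le> ennreal e"
  using assms
proof (induction g arbitrary: e rule: integrable_induct)
  case (base A r)
  define d where "d = e / (2 * (\<bar>r\<bar> + 1))"
  have d: "d > 0" "\<bar>r\<bar> * (2 * d) \<le> e" using base(3) by (auto simp: d_def field_simps mult_mono)
  obtain T where T: "open T" "A \<subseteq> T" "emeasure lebesgue (T - A) < ennreal d"
    using sets_lebesgue_outer_open[OF base(1) d(1)] by metis
  have [measurable]: "T \<in> sets lebesgue" using T(1) by simp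
  note base(1)[measurable]
  \<comment> \<open>\<open>TN N\<close> is the union of the cells of generation \<open>N\<close>
    inside the open set \<open>T\<close>. It increases with \<open>N\<close> and exhausts
    \<open>T\<close>.\<close>
  define TN where "TN N = {x. cell (cell_at N x) \<subseteq> T}" for N
  have cst: "indicator (TN N) x = (indicator (TN N) y :: real)" if "idx N x = idx N y" for x y N
    using that by (simp add: TN_def indicator_def)
  have TNm [measurable]: "TN N \<in> sets lebesgue" for N
  proof -
    have "(indicator (TN N) :: _ \<Rightarrow> real) \<in> borel_measurable lebesgue"
      by (rule idx_constant_measurable) (rule cst)
    then show ?thesis by (simp add: borel_measurable_indicator_iff)
  qed
  have sub: "TN N \<subseteq> T" for N using mem_cell_at by (auto simp: TN_def)
  have incr: "TN N \<subseteq> TN M" if "N \<le> M" for N M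
  proof
    fix x assume "x \<in> TN N"
    moreover have "cell (cell_at M x) \<subseteq> cell (cell_at N x)"
      using that by (intro cell_nested[of x]) auto
    ultimately show "x \<in> TN M" by (auto simp: TN_def)
  qed
  \<comment> \<open>Continuity from above requires finite measure, supplied here by the intersection
    with \<open>cell c\<close>.\<close>
  have "(\<lambda>N. emeasure lebesgue (cell c \<inter> (T - TN N))) \<longlonglongrightarrow> emeasure lebesgue (\<Inter>N. cell c \<inter> (T - TN N))"
  proof (rule Lim_emeasure_decseq)
    show "decseq (\<lambda>N. cell c \<inter> (T - TN N))" using incr by (auto simp: decseq_def)
    show "emeasure lebesgue (cell c \<inter> (T - TN N)) \<noteq> \<infinity>" for N
      using emeasure_mono[of "cell c \<inter> (T - TN N)" "cell c" lebesgue]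
      by (auto simp: emeasure_cell top_unique)
  qed auto
  moreover have "(\<Inter>N. cell c \<inter> (T - TN N)) = {}"
    using open_inner_cells[OF T(1)] by (auto simp: TN_def)
  ultimately have "(\<lambda>N. emeasure lebesgue (cell c \<inter> (T - TN N))) \<longlonglongrightarrow> 0" by simp
  then have "eventually (\<lambda>N. emeasure lebesgue (cell c \<inter> (T - TN N)) < ennreal d) sequentially"
    using d by (intro order_tendstoD(2)[of _ 0]) auto
  then obtain N where N: "emeasure lebesgue (cell c \<inter> (T - TN N)) < ennreal d"
    by (auto simp: eventually_sequentially)
  have "(\<integral>\<^sup>+x\<in>cell c. ennreal \<bar>indicator A x *\<^sub>R r - indicator (TN N) x * r\<bar> \<partial>lebesgue)
    \<le> (\<integral>\<^sup>+x. ennreal \<bar>r\<bar> * (indicator (T - A) x + indicator (cell c \<inter> (T - TN N)) x) \<partial>lebesgue)"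
    using sub[of N] T(2) by (intro nn_integral_mono) (auto simp: indicator_def)
  also have "\<dots> = ennreal \<bar>r\<bar> * (emeasure lebesgue (T - A) + emeasure lebesgue (cell c \<inter> (T - TN N)))"
    by (simp add: nn_integral_cmult nn_integral_add)
  also have "\<dots> \<le> ennreal \<bar>r\<bar> * (ennreal d + ennreal d)"
    using T(3) N by (intro mult_left_mono add_mono) auto
  also have "\<dots> = ennreal (\<bar>r\<bar> * (2 * d))"
    using d by (simp add: ennreal_mult'[symmetric] ennreal_plus[symmetric] del: ennreal_plus)
  also have "\<dots> \<le> ennreal e" using d by (intro ennreal_leI) auto
  finally have bd: "(\<integral>\<^sup>+x\<in>cell c. ennreal \<bar>indicator A x *\<^sub>R r - indicator (TN N) x * r\<bar> \<partial>lebesgue) \<le> ennreal e" .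
  have cs: "idx N x = idx N y \<Longrightarrow> indicator (TN N) x * r = indicator (TN N) y * r" for x y
    using cst[of N x y] by simp
  show ?case
    by (rule exI[of _ N], rule exI[of _ "\<lambda>x. indicator (TN N) x * r"], rule conjI, (rule allI)+, rule impI, erule cs, rule bd)
next
  case (add f g)
  have e2: "e/2 > 0" using add.prems by simp
  obtain N s where s: "\<And>x y. idx N x = idx N y \<Longrightarrow> s x = s y"
    "(\<integral>\<^sup>+x\<in>cell c. ennreal \<bar>f x - s x\<bar> \<partial>lebesgue) \<le> ennreal (e/2)"
    using add.IH(1)[OF e2] by blast
  obtain M t where t: "\<And>x y. idx M x = idx M y \<Longrightarrow> t x = t y"
    "(\<integral>\<^sup>+x\<in>cell c. ennreal \<bar>g x - t x\<bar> \<partial>lebesgue) \<le> ennreal (e/2)"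
    using add.IH(2)[OF e2] by blast
  have [measurable]: "s \<in> borel_measurable lebesgue" "t \<in> borel_measurable lebesgue"
    using idx_constant_measurable s(1) t(1) by blast+
  have [measurable]: "f \<in> borel_measurable lebesgue" "g \<in> borel_measurable lebesgue"
    using add by auto
  have "(\<integral>\<^sup>+x\<in>cell c. ennreal \<bar>f x + g x - (s x + t x)\<bar> \<partial>lebesgue)
    \<le> (\<integral>\<^sup>+x. ennreal \<bar>f x - s x\<bar> * indicator (cell c) x + ennreal \<bar>g x - t x\<bar> * indicator (cell c) x \<partial>lebesgue)"
    by (intro nn_integral_mono)
       (auto simp: indicator_def ennreal_plus[symmetric] simp del: ennreal_plus intro!: ennreal_leI)
  also have "\<dots> \<le> ennreal (e/2) + ennreal (e/2)"
    using s(2) t(2) by (subst nn_integral_add) (auto intro: add_mono)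
  also have "\<dots> = ennreal e" using add.prems by (simp add: ennreal_plus[symmetric] del: ennreal_plus)
  finally have bd: "(\<integral>\<^sup>+x\<in>cell c. ennreal \<bar>f x + g x - (s x + t x)\<bar> \<partial>lebesgue) \<le> ennreal e" .
  have cs: "s x + t x = s y + t y" if "idx (max N M) x = idx (max N M) y" for x y
    using s(1)[OF idx_coarsen[OF _ that]] t(1)[OF idx_coarsen[OF _ that]] by simp
  show ?case
    by (rule exI[of _ "max N M"], rule exI[of _ "\<lambda>x. s x + t x"], rule conjI, (rule allI)+, rule impI, erule cs, rule bd)
next
  case (lim f s)
  have [measurable]: "\<And>i. s i \<in> borel_measurable lebesgue" "f \<in> borel_measurable lebesgue"
    using lim by auto
  have "(\<lambda>i. \<integral>x. norm (s i x - f x) \<partial>lebesgue) \<longlonglongrightarrow> (\<integral>x. 0 \<partial>(lebesgue :: (real^'n) measure))"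
  proof (rule integral_dominated_convergence[where w="\<lambda>x. 3 * norm (f x)"])
    show "AE x in lebesgue. (\<lambda>i. norm (s i x - f x)) \<longlonglongrightarrow> 0"
    proof (rule AE_I2)
      fix x :: "real^'n"
      show "(\<lambda>i. norm (s i x - f x)) \<longlonglongrightarrow> 0"
        using tendsto_norm[OF tendsto_diff[OF lim.hyps(2)[of x] tendsto_const[of "f x"]]] by simp
    qed
    show "AE x in lebesgue. norm (norm (s i x - f x)) \<le> 3 * norm (f x)" for i
    proof (rule AE_I2)
      fix x :: "real^'n"
      have "norm (s i x - f x) \<le> norm (s i x) + norm (f x)" by (rule norm_triangle_ineq4)
      then show "norm (norm (s i x - f x)) \<le> 3 * norm (f x)" using lim.hyps(3)[of x i] by simp
    qed
  qed (use lim in auto)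
  then have "eventually (\<lambda>i. (\<integral>x. norm (s i x - f x) \<partial>lebesgue) < e/2) sequentially"
    using lim.prems by (intro order_tendstoD(2)[of _ 0]) auto
  then obtain i where i: "(\<integral>x. norm (s i x - f x) \<partial>lebesgue) < e/2"
    by (auto simp: eventually_sequentially)
  have e2: "e/2 > 0" using lim.prems by simp
  obtain N t where t: "\<And>x y. idx N x = idx N y \<Longrightarrow> t x = t y"
    "(\<integral>\<^sup>+x\<in>cell c. ennreal \<bar>s i x - t x\<bar> \<partial>lebesgue) \<le> ennreal (e/2)"
    using lim.IH[OF e2, of i] by blast
  have [measurable]: "t \<in> borel_measurable lebesgue" using idx_constant_measurable t(1) by blast
  have "(\<integral>\<^sup>+x\<in>cell c. ennreal \<bar>f x - t x\<bar> \<partial>lebesgue)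
    \<le> (\<integral>\<^sup>+x. ennreal (norm (s i x - f x)) + ennreal \<bar>s i x - t x\<bar> * indicator (cell c) x \<partial>lebesgue)"
    by (intro nn_integral_mono)
       (auto simp: indicator_def ennreal_plus[symmetric] simp del: ennreal_plus intro!: ennreal_leI)
  also have "\<dots> = (\<integral>\<^sup>+x. ennreal (norm (s i x - f x)) \<partial>lebesgue) + (\<integral>\<^sup>+x\<in>cell c. ennreal \<bar>s i x - t x\<bar> \<partial>lebesgue)"
    by (subst nn_integral_add) auto
  also have "(\<integral>\<^sup>+x. ennreal (norm (s i x - f x)) \<partial>lebesgue) = ennreal (\<integral>x. norm (s i x - f x) \<partial>lebesgue)"
    using lim by (intro nn_integral_eq_integral integrable_norm Bochner_Integration.integrable_diff) auto
  also have "\<dots> + (\<integral>\<^sup>+x\<in>cell c. ennreal \<bar>s i x - t x\<bar> \<partial>lebesgue) \<le> ennreal (e/2) + ennreal (e/2)"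
    using i t(2) by (intro add_mono ennreal_leI) auto
  also have "\<dots> = ennreal e" using lim.prems by (simp add: ennreal_plus[symmetric] del: ennreal_plus)
  finally have bd: "(\<integral>\<^sup>+x\<in>cell c. ennreal \<bar>f x - t x\<bar> \<partial>lebesgue) \<le> ennreal e" .
  show ?case
    by (rule exI[of _ N], rule exI[of _ t], rule conjI, (rule allI)+, rule impI, erule t(1), rule bd)
qed

end

text \<open>Oscillation at most 1 on every cell is the normalised BMO condition; a general symbol is
  first divided by a bound of its norm. All constants below are thereby independent of
  \<open>b\<close>.\<close>

locale bmo_grid = dyadic_grid a h for a :: "real^'n" and h :: real +
  fixes b :: "real^'n \<Rightarrow> real"
  assumes b_meas [measurable]: "b \<in> borel_measurable lebesgue"
    and b_int: "\<And>c. set_integrable lebesgue (cell c) b"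
    and b_osc: "\<And>c. (\<integral>\<^sup>+x\<in>cell c. ennreal \<bar>b x - mean b c\<bar> \<partial>lebesgue) \<le> ennreal (vol c)"
begin

abbreviation "bm \<equiv> mean b"

text \<open>The constant \<open>r\<close> enters through a function \<open>s\<close> equal to
  \<open>r\<close> on the cell, so that one piecewise constant \<open>s\<close> can serve all cells
  of a generation at once, as in \<open>mean_L1_approx\<close>.\<close>

lemma mean_dist_le:
  assumes s: "\<And>x. x \<in> cell d \<Longrightarrow> s x = r"
  shows "ennreal (vol d * \<bar>bm d - r\<bar>) \<le> (\<integral>\<^sup>+x\<in>cell d. ennreal \<bar>b x - s x\<bar> \<partial>lebesgue)"
proof -
  have i1: "integrable lebesgue (\<lambda>x. indicator (cell d) x *\<^sub>R b x)"
    using b_int[of d] by (simp add: set_integrable_def)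
  have i2: "integrable lebesgue (\<lambda>x. indicator (cell d) x *\<^sub>R r)"
    by (rule integrable_real_indicator[THEN integrable_scaleR_left]) (auto simp: emeasure_cell)
  have "(\<integral>x. indicator (cell d) x *\<^sub>R b x - indicator (cell d) x *\<^sub>R r \<partial>lebesgue)
     = vol d * bm d - vol d * r"
    using i1 i2 by (subst Bochner_Integration.integral_diff)
      (auto simp: mean_def set_lebesgue_integral_def measure_cell less_imp_neq[OF vol_pos, symmetric])
  moreover have "ennreal (norm (\<integral>x. indicator (cell d) x *\<^sub>R b x - indicator (cell d) x *\<^sub>R r \<partial>lebesgue))
     \<le> (\<integral>\<^sup>+x. norm (indicator (cell d) x *\<^sub>R b x - indicator (cell d) x *\<^sub>R r) \<partial>lebesgue)"
    using i1 i2 by (intro integral_norm_bound_ennreal) auto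
  moreover have "(\<integral>\<^sup>+x. norm (indicator (cell d) x *\<^sub>R b x - indicator (cell d) x *\<^sub>R r) \<partial>lebesgue)
     = (\<integral>\<^sup>+x\<in>cell d. ennreal \<bar>b x - s x\<bar> \<partial>lebesgue)"
    using s by (intro nn_integral_cong) (auto simp: indicator_def)
  moreover have "norm (vol d * bm d - vol d * r) = vol d * \<bar>bm d - r\<bar>"
    by (simp add: right_diff_distrib[symmetric] abs_mult less_imp_le)
  ultimately show ?thesis by simp
qed

lemma mean_parent:
  assumes "fst d = Suc k" shows "\<bar>bm d - bm (anc k d)\<bar> \<le> 2 ^ CARD('n)"
proof -
  let ?c = "anc k d"
  have "ennreal (vol d * \<bar>bm d - bm ?c\<bar>) \<le> (\<integral>\<^sup>+x\<in>cell d. ennreal \<bar>b x - bm ?c\<bar> \<partial>lebesgue)"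
    by (rule mean_dist_le) simp
  also have "\<dots> \<le> (\<integral>\<^sup>+x\<in>cell ?c. ennreal \<bar>b x - bm ?c\<bar> \<partial>lebesgue)"
    using cell_sub_anc[of k d] assms by (intro nn_integral_mono) (auto simp: indicator_def)
  also have "\<dots> \<le> ennreal (vol ?c)" by (rule b_osc)
  also have "vol ?c = vol d * 2 ^ CARD('n)" using vol_scale[of d ?c 1] assms by simp
  finally have "vol d * \<bar>bm d - bm ?c\<bar> \<le> vol d * 2 ^ CARD('n)"
    by (subst (asm) ennreal_le_iff) (auto simp: less_imp_le)
  then show ?thesis by (subst (asm) mult_le_cancel_left_pos) auto
qed

text \<open>Telescoping over generations: each step moves the mean by at most
  \<open>2 ^ CARD('n)\<close>, the volume ratio of parent and child. Growth linear in
  \<open>j\<close> is what makes the change of \<open>Phi\<close> between generations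
  polynomial.\<close>

lemma mean_anc:
  assumes "fst d = k + j" shows "\<bar>bm d - bm (anc k d)\<bar> \<le> 2 ^ CARD('n) * real j"
  using assms
proof (induction j arbitrary: d)
  case 0
  then have "anc k d = d" using anc_self[of d] by simp
  then show ?case by simp
next
  case (Suc j)
  let ?e = "anc (k + j) d"
  have "\<bar>bm d - bm ?e\<bar> \<le> 2 ^ CARD('n)" using Suc.prems by (intro mean_parent) simp
  moreover have "\<bar>bm ?e - bm (anc k ?e)\<bar> \<le> 2 ^ CARD('n) * real j" by (rule Suc.IH) simp
  moreover have "anc k ?e = anc k d" using Suc.prems by (intro anc_anc) auto
  ultimately have "\<bar>bm d - bm (anc k d)\<bar> \<le> 2 ^ CARD('n) + 2 ^ CARD('n) * real j" by simp
  then show ?case by (simp add: algebra_simps)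
qed

text \<open>Between a cell and one of its stopping cells the mean of \<open>b\<close> jumps by at
  most \<open>4 * 2 ^ CARD('n)\<close>. Multiplied by \<open>jn\<close>, this bound is exactly
  1/4.\<close>

definition jn :: real where "jn = 1 / (4 * 2 ^ (CARD('n) + 2))"

lemma jn_pos: "jn > 0" by (simp add: jn_def)

text \<open>Calderon-Zygmund stopping, iterated by induction on the number of generations between
  \<open>P\<close> and \<open>N\<close>. Replacing \<open>b\<close> by its means at generation
  \<open>N\<close> makes the iteration finite, and the constant 2 reproduces itself: E * vol P + E *
  2 * (vol P / 4) equals 3/2 * E * vol P, and E \<le> 4/3.\<close>

lemma John_Nirenberg_step:
  assumes "fst P \<le> N"
  shows "(\<integral>\<^sup>+x\<in>cell P. ennreal (exp (jn * \<bar>bm (cell_at N x) - bm P\<bar>)) \<partial>lebesgue) \<le> ennreal (2 * vol P)"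
  using assms
proof (induction "N - fst P" arbitrary: P rule: less_induct)
  case less
  have meas [measurable]: "(\<lambda>x. bm (cell_at N x)) \<in> borel_measurable lebesgue"
    by (rule measurable_compose[OF idx_measurable_lebesgue]) simp
  show ?case
  proof (cases "fst P = N")
    case True
    have "(\<integral>\<^sup>+x\<in>cell P. ennreal (exp (jn * \<bar>bm (cell_at N x) - bm P\<bar>)) \<partial>lebesgue)
      = (\<integral>\<^sup>+x. indicator (cell P) x \<partial>lebesgue)"
    proof (intro nn_integral_cong)
      fix x
      show "ennreal (exp (jn * \<bar>bm (cell_at N x) - bm P\<bar>)) * indicator (cell P) x = indicator (cell P) x"
        using cell_at_eq[of x P] True by (cases "x \<in> cell P") simp_all
    qed
    also have "\<dots> \<le> ennreal (2 * vol P)" by (simp add: emeasure_cell less_imp_le ennreal_leI)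
    finally show ?thesis .
  next
    case False
    with less.prems have PN: "fst P < N" by simp
    define av where "av d = (\<integral>\<^sup>+x\<in>cell d. ennreal \<bar>b x - bm P\<bar> \<partial>lebesgue)" for d
    \<comment> \<open>The threshold 4 makes the stopping cells occupy at most a quarter of
      \<open>P\<close>. \<open>St\<close> keeps the bad cells without a bad ancestor strictly
      between them and \<open>P\<close>.\<close>
    define Bad where "Bad d \<longleftrightarrow> cell d \<subseteq> cell P \<and> fst P < fst d \<and> fst d \<le> N \<and> ennreal (4 * vol d) < av d" for d
    define St where "St = {d. Bad d \<and> (\<forall>j. fst P < j \<and> j < fst d \<longrightarrow> \<not> Bad (anc j d))}"
    have finSt: "finite St"
      by (rule finite_subset[OF _ finite_subcells[of P N]]) (auto simp: St_def Bad_def)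
    have dis: "disjoint_family_on cell St"
    proof -
      have "False" if "d \<in> St" "e \<in> St" "d \<noteq> e" "x \<in> cell d" "x \<in> cell e" "fst d \<le> fst e" for d e x
      proof -
        have "d = anc (fst d) e" using that by (intro anc_unique) auto
        moreover have "fst d \<noteq> fst e" using cell_unique that by blast
        ultimately show False using that unfolding St_def Bad_def
          by (metis (mono_tags, lifting) le_neq_implies_less mem_Collect_eq)
      qed
      then show ?thesis unfolding disjoint_family_on_def
        by (metis disjoint_iff nat_le_linear)
    qed
    \<comment> \<open>The parent of a stopping cell is not bad or is \<open>P\<close> itself, so the
      average over the cell is at most \<open>2 ^ CARD('n)\<close> times the threshold.\<close>
    have osc: "\<bar>bm d - bm P\<bar> \<le> 4 * 2 ^ CARD('n)" if "d \<in> St" for d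
    proof -
      have d: "Bad d" using that by (simp add: St_def)
      then obtain k where k: "fst d = Suc k" "fst P \<le> k"
        unfolding Bad_def by (metis less_Suc_eq_le less_imp_Suc_add)
      let ?e = "anc k d"
      have sub: "cell d \<subseteq> cell ?e" using k by (intro cell_sub_anc) simp
      have "av ?e \<le> ennreal (4 * vol ?e)"
      proof (cases "fst P = k")
        case True
        have "corner d \<in> cell P" using d corner_in_cell[of d] by (auto simp: Bad_def)
        then have "?e = P" using True anc_unique[of "corner d" d P] k by simp
        then show ?thesis using b_osc[of P] order_trans[OF b_osc[of P], of "ennreal (4 * vol P)"]
          by (simp add: av_def less_imp_le ennreal_leI)
      next
        case False
        then have "\<not> Bad ?e" using that k by (auto simp: St_def)
        moreover have "cell ?e \<subseteq> cell P"
        proof (rule cell_nested)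
          show "corner d \<in> cell ?e" using sub corner_in_cell[of d] by blast
          show "corner d \<in> cell P" using d corner_in_cell[of d] by (auto simp: Bad_def)
        qed (use k in auto)
        ultimately show ?thesis using False k d by (auto simp: Bad_def)
      qed
      moreover have "av d \<le> av ?e" unfolding av_def
        using sub by (intro nn_integral_mono) (auto simp: indicator_def)
      moreover have "ennreal (vol d * \<bar>bm d - bm P\<bar>) \<le> av d"
        unfolding av_def by (rule mean_dist_le) simp
      ultimately have "ennreal (vol d * \<bar>bm d - bm P\<bar>) \<le> ennreal (4 * vol ?e)" by (meson order_trans)
      moreover have "4 * vol ?e = vol d * (4 * 2 ^ CARD('n))" using vol_scale[of d ?e 1] k by simp
      ultimately have "vol d * \<bar>bm d - bm P\<bar> \<le> vol d * (4 * 2 ^ CARD('n))"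
        by (simp only:) (subst (asm) ennreal_le_iff, auto simp: less_imp_le)
      then show ?thesis by (subst (asm) mult_le_cancel_left_pos) auto
    qed
    have subP: "cell d \<subseteq> cell P" if "d \<in> St" for d using that by (auto simp: St_def Bad_def)
    have small: "(\<Sum>d\<in>St. vol d) \<le> vol P / 4"
    proof -
      have "ennreal (\<Sum>d\<in>St. 4 * vol d) = (\<Sum>d\<in>St. ennreal (4 * vol d))"
        by (subst sum_ennreal) (auto simp: less_imp_le)
      also have "\<dots> \<le> (\<Sum>d\<in>St. av d)" by (intro sum_mono) (auto simp: St_def Bad_def)
      also have "\<dots> \<le> av P" unfolding av_def
        by (rule sum_nn_integral_disjoint_le[OF finSt dis]) (use subP in auto)
      also have "\<dots> \<le> ennreal (vol P)" unfolding av_def by (rule b_osc)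
      finally have "(\<Sum>d\<in>St. 4 * vol d) \<le> vol P" by (subst (asm) ennreal_le_iff) (auto simp: less_imp_le)
      then show ?thesis by (simp add: sum_distrib_left[symmetric])
    qed
    \<comment> \<open>If some cell around \<open>x\<close> were bad, the coarsest bad one would
      belong to \<open>St\<close>. Hence no cell containing \<open>x\<close> is bad, in particular
      not the one of generation \<open>N\<close>.\<close>
    have good: "\<bar>bm (cell_at N x) - bm P\<bar> \<le> 4" if x: "x \<in> cell P" "\<And>d. d \<in> St \<Longrightarrow> x \<notin> cell d" for x
    proof -
      let ?d = "cell_at N x"
      have "\<not> Bad (cell_at j x)" for j
      proof
        assume "Bad (cell_at j x)"
        define i where "i = (LEAST i. Bad (cell_at i x))"
        have i: "Bad (cell_at i x)" unfolding i_def by (rule LeastI) fact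
        have "\<not> Bad (anc k (cell_at i x))" if "k < i" for k
        proof -
          have "anc k (cell_at i x) = cell_at k x" using that by (intro anc_cell_at) auto
          then show ?thesis using not_less_Least[of k "\<lambda>i. Bad (cell_at i x)"] that by (simp add: i_def)
        qed
        then have "cell_at i x \<in> St" using i by (auto simp: St_def)
        then show False using x(2) mem_cell_at by blast
      qed
      then have "\<not> Bad ?d" .
      moreover have "cell ?d \<subseteq> cell P" using x PN by (intro cell_nested[of x]) auto
      ultimately have "av ?d \<le> ennreal (4 * vol ?d)" using PN by (auto simp: Bad_def)
      moreover have "ennreal (vol ?d * \<bar>bm ?d - bm P\<bar>) \<le> av ?d"
        unfolding av_def by (rule mean_dist_le) simp
      ultimately have "ennreal (vol ?d * \<bar>bm ?d - bm P\<bar>) \<le> ennreal (4 * vol ?d)" by (meson order_trans)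
      then have "vol ?d * \<bar>bm ?d - bm P\<bar> \<le> vol ?d * 4"
        by (subst (asm) ennreal_le_iff) (auto simp: less_imp_le mult.commute)
      then show ?thesis by (subst (asm) mult_le_cancel_left_pos) auto
    qed
    define E where "E = exp (1/4 :: real)"
    have E0: "E > 0" by (simp add: E_def)
    have "E ^ 4 = exp 1" by (simp add: E_def exp_of_nat_mult[symmetric])
    then have "E ^ 4 \<le> 3" using exp_le by simp
    \<comment> \<open>\<open>exp 1 \<le> 3\<close>, while (4/3)^4 = 256/81 exceeds 3.\<close>
    have E: "E \<le> 4/3"
    proof (rule ccontr)
      assume "\<not> E \<le> 4/3"
      then have "(4/3)^4 < E^4" by (intro power_strict_mono) auto
      then show False using \<open>E ^ 4 \<le> 3\<close> by (simp add: power4_eq_xxxx)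
    qed
    have e1: "exp (jn * t) \<le> E" if "t \<le> 4 * 2 ^ CARD('n)" for t
    proof -
      have "jn * t \<le> jn * (4 * 2 ^ CARD('n))" using that jn_pos by (intro mult_left_mono) auto
      also have "\<dots> = 1/4" by (simp add: jn_def)
      finally show ?thesis by (simp add: E_def)
    qed
    let ?F = "\<lambda>R x. ennreal (exp (jn * \<bar>bm (cell_at N x) - bm R\<bar>))"
    \<comment> \<open>Inside a stopping cell the exponential splits at the mean of that cell: the
      jump costs the factor \<open>E\<close>, and the rest is the same integrand based at the
      smaller cell, to which the induction hypothesis applies.\<close>
    have pw: "?F P x * indicator (cell P) x \<le>
       ennreal E * indicator (cell P) x + (\<Sum>d\<in>St. ennreal E * (?F d x * indicator (cell d) x))" for x
    proof (cases "\<exists>d\<in>St. x \<in> cell d")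
      case True
      then obtain d where d: "d \<in> St" "x \<in> cell d" by blast
      have "exp (jn * \<bar>bm (cell_at N x) - bm P\<bar>) \<le> exp (jn * \<bar>bm d - bm P\<bar> + jn * \<bar>bm (cell_at N x) - bm d\<bar>)"
        using jn_pos by (simp flip: distrib_left)
      also have "\<dots> \<le> E * exp (jn * \<bar>bm (cell_at N x) - bm d\<bar>)"
        using e1[OF osc[OF d(1)]] by (simp add: exp_add)
      finally have "?F P x \<le> ennreal E * ?F d x" using E0 by (simp add: ennreal_mult'[symmetric] ennreal_leI)
      then have "?F P x * indicator (cell P) x \<le> ennreal E * (?F d x * indicator (cell d) x)"
        using d subP by (auto simp: indicator_def)
      also have "\<dots> \<le> (\<Sum>d\<in>St. ennreal E * (?F d x * indicator (cell d) x))"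
        by (rule member_le_sum[OF d(1)]) (use finSt in auto)
      finally show ?thesis by (simp add: add_increasing)
    next
      case False
      have "?F P x * indicator (cell P) x \<le> ennreal E * indicator (cell P) x"
      proof (cases "x \<in> cell P")
        case True
        have "\<bar>bm (cell_at N x) - bm P\<bar> \<le> 4 * 2 ^ CARD('n)"
          using good[OF True] False by (smt (verit) one_le_power)
        then show ?thesis using e1 by (auto simp: indicator_def intro!: ennreal_leI)
      qed auto
      then show ?thesis by (simp add: add_increasing2)
    qed
    have "(\<integral>\<^sup>+x\<in>cell P. ?F P x \<partial>lebesgue) \<le>
      (\<integral>\<^sup>+x. ennreal E * indicator (cell P) x + (\<Sum>d\<in>St. ennreal E * (?F d x * indicator (cell d) x)) \<partial>lebesgue)"
      by (intro nn_integral_mono pw)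
    also have "\<dots> = ennreal E * ennreal (vol P) + (\<Sum>d\<in>St. ennreal E * (\<integral>\<^sup>+x\<in>cell d. ?F d x \<partial>lebesgue))"
      by (subst nn_integral_add) (auto simp: nn_integral_sum nn_integral_cmult emeasure_cell)
    also have "\<dots> \<le> ennreal E * ennreal (vol P) + (\<Sum>d\<in>St. ennreal E * ennreal (2 * vol d))"
    proof (intro add_mono order_refl sum_mono mult_left_mono)
      fix d assume "d \<in> St"
      then show "(\<integral>\<^sup>+x\<in>cell d. ?F d x \<partial>lebesgue) \<le> ennreal (2 * vol d)"
        using less.hyps[of d] PN by (auto simp: St_def Bad_def)
    qed simp
    also have "\<dots> = ennreal (E * vol P + E * (2 * (\<Sum>d\<in>St. vol d)))"
      using E0 by (simp add: ennreal_mult'[symmetric] sum_ennreal less_imp_le sum_nonneg sum_distrib_left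
        ennreal_plus[symmetric] del: ennreal_plus)
    also have "\<dots> \<le> ennreal (2 * vol P)"
    proof (rule ennreal_leI)
      have "E * vol P + E * (2 * (\<Sum>d\<in>St. vol d)) \<le> E * vol P + E * (2 * (vol P / 4))"
        using small E0 by (intro add_left_mono mult_left_mono) auto
      also have "\<dots> = (3/2 * E) * vol P" by (simp add: algebra_simps)
      also have "\<dots> \<le> 2 * vol P" using E by (intro mult_right_mono) (auto simp: less_imp_le)
      finally show "E * vol P + E * (2 * (\<Sum>d\<in>St. vol d)) \<le> 2 * vol P" .
    qed
    finally show ?thesis .
  qed
qed

text \<open>Averaging over cells of generation \<open>N\<close> contracts the L^1 norm and fixes a
  function \<open>s\<close> that is constant on coarser cells. So the means of \<open>b\<close> are
  as close to \<open>s\<close> as \<open>b\<close> is, and the triangle inequality finishes.\<close>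

lemma mean_L1_approx:
  assumes "e > 0"
  shows "\<exists>N0. \<forall>N\<ge>N0. (\<integral>\<^sup>+x\<in>cell P. ennreal \<bar>bm (cell_at N x) - b x\<bar> \<partial>lebesgue) \<le> ennreal e"
proof -
  have "integrable lebesgue (\<lambda>x. indicator (cell P) x *\<^sub>R b x)"
    using b_int[of P] by (simp add: set_integrable_def)
  from L1_approx_cells[OF this half_gt_zero[OF assms], of P] obtain M s where
    s: "\<And>x y. idx M x = idx M y \<Longrightarrow> s x = s y" and
    sb: "(\<integral>\<^sup>+x\<in>cell P. ennreal \<bar>indicator (cell P) x *\<^sub>R b x - s x\<bar> \<partial>lebesgue) \<le> ennreal (e/2)" by blast
  have [measurable]: "s \<in> borel_measurable lebesgue" using s idx_constant_measurable by blast
  have "(\<integral>\<^sup>+x\<in>cell P. ennreal \<bar>indicator (cell P) x *\<^sub>R b x - s x\<bar> \<partial>lebesgue)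
     = (\<integral>\<^sup>+x\<in>cell P. ennreal \<bar>b x - s x\<bar> \<partial>lebesgue)"
    by (intro nn_integral_cong) (auto simp: indicator_def)
  with sb have sb: "(\<integral>\<^sup>+x\<in>cell P. ennreal \<bar>b x - s x\<bar> \<partial>lebesgue) \<le> ennreal (e/2)" by simp
  show ?thesis
  proof (intro exI allI impI)
    fix N assume N: "max M (fst P) \<le> N"
    have [measurable]: "(\<lambda>x. bm (cell_at N x)) \<in> borel_measurable lebesgue"
      by (rule measurable_compose[OF idx_measurable_lebesgue]) simp
    define F where "F = {d. cell d \<subseteq> cell P \<and> fst d = N}"
    have finF: "finite F"
      by (rule finite_subset[OF _ finite_subcells[of P N]]) (auto simp: F_def)
    have dis: "disjoint_family_on cell F" by (rule disjoint_cells[of _ N]) (auto simp: F_def)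
    have "(\<integral>\<^sup>+x\<in>cell P. ennreal \<bar>bm (cell_at N x) - s x\<bar> \<partial>lebesgue)
      \<le> (\<integral>\<^sup>+x. (\<Sum>d\<in>F. ennreal \<bar>bm d - s (corner d)\<bar> * indicator (cell d) x) \<partial>lebesgue)"
    proof (rule nn_integral_mono)
      fix x
      show "ennreal \<bar>bm (cell_at N x) - s x\<bar> * indicator (cell P) x
        \<le> (\<Sum>d\<in>F. ennreal \<bar>bm d - s (corner d)\<bar> * indicator (cell d) x)"
      proof (cases "x \<in> cell P")
        case True
        let ?d = "cell_at N x"
        have dF: "?d \<in> F" using True N cell_nested[of x ?d P] by (auto simp: F_def)
        have "idx N x = idx N (corner ?d)" using corner_in_cell[of ?d] by (simp add: cell_def)
        then have "s x = s (corner ?d)" using N by (intro s idx_coarsen[of M N]) auto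
        then have "ennreal \<bar>bm (cell_at N x) - s x\<bar> * indicator (cell P) x
          = ennreal \<bar>bm ?d - s (corner ?d)\<bar> * indicator (cell ?d) x" using True by simp
        also have "\<dots> \<le> (\<Sum>d\<in>F. ennreal \<bar>bm d - s (corner d)\<bar> * indicator (cell d) x)"
          by (rule member_le_sum[OF dF]) (use finF in auto)
        finally show ?thesis .
      qed auto
    qed
    also have "\<dots> = (\<Sum>d\<in>F. ennreal (vol d * \<bar>bm d - s (corner d)\<bar>))"
      by (subst nn_integral_sum)
         (auto simp: nn_integral_cmult emeasure_cell ennreal_mult' mult.commute[of "vol _"] less_imp_le)
    also have "\<dots> \<le> (\<Sum>d\<in>F. \<integral>\<^sup>+x\<in>cell d. ennreal \<bar>b x - s x\<bar> \<partial>lebesgue)"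
    proof (intro sum_mono mean_dist_le s)
      fix d x assume "d \<in> F" "x \<in> cell d"
      then have "idx N x = idx N (corner d)" using corner_in_cell[of d] by (simp add: cell_def F_def)
      then show "idx M x = idx M (corner d)" by (rule idx_coarsen[of M N, rotated]) (use N in simp)
    qed
    also have "\<dots> \<le> (\<integral>\<^sup>+x\<in>cell P. ennreal \<bar>b x - s x\<bar> \<partial>lebesgue)"
      by (rule sum_nn_integral_disjoint_le[OF finF dis]) (auto simp: F_def)
    finally have 1: "(\<integral>\<^sup>+x\<in>cell P. ennreal \<bar>bm (cell_at N x) - s x\<bar> \<partial>lebesgue) \<le> ennreal (e/2)"
      using sb by (rule order_trans)
    have "(\<integral>\<^sup>+x\<in>cell P. ennreal \<bar>bm (cell_at N x) - b x\<bar> \<partial>lebesgue) \<le>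
      (\<integral>\<^sup>+x. ennreal \<bar>bm (cell_at N x) - s x\<bar> * indicator (cell P) x + ennreal \<bar>b x - s x\<bar> * indicator (cell P) x \<partial>lebesgue)"
      by (intro nn_integral_mono)
         (auto simp: indicator_def ennreal_plus[symmetric] simp del: ennreal_plus intro!: ennreal_leI)
    also have "\<dots> \<le> ennreal (e/2) + ennreal (e/2)"
      using 1 sb by (subst nn_integral_add) (auto intro: add_mono)
    also have "\<dots> = ennreal e" using assms by (simp add: ennreal_plus[symmetric] del: ennreal_plus)
    finally show "(\<integral>\<^sup>+x\<in>cell P. ennreal \<bar>bm (cell_at N x) - b x\<bar> \<partial>lebesgue) \<le> ennreal e" .
  qed
qed

text \<open>The means converge to \<open>b\<close> in L^1 on \<open>P\<close>, hence almost
  everywhere along a subsequence; Fatou's lemma carries over the bound, which is uniform in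
  \<open>N\<close>.\<close>

theorem John_Nirenberg:
  "(\<integral>\<^sup>+x\<in>cell P. ennreal (exp (jn * \<bar>b x - bm P\<bar>)) \<partial>lebesgue) \<le> ennreal (2 * vol P)"
proof -
  have [measurable]: "(\<lambda>x. bm (cell_at N x)) \<in> borel_measurable lebesgue" for N
    by (rule measurable_compose[OF idx_measurable_lebesgue]) simp
  obtain N0 where N0: "\<And>N. N \<ge> N0 \<Longrightarrow> (\<integral>\<^sup>+x\<in>cell P. ennreal \<bar>bm (cell_at N x) - b x\<bar> \<partial>lebesgue) \<le> ennreal 1"
    using mean_L1_approx[of 1 P] by auto
  \<comment> \<open>The offset makes every member of the sequence integrable and at least as fine as
    \<open>P\<close>, where \<open>John_Nirenberg_step\<close> applies.\<close>
  define K where "K = max N0 (fst P)"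
  define w where "w N x = indicator (cell P) x * (bm (cell_at (N + K) x) - b x)" for N x
  have wm [measurable]: "w N \<in> borel_measurable lebesgue" for N unfolding w_def by measurable
  have nnw: "(\<integral>\<^sup>+x. ennreal (norm (w N x)) \<partial>lebesgue) =
    (\<integral>\<^sup>+x\<in>cell P. ennreal \<bar>bm (cell_at (N + K) x) - b x\<bar> \<partial>lebesgue)" for N
    by (intro nn_integral_cong) (auto simp: w_def indicator_def)
  have wi: "integrable lebesgue (w N)" for N
  proof (rule integrableI_bounded)
    show "(\<integral>\<^sup>+x. ennreal (norm (w N x)) \<partial>lebesgue) < \<infinity>"
      unfolding nnw by (rule le_less_trans[OF N0[of "N + K"]]) (auto simp: K_def)
  qed simp
  have lim: "(\<lambda>N. \<integral>x. norm (w N x) \<partial>lebesgue) \<longlonglongrightarrow> 0"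
  proof (rule LIMSEQ_I)
    fix r :: real assume r: "r > 0"
    obtain M where M: "\<And>N. N \<ge> M \<Longrightarrow> (\<integral>\<^sup>+x\<in>cell P. ennreal \<bar>bm (cell_at N x) - b x\<bar> \<partial>lebesgue) \<le> ennreal (r/2)"
      using mean_L1_approx[of "r/2" P] r by auto
    have "norm ((\<integral>x. norm (w N x) \<partial>lebesgue) - 0) < r" if "N \<ge> M" for N
    proof -
      have "ennreal (\<integral>x. norm (w N x) \<partial>lebesgue) = (\<integral>\<^sup>+x. ennreal (norm (w N x)) \<partial>lebesgue)"
        using wi by (subst nn_integral_eq_integral) auto
      also have "\<dots> \<le> ennreal (r/2)" unfolding nnw using M[of "N + K"] that by simp
      finally have "(\<integral>x. norm (w N x) \<partial>lebesgue) \<le> r/2" using r by (subst (asm) ennreal_le_iff) auto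
      then show ?thesis using r by simp
    qed
    then show "\<exists>no. \<forall>n\<ge>no. norm ((\<integral>x. norm (w n x) \<partial>lebesgue) - 0) < r" by blast
  qed
  obtain \<rho> where \<rho>: "AE x in lebesgue. (\<lambda>n. w (\<rho> n) x) \<longlonglongrightarrow> 0"
    using tendsto_L1_AE_subseq[OF wi lim] by blast
  let ?G = "\<lambda>n x. ennreal (exp (jn * \<bar>bm (cell_at (\<rho> n + K) x) - bm P\<bar>)) * indicator (cell P) x"
  have "(\<integral>\<^sup>+x\<in>cell P. ennreal (exp (jn * \<bar>b x - bm P\<bar>)) \<partial>lebesgue) \<le> (\<integral>\<^sup>+x. liminf (\<lambda>n. ?G n x) \<partial>lebesgue)"
  proof (rule nn_integral_mono_AE, use \<rho> in eventually_elim)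
    fix x assume x: "(\<lambda>n. w (\<rho> n) x) \<longlonglongrightarrow> 0"
    show "ennreal (exp (jn * \<bar>b x - bm P\<bar>)) * indicator (cell P) x \<le> liminf (\<lambda>n. ?G n x)"
    proof (cases "x \<in> cell P")
      case True
      then have "(\<lambda>n. bm (cell_at (\<rho> n + K) x) - b x) \<longlonglongrightarrow> 0" using x by (simp add: w_def)
      then have "(\<lambda>n. bm (cell_at (\<rho> n + K) x)) \<longlonglongrightarrow> b x" by (simp add: LIM_zero_iff)
      then have "(\<lambda>n. ennreal (exp (jn * \<bar>bm (cell_at (\<rho> n + K) x) - bm P\<bar>))) \<longlonglongrightarrow> ennreal (exp (jn * \<bar>b x - bm P\<bar>))"
        by (intro tendsto_intros)
      then have "liminf (\<lambda>n. ?G n x) = ennreal (exp (jn * \<bar>b x - bm P\<bar>))"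
        using True by (intro lim_imp_Liminf) auto
      then show ?thesis using True by simp
    qed auto
  qed
  also have "\<dots> \<le> liminf (\<lambda>n. \<integral>\<^sup>+x. ?G n x \<partial>lebesgue)"
    by (rule nn_integral_liminf) simp
  also have "\<dots> \<le> ennreal (2 * vol P)"
  proof (rule Liminf_le)
    show "eventually (\<lambda>n. (\<integral>\<^sup>+x. ?G n x \<partial>lebesgue) \<le> ennreal (2 * vol P)) sequentially"
      using John_Nirenberg_step by (simp add: K_def)
  qed simp
  finally show ?thesis .
qed

end

section \<open>Stopping cells and the Carleson embedding\<close>

context dyadic_grid
begin

lemma vol_simps [simp]: "vol c \<noteq> 0" "vol c \<ge> 0" "\<not> vol c < 0"
  using vol_pos[of c] by (simp_all only: not_less less_imp_le less_imp_neq[symmetric] simp_thms)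

lemma side_simps [simp]: "side c \<noteq> 0" "side c \<ge> 0"
  using side_pos[of c] by (simp_all only: less_imp_le less_imp_neq[symmetric] simp_thms)

definition sparse :: "(nat \<times> (int^'n)) set \<Rightarrow> bool" where
  "sparse S \<longleftrightarrow> (\<exists>E. disjoint_family_on E S \<and>
     (\<forall>c\<in>S. E c \<subseteq> cell c \<and> E c \<in> sets lebesgue \<and> vol c \<le> 2 * measure lebesgue (E c)))"

text \<open>\<open>F P Q\<close> stands for the integral over \<open>Q\<close> of a function that may depend on the stopping
  ancestor \<open>P\<close>; the family is built by adding cells in the order of their generation.\<close>

lemma sparse_stopping_cells:
  fixes F :: "nat \<times> (int^'n) \<Rightarrow> nat \<times> (int^'n) \<Rightarrow> real"
  assumes fin: "finite DD"
    and nonneg: "\<And>P Q. F P Q \<ge> 0"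
    and add: "\<And>P U. finite U \<Longrightarrow> disjoint_family_on cell U \<Longrightarrow> (\<And>Q. Q \<in> U \<Longrightarrow> cell Q \<subseteq> cell P) \<Longrightarrow>
      (\<Sum>Q\<in>U. F P Q) \<le> F P P"
  shows "\<exists>S\<subseteq>DD. sparse S \<and> (\<forall>Q\<in>DD. \<exists>P\<in>S. cell Q \<subseteq> cell P \<and> F P Q * vol P \<le> 2 * vol Q * F P P)"
proof -
  \<comment> \<open>The invariant: from \<open>P\<close>, the smallest selected cell properly
    containing \<open>Q\<close>, down to \<open>Q\<close>, the density of \<open>F P\<close> more
    than doubles. Sparseness will follow from this and from additivity.\<close>
  define J where "J S \<longleftrightarrow> (\<forall>Q\<in>S. \<forall>P\<in>S. cell Q \<subseteq> cell P \<longrightarrow> P \<noteq> Q \<longrightarrow>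
     (\<forall>R\<in>S. cell Q \<subseteq> cell R \<longrightarrow> R \<noteq> Q \<longrightarrow> fst R \<le> fst P) \<longrightarrow> 2 * vol Q * F P P < F P Q * vol P)" for S
  \<comment> \<open>Cells are added coarsest first. A new cell then properly contains no selected
    one, so it cannot become an ancestor of an earlier cell and the invariant there
    persists.\<close>
  have "\<exists>S\<subseteq>DD. J S \<and> (\<forall>Q\<in>DD. \<exists>P\<in>S. cell Q \<subseteq> cell P \<and> F P Q * vol P \<le> 2 * vol Q * F P P)"
    using fin
  proof (induction DD rule: finite_ranking_induct[where f=fst])
    case empty
    show ?case by (simp add: J_def)
  next
    case (insert x D)
    then obtain S where S: "S \<subseteq> D" "J S"
      "\<And>Q. Q \<in> D \<Longrightarrow> \<exists>P\<in>S. cell Q \<subseteq> cell P \<and> F P Q * vol P \<le> 2 * vol Q * F P P" by blast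
    show ?case
    proof (cases "x \<in> D \<or> (\<exists>P\<in>S. cell x \<subseteq> cell P \<and> F P x * vol P \<le> 2 * vol x * F P P)")
      case True
      then show ?thesis using S by (intro exI[of _ S]) blast
    next
      case False
      have small: "fst P \<le> fst x" if "P \<in> S" for P using insert.hyps(2) S(1) that by blast
      have noanc: "P = x" if "P \<in> S" "cell P \<subseteq> cell x" for P
        using cell_subset_antisym[OF that(2)] cell_subset_fst[OF that(2)] small[OF that(1)] by simp
      have "J (insert x S)"
        unfolding J_def
      proof (intro ballI impI)
        fix Q P
        assume QP: "Q \<in> insert x S" "P \<in> insert x S" "cell Q \<subseteq> cell P" "P \<noteq> Q"
          and mx: "\<forall>R\<in>insert x S. cell Q \<subseteq> cell R \<longrightarrow> R \<noteq> Q \<longrightarrow> fst R \<le> fst P"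
        show "2 * vol Q * F P P < F P Q * vol P"
        proof (cases "Q = x")
          case True
          then have "P \<in> S" using QP by auto
          then show ?thesis using False QP True by (auto simp: not_le)
        next
          case Qx: False
          then have "Q \<in> S" using QP by auto
          moreover have "P \<in> S" using QP noanc[OF \<open>Q \<in> S\<close>] Qx by auto
          ultimately show ?thesis using S(2) QP mx unfolding J_def by blast
        qed
      qed
      moreover have "insert x S \<subseteq> insert x D" using S(1) by blast
      moreover have "\<exists>P\<in>insert x S. cell Q \<subseteq> cell P \<and> F P Q * vol P \<le> 2 * vol Q * F P P"
        if "Q \<in> insert x D" for Q
      proof (cases "Q = x")
        case True
        have "F x x * vol x \<le> 2 * vol x * F x x"
          using mult_nonneg_nonneg[OF nonneg[of x x] less_imp_le[OF vol_pos[of x]]] by (simp add: mult.commute)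
        then show ?thesis using True by blast
      next
        case False
        then show ?thesis using S(3) that by blast
      qed
      ultimately show ?thesis by blast
    qed
  qed
  then obtain S where S: "S \<subseteq> DD" "J S"
    "\<And>Q. Q \<in> DD \<Longrightarrow> \<exists>P\<in>S. cell Q \<subseteq> cell P \<and> F P Q * vol P \<le> 2 * vol Q * F P P" by blast
  have finS: "finite S" using S(1) fin finite_subset by blast
  define desc where "desc P = {Q\<in>S. cell Q \<subseteq> cell P \<and> Q \<noteq> P}" for P
  \<comment> \<open>\<open>Mx P\<close> holds the children of \<open>P\<close> in the tree of
    selected cells. They are disjoint and cover all descendants, so removing them from
    \<open>P\<close> is the same as removing all descendants.\<close>
  define Mx where "Mx P = {Q \<in> desc P. \<forall>R\<in>S. cell Q \<subseteq> cell R \<longrightarrow> R \<noteq> Q \<longrightarrow> fst R \<le> fst P}" for P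
  define E where "E P = cell P - (\<Union>Q\<in>desc P. cell Q)" for P
  have desc_fst: "fst P < fst Q" if "Q \<in> desc P" for P Q
  proof -
    have "cell Q \<subseteq> cell P" "Q \<noteq> P" using that by (auto simp: desc_def)
    then show ?thesis using cell_subset_fst[of Q P] cell_subset_antisym[of Q P] by fastforce
  qed
  have "sparse S"
    unfolding sparse_def
  proof (intro exI conjI ballI)
    have "False" if "P \<in> S" "R \<in> S" "P \<noteq> R" "x \<in> E P" "x \<in> E R" "fst P \<le> fst R" for P R x
    proof -
      have "cell R \<subseteq> cell P" using that by (intro cell_nested[of x]) (auto simp: E_def)
      then have "R \<in> desc P" using that by (auto simp: desc_def)
      then show False using that by (auto simp: E_def)
    qed
    then show "disjoint_family_on E S"
      unfolding disjoint_family_on_def by (metis disjoint_iff nat_le_linear)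
    fix P assume P: "P \<in> S"
    show "E P \<subseteq> cell P" by (auto simp: E_def)
    have finU: "finite (desc P)" "finite (Mx P)" using finS by (auto simp: desc_def Mx_def)
    show Em: "E P \<in> sets lebesgue"
      unfolding E_def using finU by (intro sets.Diff sets.finite_UN) auto
    have cover: "(\<Union>Q\<in>desc P. cell Q) \<subseteq> (\<Union>Q\<in>Mx P. cell Q)"
    proof safe
      fix Q x assume Q: "Q \<in> desc P" "x \<in> cell Q"
      define n where "n = (LEAST n. \<exists>Q\<in>desc P. x \<in> cell Q \<and> fst Q = n)"
      have ex: "\<exists>n. \<exists>Q\<in>desc P. x \<in> cell Q \<and> fst Q = n" using Q by blast
      obtain Q0 where Q0: "Q0 \<in> desc P" "x \<in> cell Q0" "fst Q0 = n"
        using LeastI_ex[OF ex] n_def by blast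
      have "fst R \<le> fst P" if R: "R \<in> S" "cell Q0 \<subseteq> cell R" "R \<noteq> Q0" for R
      proof (rule ccontr)
        assume less: "\<not> fst R \<le> fst P"
        have xR: "x \<in> cell R" "x \<in> cell P" using R Q0 by (auto simp: desc_def)
        then have "cell R \<subseteq> cell P" using less by (intro cell_nested[of x]) auto
        then have "R \<in> desc P" using R less by (auto simp: desc_def)
        then have "n \<le> fst R" unfolding n_def using xR by (intro Least_le) blast
        moreover have "fst R \<le> fst Q0" using R(2) by (rule cell_subset_fst)
        ultimately have "fst R = fst Q0" using Q0 by simp
        then show False using cell_unique[of x R Q0] xR Q0 R by simp
      qed
      then have "Q0 \<in> Mx P" using Q0 by (auto simp: Mx_def)
      then show "x \<in> (\<Union>Q\<in>Mx P. cell Q)" using Q0 by blast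
    qed
    have dis: "disjoint_family_on cell (Mx P)"
    proof -
      have "False" if "Q \<in> Mx P" "R \<in> Mx P" "Q \<noteq> R" "x \<in> cell Q" "x \<in> cell R" "fst Q \<le> fst R" for Q R x
      proof -
        have "cell R \<subseteq> cell Q" using that by (intro cell_nested[of x]) auto
        then have "fst Q \<le> fst P" using that by (auto simp: Mx_def desc_def)
        then show False using desc_fst[of Q P] that by (auto simp: Mx_def)
      qed
      then show ?thesis unfolding disjoint_family_on_def by (metis disjoint_iff nat_le_linear)
    qed
    \<comment> \<open>Each child has more than twice the density of \<open>P\<close>, and the
      \<open>F P\<close>-masses of the children add up to at most \<open>F P P\<close>; so their
      volumes add up to at most half of \<open>vol P\<close>. Strictness of the invariant gives
      \<open>F P P > 0\<close> as soon as there is a child.\<close>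
    have half: "2 * (\<Sum>Q\<in>Mx P. vol Q) \<le> vol P"
    proof (cases "Mx P = {}")
      case True
      then show ?thesis by (simp add: less_imp_le)
    next
      case False
      have bad: "2 * vol Q * F P P < F P Q * vol P" if "Q \<in> Mx P" for Q
        using S(2) that P unfolding J_def Mx_def desc_def by blast
      obtain Q where Q: "Q \<in> Mx P" using False by blast
      have "0 \<le> 2 * vol Q * F P P" using nonneg[of P P] by (simp add: less_imp_le)
      then have "0 < F P Q * vol P" using bad[OF Q] by linarith
      then have "0 < F P Q" by (simp add: zero_less_mult_iff)
      also have "F P Q \<le> (\<Sum>Q\<in>Mx P. F P Q)" by (rule member_le_sum[OF Q]) (use finU nonneg in auto)
      also have sumF: "\<dots> \<le> F P P" by (rule add[OF finU(2) dis]) (auto simp: Mx_def desc_def)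
      finally have FP: "0 < F P P" .
      have "2 * (\<Sum>Q\<in>Mx P. vol Q) * F P P = (\<Sum>Q\<in>Mx P. 2 * vol Q * F P P)"
        by (simp add: sum_distrib_left sum_distrib_right)
      also have "\<dots> \<le> (\<Sum>Q\<in>Mx P. F P Q * vol P)" using bad by (intro sum_mono) (auto simp: less_imp_le)
      also have "\<dots> = (\<Sum>Q\<in>Mx P. F P Q) * vol P" by (simp add: sum_distrib_right)
      also have "\<dots> \<le> F P P * vol P" using sumF by (intro mult_right_mono) (auto simp: less_imp_le)
      finally show ?thesis using FP by (simp add: mult.commute)
    qed
    have fm: "cell Q \<in> fmeasurable lebesgue" for Q by (intro fmeasurableI) (auto simp: emeasure_cell)
    have fmU: "(\<Union>Q\<in>Mx P. cell Q) \<in> fmeasurable lebesgue"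
      using finU(2) fm by (rule fmeasurable.finite_UN)
    have fmE: "E P \<in> fmeasurable lebesgue"
      by (rule fmeasurableI2[OF fm[of P]]) (use Em in \<open>auto simp: E_def\<close>)
    have "measure lebesgue (cell P) \<le> measure lebesgue (E P \<union> (\<Union>Q\<in>Mx P. cell Q))"
    proof (rule measure_mono_fmeasurable)
      show "cell P \<subseteq> E P \<union> (\<Union>Q\<in>Mx P. cell Q)" using cover by (auto simp: E_def)
    qed (use fmU fmE in \<open>auto intro: fmeasurable.Un\<close>)
    also have "\<dots> \<le> measure lebesgue (E P) + measure lebesgue (\<Union>Q\<in>Mx P. cell Q)"
      using Em finU by (intro measure_Un_le) (auto intro!: sets.finite_UN)
    also have "measure lebesgue (\<Union>Q\<in>Mx P. cell Q) \<le> (\<Sum>Q\<in>Mx P. measure lebesgue (cell Q))"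
      using finU fm by (intro measure_UNION_le) auto
    finally show "vol P \<le> 2 * measure lebesgue (E P)" using half by (simp add: measure_cell)
  qed
  then show ?thesis using S by blast
qed

end

text \<open>The terms belong to a geometric series descending from the largest index with ratio
  2^(-\<eta>), and 1 - 2^(-\<eta>) \<ge> \<eta>/2. What matters is that \<eta> enters the
  denominator only to the first power.\<close>

lemma geometric_sum_below:
  fixes \<eta> G :: real and K :: "int set"
  assumes K: "finite K" and \<eta>: "0 < \<eta>" "\<eta> \<le> 1" and G: "G \<ge> 0"
    and le: "\<And>k. k \<in> K \<Longrightarrow> 2 powr (real_of_int k - 1) < G"
  shows "(\<Sum>k\<in>K. 2 powr (real_of_int k * \<eta>)) \<le> 4 / \<eta> * G powr \<eta>"
proof (cases "K = {}")
  case True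
  then show ?thesis using \<eta> by simp
next
  case False
  define k0 where "k0 = Max K"
  have k0: "k0 \<in> K" "\<And>k. k \<in> K \<Longrightarrow> k \<le> k0" using K False by (auto simp: k0_def)
  define x where "x = (2::real) powr (-\<eta>)"
  have x0: "0 < x" by (simp add: x_def)
  \<comment> \<open>Convexity of the exponential on [-ln 2, 0]: the chord joining the values 1/2 and
    1 lies above the graph.\<close>
  have x1: "x \<le> 1 - \<eta>/2"
  proof -
    have "exp ((1 - \<eta>) *\<^sub>R 0 + \<eta> *\<^sub>R (- ln 2)) \<le> (1 - \<eta>) * exp 0 + \<eta> * exp (- ln (2::real))"
      using \<eta> by (intro convex_onD[OF exp_convex]) auto
    then show ?thesis by (simp add: x_def powr_def exp_minus algebra_simps)
  qed
  then have x1': "x < 1" using \<eta> by simp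
  have "(\<Sum>k\<in>K. 2 powr (real_of_int k * \<eta>)) = (\<Sum>k\<in>K. 2 powr (real_of_int k0 * \<eta>) * x ^ nat (k0 - k))"
  proof (intro sum.cong refl)
    fix k assume "k \<in> K"
    then have "real_of_int k * \<eta> = k0 * \<eta> + real (nat (k0 - k)) * (-\<eta>)"
      using k0(2)[of k] by (simp add: algebra_simps)
    then show "2 powr (real_of_int k * \<eta>) = 2 powr (real_of_int k0 * \<eta>) * x ^ nat (k0 - k)"
      unfolding \<open>real_of_int k * \<eta> = _\<close> powr_add
      by (simp add: x_def powr_realpow[symmetric] powr_powr mult.commute)
  qed
  also have "\<dots> = 2 powr (real_of_int k0 * \<eta>) * (\<Sum>k\<in>K. x ^ nat (k0 - k))" by (simp add: sum_distrib_left)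
  also have "(\<Sum>k\<in>K. x ^ nat (k0 - k)) = (\<Sum>i\<in>(\<lambda>k. nat (k0 - k)) ` K. x ^ i)"
    by (subst sum.reindex) (auto simp: inj_on_def dest!: k0(2))
  also have "\<dots> \<le> (\<Sum>i. x ^ i)"
    using x0 x1' K by (intro sum_le_suminf summable_geometric) auto
  also have "\<dots> = 1 / (1 - x)" using x0 x1' by (intro suminf_geometric) auto
  also have "\<dots> \<le> 1 / (\<eta>/2)" using x1 \<eta> by (intro divide_left_mono) auto
  also have "2 powr (real_of_int k0 * \<eta>) * (1 / (\<eta>/2)) \<le> (2 * G) powr \<eta> * (1 / (\<eta>/2))"
  proof (intro mult_right_mono)
    have "2 powr real_of_int k0 \<le> 2 * G"
      using le[OF k0(1)] by (simp add: powr_diff)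
    then have "(2 powr real_of_int k0) powr \<eta> \<le> (2 * G) powr \<eta>" using \<eta> by (intro powr_mono2) auto
    then show "2 powr (real_of_int k0 * \<eta>) \<le> (2 * G) powr \<eta>" by (simp add: powr_powr)
  qed (use \<eta> in auto)
  also have "(2 * G) powr \<eta> * (1 / (\<eta>/2)) = 2 powr \<eta> * (2 / \<eta> * G powr \<eta>)"
    using G by (simp add: powr_mult)
  also have "\<dots> \<le> 2 powr 1 * (2 / \<eta> * G powr \<eta>)"
    using \<eta> by (intro mult_right_mono powr_mono) auto
  finally show ?thesis by (simp add: mult_left_mono)
qed

context dyadic_grid
begin

text \<open>An infinite integral would be read as average 0, so statements about \<open>av\<close>
  go together with finiteness of the integral, as in \<open>nn_integral_cell_Jensen\<close>.\<close>

definition av :: "(real^'n \<Rightarrow> real) \<Rightarrow> nat \<times> (int^'n) \<Rightarrow> real" where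
  "av g c = enn2real (\<integral>\<^sup>+x\<in>cell c. ennreal (g x) \<partial>lebesgue) / vol c"

lemma av_nonneg [simp]: "av g c \<ge> 0"
  by (simp add: av_def less_imp_le)

lemma nn_integral_cell_eq_av:
  "(\<integral>\<^sup>+x\<in>cell c. ennreal (g x) \<partial>lebesgue) < \<infinity> \<Longrightarrow>
    (\<integral>\<^sup>+x\<in>cell c. ennreal (g x) \<partial>lebesgue) = ennreal (vol c * av g c)"
  using vol_pos[of c] by (simp add: av_def)

lemma nn_integral_cell_Jensen:
  assumes [measurable]: "g \<in> borel_measurable lebesgue" and g: "\<And>x. g x \<ge> 0" and \<rho>: "1 < \<rho>"
    and B: "B \<ge> 0" "(\<integral>\<^sup>+x. ennreal (g x powr \<rho>) \<partial>lebesgue) \<le> ennreal B"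
  shows "(\<integral>\<^sup>+x\<in>cell c. ennreal (g x) \<partial>lebesgue) < \<infinity>" "vol c * av g c powr \<rho> \<le> B"
proof -
  define \<rho>' where "\<rho>' = \<rho> / (\<rho> - 1)"
  have \<rho>': "\<rho>' > 1" "1/\<rho> + 1/\<rho>' = 1" using \<rho> by (auto simp: \<rho>'_def field_simps)
  have "(\<integral>\<^sup>+x. ennreal (\<bar>g x\<bar> * \<bar>indicator (cell c) x\<bar>) \<partial>lebesgue) \<le> ennreal (B powr (1/\<rho>) * vol c powr (1/\<rho>'))"
  proof (rule nn_integral_Hoelder[OF _ _ \<rho> \<rho>' B(1)])
    have "(\<integral>\<^sup>+x. ennreal (\<bar>indicator (cell c) x\<bar> powr \<rho>') \<partial>lebesgue) = (\<integral>\<^sup>+x. indicator (cell c) x \<partial>lebesgue)"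
      using \<rho>' by (intro nn_integral_cong) (auto simp: indicator_def)
    then show "(\<integral>\<^sup>+x. ennreal (\<bar>indicator (cell c) x\<bar> powr \<rho>') \<partial>lebesgue) \<le> ennreal (vol c)"
      by (simp add: emeasure_cell)
  qed (use B g in \<open>auto simp: less_imp_le\<close>)
  also have "(\<integral>\<^sup>+x. ennreal (\<bar>g x\<bar> * \<bar>indicator (cell c) x\<bar>) \<partial>lebesgue) = (\<integral>\<^sup>+x\<in>cell c. ennreal (g x) \<partial>lebesgue)"
    using g by (intro nn_integral_cong) (auto simp: indicator_def)
  finally have le: "(\<integral>\<^sup>+x\<in>cell c. ennreal (g x) \<partial>lebesgue) \<le> ennreal (B powr (1/\<rho>) * vol c powr (1/\<rho>'))" .
  then show fin: "(\<integral>\<^sup>+x\<in>cell c. ennreal (g x) \<partial>lebesgue) < \<infinity>" by (rule le_less_trans) simp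
  have "vol c * av g c \<le> B powr (1/\<rho>) * vol c powr (1/\<rho>')"
    using le nn_integral_cell_eq_av[OF fin] by (simp add: ennreal_le_iff)
  then have "(vol c * av g c) powr \<rho> \<le> (B powr (1/\<rho>) * vol c powr (1/\<rho>')) powr \<rho>"
    using \<rho> by (intro powr_mono2) (auto simp: less_imp_le)
  also have "\<dots> = B * vol c powr (\<rho> - 1)"
    using \<rho> B by (simp add: powr_mult powr_powr \<rho>'_def)
  also have "(vol c * av g c) powr \<rho> = vol c powr (\<rho> - 1) * (vol c * av g c powr \<rho>)"
    using powr_add[of "vol c" "\<rho> - 1" 1] by (simp add: powr_mult less_imp_le)
  finally have "vol c powr (\<rho> - 1) * (vol c * av g c powr \<rho>) \<le> vol c powr (\<rho> - 1) * B" by (simp add: mult.commute)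
  then show "vol c * av g c powr \<rho> \<le> B"
    by (subst (asm) mult_le_cancel_left_pos) (use vol_pos[of c] in auto)
qed

text \<open>The constant must blow up no faster than \<open>1/(\<rho> - 1)\<close>. For the cells with \<open>av g c \<approx> 2\<^sup>k\<close> the
  maximal ones carry the measure, and there the part of \<open>g\<close> below \<open>2\<^bsup>k-1\<^esup>\<close> is negligible.\<close>

lemma Carleson_embedding:
  assumes S: "finite S" "sparse S"
    and [measurable]: "g \<in> borel_measurable lebesgue" and g: "\<And>x. g x \<ge> 0" and \<rho>: "1 < \<rho>" "\<rho> \<le> 2"
    and B: "B \<ge> 0" "(\<integral>\<^sup>+x. ennreal (g x powr \<rho>) \<partial>lebesgue) \<le> ennreal B"
  shows "(\<Sum>c\<in>S. vol c * av g c powr \<rho>) \<le> 64 / (\<rho> - 1) * B"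
proof -
  note fin = nn_integral_cell_Jensen(1)[OF assms(3) g \<rho>(1) B]
  obtain E where E: "disjoint_family_on E S" "\<And>c. c \<in> S \<Longrightarrow> E c \<subseteq> cell c"
    "\<And>c. c \<in> S \<Longrightarrow> E c \<in> sets lebesgue" "\<And>c. c \<in> S \<Longrightarrow> vol c \<le> 2 * measure lebesgue (E c)"
    using S(2) unfolding sparse_def by blast
  define \<eta> where "\<eta> = \<rho> - 1"
  have \<eta>: "0 < \<eta>" "\<eta> \<le> 1" using \<rho> by (auto simp: \<eta>_def)
  define lev where "lev c = \<lfloor>log 2 (av g c)\<rfloor>" for c
  define S' where "S' = {c\<in>S. av g c > 0}"
  define K where "K = lev ` S'"
  define Sk where "Sk k = {c\<in>S'. lev c = k}" for k
  define J where "J k = (\<integral>\<^sup>+x. ennreal (g x * indicator {x. 2 powr (real_of_int k - 1) < g x} x) \<partial>lebesgue)" for k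
  have finK: "finite K" "finite S'" "finite (Sk k)" for k using S by (auto simp: K_def S'_def Sk_def)
  have lev: "2 powr real_of_int k \<le> av g c" "av g c \<le> 2 powr (real_of_int k + 1)" if "c \<in> Sk k" for c k
  proof -
    have pos: "av g c > 0" and k: "lev c = k" using that by (auto simp: Sk_def S'_def)
    have "real_of_int k \<le> log 2 (av g c)" "log 2 (av g c) < real_of_int k + 1" using k unfolding lev_def by linarith+
    then show "2 powr real_of_int k \<le> av g c" "av g c \<le> 2 powr (real_of_int k + 1)"
      using pos by (simp_all add: le_log_iff log_less_iff less_imp_le)
  qed
  \<comment> \<open>Sparseness bounds the total volume by twice the measure of the union, which the
    maximal cells of the level cover. On such a cell the average is at least 2^k, and the part of
    \<open>g\<close> below 2^(k-1) accounts for at most half of it.\<close>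
  have packing: "(\<Sum>c\<in>Sk k. ennreal (vol c)) \<le> ennreal (2 powr (2 - real_of_int k)) * J k" for k
  proof -
    define M where "M = {c\<in>Sk k. \<forall>d\<in>Sk k. cell c \<subseteq> cell d \<longrightarrow> d = c}"
    have finM: "finite M" using finK by (simp add: M_def)
    have dis: "disjoint_family_on cell M"
    proof -
      have "False" if "Q \<in> M" "R \<in> M" "Q \<noteq> R" "x \<in> cell Q" "x \<in> cell R" "fst Q \<le> fst R" for Q R x
      proof -
        have "cell R \<subseteq> cell Q" using that by (intro cell_nested[of x]) auto
        then show False using that by (auto simp: M_def)
      qed
      then show ?thesis unfolding disjoint_family_on_def by (metis disjoint_iff nat_le_linear)
    qed
    have cover: "(\<Union>c\<in>Sk k. cell c) \<subseteq> (\<Union>c\<in>M. cell c)"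
    proof safe
      fix Q x assume Q: "Q \<in> Sk k" "x \<in> cell Q"
      define n where "n = (LEAST n. \<exists>Q\<in>Sk k. x \<in> cell Q \<and> fst Q = n)"
      have ex: "\<exists>n. \<exists>Q\<in>Sk k. x \<in> cell Q \<and> fst Q = n" using Q by blast
      obtain Q0 where Q0: "Q0 \<in> Sk k" "x \<in> cell Q0" "fst Q0 = n"
        using LeastI_ex[OF ex] n_def by blast
      have "R = Q0" if R: "R \<in> Sk k" "cell Q0 \<subseteq> cell R" for R
      proof -
        have xR: "x \<in> cell R" using R Q0 by auto
        then have "n \<le> fst R" unfolding n_def using R by (intro Least_le) blast
        moreover have "fst R \<le> fst Q0" using R(2) by (rule cell_subset_fst)
        ultimately show ?thesis using cell_unique[of x R Q0] xR Q0 by simp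
      qed
      then have "Q0 \<in> M" using Q0 by (auto simp: M_def)
      then show "x \<in> (\<Union>c\<in>M. cell c)" using Q0 by blast
    qed
    have SkS: "Sk k \<subseteq> S" by (auto simp: Sk_def S'_def)
    have "(\<Sum>c\<in>Sk k. ennreal (vol c)) \<le> (\<Sum>c\<in>Sk k. 2 * emeasure lebesgue (E c))"
    proof (intro sum_mono)
      fix c assume c: "c \<in> Sk k"
      then have cS: "c \<in> S" using SkS by blast
      have "emeasure lebesgue (E c) \<le> emeasure lebesgue (cell c)"
        using E(2)[OF cS] by (intro emeasure_mono) auto
      then have "emeasure lebesgue (E c) \<noteq> \<infinity>" by (auto simp: emeasure_cell top_unique)
      then have "emeasure lebesgue (E c) = ennreal (measure lebesgue (E c))" by (intro emeasure_eq_ennreal_measure) auto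
      then have "2 * emeasure lebesgue (E c) = ennreal (2 * measure lebesgue (E c))" by (simp add: ennreal_mult')
      then show "ennreal (vol c) \<le> 2 * emeasure lebesgue (E c)" using E(4)[OF cS] by (simp add: ennreal_leI)
    qed
    also have "\<dots> = 2 * emeasure lebesgue (\<Union>c\<in>Sk k. E c)"
    proof -
      have "disjoint_family_on E (Sk k)" using E(1) SkS by (rule disjoint_family_on_mono[rotated])
      then have "(\<Sum>c\<in>Sk k. emeasure lebesgue (E c)) = emeasure lebesgue (\<Union>c\<in>Sk k. E c)"
        using E(3) SkS finK by (intro sum_emeasure) auto
      then show ?thesis by (simp add: sum_distrib_left[symmetric])
    qed
    also have "\<dots> \<le> 2 * emeasure lebesgue (\<Union>c\<in>M. cell c)"
    proof (intro mult_left_mono emeasure_mono)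
      show "(\<Union>c\<in>Sk k. E c) \<subseteq> (\<Union>c\<in>M. cell c)"
        using E(2) SkS by (intro order_trans[OF _ cover]) blast
    qed (use finM in \<open>auto intro!: sets.finite_UN\<close>)
    also have "\<dots> = 2 * (\<Sum>c\<in>M. ennreal (vol c))"
      using finM dis by (subst sum_emeasure[symmetric]) (auto simp: emeasure_cell)
    also have "\<dots> \<le> 2 * (\<Sum>c\<in>M. ennreal (2 powr (1 - real_of_int k)) *
        (\<integral>\<^sup>+x\<in>cell c. ennreal (g x * indicator {x. 2 powr (real_of_int k - 1) < g x} x) \<partial>lebesgue))"
    proof (intro mult_left_mono sum_mono)
      fix c assume "c \<in> M"
      then have c: "c \<in> Sk k" by (simp add: M_def)
      define X where "X = (\<integral>\<^sup>+x\<in>cell c. ennreal (g x * indicator {x. 2 powr (real_of_int k - 1) < g x} x) \<partial>lebesgue)"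
      have "X \<le> (\<integral>\<^sup>+x\<in>cell c. ennreal (g x) \<partial>lebesgue)"
        unfolding X_def using g by (intro nn_integral_mono) (auto simp: indicator_def)
      then have "X < \<infinity>" using fin by (rule le_less_trans)
      then obtain X' where X': "X = ennreal X'" "X' \<ge> 0" by (cases X) auto
      have "ennreal (vol c * av g c) = (\<integral>\<^sup>+x\<in>cell c. ennreal (g x) \<partial>lebesgue)"
        using nn_integral_cell_eq_av[OF fin] by simp
      also have "\<dots> \<le> (\<integral>\<^sup>+x. ennreal (2 powr (real_of_int k - 1)) * indicator (cell c) x +
          ennreal (g x * indicator {x. 2 powr (real_of_int k - 1) < g x} x) * indicator (cell c) x \<partial>lebesgue)"
        by (intro nn_integral_mono) (auto simp: indicator_def intro!: ennreal_leI)
      also have "\<dots> = ennreal (2 powr (real_of_int k - 1) * vol c) + X"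
        unfolding X_def
        by (subst nn_integral_add) (auto simp: nn_integral_cmult emeasure_cell ennreal_mult')
      also have "\<dots> = ennreal (2 powr (real_of_int k - 1) * vol c + X')"
        using X' by (simp add: less_imp_le)
      finally have "vol c * av g c \<le> 2 powr (real_of_int k - 1) * vol c + X'"
        using X' by (subst (asm) ennreal_le_iff) (auto simp: less_imp_le)
      moreover have "vol c * 2 powr real_of_int k \<le> vol c * av g c"
        using lev(1)[OF c] by (intro mult_left_mono) (auto simp: less_imp_le)
      ultimately have "vol c * 2 powr real_of_int k - 2 powr (real_of_int k - 1) * vol c \<le> X'" by linarith
      then have "vol c * 2 powr (real_of_int k - 1) \<le> X'" by (simp add: powr_diff)
      then have "2 powr (1 - real_of_int k) * (vol c * 2 powr (real_of_int k - 1)) \<le> 2 powr (1 - real_of_int k) * X'"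
        by (intro mult_left_mono) auto
      moreover have "2 powr (1 - real_of_int k) * 2 powr (real_of_int k - 1) = (1::real)" by (simp add: powr_add[symmetric])
      ultimately have "vol c \<le> 2 powr (1 - real_of_int k) * X'" by (simp add: mult.left_commute)
      then show "ennreal (vol c) \<le> ennreal (2 powr (1 - real_of_int k)) *
         (\<integral>\<^sup>+x\<in>cell c. ennreal (g x * indicator {x. 2 powr (real_of_int k - 1) < g x} x) \<partial>lebesgue)"
        unfolding X_def[symmetric] X'(1) using X'(2) by (simp add: ennreal_mult'[symmetric] ennreal_leI)
    qed auto
    also have "\<dots> = 2 * (ennreal (2 powr (1 - real_of_int k)) * (\<Sum>c\<in>M. 
        (\<integral>\<^sup>+x\<in>cell c. ennreal (g x * indicator {x. 2 powr (real_of_int k - 1) < g x} x) \<partial>lebesgue)))"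
      by (simp add: sum_distrib_left)
    also have "\<dots> \<le> 2 * (ennreal (2 powr (1 - real_of_int k)) *
        (\<integral>\<^sup>+x\<in>UNIV. ennreal (g x * indicator {x. 2 powr (real_of_int k - 1) < g x} x) \<partial>lebesgue))"
      by (intro mult_left_mono sum_nn_integral_disjoint_le[OF finM dis]) auto
    also have "\<dots> = ennreal (2 powr (2 - real_of_int k)) * J k"
    proof -
      have "2 * ennreal (2 powr (1 - real_of_int k)) = ennreal (2 * 2 powr (1 - real_of_int k))" by (simp add: ennreal_mult')
      also have "2 * 2 powr (1 - real_of_int k) = 2 powr (2 - real_of_int k)" by (simp add: powr_diff)
      finally show ?thesis by (simp add: J_def mult.assoc[symmetric])
    qed
    finally show ?thesis .
  qed
  have "(\<Sum>c\<in>S. vol c * av g c powr \<rho>) = (\<Sum>c\<in>S'. vol c * av g c powr \<rho>)"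
    using S by (intro sum.mono_neutral_right) (auto simp: S'_def less_le)
  also have "\<dots> = (\<Sum>k\<in>K. \<Sum>c\<in>Sk k. vol c * av g c powr \<rho>)"
    unfolding K_def Sk_def using finK(2) by (rule sum.image_gen)
  also have "\<dots> \<le> (\<Sum>k\<in>K. \<Sum>c\<in>Sk k. (2 powr (real_of_int k + 1)) powr \<rho> * vol c)"
  proof (intro sum_mono)
    fix k c assume "c \<in> Sk k"
    then have "av g c powr \<rho> \<le> (2 powr (real_of_int k + 1)) powr \<rho>" using lev(2) \<rho> by (intro powr_mono2) auto
    then show "vol c * av g c powr \<rho> \<le> (2 powr (real_of_int k + 1)) powr \<rho> * vol c"
      by (simp add: mult.commute mult_right_mono)
  qed
  also have "\<dots> = (\<Sum>k\<in>K. (2 powr (real_of_int k + 1)) powr \<rho> * (\<Sum>c\<in>Sk k. vol c))"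
    by (simp add: sum_distrib_left)
  finally have "ennreal (\<Sum>c\<in>S. vol c * av g c powr \<rho>) \<le> ennreal (\<Sum>k\<in>K. (2 powr (real_of_int k + 1)) powr \<rho> * (\<Sum>c\<in>Sk k. vol c))"
    by (rule ennreal_leI)
  also have "\<dots> = (\<Sum>k\<in>K. ennreal ((2 powr (real_of_int k + 1)) powr \<rho> * (\<Sum>c\<in>Sk k. vol c)))"
    by (rule sum_ennreal[symmetric]) (auto intro!: mult_nonneg_nonneg sum_nonneg)
  also have "\<dots> = (\<Sum>k\<in>K. ennreal ((2 powr (real_of_int k + 1)) powr \<rho>) * (\<Sum>c\<in>Sk k. ennreal (vol c)))"
    by (simp add: ennreal_mult' sum_ennreal)
  also have "\<dots> \<le> (\<Sum>k\<in>K. ennreal ((2 powr (real_of_int k + 1)) powr \<rho>) * (ennreal (2 powr (2 - real_of_int k)) * J k))"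
    by (intro sum_mono mult_left_mono packing) auto
  \<comment> \<open>The factor 16 bounds 2^(2 + \<rho>), using \<rho> \<le> 2.\<close>
  also have "\<dots> \<le> (\<Sum>k\<in>K. ennreal (16 * 2 powr (real_of_int k * \<eta>)) * J k)"
  proof (intro sum_mono)
    fix k :: int
    have "(2 powr (real_of_int k + 1)) powr \<rho> * 2 powr (2 - real_of_int k) = 2 powr (2 + \<rho>) * 2 powr (real_of_int k * \<eta>)"
      by (simp add: powr_powr powr_add[symmetric] \<eta>_def algebra_simps)
    also have "\<dots> \<le> 2 powr 4 * 2 powr (real_of_int k * \<eta>)" using \<rho> by (intro mult_right_mono powr_mono) auto
    finally have "(2 powr (real_of_int k + 1)) powr \<rho> * 2 powr (2 - real_of_int k) \<le> 16 * 2 powr (real_of_int k * \<eta>)" by simp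
    then have "ennreal ((2 powr (real_of_int k + 1)) powr \<rho>) * ennreal (2 powr (2 - real_of_int k)) \<le> ennreal (16 * 2 powr (real_of_int k * \<eta>))"
      by (simp add: ennreal_mult'[symmetric] ennreal_leI)
    then show "ennreal ((2 powr (real_of_int k + 1)) powr \<rho>) * (ennreal (2 powr (2 - real_of_int k)) * J k) \<le> ennreal (16 * 2 powr (real_of_int k * \<eta>)) * J k"
      by (simp add: mult.assoc[symmetric] mult_right_mono)
  qed
  \<comment> \<open>After exchanging sum and integral, there remains at each point a geometric sum
    over the levels with 2^(k-1) < g x. It costs 4/\<eta>, whence 64 = 16 * 4.\<close>
  also have "\<dots> = (\<integral>\<^sup>+x. (\<Sum>k\<in>K. ennreal (16 * 2 powr (real_of_int k * \<eta>)) * ennreal (g x * indicator {x. 2 powr (real_of_int k - 1) < g x} x)) \<partial>lebesgue)"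
    unfolding J_def by (subst nn_integral_sum) (auto simp: nn_integral_cmult)
  also have "\<dots> \<le> (\<integral>\<^sup>+x. ennreal (64 / \<eta>) * ennreal (g x powr \<rho>) \<partial>lebesgue)"
  proof (intro nn_integral_mono)
    fix x
    let ?K = "{k\<in>K. 2 powr (real_of_int k - 1) < g x}"
    have "(\<Sum>k\<in>K. ennreal (16 * 2 powr (real_of_int k * \<eta>)) * ennreal (g x * indicator {x. 2 powr (real_of_int k - 1) < g x} x))
      = (\<Sum>k\<in>K. ennreal (if 2 powr (real_of_int k - 1) < g x then 16 * 2 powr (real_of_int k * \<eta>) * g x else 0))"
      using g by (intro sum.cong) (auto simp: indicator_def ennreal_mult')
    also have "\<dots> = ennreal (\<Sum>k\<in>K. if 2 powr (real_of_int k - 1) < g x then 16 * 2 powr (real_of_int k * \<eta>) * g x else 0)"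
      using g by (subst sum_ennreal) auto
    also have "(\<Sum>k\<in>K. if 2 powr (real_of_int k - 1) < g x then 16 * 2 powr (real_of_int k * \<eta>) * g x else 0)
      = (\<Sum>k\<in>?K. 16 * 2 powr (real_of_int k * \<eta>) * g x)"
      using finK by (subst sum.inter_filter[symmetric]) auto
    also have "\<dots> = 16 * g x * (\<Sum>k\<in>?K. 2 powr (real_of_int k * \<eta>))"
      by (simp add: sum_distrib_left algebra_simps)
    also have "\<dots> \<le> 16 * g x * (4 / \<eta> * g x powr \<eta>)"
      using finK g \<eta> by (intro mult_left_mono geometric_sum_below) auto
    also have "\<dots> = 64 / \<eta> * g x powr \<rho>"
      using g[of x] powr_mult_base[of "g x" \<eta>] by (simp add: \<eta>_def algebra_simps)
    finally show "(\<Sum>k\<in>K. ennreal (16 * 2 powr (real_of_int k * \<eta>)) * ennreal (g x * indicator {x. 2 powr (real_of_int k - 1) < g x} x))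
       \<le> ennreal (64 / \<eta>) * ennreal (g x powr \<rho>)"
      using \<eta> by (simp add: ennreal_mult'[symmetric] ennreal_leI)
  qed
  also have "\<dots> \<le> ennreal (64 / \<eta>) * ennreal B"
    using B by (subst nn_integral_cmult) (auto intro: mult_left_mono)
  also have "\<dots> = ennreal (64 / \<eta> * B)" using \<eta> B by (simp add: ennreal_mult'[symmetric])
  finally show ?thesis using \<eta> B by (subst (asm) ennreal_le_iff) (auto simp: \<eta>_def)
qed

end

section \<open>Sparse domination\<close>

lemma power_le_fact_exp: "(x::real) \<ge> 0 \<Longrightarrow> x ^ k \<le> fact k * exp x"
proof -
  assume x: "x \<ge> 0"
  have "(\<Sum>n\<in>{k}. x ^ n /\<^sub>R fact n) \<le> (\<Sum>n. x ^ n /\<^sub>R fact n)"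
    using x by (intro sum_le_suminf summable_exp_generic) auto
  then have "x ^ k / fact k \<le> exp x" by (simp add: exp_def divide_inverse mult.commute)
  then show ?thesis by (simp add: field_simps)
qed

text \<open>The cost of passing to a subcell \<open>k\<close> generations down. Both integrals in
  the bilinear form change the mean of \<open>b\<close> in \<open>Phi\<close>, each at the price of
  an \<open>m\<close>-th power, hence \<open>2 * m\<close>; the other factor is the ratio of the
  \<alpha>-th powers of the sides.\<close>

definition gap_coeff :: "nat \<Rightarrow> real \<Rightarrow> nat \<Rightarrow> nat \<Rightarrow> real" where
  "gap_coeff n \<alpha> m k = (1 + 2 ^ n * real k) ^ (2 * m) * 2 powr (- \<alpha> * real k)"

lemma gap_coeff_nonneg: "gap_coeff n \<alpha> m k \<ge> 0"
  by (simp add: gap_coeff_def)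

lemma summable_gap_coeff: assumes "\<alpha> > 0" shows "summable (gap_coeff n \<alpha> m)"
proof -
  \<comment> \<open>The polynomial is absorbed by half of the available exponential decay:
    \<open>e * 2 ^ n\<close> equals \<alpha> * ln 2 / 2.\<close>
  define e where "e = \<alpha> * ln 2 / 2 / 2 ^ n"
  have e: "e > 0" using assms by (simp add: e_def)
  define C where "C = (1 / e) ^ (2 * m) * fact (2 * m) * exp e"
  have "gap_coeff n \<alpha> m k \<le> C * (exp (- (\<alpha> * ln 2 / 2))) ^ k" for k
  proof -
    have "(e * (1 + 2 ^ n * real k)) ^ (2 * m) \<le> fact (2 * m) * exp (e * (1 + 2 ^ n * real k))"
      using e by (intro power_le_fact_exp) auto
    moreover have "exp (e * (1 + 2 ^ n * real k)) = exp (e + \<alpha> * ln 2 / 2 * real k)" by (simp add: e_def field_simps)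
    ultimately have "(1 / e) ^ (2 * m) * (e * (1 + 2 ^ n * real k)) ^ (2 * m) \<le> (1 / e) ^ (2 * m) * (fact (2 * m) * exp (e + \<alpha> * ln 2 / 2 * real k))"
      using e by (intro mult_left_mono) auto
    moreover have "(1 / e) ^ (2 * m) * (e * (1 + 2 ^ n * real k)) ^ (2 * m) = (1 + 2 ^ n * real k) ^ (2 * m)"
      using e unfolding power_mult_distrib[symmetric] by (simp add: mult.assoc[symmetric])
    ultimately have "(1 + 2 ^ n * real k) ^ (2 * m) \<le> C * exp (\<alpha> * ln 2 / 2 * real k)"
      by (simp add: C_def exp_add mult.assoc)
    then have "gap_coeff n \<alpha> m k \<le> C * exp (\<alpha> * ln 2 / 2 * real k) * 2 powr (- \<alpha> * real k)"
      unfolding gap_coeff_def by (intro mult_right_mono) auto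
    also have "\<dots> = C * (exp (- (\<alpha> * ln 2 / 2))) ^ k"
      by (simp add: powr_def exp_of_nat_mult[symmetric] mult.assoc exp_add[symmetric] algebra_simps)
    finally show ?thesis .
  qed
  moreover have "summable (\<lambda>k. C * (exp (- (\<alpha> * ln 2 / 2))) ^ k)"
    using assms by (intro summable_mult summable_geometric) auto
  ultimately show ?thesis
    by (rule_tac summable_comparison_test'[of "\<lambda>k. C * (exp (- (\<alpha> * ln 2 / 2))) ^ k" 0])
       (simp_all add: abs_of_nonneg[OF gap_coeff_nonneg])
qed

context bmo_grid
begin

definition Phi :: "nat \<Rightarrow> nat \<times> (int^'n) \<Rightarrow> real^'n \<Rightarrow> real" where
  "Phi m c x = (1 + \<bar>b x - bm c\<bar>) ^ m"

lemma Phi_measurable [measurable]: "Phi m c \<in> borel_measurable lebesgue"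
  unfolding Phi_def by measurable

lemma Phi_ge1: "1 \<le> Phi m c x"
  by (simp add: Phi_def one_le_power)

lemma Phi_nonneg [simp]: "0 \<le> Phi m c x"
  using Phi_ge1[of m c x] by linarith

text \<open>The inequality 1 + s + t \<le> (1 + s) (1 + t) separates the variables. Adding 1 before
  taking the power is what makes the oscillation factor submultiplicative.\<close>

lemma Phi_kernel_le: "(1 + \<bar>b x - b y\<bar>) ^ m \<le> Phi m c x * Phi m c y"
proof -
  have "1 + \<bar>b x - b y\<bar> \<le> 1 + \<bar>b x - bm c\<bar> + \<bar>b y - bm c\<bar> + \<bar>b x - bm c\<bar> * \<bar>b y - bm c\<bar>"
    by (smt (verit) mult_nonneg_nonneg)
  then have "1 + \<bar>b x - b y\<bar> \<le> (1 + \<bar>b x - bm c\<bar>) * (1 + \<bar>b y - bm c\<bar>)" by (simp add: algebra_simps)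
  then show ?thesis unfolding Phi_def power_mult_distrib[symmetric] by (intro power_mono) auto
qed

lemma Phi_descend:
  assumes "cell Q \<subseteq> cell P" "fst Q = fst P + k"
  shows "Phi m Q x \<le> (1 + 2 ^ CARD('n) * real k) ^ m * Phi m P x"
proof -
  have "P = anc (fst P) Q"
    using assms corner_in_cell[of Q] by (intro anc_unique[of "corner Q"]) auto
  then have "\<bar>bm Q - bm P\<bar> \<le> 2 ^ CARD('n) * real k" using mean_anc[OF assms(2)] by simp
  then have "1 + \<bar>b x - bm Q\<bar> \<le> 1 + \<bar>b x - bm P\<bar> + 2 ^ CARD('n) * real k"
    by linarith
  also have "\<dots> \<le> \<dots> + 2 ^ CARD('n) * real k * \<bar>b x - bm P\<bar>" by simp
  also have "\<dots> = (1 + 2 ^ CARD('n) * real k) * (1 + \<bar>b x - bm P\<bar>)" by (simp add: algebra_simps)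
  finally show ?thesis unfolding Phi_def power_mult_distrib[symmetric] by (intro power_mono) auto
qed

text \<open>The first cell says where the mean of \<open>b\<close> is taken, the second where one
  integrates. With the first cell fixed the quantity is additive in the second, as the stopping
  argument requires.\<close>

definition osc_int :: "nat \<Rightarrow> (real^'n \<Rightarrow> real) \<Rightarrow> nat \<times> (int^'n) \<Rightarrow> nat \<times> (int^'n) \<Rightarrow> real" where
  "osc_int m F P Q = enn2real (\<integral>\<^sup>+x\<in>cell Q. ennreal (Phi m P x * F x) \<partial>lebesgue)"

context
  fixes m :: nat and F :: "real^'n \<Rightarrow> real"
  assumes F [measurable]: "F \<in> borel_measurable lebesgue" and F0: "\<And>x. F x \<ge> 0"
    and fin: "\<And>c. (\<integral>\<^sup>+x\<in>cell c. ennreal (Phi m c x * F x) \<partial>lebesgue) < \<infinity>"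
begin

lemma osc_int_finite:
  assumes "cell Q \<subseteq> cell P"
  shows "(\<integral>\<^sup>+x\<in>cell Q. ennreal (Phi m P x * F x) \<partial>lebesgue) = ennreal (osc_int m F P Q)"
proof -
  have "(\<integral>\<^sup>+x\<in>cell Q. ennreal (Phi m P x * F x) \<partial>lebesgue) \<le> (\<integral>\<^sup>+x\<in>cell P. ennreal (Phi m P x * F x) \<partial>lebesgue)"
    using assms by (intro nn_integral_mono) (auto simp: indicator_def)
  then have "(\<integral>\<^sup>+x\<in>cell Q. ennreal (Phi m P x * F x) \<partial>lebesgue) < \<infinity>" using fin by (rule le_less_trans)
  then show ?thesis by (simp add: osc_int_def)
qed

lemma osc_int_add:
  assumes U: "finite U" "disjoint_family_on cell U" "\<And>Q. Q \<in> U \<Longrightarrow> cell Q \<subseteq> cell P"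
  shows "(\<Sum>Q\<in>U. osc_int m F P Q) \<le> osc_int m F P P"
proof -
  have "ennreal (\<Sum>Q\<in>U. osc_int m F P Q) = (\<Sum>Q\<in>U. ennreal (osc_int m F P Q))"
    by (subst sum_ennreal) (auto simp: osc_int_def)
  also have "\<dots> = (\<Sum>Q\<in>U. \<integral>\<^sup>+x\<in>cell Q. ennreal (Phi m P x * F x) \<partial>lebesgue)"
    using U(3) osc_int_finite by (intro sum.cong) auto
  also have "\<dots> \<le> (\<integral>\<^sup>+x\<in>cell P. ennreal (Phi m P x * F x) \<partial>lebesgue)"
    using U by (intro sum_nn_integral_disjoint_le) auto
  also have "\<dots> = ennreal (osc_int m F P P)" by (rule osc_int_finite) simp
  finally show ?thesis by (subst (asm) ennreal_le_iff) (auto simp: osc_int_def)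
qed

lemma osc_int_descend:
  assumes "cell Q \<subseteq> cell P" "fst Q = fst P + k"
  shows "osc_int m F Q Q \<le> (1 + 2 ^ CARD('n) * real k) ^ m * osc_int m F P Q"
proof -
  have "ennreal (osc_int m F Q Q) = (\<integral>\<^sup>+x\<in>cell Q. ennreal (Phi m Q x * F x) \<partial>lebesgue)"
    using osc_int_finite[of Q Q] by simp
  also have "\<dots> \<le> (\<integral>\<^sup>+x. ennreal ((1 + 2 ^ CARD('n) * real k) ^ m) * (ennreal (Phi m P x * F x) * indicator (cell Q) x) \<partial>lebesgue)"
  proof (intro nn_integral_mono)
    fix x
    have "Phi m Q x * F x \<le> (1 + 2 ^ CARD('n) * real k) ^ m * (Phi m P x * F x)"
      using mult_right_mono[OF Phi_descend[OF assms, of m x] F0[of x]] by (simp add: mult.assoc)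
    then have "ennreal (Phi m Q x * F x) \<le> ennreal ((1 + 2 ^ CARD('n) * real k) ^ m) * ennreal (Phi m P x * F x)"
      by (simp add: ennreal_mult'[symmetric] ennreal_leI)
    then show "ennreal (Phi m Q x * F x) * indicator (cell Q) x \<le>
      ennreal ((1 + 2 ^ CARD('n) * real k) ^ m) * (ennreal (Phi m P x * F x) * indicator (cell Q) x)"
      by (simp add: mult.assoc[symmetric] mult_right_mono)
  qed
  also have "\<dots> = ennreal ((1 + 2 ^ CARD('n) * real k) ^ m * osc_int m F P Q)"
    by (subst nn_integral_cmult, simp, simp only: osc_int_finite[OF assms(1)])
       (simp add: ennreal_mult' osc_int_def)
  finally show ?thesis by (subst (asm) ennreal_le_iff) (auto simp: osc_int_def)
qed

end

text \<open>Stopping is governed by \<open>F\<close> alone. A cell \<open>Q\<close> is charged to a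
  selected \<open>P\<close> on which the density of \<open>F\<close> has at most doubled, so its
  \<open>F\<close>-integral is at most 2 * vol Q / vol P times that over \<open>P\<close>. The
  \<open>H\<close>-integrals over cells of one generation inside \<open>P\<close> add up to at most
  the one over \<open>P\<close>, and the sum over generations converges by the gap
  coefficients.\<close>

lemma sparse_domination:
  fixes F H :: "real^'n \<Rightarrow> real"
  assumes F: "F \<in> borel_measurable lebesgue" "\<And>x. F x \<ge> 0"
      "\<And>c. (\<integral>\<^sup>+x\<in>cell c. ennreal (Phi m c x * F x) \<partial>lebesgue) < \<infinity>"
    and H: "H \<in> borel_measurable lebesgue" "\<And>x. H x \<ge> 0"
      "\<And>c. (\<integral>\<^sup>+x\<in>cell c. ennreal (Phi m c x * H x) \<partial>lebesgue) < \<infinity>"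
    and DD: "finite DD" and \<alpha>: "\<alpha> > 0"
  shows "\<exists>S\<subseteq>DD. sparse S \<and>
     (\<Sum>Q\<in>DD. side Q powr (\<alpha> - real CARD('n)) * osc_int m F Q Q * osc_int m H Q Q)
      \<le> 2 * suminf (gap_coeff CARD('n) \<alpha> m) * (\<Sum>P\<in>S. side P powr (\<alpha> - real CARD('n)) * osc_int m F P P * osc_int m H P P)"
proof -
  note Ffin = osc_int_finite[OF F] and Fadd = osc_int_add[OF F] and Fdesc = osc_int_descend[OF F]
  note Hfin = osc_int_finite[OF H] and Hadd = osc_int_add[OF H] and Hdesc = osc_int_descend[OF H]
  let ?n = "CARD('n)"
  have nn: "osc_int m F P Q \<ge> 0" "osc_int m H P Q \<ge> 0" for P Q by (auto simp: osc_int_def)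
  obtain S where S: "S \<subseteq> DD" "sparse S"
    "\<And>Q. Q \<in> DD \<Longrightarrow> \<exists>P\<in>S. cell Q \<subseteq> cell P \<and> osc_int m F P Q * vol P \<le> 2 * vol Q * osc_int m F P P"
    using sparse_stopping_cells[OF DD nn(1) Fadd] by blast
  define pi where "pi Q = (SOME P. P \<in> S \<and> cell Q \<subseteq> cell P \<and> osc_int m F P Q * vol P \<le> 2 * vol Q * osc_int m F P P)" for Q
  have pi: "pi Q \<in> S" "cell Q \<subseteq> cell (pi Q)" "osc_int m F (pi Q) Q * vol (pi Q) \<le> 2 * vol Q * osc_int m F (pi Q) (pi Q)"
    if "Q \<in> DD" for Q
    using someI_ex[of "\<lambda>P. P \<in> S \<and> cell Q \<subseteq> cell P \<and> osc_int m F P Q * vol P \<le> 2 * vol Q * osc_int m F P P"]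
      S(3)[OF that] unfolding pi_def by blast+
  define T where "T Q = side Q powr (\<alpha> - real ?n) * osc_int m F Q Q * osc_int m H Q Q" for Q
  let ?g = "gap_coeff ?n \<alpha> m"
  have each: "T Q \<le> 2 * side P powr (\<alpha> - real ?n) * osc_int m F P P * (?g k * osc_int m H P Q)"
    if Q: "Q \<in> DD" "pi Q = P" "fst Q = fst P + k" for P Q k
  proof -
    let ?c = "(1 + 2 ^ ?n * real k) ^ m"
    have sub: "cell Q \<subseteq> cell P" using pi(2)[OF Q(1)] Q(2) by simp
    have c0: "?c \<ge> 0" by simp
    have "T Q \<le> side Q powr (\<alpha> - real ?n) * (?c * osc_int m F P Q) * (?c * osc_int m H P Q)"
      unfolding T_def using Fdesc[OF sub Q(3)] Hdesc[OF sub Q(3)] nn c0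
      by (intro mult_mono mult_left_mono mult_nonneg_nonneg) auto
    also have "\<dots> = side Q powr (\<alpha> - real ?n) * (?c * ?c) * osc_int m H P Q * osc_int m F P Q" by simp
    also have "\<dots> \<le> side Q powr (\<alpha> - real ?n) * (?c * ?c) * osc_int m H P Q * (2 * vol Q * osc_int m F P P / vol P)"
      using pi(3)[OF Q(1)] Q(2) nn c0
      by (intro mult_left_mono mult_nonneg_nonneg) (auto simp: pos_le_divide_eq)
    also have "\<dots> = 2 * (side Q powr (\<alpha> - real ?n) * vol Q / vol P) * osc_int m F P P * (?c * ?c * osc_int m H P Q)"
      by simp
    \<comment> \<open>The factor vol Q gained from \<open>F\<close> turns side^(\<alpha> - n) into
      side^\<alpha>, which decays geometrically in the generation gap.\<close>
    also have "side Q powr (\<alpha> - real ?n) * vol Q / vol P = side P powr (\<alpha> - real ?n) * 2 powr (- \<alpha> * real k)"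
    proof -
      have v: "vol c = side c powr real ?n" for c by (simp add: vol_def powr_realpow)
      have "side Q powr (\<alpha> - real ?n) * vol Q = side Q powr \<alpha>" by (simp add: v powr_add[symmetric])
      also have "\<dots> = side P powr \<alpha> * 2 powr (- \<alpha> * real k)"
        by (simp add: side_scale[OF Q(3)] powr_divide powr_minus_divide powr_powr[symmetric] powr_realpow
            mult.commute[of \<alpha>])
      also have "\<dots> / vol P = side P powr (\<alpha> - real ?n) * 2 powr (- \<alpha> * real k)"
        by (simp add: v powr_diff)
      finally show ?thesis .
    qed
    also have "2 * (side P powr (\<alpha> - real ?n) * 2 powr (- \<alpha> * real k)) * osc_int m F P P * (?c * ?c * osc_int m H P Q)
      = 2 * side P powr (\<alpha> - real ?n) * osc_int m F P P * (?g k * osc_int m H P Q)"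
      by (simp add: gap_coeff_def power_mult power2_eq_square power_mult_distrib mult_ac)
    finally show ?thesis .
  qed
  have grp: "(\<Sum>Q\<in>{Q\<in>DD. pi Q = P}. T Q) \<le> 2 * suminf ?g * T P" if P: "P \<in> S" for P
  proof -
    define U where "U = {Q\<in>DD. pi Q = P}"
    define gap where "gap Q = fst Q - fst P" for Q :: "nat \<times> (int^'n)"
    have finU: "finite U" using DD by (simp add: U_def)
    have U: "cell Q \<subseteq> cell P" "fst Q = fst P + gap Q" if "Q \<in> U" for Q
    proof -
      show sub: "cell Q \<subseteq> cell P" using pi(2)[of Q] that by (auto simp: U_def)
      show "fst Q = fst P + gap Q" using cell_subset_fst[OF sub] by (simp add: gap_def)
    qed
    let ?A = "2 * side P powr (\<alpha> - real ?n) * osc_int m F P P"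
    have A0: "?A \<ge> 0" using nn by simp
    have "(\<Sum>Q\<in>U. T Q) \<le> (\<Sum>Q\<in>U. ?A * (?g (gap Q) * osc_int m H P Q))"
    proof (intro sum_mono)
      fix Q assume Q: "Q \<in> U"
      show "T Q \<le> ?A * (?g (gap Q) * osc_int m H P Q)"
        by (rule each[OF _ _ U(2)[OF Q]]) (use Q in \<open>simp_all add: U_def\<close>)
    qed
    also have "\<dots> = ?A * (\<Sum>Q\<in>U. ?g (gap Q) * osc_int m H P Q)" by (simp add: sum_distrib_left)
    \<comment> \<open>Grouping by generation makes the cells of each group disjoint.\<close>
    also have "(\<Sum>Q\<in>U. ?g (gap Q) * osc_int m H P Q) = (\<Sum>k\<in>gap ` U. \<Sum>Q\<in>{Q\<in>U. gap Q = k}. ?g (gap Q) * osc_int m H P Q)"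
      using finU by (rule sum.image_gen)
    also have "?A * \<dots> \<le> ?A * (\<Sum>k\<in>gap ` U. ?g k * osc_int m H P P)"
    proof (intro mult_left_mono[OF _ A0] sum_mono)
      fix k
      have "(\<Sum>Q\<in>{Q\<in>U. gap Q = k}. ?g (gap Q) * osc_int m H P Q) = ?g k * (\<Sum>Q\<in>{Q\<in>U. gap Q = k}. osc_int m H P Q)"
        by (simp add: sum_distrib_left)
      also have "\<dots> \<le> ?g k * osc_int m H P P"
        using finU U by (intro mult_left_mono Hadd disjoint_cells[of _ "fst P + k"])
          (auto simp: gap_coeff_nonneg)
      finally show "(\<Sum>Q\<in>{Q\<in>U. gap Q = k}. ?g (gap Q) * osc_int m H P Q) \<le> ?g k * osc_int m H P P" .
    qed
    also have "(\<Sum>k\<in>gap ` U. ?g k * osc_int m H P P) = (\<Sum>k\<in>gap ` U. ?g k) * osc_int m H P P"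
      by (simp add: sum_distrib_right)
    also have "?A * \<dots> \<le> ?A * (suminf ?g * osc_int m H P P)"
      using finU \<alpha> nn by (intro mult_left_mono[OF _ A0] mult_right_mono sum_le_suminf summable_gap_coeff)
        (auto simp: gap_coeff_nonneg)
    also have "\<dots> = 2 * suminf ?g * T P" by (simp add: T_def)
    finally show ?thesis by (simp add: U_def)
  qed
  have finS: "finite S" using S(1) DD finite_subset by blast
  have "(\<Sum>Q\<in>DD. T Q) = (\<Sum>P\<in>pi ` DD. \<Sum>Q\<in>{Q\<in>DD. pi Q = P}. T Q)"
    using DD by (rule sum.image_gen)
  also have "\<dots> \<le> (\<Sum>P\<in>pi ` DD. 2 * suminf ?g * T P)"
    by (intro sum_mono grp) (use pi(1) in blast)
  also have "\<dots> \<le> (\<Sum>P\<in>S. 2 * suminf ?g * T P)"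
    using pi(1) finS nn \<alpha>
    by (intro sum_mono2) (auto simp: T_def intro!: mult_nonneg_nonneg suminf_nonneg summable_gap_coeff gap_coeff_nonneg)
  also have "\<dots> = 2 * suminf ?g * (\<Sum>P\<in>S. T P)" by (simp add: sum_distrib_left)
  finally show ?thesis using S unfolding T_def by blast
qed

text \<open>One term of the exponential series together with the John--Nirenberg inequality. The
  growth k^k is essential: its k-th root is linear in k, so a high moment costs only a power of its
  order.\<close>

lemma Phi_moment:
  assumes "k \<ge> 1"
  shows "(\<integral>\<^sup>+x\<in>cell c. ennreal ((1 + \<bar>b x - bm c\<bar>) ^ k) \<partial>lebesgue) \<le> ennreal (6 * (real k / jn) ^ k * vol c)"
proof -
  have "(1::real) \<le> 2 ^ (CARD('n) + 2)" by (rule one_le_power) simp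
  then have "(1::real) \<le> 4 * 2 ^ (CARD('n) + 2)" by linarith
  then have jn1: "jn \<le> 1" unfolding jn_def by (rule divide_le_eq_1_pos[THEN iffD2, rotated]) simp
  have pw: "(1 + y) ^ k \<le> 3 * (real k / jn) ^ k * exp (jn * y)" if "y \<ge> 0" for y
  proof -
    have "(jn * (1 + y)) ^ k \<le> fact k * exp (jn * (1 + y))"
      using that jn_pos by (intro power_le_fact_exp) auto
    also have "\<dots> = fact k * exp jn * exp (jn * y)" by (simp add: exp_add distrib_left)
    also have "\<dots> \<le> real k ^ k * 3 * exp (jn * y)"
    proof -
      have "fact k \<le> real (k ^ k)" by (rule fact_le_power)
      moreover have "exp jn \<le> 3" using jn1 exp_le order_trans[of "exp jn" "exp 1" 3] by simp
      ultimately show ?thesis by (intro mult_mono) auto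
    qed
    finally have "jn ^ k * (1 + y) ^ k \<le> real k ^ k * 3 * exp (jn * y)" unfolding power_mult_distrib .
    moreover have "jn ^ k > 0" using jn_pos by simp
    ultimately have "(1 + y) ^ k \<le> real k ^ k * 3 * exp (jn * y) / jn ^ k"
      by (simp add: pos_le_divide_eq mult.commute)
    then show ?thesis by (simp add: power_divide mult_ac)
  qed
  have "(\<integral>\<^sup>+x\<in>cell c. ennreal ((1 + \<bar>b x - bm c\<bar>) ^ k) \<partial>lebesgue) \<le>
    (\<integral>\<^sup>+x. ennreal (3 * (real k / jn) ^ k) * (ennreal (exp (jn * \<bar>b x - bm c\<bar>)) * indicator (cell c) x) \<partial>lebesgue)"
  proof (intro nn_integral_mono)
    fix x
    have "ennreal ((1 + \<bar>b x - bm c\<bar>) ^ k) \<le> ennreal (3 * (real k / jn) ^ k) * ennreal (exp (jn * \<bar>b x - bm c\<bar>))"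
      using pw[of "\<bar>b x - bm c\<bar>"] jn_pos by (simp add: ennreal_mult'[symmetric] ennreal_leI)
    then show "ennreal ((1 + \<bar>b x - bm c\<bar>) ^ k) * indicator (cell c) x \<le>
      ennreal (3 * (real k / jn) ^ k) * (ennreal (exp (jn * \<bar>b x - bm c\<bar>)) * indicator (cell c) x)"
      by (simp add: mult.assoc[symmetric] mult_right_mono)
  qed
  also have "\<dots> = ennreal (3 * (real k / jn) ^ k) * (\<integral>\<^sup>+x\<in>cell c. ennreal (exp (jn * \<bar>b x - bm c\<bar>)) \<partial>lebesgue)"
    by (rule nn_integral_cmult) simp
  also have "\<dots> \<le> ennreal (3 * (real k / jn) ^ k) * ennreal (2 * vol c)"
    by (intro mult_left_mono John_Nirenberg) simp
  also have "\<dots> = ennreal (6 * (real k / jn) ^ k * vol c)"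
    using jn_pos by (simp add: ennreal_mult'[symmetric])
  finally show ?thesis .
qed

end

section \<open>The bump condition on one cell\<close>

text \<open>On the level set \<open>log(e + w/\<lambda>) \<approx> 2\<^sup>i\<close>, Hoelder's inequality is used with the exponents
  \<open>1/r = 1/p + \<epsilon>\<close> for \<open>f\<close>, \<open>1/t - 2 \<epsilon>\<close> for \<open>w\<close> and \<open>\<epsilon>\<close> for \<open>\<Phi>\<close>, where \<open>\<epsilon> = bump_eps t p i\<close>.
  The integer \<open>bump_N\<close> is so large that all exponents are admissible for \<open>i = 0\<close>, and \<open>1/\<epsilon>\<close> is an
  integer so that only integral moments of \<open>\<Phi>\<close> occur.\<close>

definition bump_N :: "real \<Rightarrow> real \<Rightarrow> nat" where
  "bump_N t p = nat \<lceil>4 * t + p\<rceil>"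

definition bump_eps :: "real \<Rightarrow> real \<Rightarrow> nat \<Rightarrow> real" where
  "bump_eps t p i = 1 / (real (bump_N t p) * 2 ^ i)"

definition bump_r :: "real \<Rightarrow> real \<Rightarrow> nat \<Rightarrow> real" where
  "bump_r t p i = p / (1 + p * bump_eps t p i)"

text \<open>The factor 6 and the \<open>m\<close>-th power come from the moments of
  \<open>Phi\<close>, \<open>exp (2 * t)\<close> from raising the exponent of the weight on a level,
  and \<open>2 powr (2 * a)\<close> from replacing that exponent by \<open>t\<close> in the
  logarithmic gain. No factor depends on the level.\<close>

definition bump_C :: "real \<Rightarrow> nat \<Rightarrow> real \<Rightarrow> real \<Rightarrow> real \<Rightarrow> real" where
  "bump_C j m t p a = 6 * (real m * real (bump_N t p) / j) ^ m * exp (2 * t) * 2 powr (2 * a)"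

lemma bump_N_ge: "4 * t + p \<le> real (bump_N t p)"
  unfolding bump_N_def by linarith

context bmo_grid
begin

text \<open>\<open>\<kappa>\<close> is the share of the logarithm reserved for the Carleson loss,
  later 1/s or 1/s'. The context is used twice: with exponents (p, p') for \<open>f\<close> and
  \<open>w\<close>, and with (q', q) for \<open>g\<close> and \<open>z\<close>.\<close>

context
  fixes m :: nat and p t \<kappa> \<delta> :: real
  assumes m: "m \<ge> 1" and pt: "p > 1" "t > 1" "1/p + 1/t = 1" and kd: "\<kappa> \<ge> 0" "\<delta> > 0"
begin

abbreviation (input) "aa \<equiv> (real m + \<kappa>) * t + \<delta>"

lemma bump_N1: "real (bump_N t p) \<ge> 1"
  using bump_N_ge[of t p] pt by linarith

lemma bump_eps_props:
  shows "bump_eps t p i > 0" "bump_eps t p i \<le> 1" "4 * t * bump_eps t p i \<le> 1 / 2 ^ i" "p * bump_eps t p i \<le> 1"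
    "1 / bump_eps t p i = real (bump_N t p * 2 ^ i)"
proof -
  have N: "real (bump_N t p) \<ge> 4 * t + p" by (rule bump_N_ge)
  note N1 = bump_N1
  have N2: "1 \<le> real (bump_N t p) * 2 ^ i" "real (bump_N t p) \<le> real (bump_N t p) * 2 ^ i"
    using N1 mult_mono[OF N1 one_le_power[of "2::real" i]] mult_left_mono[OF one_le_power[of "2::real" i], of "real (bump_N t p)"] by auto
  have N0: "0 < real (bump_N t p) * 2 ^ i" using N1 by simp
  show "bump_eps t p i > 0" using N1 by (simp add: bump_eps_def)
  show "bump_eps t p i \<le> 1" using N2 N0 unfolding bump_eps_def by (subst divide_le_eq_1_pos) auto
  have "4 * t * bump_eps t p i = (4 * t / real (bump_N t p)) / 2 ^ i" by (simp add: bump_eps_def)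
  also have "\<dots> \<le> 1 / 2 ^ i" using N N1 pt by (intro divide_right_mono) (auto simp: divide_le_eq_1)
  finally show "4 * t * bump_eps t p i \<le> 1 / 2 ^ i" .
  have "p \<le> real (bump_N t p) * 2 ^ i" using N N2 pt by linarith
  then show "p * bump_eps t p i \<le> 1" using N0 by (simp add: bump_eps_def divide_le_eq_1)
  show "1 / bump_eps t p i = real (bump_N t p * 2 ^ i)" by (simp add: bump_eps_def)
qed

lemma bump_r_props: "bump_r t p i > 0" "1 / bump_r t p i = 1/p + bump_eps t p i"
  "bump_r t p i * (1 + p * bump_eps t p i) = p"
proof -
  have "1 + p * bump_eps t p i > 0" using bump_eps_props(1)[of i] pt by (simp add: add_pos_pos)
  then show "bump_r t p i > 0" "1 / bump_r t p i = 1/p + bump_eps t p i" "bump_r t p i * (1 + p * bump_eps t p i) = p"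
    using pt by (auto simp: bump_r_def add_divide_distrib)
qed

context
  fixes w f :: "real^'n \<Rightarrow> real"
  assumes wm [measurable]: "w \<in> borel_measurable lebesgue" and fm [measurable]: "f \<in> borel_measurable lebesgue"
    and w0: "\<And>x. w x \<ge> 0" and f0: "\<And>x. f x \<ge> 0"
    and f1: "(\<integral>\<^sup>+x. ennreal (f x powr p) \<partial>lebesgue) \<le> ennreal 1"
begin

text \<open>The power of the volume makes the \<open>p\<close>-th power of \<open>avr\<close> a
  summand of the Carleson embedding with exponent \<open>1 + p * bump_eps t p i\<close>, in which
  \<open>f powr p\<close> is the function to be integrated.\<close>

definition avr :: "nat \<Rightarrow> nat \<times> (int^'n) \<Rightarrow> real" where
  "avr i c = vol c powr (1/p) * av (\<lambda>x. f x powr bump_r t p i) c powr (1 / bump_r t p i)"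

lemma avr_power: "avr i c powr p = vol c * av (\<lambda>x. f x powr bump_r t p i) c powr (1 + p * bump_eps t p i)"
proof -
  have "1 / bump_r t p i * p = 1 + p * bump_eps t p i"
    unfolding bump_r_props(2) using pt by (simp add: field_simps)
  then show ?thesis using pt by (simp add: avr_def powr_mult powr_powr)
qed

lemma f_powr_r: "(f x powr bump_r t p i) powr (1 + p * bump_eps t p i) = f x powr p"
  by (simp add: powr_powr bump_r_props(3))

lemma cell_powr_finite: "(\<integral>\<^sup>+x\<in>cell c. ennreal (f x powr bump_r t p i) \<partial>lebesgue) < \<infinity>"
  by (rule nn_integral_cell_Jensen(1)[where \<rho> = "1 + p * bump_eps t p i" and B = 1])
     (use f1 bump_eps_props(1)[of i] pt in \<open>auto simp: f_powr_r\<close>)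

lemma avr_le_1: "avr i c powr p \<le> 1"
  unfolding avr_power
  by (rule nn_integral_cell_Jensen(2)[where B = 1])
     (use f1 bump_eps_props(1)[of i] pt in \<open>auto simp: f_powr_r\<close>)

lemma avr_bounds: "0 \<le> avr i c" "avr i c \<le> 1"
proof -
  show 0: "0 \<le> avr i c" by (simp add: avr_def)
  have "(avr i c powr p) powr (1/p) \<le> 1 powr (1/p)"
    using avr_le_1[of i c] pt by (intro powr_mono2) auto
  then show "avr i c \<le> 1" using pt 0 by (simp add: powr_powr)
qed

text \<open>In the embedding constant 64/(\<rho> - 1) one has \<rho> - 1 = p * \<epsilon>, which is
  the source of the factor 2^i. Exponents above \<open>p\<close> are allowed since
  \<open>avr\<close> is at most 1.\<close>

lemma avr_sum:
  assumes S: "finite S" "sparse S" and s: "s \<ge> p"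
  shows "(\<Sum>c\<in>S. avr i c powr s) \<le> 64 * real (bump_N t p) * 2 ^ i"
proof -
  have "(\<Sum>c\<in>S. avr i c powr s) \<le> (\<Sum>c\<in>S. avr i c powr p)"
    using avr_bounds s by (intro sum_mono powr_mono') auto
  also have "\<dots> \<le> 64 / (1 + p * bump_eps t p i - 1) * 1"
    unfolding avr_power
    by (rule Carleson_embedding) (use S f1 bump_eps_props[of i] pt in \<open>auto simp: f_powr_r\<close>)
  also have "\<dots> = 64 / p * (1 / bump_eps t p i)" by simp
  also have "\<dots> = 64 / p * (real (bump_N t p) * 2 ^ i)" unfolding bump_eps_props(5) by simp
  also have "\<dots> \<le> 64 * (real (bump_N t p) * 2 ^ i)"
    using pt by (intro mult_right_mono) (auto simp: divide_le_eq)
  finally show ?thesis by simp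
qed

context
  fixes lam :: real and c :: "nat \<times> (int^'n)"
  assumes lam: "lam > 0"
    and wb: "(\<integral>\<^sup>+x\<in>cell c. ennreal ((w x / lam) powr t * ln (exp 1 + w x / lam) powr ((real m + \<kappa>) * t + \<delta>)) \<partial>lebesgue)
       \<le> ennreal (vol c)"
begin

definition lev :: "nat \<Rightarrow> (real^'n) set" where
  "lev i = {x. 2 ^ i \<le> ln (exp 1 + w x / lam) \<and> ln (exp 1 + w x / lam) < 2 ^ (i + 1)}"

lemma lev_measurable [measurable]: "lev i \<in> sets lebesgue"
proof -
  have "{x \<in> space lebesgue. 2 ^ i \<le> ln (exp 1 + w x / lam) \<and> ln (exp 1 + w x / lam) < 2 ^ (i + 1)} \<in> sets lebesgue"
    by measurable
  then show ?thesis by (simp add: lev_def)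
qed

lemma lev_cover: "\<exists>i. x \<in> lev i"
proof -
  define L where "L = ln (exp 1 + w x / lam)"
  have "exp 1 \<le> exp 1 + w x / lam" using w0[of x] lam by simp
  then have "ln (exp 1) \<le> L" unfolding L_def by (subst ln_le_cancel_iff) (auto simp: add_pos_nonneg w0 lam less_imp_le)
  then have L: "1 \<le> L" by simp
  define i where "i = (LEAST i. L < 2 ^ (i + 1))"
  obtain n where "L < 2 ^ n" using real_arch_pow[of 2 L] by auto
  also have "(2::real) ^ n \<le> 2 ^ (n + 1)" by simp
  finally have ex: "\<exists>i. L < 2 ^ (i + 1)" by blast
  have "L < 2 ^ (i + 1)" unfolding i_def using ex by (rule LeastI_ex)
  moreover have "2 ^ i \<le> L"
  proof (cases i)
    case 0
    then show ?thesis using L by simp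
  next
    case (Suc j)
    then have "\<not> L < 2 ^ (j + 1)" using not_less_Least[of j "\<lambda>i. L < 2 ^ (i + 1)"] i_def by simp
    then show ?thesis using Suc by simp
  qed
  ultimately show ?thesis unfolding lev_def L_def by blast
qed

text \<open>The weight can be raised to a power \<open>r2\<close> above \<open>t\<close>: on the
  level, \<open>w / lam\<close> is at most exp(2^(i+1)), and \<open>r2 - t\<close> is at most a
  multiple of 2^(-i), so the surplus power is bounded. This room in the exponents is what pays for a
  finite moment of \<open>Phi\<close> and for an exponent of \<open>f\<close> below
  \<open>p\<close>.\<close>

lemma bump_level:
  "(\<integral>\<^sup>+x\<in>cell c. ennreal (Phi m c x * (f x * w x) * indicator (lev i) x) \<partial>lebesgue)
    \<le> ennreal (bump_C jn m t p aa * lam * vol c powr (1 - 1/p) * (2 powr (- real i * (\<kappa> + \<delta>/t)) * avr i c))"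
proof -
  let ?e = "bump_eps t p i" and ?r = "bump_r t p i" and ?N = "bump_N t p"
  define a where "a = aa"
  have a0: "a > 0" using pt kd by (auto simp: a_def intro!: add_nonneg_pos mult_nonneg_nonneg)
  note e = bump_eps_props[of i] and r = bump_r_props[of i]
  have et: "4 * t * ?e \<le> 1" by (rule order_trans[OF e(3)]) (simp add: divide_le_eq_1)
  define r2 where "r2 = 1 / (1/t - 2 * ?e)"
  have pos: "1/t - 2 * ?e > 0"
  proof -
    have "2 * ?e * t \<le> 1/2" using et by (simp add: mult_ac)
    then have "2 * ?e * t < 1" by simp
    then show ?thesis using pt by (simp add: field_simps)
  qed
  have r2: "r2 > 0" "1/r2 = 1/t - 2 * ?e" using pos by (auto simp: r2_def)
  have r2le: "1/r2 \<le> 1" using r2(2) e(1) pt by (smt (verit) divide_le_eq_1_pos)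
  have r2t: "r2 \<ge> t" "r2 - t \<le> 4 * t\<^sup>2 * ?e"
  proof -
    have q: "r2 = t / (1 - 2 * ?e * t)" using pt pos by (simp add: r2_def field_simps)
    have d: "1 - 2 * ?e * t \<ge> 1/2" using et by (simp add: mult_ac)
    show "r2 \<ge> t" unfolding q using d e(1) pt by (simp add: pos_le_divide_eq)
    have "r2 - t = t * (2 * ?e * t) / (1 - 2 * ?e * t)" unfolding q using d by (simp add: field_simps)
    also have "\<dots> \<le> t * (2 * ?e * t) / (1/2)" using d e(1) pt by (intro divide_left_mono) auto
    finally show "r2 - t \<le> 4 * t\<^sup>2 * ?e" by (simp add: power2_eq_square mult_ac)
  qed
  \<comment> \<open>1/\<epsilon> is an integer, so the moment of \<open>Phi\<close> is the integral
    moment of order \<open>m * k0\<close> provided by \<open>Phi_moment\<close>.\<close>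
  define k0 where "k0 = ?N * 2 ^ i"
  have tau: "1 / ?e = real k0" unfolding k0_def by (rule e(5))
  have k01: "k0 \<ge> 1" using bump_N1 by (simp add: k0_def)
  have "?e = 1 / (1 / ?e)" by simp
  then have ek: "?e = 1 / real k0" unfolding tau .
  define A where "A = 6 * (real (m * k0) / jn) ^ (m * k0) * vol c"
  define B where "B = vol c * av (\<lambda>x. f x powr ?r) c"
  define C where "C = lam powr r2 * exp (2 * t) * 2 powr (- real i * a) * vol c"
  have "(\<integral>\<^sup>+x. ennreal (\<bar>Phi m c x * indicator (cell c) x\<bar> * \<bar>f x * indicator (cell c) x\<bar> * \<bar>w x * indicator (cell c \<inter> lev i) x\<bar>) \<partial>lebesgue)
    \<le> ennreal (A powr (1 / real k0) * B powr (1 / ?r) * C powr (1 / r2))"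
  proof (rule nn_integral_Hoelder3)
    show "1 / real k0 + 1 / ?r + 1 / r2 = 1" unfolding r(2) r2(2) ek[symmetric] using pt by simp
    have "(\<integral>\<^sup>+x. ennreal (\<bar>Phi m c x * indicator (cell c) x\<bar> powr real k0) \<partial>lebesgue)
      = (\<integral>\<^sup>+x\<in>cell c. ennreal ((1 + \<bar>b x - bm c\<bar>) ^ (m * k0)) \<partial>lebesgue)"
    proof (intro nn_integral_cong)
      fix x
      have "(1 + \<bar>b x - bm c\<bar>) ^ m > 0" by (intro zero_less_power) simp
      then show "ennreal (\<bar>Phi m c x * indicator (cell c) x\<bar> powr real k0) = ennreal ((1 + \<bar>b x - bm c\<bar>) ^ (m * k0)) * indicator (cell c) x"
        using k01 by (cases "x \<in> cell c") (auto simp: Phi_def powr_realpow power_mult)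
    qed
    also have "\<dots> \<le> ennreal A" unfolding A_def using m k01 by (intro Phi_moment) auto
    finally show "(\<integral>\<^sup>+x. ennreal (\<bar>Phi m c x * indicator (cell c) x\<bar> powr real k0) \<partial>lebesgue) \<le> ennreal A" .
    have "(\<integral>\<^sup>+x. ennreal (\<bar>f x * indicator (cell c) x\<bar> powr ?r) \<partial>lebesgue) = (\<integral>\<^sup>+x\<in>cell c. ennreal (f x powr ?r) \<partial>lebesgue)"
      using r(1) f0 by (intro nn_integral_cong) (auto simp: indicator_def)
    also have "\<dots> = ennreal B" unfolding B_def by (rule nn_integral_cell_eq_av[OF cell_powr_finite])
    finally show "(\<integral>\<^sup>+x. ennreal (\<bar>f x * indicator (cell c) x\<bar> powr ?r) \<partial>lebesgue) \<le> ennreal B" by simp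
    have "(\<integral>\<^sup>+x. ennreal (\<bar>w x * indicator (cell c \<inter> lev i) x\<bar> powr r2) \<partial>lebesgue)
      \<le> (\<integral>\<^sup>+x. ennreal (lam powr r2 * exp (2 * t) * 2 powr (- real i * a)) *
          (ennreal ((w x / lam) powr t * ln (exp 1 + w x / lam) powr a) * indicator (cell c) x) \<partial>lebesgue)"
    proof (intro nn_integral_mono)
      fix x
      show "ennreal (\<bar>w x * indicator (cell c \<inter> lev i) x\<bar> powr r2) \<le> ennreal (lam powr r2 * exp (2 * t) * 2 powr (- real i * a)) *
          (ennreal ((w x / lam) powr t * ln (exp 1 + w x / lam) powr a) * indicator (cell c) x)"
      proof (cases "x \<in> cell c \<inter> lev i")
        case True
        define W where "W = w x / lam"
        define L where "L = ln (exp 1 + W)"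
        have W0: "W \<ge> 0" using w0[of x] lam by (simp add: W_def)
        have L: "2 ^ i \<le> L" "L < 2 ^ (i + 1)" using True by (auto simp: lev_def L_def W_def)
        have L0: "L > 0" using L(1) by (rule less_le_trans[rotated]) simp
        have "W \<le> exp L" unfolding L_def using W0 by (simp add: add_pos_nonneg)
        then have "W powr (r2 - t) \<le> exp L powr (r2 - t)" using W0 r2t by (intro powr_mono2) auto
        also have "\<dots> = exp ((r2 - t) * L)" by (simp add: powr_def)
        also have "(r2 - t) * L \<le> 4 * t\<^sup>2 * ?e * 2 ^ (i + 1)"
          using r2t L L0 e(1) by (intro mult_mono) auto
        also have "\<dots> = 2 * t * (4 * t * ?e * 2 ^ i)" by (simp add: power2_eq_square)
        also have "\<dots> \<le> 2 * t * 1"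
          using e(3) pt by (intro mult_left_mono) (auto simp: field_simps)
        finally have 1: "W powr (r2 - t) \<le> exp (2 * t)" by simp
        \<comment> \<open>On the level the logarithm is at least 2^i. Inserting the full bump factor
          therefore gains 2^(-i a).\<close>
        have "(2 ^ i) powr a \<le> L powr a" using L a0 by (intro powr_mono2) auto
        then have "2 powr (- real i * a) * (2 ^ i) powr a \<le> 2 powr (- real i * a) * L powr a"
          by (intro mult_left_mono) auto
        moreover have "2 powr (- real i * a) * (2 ^ i) powr a = (1::real)"
          by (simp add: powr_realpow[symmetric] powr_powr powr_add[symmetric])
        ultimately have 2: "1 \<le> 2 powr (- real i * a) * L powr a" by linarith
        have "w x powr r2 = lam powr r2 * (W powr (r2 - t) * W powr t)"
          using lam w0[of x] by (simp add: W_def powr_divide powr_add[symmetric])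
        also have "\<dots> \<le> lam powr r2 * (exp (2 * t) * W powr t)"
          using 1 by (intro mult_left_mono mult_right_mono) auto
        also have "\<dots> \<le> lam powr r2 * (exp (2 * t) * W powr t) * (2 powr (- real i * a) * L powr a)"
          using mult_left_mono[OF 2, of "lam powr r2 * (exp (2 * t) * W powr t)"] by simp
        finally have "w x powr r2 \<le> lam powr r2 * exp (2 * t) * 2 powr (- real i * a) * (W powr t * L powr a)"
          by (simp add: mult_ac)
        then have "ennreal (w x powr r2) \<le> ennreal (lam powr r2 * exp (2 * t) * 2 powr (- real i * a)) * ennreal (W powr t * L powr a)"
          by (simp add: ennreal_mult'[symmetric] ennreal_leI)
        then show ?thesis using True w0[of x] by (simp add: W_def L_def)
      qed (use r2 in auto)
    qed
    also have "\<dots> = ennreal (lam powr r2 * exp (2 * t) * 2 powr (- real i * a)) *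
        (\<integral>\<^sup>+x\<in>cell c. ennreal ((w x / lam) powr t * ln (exp 1 + w x / lam) powr a) \<partial>lebesgue)"
      by (rule nn_integral_cmult) measurable
    also have "\<dots> \<le> ennreal (lam powr r2 * exp (2 * t) * 2 powr (- real i * a)) * ennreal (vol c)"
      using wb by (intro mult_left_mono) (auto simp: a_def)
    also have "\<dots> = ennreal C" by (simp add: C_def ennreal_mult'[symmetric])
    finally show "(\<integral>\<^sup>+x. ennreal (\<bar>w x * indicator (cell c \<inter> lev i) x\<bar> powr r2) \<partial>lebesgue) \<le> ennreal C" .
    show "A \<ge> 0" using jn_pos by (simp add: A_def)
    show "B \<ge> 0" by (simp add: B_def)
    show "C \<ge> 0" by (simp add: C_def)
  qed (use k01 r r2 in \<open>auto simp: borel_measurable_indicator\<close>)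
  also have "(\<integral>\<^sup>+x. ennreal (\<bar>Phi m c x * indicator (cell c) x\<bar> * \<bar>f x * indicator (cell c) x\<bar> * \<bar>w x * indicator (cell c \<inter> lev i) x\<bar>) \<partial>lebesgue)
     = (\<integral>\<^sup>+x\<in>cell c. ennreal (Phi m c x * (f x * w x) * indicator (lev i) x) \<partial>lebesgue)"
    using f0 w0 by (intro nn_integral_cong) (auto simp: indicator_def)
  finally have main: "(\<integral>\<^sup>+x\<in>cell c. ennreal (Phi m c x * (f x * w x) * indicator (lev i) x) \<partial>lebesgue)
     \<le> ennreal (A powr (1 / real k0) * B powr (1 / ?r) * C powr (1 / r2))" .
  define Z where "Z = real m * real ?N / jn"
  have Z0: "Z \<ge> 0" using jn_pos by (simp add: Z_def)
  \<comment> \<open>The \<open>k0\<close>-th root of the moment bound: (m * k0 / jn)^(m * k0)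
    becomes (m * k0 / jn)^m, and k0 = N * 2^i produces 2^(i m).\<close>
  have A1: "A powr (1 / real k0) \<le> 6 * (Z ^ m * 2 powr (real i * real m)) * vol c powr ?e"
  proof -
    have b0: "real (m * k0) / jn > 0" using m k01 jn_pos by simp
    have "A powr (1 / real k0) = 6 powr (1 / real k0) * ((real (m * k0) / jn) ^ (m * k0)) powr (1 / real k0) * vol c powr (1 / real k0)"
      using jn_pos by (simp add: A_def powr_mult)
    also have "((real (m * k0) / jn) ^ (m * k0)) powr (1 / real k0) = (real (m * k0) / jn) ^ m"
      using b0 k01 by (simp only: powr_realpow[symmetric] powr_powr) (simp add: powr_realpow[symmetric])
    also have "real (m * k0) / jn = Z * 2 ^ i" by (simp add: Z_def k0_def)
    also have "(Z * 2 ^ i) ^ m = Z ^ m * 2 powr (real i * real m)"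
      by (simp add: power_mult_distrib powr_realpow[symmetric] powr_powr power_mult[symmetric])
    also have "6 powr (1 / real k0) * (Z ^ m * 2 powr (real i * real m)) * vol c powr (1 / real k0)
       \<le> 6 powr 1 * (Z ^ m * 2 powr (real i * real m)) * vol c powr (1 / real k0)"
      using Z0 k01 by (intro mult_right_mono powr_mono) (auto simp: divide_le_eq_1)
    finally show ?thesis unfolding ek[symmetric] by simp
  qed
  have C1: "C powr (1 / r2) \<le> lam * exp (2 * t) * (2 powr (- real i * a / t) * 2 powr (2 * a)) * vol c powr (1 / r2)"
  proof -
    have "C powr (1 / r2) = lam * exp (2 * t) powr (1 / r2) * 2 powr (- real i * a * (1 / r2)) * vol c powr (1 / r2)"
      using lam r2(1) by (simp add: C_def powr_mult powr_powr)
    also have "\<dots> \<le> lam * exp (2 * t) powr 1 * (2 powr (- real i * a / t) * 2 powr (2 * a)) * vol c powr (1 / r2)"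
    proof (intro mult_right_mono mult_mono mult_left_mono)
      show "exp (2 * t) powr (1 / r2) \<le> exp (2 * t) powr 1" using r2le pt by (intro powr_mono) auto
      \<comment> \<open>Since i \<le> 2^i, replacing 1/r2 by 1/t in the exponent of 2^(-i a / r2)
        costs at most the constant 2^(2 a).\<close>
      have "real i * ?e \<le> 1"
      proof -
        have "real i \<le> 2 ^ i" by (simp add: of_nat_less_two_power less_imp_le)
        also have "\<dots> \<le> real ?N * 2 ^ i" using bump_N1 by simp
        finally show ?thesis using bump_N1 by (simp add: bump_eps_def divide_le_eq_1)
      qed
      then have "a * (real i * ?e) \<le> a * 1" using a0 by (intro mult_left_mono) auto
      moreover have "- real i * a * (1 / r2) = - real i * a / t + 2 * (a * (real i * ?e))"
        unfolding r2(2) by (simp add: algebra_simps)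
      ultimately have "- real i * a * (1 / r2) \<le> - real i * a / t + 2 * a" by simp
      then have "2 powr (- real i * a * (1 / r2)) \<le> 2 powr (- real i * a / t + 2 * a)" by (intro powr_mono) auto
      then show "2 powr (- real i * a * (1 / r2)) \<le> 2 powr (- real i * a / t) * 2 powr (2 * a)"
        by (simp only: powr_add)
    qed (use lam in auto)
    finally show ?thesis by simp
  qed
  have B1: "B powr (1 / ?r) = vol c powr (1 / ?r) * av (\<lambda>x. f x powr ?r) c powr (1 / ?r)"
    by (simp add: B_def powr_mult)
  have "A powr (1 / real k0) * B powr (1 / ?r) * C powr (1 / r2) \<le>
     (6 * (Z ^ m * 2 powr (real i * real m)) * vol c powr ?e) *
     (vol c powr (1 / ?r) * av (\<lambda>x. f x powr ?r) c powr (1 / ?r)) *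
     (lam * exp (2 * t) * (2 powr (- real i * a / t) * 2 powr (2 * a)) * vol c powr (1 / r2))"
    unfolding B1 using A1 C1 Z0 lam by (intro mult_mono) auto
  also have "\<dots> = (6 * Z ^ m * exp (2 * t) * 2 powr (2 * a)) * lam * (vol c powr ?e * vol c powr (1 / ?r) * vol c powr (1 / r2)) *
     (2 powr (real i * real m) * 2 powr (- real i * a / t)) * av (\<lambda>x. f x powr ?r) c powr (1 / ?r)"
    by (simp add: mult_ac)
  also have "vol c powr ?e * vol c powr (1 / ?r) * vol c powr (1 / r2) = vol c powr (1 - 1/p) * vol c powr (1/p)"
    unfolding r(2) r2(2) powr_add[symmetric] using pt by simp
  \<comment> \<open>The bump exponent (m + \<kappa>) * t + \<delta> is made for this point: after
    division by \<open>t\<close>, the \<open>m\<close> cancels the cost of the moments.\<close>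
  also have "2 powr (real i * real m) * 2 powr (- real i * a / t) = 2 powr (- real i * (\<kappa> + \<delta>/t))"
  proof -
    have "a / t = real m + \<kappa> + \<delta> / t" using pt by (simp add: a_def field_simps)
    then have "- real i * a / t = - real i * (real m + \<kappa> + \<delta> / t)" by (metis times_divide_eq_right)
    then have "real i * real m + - real i * a / t = - real i * (\<kappa> + \<delta> / t)" by (simp only:) (simp add: algebra_simps)
    then show ?thesis by (simp only: powr_add[symmetric])
  qed
  also have "6 * Z ^ m * exp (2 * t) * 2 powr (2 * a) = bump_C jn m t p aa"
    by (simp add: bump_C_def Z_def a_def)
  also have "bump_C jn m t p aa * lam * (vol c powr (1 - 1/p) * vol c powr (1/p)) *
     2 powr (- real i * (\<kappa> + \<delta>/t)) * av (\<lambda>x. f x powr ?r) c powr (1 / ?r)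
     = bump_C jn m t p aa * lam * vol c powr (1 - 1/p) * (2 powr (- real i * (\<kappa> + \<delta>/t)) * avr i c)"
    by (simp add: avr_def mult_ac)
  finally show ?thesis using main by (meson ennreal_leI order_trans)
qed

text \<open>Convergence over the levels comes from \<delta>, through the ratio 2^(-\<delta>/t). The
  factors 2^(-i \<kappa>) stay attached to \<open>avr\<close> because they have to compensate the
  Carleson loss once cells are summed.\<close>

lemma bump_cell:
  defines "X \<equiv> (\<Sum>i. (2 powr (- \<delta>/t)) ^ i * (2 powr (- real i * \<kappa>) * avr i c))"
  shows "(\<integral>\<^sup>+x\<in>cell c. ennreal (Phi m c x * (f x * w x)) \<partial>lebesgue) < \<infinity>"
    and "osc_int m (\<lambda>x. f x * w x) c c \<le> bump_C jn m t p aa * lam * vol c powr (1 - 1/p) * X"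
proof -
  define \<theta> where "\<theta> = 2 powr (- \<delta>/t)"
  have \<theta>: "0 < \<theta>" "\<theta> < 1" using kd pt by (auto simp: \<theta>_def powr_less_one)
  define K where "K = bump_C jn m t p aa * lam * vol c powr (1 - 1/p)"
  have K0: "K \<ge> 0" using lam jn_pos by (simp add: K_def bump_C_def)
  define Y where "Y i = 2 powr (- real i * \<kappa>) * avr i c" for i
  have Y: "0 \<le> Y i" "Y i \<le> 1" for i
  proof -
    have "2 powr (- real i * \<kappa>) \<le> 2 powr 0" using kd by (intro powr_mono) auto
    then show "Y i \<le> 1" unfolding Y_def using avr_bounds[of i c] by (intro mult_le_one) auto
    show "0 \<le> Y i" unfolding Y_def using avr_bounds[of i c] by auto
  qed
  have sm: "summable (\<lambda>i. \<theta> ^ i * Y i)"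
  proof (rule summable_comparison_test')
    show "summable (\<lambda>i. \<theta> ^ i)" using \<theta> by (intro summable_geometric) auto
    show "norm (\<theta> ^ i * Y i) \<le> \<theta> ^ i" for i
      using \<theta> Y[of i] mult_left_mono[of "Y i" 1 "\<theta> ^ i"] by (simp add: abs_mult)
  qed
  have X: "X = (\<Sum>i. \<theta> ^ i * Y i)" unfolding X_def \<theta>_def Y_def ..
  have "(\<integral>\<^sup>+x\<in>cell c. ennreal (Phi m c x * (f x * w x)) \<partial>lebesgue) \<le>
    (\<integral>\<^sup>+x. (\<Sum>i. ennreal (Phi m c x * (f x * w x) * indicator (lev i) x) * indicator (cell c) x) \<partial>lebesgue)"
  proof (intro nn_integral_mono)
    fix x
    obtain i where i: "x \<in> lev i" using lev_cover by blast
    have "(\<Sum>j\<in>{i}. ennreal (Phi m c x * (f x * w x) * indicator (lev j) x) * indicator (cell c) x) \<le>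
      (\<Sum>i. ennreal (Phi m c x * (f x * w x) * indicator (lev i) x) * indicator (cell c) x)"
      by (intro sum_le_suminf) auto
    then show "ennreal (Phi m c x * (f x * w x)) * indicator (cell c) x \<le>
      (\<Sum>i. ennreal (Phi m c x * (f x * w x) * indicator (lev i) x) * indicator (cell c) x)"
      using i by simp
  qed
  also have "\<dots> = (\<Sum>i. \<integral>\<^sup>+x\<in>cell c. ennreal (Phi m c x * (f x * w x) * indicator (lev i) x) \<partial>lebesgue)"
    by (rule nn_integral_suminf) measurable
  also have "\<dots> \<le> (\<Sum>i. ennreal (K * (\<theta> ^ i * Y i)))"
  proof (intro suminf_le)
    fix i
    have "2 powr (- real i * (\<kappa> + \<delta>/t)) = \<theta> ^ i * 2 powr (- real i * \<kappa>)"
      by (simp add: \<theta>_def powr_realpow[symmetric] powr_powr powr_add[symmetric] algebra_simps)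
    then show "(\<integral>\<^sup>+x\<in>cell c. ennreal (Phi m c x * (f x * w x) * indicator (lev i) x) \<partial>lebesgue) \<le> ennreal (K * (\<theta> ^ i * Y i))"
      using bump_level[of i] by (simp add: K_def Y_def mult.assoc)
  qed auto
  also have "\<dots> = ennreal (\<Sum>i. K * (\<theta> ^ i * Y i))"
    using K0 \<theta> Y sm by (intro suminf_ennreal2 summable_mult) auto
  also have "\<dots> = ennreal (K * X)" using sm by (simp add: suminf_mult X)
  finally have le: "(\<integral>\<^sup>+x\<in>cell c. ennreal (Phi m c x * (f x * w x)) \<partial>lebesgue) \<le> ennreal (K * X)" .
  then show "(\<integral>\<^sup>+x\<in>cell c. ennreal (Phi m c x * (f x * w x)) \<partial>lebesgue) < \<infinity>" by (rule le_less_trans) simp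
  have "X \<ge> 0" unfolding X using \<theta> Y sm by (intro suminf_nonneg) auto
  then show "osc_int m (\<lambda>x. f x * w x) c c \<le> bump_C jn m t p aa * lam * vol c powr (1 - 1/p) * X"
    using le K0 unfolding osc_int_def K_def[symmetric] by (intro enn2real_leI) auto
qed

end

end

end

end

section \<open>The bilinear form\<close>

lemma conj_exp_props:
  assumes "1 < p" shows "conj_exp p > 1" "1/p + 1/conj_exp p = 1" "1/conj_exp p = 1 - 1/p"
    "conj_exp (conj_exp p) = p"
  using assms by (auto simp: conj_exp_def field_simps)

text \<open>The order of summation is exchanged, and a bound uniform in the level survives the
  geometric weights. It is applied once for each of the two weights.\<close>

lemma sum_weighted_series_le:
  fixes Y :: "nat \<Rightarrow> 'a \<Rightarrow> real"
  assumes S: "finite S" and \<theta>: "0 \<le> \<theta>" "\<theta> < 1" and Y: "\<And>i c. 0 \<le> Y i c" "\<And>i c. Y i c \<le> 1"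
    and D: "\<And>i. (\<Sum>c\<in>S. Y i c * z c) \<le> D" and D0: "D \<ge> 0"
  shows "(\<Sum>c\<in>S. (\<Sum>i. \<theta> ^ i * Y i c) * z c) \<le> D / (1 - \<theta>)"
proof -
  have geo: "summable (\<lambda>i. \<theta> ^ i)" using \<theta> by (intro summable_geometric) auto
  have sm: "summable (\<lambda>i. \<theta> ^ i * Y i c)" for c
  proof (rule summable_comparison_test'[OF geo])
    show "norm (\<theta> ^ i * Y i c) \<le> \<theta> ^ i" for i
      using \<theta> Y mult_left_mono[of "Y i c" 1 "\<theta> ^ i"] by (simp add: abs_mult)
  qed
  have "(\<Sum>c\<in>S. (\<Sum>i. \<theta> ^ i * Y i c) * z c) = (\<Sum>c\<in>S. \<Sum>i. \<theta> ^ i * Y i c * z c)"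
    by (intro sum.cong refl suminf_mult2 sm)
  also have "\<dots> = (\<Sum>i. \<Sum>c\<in>S. \<theta> ^ i * Y i c * z c)"
    by (rule suminf_sum[symmetric]) (intro summable_mult2 sm)
  also have "\<dots> \<le> (\<Sum>i. \<theta> ^ i * D)"
  proof (rule suminf_le)
    show "(\<Sum>c\<in>S. \<theta> ^ i * Y i c * z c) \<le> \<theta> ^ i * D" for i
      using mult_left_mono[OF D[of i], of "\<theta> ^ i"] \<theta> by (simp add: sum_distrib_left mult.assoc)
    show "summable (\<lambda>i. \<Sum>c\<in>S. \<theta> ^ i * Y i c * z c)" by (intro summable_sum summable_mult2 sm)
    show "summable (\<lambda>i. \<theta> ^ i * D)" by (intro summable_mult2 geo)
  qed
  also have "\<dots> = D / (1 - \<theta>)"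
    using \<theta> suminf_mult2[OF geo, of D] by (simp add: suminf_geometric)
  finally show ?thesis .
qed

text \<open>Here \<open>w\<close> stands for v^(-1/p) and \<open>z\<close> for u^(1/q). The
  condition supplies positive admissible parameters \<open>lam\<close>, \<open>mu\<close> for each
  cube in place of the Luxemburg norms, whose infima may be 0.\<close>

locale bump_data =
  fixes \<alpha> p q s \<delta> K :: real and m :: nat and w z :: "real^'n \<Rightarrow> real"
  assumes \<alpha>: "0 < \<alpha>" "\<alpha> < real CARD('n)" and p: "1 < p" "p \<le> s" "s \<le> q" and \<delta>: "\<delta> > 0" and m: "m \<ge> 1" and K: "K \<ge> 0"
    and w [measurable]: "w \<in> borel_measurable lebesgue" and w0: "\<And>x. w x \<ge> 0"
    and z [measurable]: "z \<in> borel_measurable lebesgue" and z0: "\<And>x. z x \<ge> 0"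
    and bump: "\<And>Q. cube Q \<Longrightarrow> \<exists>lam>0. \<exists>mu>0.
      measure lebesgue Q powr (\<alpha> / real CARD('n) + 1/q - 1/p) * lam * mu \<le> K \<and>
      (\<integral>\<^sup>+x\<in>Q. ennreal ((w x / lam) powr conj_exp p * ln (exp 1 + w x / lam) powr ((real m + 1/s) * conj_exp p + \<delta>)) \<partial>lebesgue)
        \<le> ennreal (measure lebesgue Q) \<and>
      (\<integral>\<^sup>+x\<in>Q. ennreal ((z x / mu) powr q * ln (exp 1 + z x / mu) powr ((real m + 1/conj_exp s) * q + \<delta>)) \<partial>lebesgue)
        \<le> ennreal (measure lebesgue Q)"
begin

lemma q: "1 < q" "1 < s" using p by auto

text \<open>The value of \<open>jn\<close>, named outside the grid so that \<open>form_C\<close>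
  visibly depends neither on the shift, nor on \<open>h\<close>, nor on \<open>b\<close>.\<close>

definition jc :: real where "jc = 1 / (4 * 2 ^ (CARD('n) + 2))"

definition form_C :: real where
  "form_C = 2 * suminf (gap_coeff CARD('n) \<alpha> m) *
     (bump_C jc m (conj_exp p) p ((real m + 1/s) * conj_exp p + \<delta>) *
      bump_C jc m q (conj_exp q) ((real m + 1/conj_exp s) * q + \<delta>) * K *
      (64 * real (bump_N (conj_exp p) p) * (64 * real (bump_N q (conj_exp q))) /
        (1 - 2 powr (- \<delta>/conj_exp p)) / (1 - 2 powr (- \<delta>/q))))"

text \<open>On a sparse cell the bump parameters and the power of the volume multiply to at most
  \<open>K\<close>, leaving a product of two series in \<open>avr\<close>. Hoelder's inequality over
  the cells with exponents s and s' is uniform in both levels, because the s-th power of 2^(-i/s)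
  cancels the Carleson factor 2^i exactly, and likewise for s'.\<close>

lemma grid_form_bound:
  assumes "bmo_grid a h b"
    and f: "f \<in> borel_measurable lebesgue" "\<And>x. f x \<ge> 0" "(\<integral>\<^sup>+x. ennreal (f x powr p) \<partial>lebesgue) \<le> ennreal 1"
    and g: "g \<in> borel_measurable lebesgue" "\<And>x. g x \<ge> 0" "(\<integral>\<^sup>+x. ennreal (g x powr conj_exp q) \<partial>lebesgue) \<le> ennreal 1"
  shows "(\<integral>\<^sup>+x\<in>dyadic_grid.cell a h c. ennreal (bmo_grid.Phi a h b m c x * (f x * w x)) \<partial>lebesgue) < \<infinity>"
    and "(\<integral>\<^sup>+x\<in>dyadic_grid.cell a h c. ennreal (bmo_grid.Phi a h b m c x * (g x * z x)) \<partial>lebesgue) < \<infinity>"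
    and "finite DD \<Longrightarrow> (\<Sum>Q\<in>DD. dyadic_grid.side h Q powr (\<alpha> - real CARD('n)) * bmo_grid.osc_int a h b m (\<lambda>x. f x * w x) Q Q
      * bmo_grid.osc_int a h b m (\<lambda>x. g x * z x) Q Q) \<le> form_C"
proof -
  interpret bmo_grid a h b by fact
  let ?p' = "conj_exp p" and ?q' = "conj_exp q" and ?s' = "conj_exp s"
  let ?a1 = "(real m + 1/s) * ?p' + \<delta>" and ?a2 = "(real m + 1/?s') * q + \<delta>"
  note cp = conj_exp_props[OF p(1)] and cq = conj_exp_props[OF q(1)] and cs = conj_exp_props[OF q(2)]
  have j: "jn = jc" by (simp add: jn_def jc_def)
  define Adm where "Adm c l u \<longleftrightarrow> l > 0 \<and> u > 0 \<and> vol c powr (\<alpha> / real CARD('n) + 1/q - 1/p) * l * u \<le> K \<and>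
      (\<integral>\<^sup>+x\<in>cell c. ennreal ((w x / l) powr ?p' * ln (exp 1 + w x / l) powr ?a1) \<partial>lebesgue) \<le> ennreal (vol c) \<and>
      (\<integral>\<^sup>+x\<in>cell c. ennreal ((z x / u) powr q * ln (exp 1 + z x / u) powr ?a2) \<partial>lebesgue) \<le> ennreal (vol c)" for c l u
  have "\<exists>l u. Adm c l u" for c
  proof -
    have eq: "(\<integral>\<^sup>+x\<in>cell c. F x \<partial>lebesgue) \<le> (\<integral>\<^sup>+x\<in>hull_cube c. F x \<partial>lebesgue)" for F :: "real^'n \<Rightarrow> ennreal"
      using cell_sub_hull[of c] by (intro nn_integral_mono) (auto simp: indicator_def)
    obtain l u where lu: "l > 0" "u > 0" "vol c powr (\<alpha> / real CARD('n) + 1/q - 1/p) * l * u \<le> K"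
      "(\<integral>\<^sup>+x\<in>hull_cube c. ennreal ((w x / l) powr ?p' * ln (exp 1 + w x / l) powr ?a1) \<partial>lebesgue) \<le> ennreal (vol c)"
      "(\<integral>\<^sup>+x\<in>hull_cube c. ennreal ((z x / u) powr q * ln (exp 1 + z x / u) powr ?a2) \<partial>lebesgue) \<le> ennreal (vol c)"
      using bump[OF cube_hull_cube[of c]] unfolding measure_hull by blast
    have "Adm c l u" unfolding Adm_def
      by (intro conjI lu(1-3) order_trans[OF eq lu(4)] order_trans[OF eq lu(5)])
    then show ?thesis by blast
  qed
  then obtain lam mu where Adm: "\<And>c. Adm c (lam c) (mu c)" by metis
  note lm = Adm[unfolded Adm_def, THEN conjunct1] Adm[unfolded Adm_def, THEN conjunct2, THEN conjunct1]
    Adm[unfolded Adm_def, THEN conjunct2, THEN conjunct2, THEN conjunct1]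
    Adm[unfolded Adm_def, THEN conjunct2, THEN conjunct2, THEN conjunct2, THEN conjunct1]
    Adm[unfolded Adm_def, THEN conjunct2, THEN conjunct2, THEN conjunct2, THEN conjunct2]
  have k1: "1/s \<ge> 0" "1/?s' \<ge> 0" using q cs by auto
  have qq: "1/?q' + 1/q = 1" using cq by simp
  note F = bump_cell[OF m p(1) cp(1,2) k1(1) \<delta> w f(1) w0 f(2,3) lm(1) lm(4)]
  note G = bump_cell[OF m cq(1) q(1) qq k1(2) \<delta> z g(1) z0 g(2,3) lm(2) lm(5)]
  show Ffin: "(\<integral>\<^sup>+x\<in>cell c. ennreal (Phi m c x * (f x * w x)) \<partial>lebesgue) < \<infinity>" for c by (rule F(1))
  show Gfin: "(\<integral>\<^sup>+x\<in>cell c. ennreal (Phi m c x * (g x * z x)) \<partial>lebesgue) < \<infinity>" for c by (rule G(1))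
  assume DD: "finite DD"
  let ?of = "\<lambda>P. osc_int m (\<lambda>x. f x * w x) P P" and ?og = "\<lambda>P. osc_int m (\<lambda>x. g x * z x) P P"
  have Fm: "(\<lambda>x. f x * w x) \<in> borel_measurable lebesgue" "\<And>x. f x * w x \<ge> 0" using f w0 by auto
  have Gm: "(\<lambda>x. g x * z x) \<in> borel_measurable lebesgue" "\<And>x. g x * z x \<ge> 0" using g z0 by auto
  obtain S where S: "S \<subseteq> DD" "sparse S"
    "(\<Sum>Q\<in>DD. side Q powr (\<alpha> - real CARD('n)) * ?of Q * ?og Q) \<le>
      2 * suminf (gap_coeff CARD('n) \<alpha> m) * (\<Sum>P\<in>S. side P powr (\<alpha> - real CARD('n)) * ?of P * ?og P)"
    using sparse_domination[OF Fm Ffin Gm Gfin DD \<alpha>(1)] by blast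
  have finS: "finite S" using S(1) DD finite_subset by blast
  define B1 where "B1 = bump_C jc m ?p' p ?a1"
  define B2 where "B2 = bump_C jc m q ?q' ?a2"
  have B0: "B1 \<ge> 0" "B2 \<ge> 0" by (auto simp: B1_def B2_def bump_C_def jc_def)
  define th1 where "th1 = 2 powr (- \<delta>/?p')"
  define th2 where "th2 = 2 powr (- \<delta>/q)"
  have th: "0 < th1" "th1 < 1" "0 < th2" "th2 < 1" using \<delta> cp q by (auto simp: th1_def th2_def powr_less_one)
  define Y where "Y i c = 2 powr (- real i * (1/s)) * avr p ?p' f i c" for i c
  define Z where "Z i c = 2 powr (- real i * (1/?s')) * avr ?q' q g i c" for i c
  define X1 where "X1 c = (\<Sum>i. th1 ^ i * Y i c)" for c
  define X2 where "X2 c = (\<Sum>i. th2 ^ i * Z i c)" for c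
  note avb1 = avr_bounds[OF m p(1) cp(1,2) k1(1) \<delta> w f(1) w0 f(2,3)]
  note avb2 = avr_bounds[OF m cq(1) q(1) qq k1(2) \<delta> z g(1) z0 g(2,3)]
  have le1: "2 powr (- real i * (1/s)) \<le> 1" "2 powr (- real i * (1/?s')) \<le> 1" for i
    using powr_mono[of "- real i * (1/s)" 0 "2::real"] powr_mono[of "- real i * (1/?s')" 0 "2::real"] k1 by auto
  have Yb: "0 \<le> Y i c" "Y i c \<le> 1" for i c unfolding Y_def using avb1[of i c] le1[of i] by (auto intro!: mult_le_one)
  have Zb: "0 \<le> Z i c" "Z i c \<le> 1" for i c unfolding Z_def using avb2[of i c] le1[of i] by (auto intro!: mult_le_one)
  let ?N1 = "64 * real (bump_N ?p' p)" and ?N2 = "64 * real (bump_N q ?q')"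
  have N: "?N1 \<ge> 1" "?N2 \<ge> 1" using bump_N1[OF m p(1) cp(1,2) k1(1) \<delta>] bump_N1[OF m cq(1) q(1) qq k1(2) \<delta>] by auto
  have Ysum: "(\<Sum>c\<in>S. Y i c powr s) \<le> ?N1" for i
  proof -
    have "(\<Sum>c\<in>S. Y i c powr s) = (\<Sum>c\<in>S. 2 powr (- real i) * avr p ?p' f i c powr s)"
      unfolding Y_def using q by (intro sum.cong refl) (simp add: powr_mult powr_powr)
    also have "\<dots> = 2 powr (- real i) * (\<Sum>c\<in>S. avr p ?p' f i c powr s)" by (simp add: sum_distrib_left)
    also have "\<dots> \<le> 2 powr (- real i) * (?N1 * 2 ^ i)"
      using avr_sum[OF m p(1) cp(1,2) k1(1) \<delta> w f(1) w0 f(2,3) finS S(2) p(2)] by (intro mult_left_mono) auto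
    also have "\<dots> = ?N1" by (simp add: powr_minus powr_realpow)
    finally show ?thesis .
  qed
  \<comment> \<open>The inequality s \<le> q becomes q' \<le> s', the counterpart of p \<le> s;
    \<open>avr_sum\<close> is applied with each of them.\<close>
  have s'q: "?q' \<le> ?s'" using p by (simp add: conj_exp_def field_simps)
  have Zsum: "(\<Sum>c\<in>S. Z i c powr ?s') \<le> ?N2" for i
  proof -
    have "(\<Sum>c\<in>S. Z i c powr ?s') = (\<Sum>c\<in>S. 2 powr (- real i) * avr ?q' q g i c powr ?s')"
      unfolding Z_def using cs(1) by (intro sum.cong refl) (simp add: powr_mult powr_powr)
    also have "\<dots> = 2 powr (- real i) * (\<Sum>c\<in>S. avr ?q' q g i c powr ?s')" by (simp add: sum_distrib_left)
    also have "\<dots> \<le> 2 powr (- real i) * (?N2 * 2 ^ i)"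
      using avr_sum[OF m cq(1) q(1) qq k1(2) \<delta> z g(1) z0 g(2,3) finS S(2) s'q] by (intro mult_left_mono) auto
    also have "\<dots> = ?N2" by (simp add: powr_minus powr_realpow)
    finally show ?thesis .
  qed
  have YZ: "(\<Sum>c\<in>S. Y i c * Z k c) \<le> ?N1 * ?N2" for i k
  proof -
    have "(\<Sum>c\<in>S. Y i c * Z k c) \<le> ?N1 powr (1/s) * ?N2 powr (1/?s')"
      by (rule sum_Hoelder[OF finS]) (use Yb Zb Ysum Zsum q cs N in auto)
    also have "\<dots> \<le> ?N1 powr 1 * ?N2 powr 1"
      using N q cs(1) by (intro mult_mono powr_mono) auto
    finally show ?thesis using N by simp
  qed
  \<comment> \<open>The two series are summed one after the other: with the level of
    \<open>Y\<close> fixed, first the one over the levels of \<open>Z\<close>.\<close>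
  have X2Y: "(\<Sum>c\<in>S. Y i c * X2 c) \<le> ?N1 * ?N2 / (1 - th2)" for i
  proof -
    have zy: "(\<Sum>c\<in>S. Z k c * Y i c) \<le> ?N1 * ?N2" for k using YZ[of i k] by (simp add: mult.commute)
    have "(\<Sum>c\<in>S. X2 c * Y i c) \<le> ?N1 * ?N2 / (1 - th2)"
      unfolding X2_def by (rule sum_weighted_series_le[OF finS _ th(4) Zb zy]) (use th in auto)
    then show ?thesis by (simp add: mult.commute)
  qed
  have X20: "X2 c \<ge> 0" for c unfolding X2_def
  proof (rule suminf_nonneg)
    show "summable (\<lambda>i. th2 ^ i * Z i c)"
    proof (rule summable_comparison_test')
      show "summable (\<lambda>i. th2 ^ i)" using th by (intro summable_geometric) auto
      show "norm (th2 ^ i * Z i c) \<le> th2 ^ i" for i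
        using th Zb[of i c] mult_left_mono[of "Z i c" 1 "th2 ^ i"] by (simp add: abs_mult)
    qed
  qed (use th Zb in auto)
  have XX: "(\<Sum>c\<in>S. X1 c * X2 c) \<le> ?N1 * ?N2 / (1 - th2) / (1 - th1)"
    unfolding X1_def
    by (rule sum_weighted_series_le[OF finS _ th(2) Yb X2Y]) (use th N in auto)
  have X10: "X1 c \<ge> 0" for c unfolding X1_def
  proof (rule suminf_nonneg)
    show "summable (\<lambda>i. th1 ^ i * Y i c)"
    proof (rule summable_comparison_test')
      show "summable (\<lambda>i. th1 ^ i)" using th by (intro summable_geometric) auto
      show "norm (th1 ^ i * Y i c) \<le> th1 ^ i" for i
        using th Yb[of i c] mult_left_mono[of "Y i c" 1 "th1 ^ i"] by (simp add: abs_mult)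
    qed
  qed (use th Yb in auto)
  have cellwise: "side P powr (\<alpha> - real CARD('n)) * ?of P * ?og P \<le> B1 * B2 * K * (X1 P * X2 P)" for P
  proof -
    have o: "?of P \<le> B1 * lam P * vol P powr (1 - 1/p) * X1 P" "?og P \<le> B2 * mu P * vol P powr (1 - 1/?q') * X2 P"
      using F(2)[of P] G(2)[of P] unfolding j B1_def B2_def X1_def X2_def Y_def Z_def th1_def th2_def by auto
    have nn: "?of P \<ge> 0" "?og P \<ge> 0" by (auto simp: osc_int_def)
    have "side P powr (\<alpha> - real CARD('n)) * ?of P * ?og P \<le>
      side P powr (\<alpha> - real CARD('n)) * (B1 * lam P * vol P powr (1 - 1/p) * X1 P) * (B2 * mu P * vol P powr (1 - 1/?q') * X2 P)"
      using o nn lm(1)[of P] lm(2)[of P] B0 X10[of P] X20[of P]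
      by (intro mult_mono mult_left_mono mult_nonneg_nonneg) (auto simp: less_imp_le)
    also have "\<dots> = (side P powr (\<alpha> - real CARD('n)) * (vol P powr (1 - 1/p) * vol P powr (1 - 1/?q')) * lam P * mu P) * (B1 * B2 * (X1 P * X2 P))"
      by (simp add: mult_ac)
    \<comment> \<open>vol^(\<alpha>/n - 1) from the kernel, vol^(1 - 1/p) and vol^(1/q) from the two
      cell estimates combine to the power of the volume in the hypothesis.\<close>
    also have "side P powr (\<alpha> - real CARD('n)) * (vol P powr (1 - 1/p) * vol P powr (1 - 1/?q')) = vol P powr (\<alpha> / real CARD('n) + 1/q - 1/p)"
    proof -
      have "side P = vol P powr (1 / real CARD('n))"
        by (simp add: vol_def powr_realpow[symmetric] powr_powr)
      then have "side P powr (\<alpha> - real CARD('n)) = vol P powr (\<alpha> / real CARD('n) - 1)"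
        by (simp add: powr_powr diff_divide_distrib)
      then have "side P powr (\<alpha> - real CARD('n)) * (vol P powr (1 - 1/p) * vol P powr (1 - 1/?q'))
        = vol P powr (\<alpha> / real CARD('n) - 1 + ((1 - 1/p) + (1 - 1/?q')))"
        by (simp only: powr_add)
      also have "\<alpha> / real CARD('n) - 1 + ((1 - 1/p) + (1 - 1/?q')) = \<alpha> / real CARD('n) + 1/q - 1/p"
        using qq by simp
      finally show ?thesis .
    qed
    also have "vol P powr (\<alpha> / real CARD('n) + 1/q - 1/p) * lam P * mu P * (B1 * B2 * (X1 P * X2 P)) \<le> K * (B1 * B2 * (X1 P * X2 P))"
      using lm(3)[of P] B0 X10[of P] X20[of P] by (intro mult_right_mono) auto
    finally show ?thesis by (simp add: mult_ac)
  qed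
  have "(\<Sum>P\<in>S. side P powr (\<alpha> - real CARD('n)) * ?of P * ?og P) \<le> (\<Sum>P\<in>S. B1 * B2 * K * (X1 P * X2 P))"
    by (intro sum_mono cellwise)
  also have "\<dots> = B1 * B2 * K * (\<Sum>P\<in>S. X1 P * X2 P)" by (simp add: sum_distrib_left)
  also have "\<dots> \<le> B1 * B2 * K * (?N1 * ?N2 / (1 - th2) / (1 - th1))"
    using XX B0 K by (intro mult_left_mono) auto
  also have "\<dots> = B1 * B2 * K * (?N1 * ?N2 / (1 - th1) / (1 - th2))" by simp
  finally have "2 * suminf (gap_coeff CARD('n) \<alpha> m) * (\<Sum>P\<in>S. side P powr (\<alpha> - real CARD('n)) * ?of P * ?og P) \<le> form_C"
    unfolding form_C_def B1_def[symmetric] B2_def[symmetric] th1_def[symmetric] th2_def[symmetric]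
    using \<alpha>(1) by (intro mult_left_mono) (auto intro!: suminf_nonneg summable_gap_coeff gap_coeff_nonneg)
  then show "(\<Sum>Q\<in>DD. side Q powr (\<alpha> - real CARD('n)) * ?of Q * ?og Q) \<le> form_C"
    using S(3) by linarith
qed

end

section \<open>The one-third trick\<close>

definition third_shift :: "real \<Rightarrow> ('n \<Rightarrow> bool) \<Rightarrow> real^'n" where
  "third_shift h T = (\<chi> i. if T i then h / 3 else 0)"

text \<open>2^k/3 has fractional part 1/3 or 2/3. If an integer separates \<open>X\<close> and
  \<open>Y\<close>, both lie within 1/3 of it, and after the shift both lie strictly between the
  same two consecutive integers.\<close>

lemma floor_third_trick:
  fixes X Y :: real
  assumes "\<bar>X - Y\<bar> < 1/3" "\<lfloor>X\<rfloor> \<noteq> \<lfloor>Y\<rfloor>"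
  shows "\<lfloor>X + 2^k / 3\<rfloor> = \<lfloor>Y + 2^k / 3\<rfloor>"
proof -
  have "\<exists>N::int. (2::int)^k = 3 * N + 1 \<or> (2::int)^k = 3 * N + 2"
  proof (induction k)
    case 0
    show ?case by (rule exI[of _ 0]) simp
  next
    case (Suc k)
    then obtain N :: int where "(2::int)^k = 3 * N + 1 \<or> (2::int)^k = 3 * N + 2" by blast
    then have "(2::int)^Suc k = 3 * (2 * N) + 2 \<or> (2::int)^Suc k = 3 * (2 * N + 1) + 1" by auto
    then show ?case by blast
  qed
  then obtain N :: int where "(2::int)^k = 3 * N + 1 \<or> (2::int)^k = 3 * N + 2" by blast
  then have "real_of_int (2^k) = real_of_int (3 * N + 1) \<or> real_of_int (2^k) = real_of_int (3 * N + 2)" by metis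
  then have "(2::real)^k / 3 = of_int N + 1/3 \<or> (2::real)^k / 3 = of_int N + 2/3" by auto
  then obtain c :: real where c: "(2::real)^k / 3 = of_int N + c" "1/3 \<le> c" "c \<le> 2/3" by fastforce
  define M where "M = max \<lfloor>X\<rfloor> \<lfloor>Y\<rfloor>"
  have "real_of_int M - 1/3 < X \<and> X < M + 1/3 \<and> real_of_int M - 1/3 < Y \<and> Y < M + 1/3"
  proof (cases "\<lfloor>X\<rfloor> < \<lfloor>Y\<rfloor>")
    case True
    then have "X < \<lfloor>Y\<rfloor>" "\<lfloor>Y\<rfloor> \<le> Y" "M = \<lfloor>Y\<rfloor>" by (auto simp: M_def floor_less_iff)
    then show ?thesis using assms(1) by linarith
  next
    case False
    then have "\<lfloor>Y\<rfloor> < \<lfloor>X\<rfloor>" using assms(2) by simp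
    then have "Y < \<lfloor>X\<rfloor>" "\<lfloor>X\<rfloor> \<le> X" "M = \<lfloor>X\<rfloor>" by (auto simp: M_def floor_less_iff)
    then show ?thesis using assms(1) by linarith
  qed
  then have "\<lfloor>X + (of_int N + c)\<rfloor> = M + N" "\<lfloor>Y + (of_int N + c)\<rfloor> = M + N"
    using c by (auto simp: floor_eq_iff)
  then show ?thesis unfolding c(1) by simp
qed

text \<open>The shift is chosen coordinate by coordinate: by h/3 exactly where the unshifted grid
  separates the two points. So 2^n grids suffice for all scales.\<close>

lemma third_trick:
  assumes h: "h > 0" and xy: "norm (x - y) < h / 2^k / 3"
  shows "\<exists>T. dyadic_grid.idx (third_shift h T :: real^'n) h k x = dyadic_grid.idx (third_shift h T) h k y"
proof -
  define T where "T i \<longleftrightarrow> \<lfloor>2^k * (x$i) / h\<rfloor> \<noteq> \<lfloor>2^k * (y$i) / h\<rfloor>" for i :: 'n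
  interpret dyadic_grid "third_shift h T" h by unfold_locales fact
  have "\<lfloor>2^k * (x$i + third_shift h T $ i) / h\<rfloor> = \<lfloor>2^k * (y$i + third_shift h T $ i) / h\<rfloor>" for i
  proof (cases "T i")
    case True
    have "\<bar>x$i - y$i\<bar> < h / 2^k / 3" using component_le_norm_cart[of "x - y" i] xy by simp
    then have "2^k / h * \<bar>x$i - y$i\<bar> < 2^k / h * (h / 2^k / 3)" using h by (intro mult_strict_left_mono) auto
    also have "\<dots> = 1/3" using h by simp
    also have "2^k / h * \<bar>x$i - y$i\<bar> = \<bar>2^k * (x$i) / h - 2^k * (y$i) / h\<bar>"
      using h by (simp add: abs_mult diff_divide_distrib[symmetric] right_diff_distrib[symmetric])
    finally have "\<lfloor>2^k * (x$i) / h + 2^k / 3\<rfloor> = \<lfloor>2^k * (y$i) / h + 2^k / 3\<rfloor>"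
      using True by (intro floor_third_trick) (auto simp: T_def)
    moreover have "2^k * (t + third_shift h T $ i) / h = 2^k * t / h + 2^k / 3" for t
      using True h by (simp add: third_shift_def field_simps)
    ultimately show ?thesis by simp
  next
    case False
    then show ?thesis by (simp add: third_shift_def T_def)
  qed
  then have "idx k x = idx k y" by (simp add: idx_def)
  then show ?thesis by blast
qed

text \<open>Take the generation at which |x - y| is below a third of the side but no longer below a
  third of half the side. Then the side is at most 6 * |x - y|, which is the origin of the
  6.\<close>

lemma kernel_dyadic:
  assumes h: "h > 0" and xy: "x \<noteq> y" "norm (x - y) < h / 3" and \<beta>: "\<beta> > 0"
  shows "\<exists>T k. dyadic_grid.idx (third_shift h T :: real^'n) h k x = dyadic_grid.idx (third_shift h T) h k y \<and>
    norm (x - y) powr (- \<beta>) \<le> 6 powr \<beta> * (h / 2^k) powr (- \<beta>)"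
proof -
  let ?d = "norm (x - y)"
  have d: "?d > 0" using xy by simp
  obtain n where "h / 3 / ?d < 2 ^ n" using real_arch_pow[of 2] by auto
  then have n: "h / 2 ^ n / 3 \<le> ?d" using d by (simp add: field_simps)
  define k where "k = (LEAST n. h / 2 ^ Suc n / 3 \<le> ?d)"
  have "h / 2 ^ Suc n / 3 \<le> h / 2 ^ n / 3" using h by (simp add: field_simps)
  then have ex: "\<exists>n. h / 2 ^ Suc n / 3 \<le> ?d" using n by (intro exI[of _ n]) linarith
  have k: "h / 2 ^ Suc k / 3 \<le> ?d" unfolding k_def using ex by (rule LeastI_ex)
  have k2: "?d < h / 2 ^ k / 3"
  proof (cases k)
    case 0
    then show ?thesis using xy by simp
  next
    case (Suc j)
    then have "\<not> h / 2 ^ Suc j / 3 \<le> ?d" using not_less_Least[of j "\<lambda>n. h / 2 ^ Suc n / 3 \<le> ?d"] k_def by simp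
    then show ?thesis using Suc by simp
  qed
  obtain T where T: "dyadic_grid.idx (third_shift h T :: real^'n) h k x = dyadic_grid.idx (third_shift h T) h k y"
    using third_trick[OF h k2] by blast
  have "?d powr (- \<beta>) \<le> (h / 2 ^ Suc k / 3) powr (- \<beta>)"
    using k d h \<beta> by (intro powr_mono2') auto
  also have "h / 2 ^ Suc k / 3 = (h / 2 ^ k) / 6" by simp
  also have "\<dots> powr (- \<beta>) = 6 powr \<beta> * (h / 2^k) powr (- \<beta>)"
    using h by (simp add: powr_divide powr_minus_divide powr_mult)
  finally show ?thesis using T by blast
qed

section \<open>Boundedness of the positive operator\<close>

lemma locally_integrable_measurable:
  assumes "locally_integrable (b :: real^'n \<Rightarrow> real)" shows "b \<in> borel_measurable lebesgue"
proof (rule borel_measurable_LIMSEQ_real)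
  fix k :: nat
  have "set_integrable lebesgue (cball 0 (real k)) b"
    using assms by (auto simp: locally_integrable_def)
  then show "(\<lambda>x. indicator (cball 0 (real k)) x *\<^sub>R b x) \<in> borel_measurable lebesgue"
    unfolding set_integrable_def by (rule borel_measurable_integrable)
next
  fix x :: "real^'n"
  obtain N where N: "norm x \<le> real N" using real_arch_simple by blast
  show "(\<lambda>k. indicator (cball 0 (real k)) x *\<^sub>R b x) \<longlonglongrightarrow> b x"
    by (rule tendsto_eventually, rule eventually_sequentiallyI[of N]) (use N in \<open>auto simp: indicator_def\<close>)
qed

lemma (in dyadic_grid) bmo_gridI:
  assumes li: "locally_integrable b" and bn: "bmo_norm b \<le> 1"
  shows "bmo_grid a h b"
proof
  show bm [measurable]: "b \<in> borel_measurable lebesgue" using li by (rule locally_integrable_measurable)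
  fix c
  have cp: "compact (hull_cube c)" by (simp add: hull_cube_def)
  then have hi: "set_integrable lebesgue (hull_cube c) b" using li by (simp add: locally_integrable_def)
  show ci: "set_integrable lebesgue (cell c) b"
    by (rule set_integrable_subset[OF hi]) (use cell_sub_hull in auto)
  have [measurable]: "hull_cube c \<in> sets lebesgue" by (simp add: hull_cube_def)
  have AEi: "AE x in lebesgue. (indicator (cell c) x :: real) = indicator (hull_cube c) x"
    using AE_hull[of c] by eventually_elim (auto simp: indicator_def)
  have "(LINT x:cell c|lebesgue. b x) = (LINT x:hull_cube c|lebesgue. b x)"
    unfolding set_lebesgue_integral_def
    by (rule integral_cong_AE) (use AEi in \<open>auto elim!: eventually_mono\<close>)
  then have mean: "mean b c = avg b (hull_cube c)" by (simp add: mean_def avg_def measure_hull)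
  define r where "r = avg b (hull_cube c)"
  have ir: "set_integrable lebesgue (hull_cube c) (\<lambda>x. \<bar>b x - r\<bar>)"
  proof (rule set_integrable_abs, rule set_integral_diff(1)[OF hi])
    show "set_integrable lebesgue (hull_cube c) (\<lambda>x. r)"
      unfolding set_integrable_def
      by (rule integrable_real_indicator[THEN integrable_scaleR_left]) (auto simp: emeasure_hull)
  qed
  have "ennreal ((1 / vol c) * (LINT x:hull_cube c|lebesgue. \<bar>b x - r\<bar>)) \<le> bmo_norm b"
    unfolding bmo_norm_def r_def measure_hull[symmetric]
    by (rule SUP_upper) (use cube_hull_cube in auto)
  also note bn
  finally have "(1 / vol c) * (LINT x:hull_cube c|lebesgue. \<bar>b x - r\<bar>) \<le> 1"
    by (subst (asm) ennreal_le_1) auto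
  then have I: "(LINT x:hull_cube c|lebesgue. \<bar>b x - r\<bar>) \<le> vol c" by (simp add: divide_le_eq)
  have "(\<integral>\<^sup>+x\<in>cell c. ennreal \<bar>b x - mean b c\<bar> \<partial>lebesgue) \<le> (\<integral>\<^sup>+x. ennreal (indicator (hull_cube c) x *\<^sub>R \<bar>b x - r\<bar>) \<partial>lebesgue)"
    unfolding mean r_def[symmetric]
    using cell_sub_hull[of c] by (intro nn_integral_mono) (auto simp: indicator_def)
  also have "\<dots> = ennreal (LINT x:hull_cube c|lebesgue. \<bar>b x - r\<bar>)"
    unfolding set_lebesgue_integral_def
    by (rule nn_integral_eq_integral) (use ir in \<open>auto simp: set_integrable_def\<close>)
  also have "\<dots> \<le> ennreal (vol c)" using I by (rule ennreal_leI)
  finally show "(\<integral>\<^sup>+x\<in>cell c. ennreal \<bar>b x - mean b c\<bar> \<partial>lebesgue) \<le> ennreal (vol c)" .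
qed

text \<open>The summand 1 makes the factor submultiplicative, and b = 0 gives the kernel of
  I_\<alpha> itself. On the diagonal the value is 0, since \<open>0 powr _ = 0\<close>.\<close>

definition osc_kernel :: "real \<Rightarrow> nat \<Rightarrow> (real^'n \<Rightarrow> real) \<Rightarrow> real^'n \<Rightarrow> real^'n \<Rightarrow> real" where
  "osc_kernel \<alpha> m b x y = (1 + \<bar>b x - b y\<bar>) ^ m * norm (x - y) powr (\<alpha> - real CARD('n))"

lemma osc_kernel_nonneg [simp]: "osc_kernel \<alpha> m b x y \<ge> 0"
  by (simp add: osc_kernel_def)

lemma osc_kernel_measurable [measurable]:
  fixes b :: "real^'n \<Rightarrow> real"
  assumes [measurable]: "b \<in> borel_measurable lebesgue"
  shows "(\<lambda>xy. osc_kernel \<alpha> m b (fst xy) (snd xy)) \<in> borel_measurable (lebesgue \<Otimes>\<^sub>M lebesgue)"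
  unfolding osc_kernel_def by measurable

lemma osc_kernel_measurable2 [measurable]:
  fixes b :: "real^'n \<Rightarrow> real"
  assumes b [measurable]: "b \<in> borel_measurable lebesgue"
  shows "osc_kernel \<alpha> m b x \<in> borel_measurable lebesgue"
  unfolding osc_kernel_def by measurable

context bump_data
begin

definition ker_C :: real where
  "ker_C = real CARD('n \<Rightarrow> bool) * (6 powr (real CARD('n) - \<alpha>) * form_C)"

context
  fixes b f g :: "real^'n \<Rightarrow> real"
  assumes li: "locally_integrable b" and bn: "bmo_norm b \<le> 1"
    and f: "f \<in> borel_measurable lebesgue" "\<And>x. f x \<ge> 0" "(\<integral>\<^sup>+x. ennreal (f x powr p) \<partial>lebesgue) \<le> ennreal 1"
    and g: "g \<in> borel_measurable lebesgue" "\<And>x. g x \<ge> 0" "(\<integral>\<^sup>+x. ennreal (g x powr conj_exp q) \<partial>lebesgue) \<le> ennreal 1"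
begin

text \<open>Points closer than h/3 share a cell of one of the shifted grids, so the kernel is
  dominated by a sum over grids and cells of functions of \<open>x\<close> times functions of
  \<open>y\<close>. Integration leaves the discrete form bounded by
  \<open>grid_form_bound\<close>.\<close>

lemma truncated_bilinear_bound:
  assumes h: "h > 0"
  shows "(\<integral>\<^sup>+x. \<integral>\<^sup>+y. ennreal (osc_kernel \<alpha> m b x y * (f y * w y) * (g x * z x)) * indicator {y. norm (x - y) < h / 3} y \<partial>lebesgue \<partial>lebesgue)
    \<le> ennreal ker_C"
proof -
  let ?A = "\<lambda>T. third_shift h T :: real^'n"
  have G: "bmo_grid (?A T) h b" for T
    by (intro dyadic_grid.bmo_gridI li bn) (unfold_locales, rule h)
  have D: "dyadic_grid h" by (unfold_locales) (rule h)
  let ?n = "real CARD('n)"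
  let ?cell = "\<lambda>T. dyadic_grid.cell (?A T) h" and ?Phi = "\<lambda>T. bmo_grid.Phi (?A T) h b m" and ?side = "dyadic_grid.side h :: nat \<times> (int^'n) \<Rightarrow> real"
  let ?osc = "\<lambda>T F c. bmo_grid.osc_int (?A T) h b m F c c"
  have [measurable]: "?cell T c \<in> sets lebesgue" for T c by (rule dyadic_grid.cell_lebesgue) (rule D)
  have [measurable]: "?Phi T c \<in> borel_measurable lebesgue" for T c by (rule bmo_grid.Phi_measurable[OF G])
  note [measurable] = f(1) g(1) locally_integrable_measurable[OF li]
  have P0: "?Phi T c x \<ge> 0" for T c x by (rule bmo_grid.Phi_nonneg[OF G])
  define C where "C = 6 powr (?n - \<alpha>)"
  define FF where "FF T c y = ennreal (?Phi T c y * (f y * w y)) * indicator (?cell T c) y" for T c y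
  define GG where "GG T c x = ennreal (?Phi T c x * (g x * z x)) * indicator (?cell T c) x" for T c x
  \<comment> \<open>Cells are enumerated by \<open>from_nat\<close>. The weight is 0 at indices that
    are not the code of their own cell, so every cell counts once.\<close>
  define sd where "sd j = (if to_nat (from_nat j :: nat \<times> (int^'n)) = j then ?side (from_nat j) powr (\<alpha> - ?n) else 0)" for j
  have [measurable]: "FF T c \<in> borel_measurable lebesgue" "GG T c \<in> borel_measurable lebesgue" for T c
    unfolding FF_def GG_def by measurable
  have pw: "ennreal (osc_kernel \<alpha> m b x y * (f y * w y) * (g x * z x)) * indicator {y. norm (x - y) < h / 3} y
    \<le> (\<Sum>T\<in>UNIV. \<Sum>j. ennreal (C * sd j) * GG T (from_nat j) x * FF T (from_nat j) y)" for x y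
  proof (cases "x = y \<or> \<not> norm (x - y) < h / 3")
    case True
    then show ?thesis by (auto simp: osc_kernel_def)
  next
    case False
    then obtain T k where Tk: "dyadic_grid.idx (?A T) h k x = dyadic_grid.idx (?A T) h k y"
      "norm (x - y) powr (- (?n - \<alpha>)) \<le> 6 powr (?n - \<alpha>) * (h / 2^k) powr (- (?n - \<alpha>))"
      using kernel_dyadic[OF h, of x y "?n - \<alpha>"] \<alpha> by auto
    define c where "c = (k, dyadic_grid.idx (?A T) h k x)"
    have xc: "x \<in> ?cell T c" "y \<in> ?cell T c"
      using Tk(1) by (auto simp: c_def dyadic_grid.cell_def[OF D])
    have sc: "?side c = h / 2^k" by (simp add: c_def dyadic_grid.side_def[OF D])
    have "osc_kernel \<alpha> m b x y \<le> (?Phi T c x * ?Phi T c y) * (C * ?side c powr (\<alpha> - ?n))"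
      unfolding osc_kernel_def C_def sc using bmo_grid.Phi_kernel_le[OF G, of x y m T c] Tk(2) P0
      by (intro mult_mono) auto
    then have "osc_kernel \<alpha> m b x y * (f y * w y) * (g x * z x) \<le> (?Phi T c x * ?Phi T c y) * (C * ?side c powr (\<alpha> - ?n)) * (f y * w y) * (g x * z x)"
      using f g w0 z0 by (intro mult_right_mono) auto
    also have "\<dots> = (C * ?side c powr (\<alpha> - ?n)) * (?Phi T c x * (g x * z x)) * (?Phi T c y * (f y * w y))" by (simp add: mult_ac)
    finally have "ennreal (osc_kernel \<alpha> m b x y * (f y * w y) * (g x * z x)) \<le>
      ennreal ((C * ?side c powr (\<alpha> - ?n)) * (?Phi T c x * (g x * z x)) * (?Phi T c y * (f y * w y)))" by (rule ennreal_leI)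
    also have "\<dots> = ennreal (C * sd (to_nat c)) * GG T (from_nat (to_nat c)) x * FF T (from_nat (to_nat c)) y"
      using xc P0 f g w0 z0 by (simp add: sd_def GG_def FF_def ennreal_mult' C_def)
    also have "\<dots> = (\<Sum>j\<in>{to_nat c}. ennreal (C * sd j) * GG T (from_nat j) x * FF T (from_nat j) y)" by simp
    also have "\<dots> \<le> (\<Sum>j. ennreal (C * sd j) * GG T (from_nat j) x * FF T (from_nat j) y)"
      by (rule sum_le_suminf) auto
    also have "\<dots> \<le> (\<Sum>T\<in>UNIV. \<Sum>j. ennreal (C * sd j) * GG T (from_nat j) x * FF T (from_nat j) y)"
      by (rule member_le_sum[of T UNIV "\<lambda>T. \<Sum>j. ennreal (C * sd j) * GG T (from_nat j) x * FF T (from_nat j) y"]) auto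
    finally show ?thesis using False by simp
  qed
  define BF where "BF T c = (\<integral>\<^sup>+y. FF T c y \<partial>lebesgue)" for T c
  define BG where "BG T c = (\<integral>\<^sup>+x. GG T c x \<partial>lebesgue)" for T c
  have "(\<integral>\<^sup>+x. \<integral>\<^sup>+y. ennreal (osc_kernel \<alpha> m b x y * (f y * w y) * (g x * z x)) * indicator {y. norm (x - y) < h / 3} y \<partial>lebesgue \<partial>lebesgue)
    \<le> (\<integral>\<^sup>+x. \<integral>\<^sup>+y. (\<Sum>T\<in>UNIV. \<Sum>j. ennreal (C * sd j) * GG T (from_nat j) x * FF T (from_nat j) y) \<partial>lebesgue \<partial>lebesgue)"
    by (intro nn_integral_mono pw)
  also have "\<dots> = (\<integral>\<^sup>+x. (\<Sum>T\<in>UNIV. \<Sum>j. ennreal (C * sd j) * GG T (from_nat j) x * BF T (from_nat j)) \<partial>lebesgue)"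
    unfolding BF_def by (simp add: nn_integral_sum nn_integral_suminf nn_integral_cmult)
  also have "\<dots> = (\<Sum>T\<in>UNIV. \<Sum>j. ennreal (C * sd j) * BG T (from_nat j) * BF T (from_nat j))"
    unfolding BG_def by (simp add: nn_integral_sum nn_integral_suminf nn_integral_cmult nn_integral_multc)
  \<comment> \<open>A series of nonnegative terms is bounded through its partial sums, so the
    estimate for finite families of cells is enough.\<close>
  also have "\<dots> \<le> (\<Sum>T\<in>(UNIV :: ('n \<Rightarrow> bool) set). ennreal (C * form_C))"
  proof (intro sum_mono suminf_le_const)
    fix T :: "'n \<Rightarrow> bool" and N
    let ?F = "\<lambda>x. f x * w x" and ?H = "\<lambda>x. g x * z x"
    interpret bmo_grid "?A T" h b by (rule G)
    note fb = grid_form_bound[OF G[of T] f g]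
    have FG: "BF T c = ennreal (osc_int m ?F c c)" "BG T c = ennreal (osc_int m ?H c c)" for c
      using fb(1)[of c] fb(2)[of c] by (simp_all add: BF_def BG_def FF_def GG_def osc_int_def)
    have nn: "osc_int m F c c \<ge> 0" for F c by (simp add: osc_int_def)
    define DD where "DD = (from_nat :: nat \<Rightarrow> nat \<times> (int^'n)) ` {j. j < N \<and> to_nat (from_nat j :: nat \<times> (int^'n)) = j}"
    have C0: "C \<ge> 0" by (simp add: C_def)
    have "(\<Sum>j<N. ennreal (C * sd j) * BG T (from_nat j) * BF T (from_nat j))
      = (\<Sum>j<N. ennreal (C * sd j * osc_int m ?H (from_nat j) (from_nat j) * osc_int m ?F (from_nat j) (from_nat j)))"
      unfolding FG by (intro sum.cong refl) (simp add: ennreal_mult' nn C0 sd_def)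
    also have "\<dots> = ennreal (\<Sum>j<N. C * sd j * osc_int m ?H (from_nat j) (from_nat j) * osc_int m ?F (from_nat j) (from_nat j))"
      by (rule sum_ennreal) (simp add: nn C0 sd_def)
    also have "(\<Sum>j<N. C * sd j * osc_int m ?H (from_nat j) (from_nat j) * osc_int m ?F (from_nat j) (from_nat j))
      = (\<Sum>j\<in>{j. j < N \<and> to_nat (from_nat j :: nat \<times> (int^'n)) = j}. C * (side (from_nat j) powr (\<alpha> - ?n) * osc_int m ?F (from_nat j) (from_nat j) * osc_int m ?H (from_nat j) (from_nat j)))"
      by (rule sum.mono_neutral_cong_right) (auto simp: sd_def)
    also have "\<dots> = (\<Sum>c\<in>DD. C * (side c powr (\<alpha> - ?n) * osc_int m ?F c c * osc_int m ?H c c))"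
      unfolding DD_def by (rule sum.reindex_cong[symmetric, OF _ refl refl]) (metis (mono_tags, lifting) inj_onI mem_Collect_eq)
    also have "\<dots> = C * (\<Sum>c\<in>DD. side c powr (\<alpha> - ?n) * osc_int m ?F c c * osc_int m ?H c c)" by (simp add: sum_distrib_left)
    also have "ennreal \<dots> \<le> ennreal (C * form_C)"
      using C0 by (intro ennreal_leI mult_left_mono fb(3)) (auto simp: DD_def)
    finally show "(\<Sum>j<N. ennreal (C * sd j) * BG T (from_nat j) * BF T (from_nat j)) \<le> ennreal (C * form_C)" .
  qed auto
  also have "\<dots> = ennreal ker_C" by (simp add: ker_C_def C_def ennreal_of_nat_eq_real_of_nat ennreal_mult'[symmetric])
  finally show ?thesis .
qed

text \<open>\<open>ker_C\<close> does not depend on \<open>h\<close>, so monotone convergence along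
  h = 1, 2, ... removes the restriction to nearby points.\<close>

lemma bilinear_bound:
  "(\<integral>\<^sup>+x. \<integral>\<^sup>+y. ennreal (osc_kernel \<alpha> m b x y * (f y * w y) * (g x * z x)) \<partial>lebesgue \<partial>lebesgue) \<le> ennreal ker_C"
proof -
  note [measurable] = f(1) g(1) locally_integrable_measurable[OF li]
  define H where "H k x y = ennreal (osc_kernel \<alpha> m b x y * (f y * w y) * (g x * z x)) * indicator {y. norm (x - y) < real (Suc k) / 3} y" for k x y
  have Hm [measurable]: "H k x \<in> borel_measurable lebesgue" for k x unfolding H_def by measurable
  have Hm2 [measurable]: "(\<lambda>x. \<integral>\<^sup>+y. H k x y \<partial>lebesgue) \<in> borel_measurable lebesgue" for k
  proof -
    have "(\<lambda>xy. H k (fst xy) (snd xy)) \<in> borel_measurable (lebesgue \<Otimes>\<^sub>M lebesgue)"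
      unfolding H_def indicator_def mem_Collect_eq by measurable
    then show ?thesis by (intro lebesgue.borel_measurable_nn_integral) (simp add: case_prod_beta')
  qed
  have inc: "incseq (\<lambda>k. H k x)" for x
    by (auto simp: incseq_def le_fun_def H_def indicator_def)
  have sup: "(SUP k. H k x y) = ennreal (osc_kernel \<alpha> m b x y * (f y * w y) * (g x * z x))" for x y
  proof -
    obtain N where N: "3 * norm (x - y) < real N" using reals_Archimedean2 by blast
    show ?thesis
    proof (rule antisym)
      show "(SUP k. H k x y) \<le> ennreal (osc_kernel \<alpha> m b x y * (f y * w y) * (g x * z x))"
        by (rule SUP_least) (auto simp: H_def indicator_def)
      have "ennreal (osc_kernel \<alpha> m b x y * (f y * w y) * (g x * z x)) = H N x y"
        using N by (auto simp: H_def indicator_def)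
      then show "ennreal (osc_kernel \<alpha> m b x y * (f y * w y) * (g x * z x)) \<le> (SUP k. H k x y)"
        using SUP_upper[of N UNIV "\<lambda>k. H k x y"] by simp
    qed
  qed
  have "(\<integral>\<^sup>+x. \<integral>\<^sup>+y. ennreal (osc_kernel \<alpha> m b x y * (f y * w y) * (g x * z x)) \<partial>lebesgue \<partial>lebesgue)
    = (\<integral>\<^sup>+x. \<integral>\<^sup>+y. (SUP k. H k x y) \<partial>lebesgue \<partial>lebesgue)" by (simp add: sup)
  also have "\<dots> = (\<integral>\<^sup>+x. (SUP k. \<integral>\<^sup>+y. H k x y \<partial>lebesgue) \<partial>lebesgue)"
    by (intro nn_integral_cong nn_integral_monotone_convergence_SUP inc) simp
  also have "\<dots> = (SUP k. \<integral>\<^sup>+x. \<integral>\<^sup>+y. H k x y \<partial>lebesgue \<partial>lebesgue)"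
  proof (rule nn_integral_monotone_convergence_SUP)
    show "incseq (\<lambda>k x. \<integral>\<^sup>+y. H k x y \<partial>lebesgue)"
      using inc by (auto simp: incseq_def le_fun_def intro!: nn_integral_mono)
  qed simp
  also have "\<dots> \<le> ennreal ker_C"
  proof (rule SUP_least)
    fix k
    show "(\<integral>\<^sup>+x. \<integral>\<^sup>+y. H k x y \<partial>lebesgue \<partial>lebesgue) \<le> ennreal ker_C"
      unfolding H_def by (rule truncated_bilinear_bound) simp
  qed
  finally show ?thesis .
qed

end

end

section \<open>Local integrability of powers of the weights\<close>

lemma bounded_subset_cube:
  assumes "bounded (B :: (real^'n) set)"
  obtains R where "R > 0" "cube (cbox (- R *\<^sub>R One) (R *\<^sub>R One) :: (real^'n) set)" "B \<subseteq> cbox (- R *\<^sub>R One) (R *\<^sub>R One)"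
proof -
  obtain R where R: "R > 0" "\<And>x. x \<in> B \<Longrightarrow> norm x \<le> R" using assms bounded_pos by blast
  have eq: "- R *\<^sub>R One + (2 * R) *\<^sub>R One = (R *\<^sub>R One :: real^'n)"
    unfolding scaleR_left_distrib[symmetric] by simp
  have "cube (cbox (- R *\<^sub>R One) (R *\<^sub>R One) :: (real^'n) set)"
    unfolding cube_def
  proof (intro exI conjI)
    show "0 < 2 * R" using R(1) by simp
    show "cbox (- R *\<^sub>R One) (R *\<^sub>R One) = cbox (- R *\<^sub>R One) (- R *\<^sub>R One + (2 * R) *\<^sub>R (One :: real^'n))"
      by (simp only: eq)
  qed
  moreover have "B \<subseteq> cbox (- R *\<^sub>R One) (R *\<^sub>R One)"
  proof
    fix x assume "x \<in> B"
    then have "\<bar>x $ i\<bar> \<le> R" for i using R(2)[of x] component_le_norm_cart[of x i] by linarith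
    then show "x \<in> cbox (- R *\<^sub>R One) (R *\<^sub>R One)" by (simp add: mem_box_cart abs_le_iff minus_le_iff)
  qed
  ultimately show ?thesis using R(1) that by blast
qed

lemma cube_measure_pos:
  fixes Q :: "(real^'n) set"
  assumes "cube Q" shows "0 < measure lebesgue Q" "emeasure lebesgue Q = ennreal (measure lebesgue Q)" "Q \<in> sets lebesgue" "bounded Q"
proof -
  obtain a l where Q: "l > 0" "Q = cbox a (a + l *\<^sub>R One)" using assms by (auto simp: cube_def)
  have "emeasure lborel Q = (\<Prod>b\<in>Basis. (l *\<^sub>R One) \<bullet> (b::real^'n))"
    unfolding Q(2) using Q(1) by (subst emeasure_lborel_cbox) (auto simp: inner_add_left)
  then have em: "emeasure lebesgue Q = ennreal (l ^ DIM(real^'n))"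
    using Q by (simp add: prod_constant)
  then have "measure lebesgue Q = l ^ DIM(real^'n)" using Q(1) by (simp add: measure_def)
  then show "0 < measure lebesgue Q" "emeasure lebesgue Q = ennreal (measure lebesgue Q)" using em Q(1) by auto
  show "Q \<in> sets lebesgue" "bounded Q" using Q by auto
qed

lemma bump_power_le:
  fixes W r a :: real
  assumes "W \<ge> 0" "a \<ge> 0" shows "W powr r \<le> W powr r * ln (exp 1 + W) powr a"
proof -
  have "ln (exp 1) \<le> ln (exp 1 + W)" using assms by (subst ln_le_cancel_iff) (auto simp: add_pos_nonneg)
  then have "1 \<le> ln (exp 1 + W)" by simp
  then have "1 powr a \<le> ln (exp 1 + W) powr a" using assms by (intro powr_mono2) auto
  then show ?thesis using mult_left_mono[of 1 "ln (exp 1 + W) powr a" "W powr r"] by simp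
qed

lemma bump_integral_power:
  fixes f :: "real^'n \<Rightarrow> real"
  assumes [measurable]: "f \<in> borel_measurable lebesgue" and f: "\<And>x. f x \<ge> 0" and lam: "lam > 0" and a: "a \<ge> 0" and r: "r > 0"
    and Q [measurable]: "Q \<in> sets lebesgue" and M: "M \<ge> 0"
    and le: "(\<integral>\<^sup>+x\<in>Q. ennreal ((f x / lam) powr r * ln (exp 1 + f x / lam) powr a) \<partial>lebesgue) \<le> ennreal M"
  shows "(\<integral>\<^sup>+x\<in>Q. ennreal (f x powr r) \<partial>lebesgue) \<le> ennreal (lam powr r * M)"
proof -
  have "(\<integral>\<^sup>+x\<in>Q. ennreal (f x powr r) \<partial>lebesgue) \<le> (\<integral>\<^sup>+x. ennreal (lam powr r) *
     (ennreal ((f x / lam) powr r * ln (exp 1 + f x / lam) powr a) * indicator Q x) \<partial>lebesgue)"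
  proof (intro nn_integral_mono)
    fix x
    have "f x powr r = lam powr r * (f x / lam) powr r" using lam f[of x] by (simp add: powr_divide)
    also have "\<dots> \<le> lam powr r * ((f x / lam) powr r * ln (exp 1 + f x / lam) powr a)"
      using lam f[of x] a by (intro mult_left_mono bump_power_le) auto
    finally have "ennreal (f x powr r) \<le> ennreal (lam powr r) * ennreal ((f x / lam) powr r * ln (exp 1 + f x / lam) powr a)"
      by (simp add: ennreal_mult'[symmetric] ennreal_leI)
    then show "ennreal (f x powr r) * indicator Q x \<le> ennreal (lam powr r) *
     (ennreal ((f x / lam) powr r * ln (exp 1 + f x / lam) powr a) * indicator Q x)"
      by (simp add: mult.assoc[symmetric] mult_right_mono)
  qed
  also have "\<dots> = ennreal (lam powr r) * (\<integral>\<^sup>+x\<in>Q. ennreal ((f x / lam) powr r * ln (exp 1 + f x / lam) powr a) \<partial>lebesgue)"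
    by (rule nn_integral_cmult) measurable
  also have "\<dots> \<le> ennreal (lam powr r) * ennreal M" using le by (rule mult_left_mono) simp
  finally show ?thesis using M by (simp add: ennreal_mult')
qed

context bump_data
begin

lemma z_w_bounded_finite:
  assumes "bounded B"
  shows "(\<integral>\<^sup>+x\<in>B. ennreal (z x powr q) \<partial>lebesgue) < \<infinity>" "(\<integral>\<^sup>+x\<in>B. ennreal (w x powr conj_exp p) \<partial>lebesgue) < \<infinity>"
proof -
  obtain R where R: "cube (cbox (- R *\<^sub>R One) (R *\<^sub>R One) :: (real^'n) set)" "B \<subseteq> cbox (- R *\<^sub>R One) (R *\<^sub>R One)"
    using bounded_subset_cube[OF assms] by metis
  define Q where "Q = (cbox (- R *\<^sub>R One) (R *\<^sub>R One) :: (real^'n) set)"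
  have Q: "cube Q" "B \<subseteq> Q" using R by (auto simp: Q_def)
  obtain lam mu where lm: "lam > 0" "mu > 0"
      "(\<integral>\<^sup>+x\<in>Q. ennreal ((w x / lam) powr conj_exp p * ln (exp 1 + w x / lam) powr ((real m + 1/s) * conj_exp p + \<delta>)) \<partial>lebesgue)
        \<le> ennreal (measure lebesgue Q)"
      "(\<integral>\<^sup>+x\<in>Q. ennreal ((z x / mu) powr q * ln (exp 1 + z x / mu) powr ((real m + 1/conj_exp s) * q + \<delta>)) \<partial>lebesgue)
        \<le> ennreal (measure lebesgue Q)"
    using bump[OF Q(1)] by blast
  note cp = conj_exp_props[OF p(1)] and cs = conj_exp_props[OF q(2)]
  have sub: "(\<integral>\<^sup>+x\<in>B. F x \<partial>lebesgue) \<le> (\<integral>\<^sup>+x\<in>Q. F x \<partial>lebesgue)" for F :: "real^'n \<Rightarrow> ennreal"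
    using Q(2) by (intro nn_integral_mono) (auto simp: indicator_def)
  have zQ: "(\<integral>\<^sup>+x\<in>Q. ennreal (z x powr q) \<partial>lebesgue) \<le> ennreal (mu powr q * measure lebesgue Q)"
    by (rule bump_integral_power[OF z z0 lm(2) _ _ _ _ lm(4)])
       (use q cs \<delta> cube_measure_pos[OF Q(1)] in \<open>auto intro!: add_nonneg_nonneg mult_nonneg_nonneg\<close>)
  show "(\<integral>\<^sup>+x\<in>B. ennreal (z x powr q) \<partial>lebesgue) < \<infinity>"
    by (rule le_less_trans[OF order_trans[OF sub zQ]]) simp
  have wQ: "(\<integral>\<^sup>+x\<in>Q. ennreal (w x powr conj_exp p) \<partial>lebesgue) \<le> ennreal (lam powr conj_exp p * measure lebesgue Q)"
    by (rule bump_integral_power[OF w w0 lm(1) _ _ _ _ lm(3)])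
       (use q cp \<delta> cube_measure_pos[OF Q(1)] in \<open>auto intro!: add_nonneg_nonneg mult_nonneg_nonneg\<close>)
  show "(\<integral>\<^sup>+x\<in>B. ennreal (w x powr conj_exp p) \<partial>lebesgue) < \<infinity>"
    by (rule le_less_trans[OF order_trans[OF sub wQ]]) simp
qed

section \<open>From the bilinear form to a norm inequality\<close>

definition Tp :: "(real^'n \<Rightarrow> real) \<Rightarrow> (real^'n \<Rightarrow> real) \<Rightarrow> real^'n \<Rightarrow> ennreal" where
  "Tp b F x = (\<integral>\<^sup>+y. ennreal (osc_kernel \<alpha> m b x y * F y) \<partial>lebesgue)"

lemma Tp_measurable [measurable]:
  assumes [measurable]: "b \<in> borel_measurable lebesgue" "F \<in> borel_measurable lebesgue"
  shows "Tp b F \<in> borel_measurable lebesgue"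
proof -
  have "(\<lambda>xy. ennreal (osc_kernel \<alpha> m b (fst xy) (snd xy) * F (snd xy))) \<in> borel_measurable (lebesgue \<Otimes>\<^sub>M lebesgue)"
    by measurable
  then show ?thesis unfolding Tp_def by (intro lebesgue.borel_measurable_nn_integral) (simp add: case_prod_beta')
qed

context
  fixes b f :: "real^'n \<Rightarrow> real"
  assumes li: "locally_integrable b" and bn: "bmo_norm b \<le> 1"
    and f: "f \<in> borel_measurable lebesgue" "\<And>x. f x \<ge> 0" "(\<integral>\<^sup>+x. ennreal (f x powr p) \<partial>lebesgue) \<le> ennreal 1"
begin

text \<open>Duality: the norm is recovered by pairing with the normalised power (G z)^(q-1).
  Truncation in height and space makes the norm finite beforehand, so that it may be divided
  by.\<close>

lemma strong_bound_truncated: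
  fixes k :: nat
  defines "G \<equiv> \<lambda>x. enn2real (min (Tp b (\<lambda>y. f y * w y) x) (ennreal (real k))) * indicator (cball 0 (real k)) x"
  shows "(\<integral>\<^sup>+x. ennreal ((G x * z x) powr q) \<partial>lebesgue) \<le> ennreal (ker_C powr q)"
proof -
  note [measurable] = f(1) locally_integrable_measurable[OF li]
  note cq = conj_exp_props[OF q(1)]
  have [measurable]: "cball (0::real^'n) (real k) \<in> sets lebesgue" by simp
  have [measurable]: "G \<in> borel_measurable lebesgue" unfolding G_def by measurable
  have fin: "min (Tp b (\<lambda>y. f y * w y) x) (ennreal (real k)) < \<infinity>" for x by (simp add: min_less_iff_disj)
  have G0: "G x \<ge> 0" for x by (simp add: G_def)
  have Gk: "G x \<le> real k * indicator (cball 0 (real k)) x" for x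
  proof -
    have "enn2real (min (Tp b (\<lambda>y. f y * w y) x) (ennreal (real k))) \<le> real k" by (intro enn2real_leI) auto
    then show ?thesis unfolding G_def by (intro mult_right_mono) auto
  qed
  have GT: "ennreal (G x) \<le> Tp b (\<lambda>y. f y * w y) x" for x
    using fin[of x] by (auto simp: G_def indicator_def)
  define I where "I = (\<integral>\<^sup>+x. ennreal ((G x * z x) powr q) \<partial>lebesgue)"
  have "I \<le> (\<integral>\<^sup>+x. ennreal (real k powr q) * (ennreal (z x powr q) * indicator (cball 0 (real k)) x) \<partial>lebesgue)"
    unfolding I_def
  proof (intro nn_integral_mono)
    fix x
    have "(G x * z x) powr q \<le> (real k * indicator (cball 0 (real k)) x * z x) powr q"
      using Gk[of x] G0[of x] z0[of x] q by (intro powr_mono2 mult_right_mono) auto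
    also have "\<dots> = real k powr q * (z x powr q * indicator (cball 0 (real k)) x)"
      using q z0[of x] by (auto simp: indicator_def powr_mult)
    finally show "ennreal ((G x * z x) powr q) \<le> ennreal (real k powr q) * (ennreal (z x powr q) * indicator (cball 0 (real k)) x)"
      by (auto simp: ennreal_mult'[symmetric] indicator_def intro!: ennreal_leI)
  qed
  also have "\<dots> = ennreal (real k powr q) * (\<integral>\<^sup>+x\<in>cball 0 (real k). ennreal (z x powr q) \<partial>lebesgue)"
    by (rule nn_integral_cmult) measurable
  also have "\<dots> < \<infinity>" using z_w_bounded_finite(1)[of "cball 0 (real k)"] by (simp add: ennreal_mult_less_top)
  finally obtain I' where I': "I = ennreal I'" "I' \<ge> 0" by (cases I) auto
  show ?thesis
  proof (cases "I' = 0")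
    case True
    then show ?thesis using I' by (simp add: I_def)
  next
    case False
    then have Ip: "I' > 0" using I' by simp
    let ?q' = "conj_exp q"
    define g where "g x = (G x * z x) powr (q - 1) / I' powr (1/?q')" for x
    have [measurable]: "g \<in> borel_measurable lebesgue" unfolding g_def by measurable
    have qq: "(q - 1) * ?q' = q" using q by (simp add: conj_exp_def)
    have gq: "g x powr ?q' = (G x * z x) powr q / I'" for x
      using G0[of x] z0[of x] Ip cq(1) qq by (simp add: g_def powr_divide powr_powr)
    have "(\<integral>\<^sup>+x. ennreal (g x powr ?q') \<partial>lebesgue) = (\<integral>\<^sup>+x. ennreal (1 / I') * ennreal ((G x * z x) powr q) \<partial>lebesgue)"
      unfolding gq using Ip by (intro nn_integral_cong) (simp add: ennreal_mult'[symmetric])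
    also have "\<dots> = ennreal (1 / I') * I" unfolding I_def by (rule nn_integral_cmult) measurable
    also have "\<dots> = ennreal 1" unfolding I'(1) using Ip by (simp add: ennreal_mult'[symmetric])
    finally have g1: "(\<integral>\<^sup>+x. ennreal (g x powr ?q') \<partial>lebesgue) \<le> ennreal 1" by simp
    have g0: "g x \<ge> 0" for x by (simp add: g_def)
    have "ennreal (I' powr (1/q)) = ennreal (1 / I' powr (1/?q')) * I"
    proof -
      have "I' powr (1/q) = I' powr (1 - 1/?q')" using cq by simp
      also have "\<dots> = I' / I' powr (1/?q')" using Ip by (simp add: powr_diff)
      finally show ?thesis unfolding I'(1) using Ip by (simp add: ennreal_mult'[symmetric])
    qed
    also have "\<dots> = (\<integral>\<^sup>+x. ennreal (1 / I' powr (1/?q')) * ennreal ((G x * z x) powr q) \<partial>lebesgue)"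
      unfolding I_def by (rule nn_integral_cmult[symmetric]) measurable
    also have "\<dots> = (\<integral>\<^sup>+x. ennreal (G x) * ennreal (g x * z x) \<partial>lebesgue)"
    proof (intro nn_integral_cong)
      fix x
      have "(G x * z x) powr q = (G x * z x) powr (q - 1) * (G x * z x)"
        using powr_mult_base[of "G x * z x" "q - 1"] G0[of x] z0[of x] by (simp add: mult.commute)
      then show "ennreal (1 / I' powr (1/?q')) * ennreal ((G x * z x) powr q) = ennreal (G x) * ennreal (g x * z x)"
        using G0[of x] z0[of x] Ip by (simp add: ennreal_mult'[symmetric] g_def mult_ac)
    qed
    also have "\<dots> \<le> (\<integral>\<^sup>+x. Tp b (\<lambda>y. f y * w y) x * ennreal (g x * z x) \<partial>lebesgue)"
      by (intro nn_integral_mono mult_right_mono GT) auto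
    also have "\<dots> = (\<integral>\<^sup>+x. \<integral>\<^sup>+y. ennreal (osc_kernel \<alpha> m b x y * (f y * w y) * (g x * z x)) \<partial>lebesgue \<partial>lebesgue)"
    proof (intro nn_integral_cong)
      fix x
      have "Tp b (\<lambda>y. f y * w y) x * ennreal (g x * z x) = (\<integral>\<^sup>+y. ennreal (osc_kernel \<alpha> m b x y * (f y * w y)) * ennreal (g x * z x) \<partial>lebesgue)"
        unfolding Tp_def by (rule nn_integral_multc[symmetric]) measurable
      also have "\<dots> = (\<integral>\<^sup>+y. ennreal (osc_kernel \<alpha> m b x y * (f y * w y) * (g x * z x)) \<partial>lebesgue)"
        using f(2) w0 g0 z0 by (intro nn_integral_cong) (simp add: ennreal_mult)
      finally show "Tp b (\<lambda>y. f y * w y) x * ennreal (g x * z x) = (\<integral>\<^sup>+y. ennreal (osc_kernel \<alpha> m b x y * (f y * w y) * (g x * z x)) \<partial>lebesgue)" .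
    qed
    also have "\<dots> \<le> ennreal ker_C" by (rule bilinear_bound[OF li bn f _ g0 g1]) simp
    finally have le: "ennreal (I' powr (1/q)) \<le> ennreal ker_C" .
    moreover have "0 < I' powr (1/q)" using Ip by simp
    ultimately have "I' powr (1/q) \<le> ker_C" by (simp add: ennreal_le_iff2)
    then have "(I' powr (1/q)) powr q \<le> ker_C powr q" using q by (intro powr_mono2) auto
    then have "I' \<le> ker_C powr q" using q Ip by (simp add: powr_powr)
    then show ?thesis unfolding I_def[symmetric] I'(1) by (rule ennreal_leI)
  qed
qed

text \<open>Monotone convergence removes the truncation. Pointwise finiteness is a separate claim
  because \<open>enn2real\<close> turns infinity into 0; it holds since an infinite value at a point
  with z > 0 would make the truncated integrands unbounded there.\<close>

lemma strong_bound:
  shows "AE x in lebesgue. z x > 0 \<longrightarrow> Tp b (\<lambda>y. f y * w y) x < \<infinity>"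
    and "(\<integral>\<^sup>+x. ennreal ((enn2real (Tp b (\<lambda>y. f y * w y) x) * z x) powr q) \<partial>lebesgue) \<le> ennreal (ker_C powr q)"
proof -
  note [measurable] = f(1) locally_integrable_measurable[OF li]
  let ?T = "Tp b (\<lambda>y. f y * w y)"
  define G where "G k x = enn2real (min (?T x) (ennreal (real k))) * indicator (cball 0 (real k)) x" for k :: nat and x
  define S where "S k x = ennreal ((G k x * z x) powr q)" for k x
  have [measurable]: "cball (0::real^'n) (real k) \<in> sets lebesgue" for k by simp
  have [measurable]: "S k \<in> borel_measurable lebesgue" for k unfolding S_def G_def by measurable
  have Sb: "(\<integral>\<^sup>+x. S k x \<partial>lebesgue) \<le> ennreal (ker_C powr q)" for k
    unfolding S_def G_def by (rule strong_bound_truncated)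
  have G0: "G k x \<ge> 0" for k x by (simp add: G_def)
  have Gm: "G j x \<le> G k x" if "j \<le> k" for j k x
  proof -
    have "min (?T x) (ennreal (real j)) \<le> min (?T x) (ennreal (real k))"
      using that by (intro min.mono ennreal_leI) auto
    then show ?thesis unfolding G_def using that
      by (intro mult_mono enn2real_mono) (auto simp: min_less_iff_disj indicator_def)
  qed
  have inc: "incseq S"
    unfolding incseq_def le_fun_def S_def using q z0 G0 Gm
    by (auto intro!: ennreal_leI powr_mono2 mult_right_mono)
  have SS: "(\<integral>\<^sup>+x. (SUP k. S k x) \<partial>lebesgue) \<le> ennreal (ker_C powr q)"
    using Sb by (subst nn_integral_monotone_convergence_SUP[OF inc]) (auto intro: SUP_least)
  have "(\<integral>\<^sup>+x. (SUP k. S k x) \<partial>lebesgue) \<noteq> \<infinity>" using SS by (auto simp: top_unique)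
  then have AE: "AE x in lebesgue. (SUP k. S k x) \<noteq> \<infinity>" by (intro nn_integral_PInf_AE) auto
  show "AE x in lebesgue. z x > 0 \<longrightarrow> ?T x < \<infinity>"
    using AE
  proof eventually_elim
    fix x assume fin: "(SUP k. S k x) \<noteq> \<infinity>"
    show "z x > 0 \<longrightarrow> ?T x < \<infinity>"
    proof (rule impI, rule ccontr)
      assume zx: "z x > 0" and "\<not> ?T x < \<infinity>"
      then have T: "?T x = \<infinity>" by (simp add: less_top[symmetric])
      obtain r where r: "(SUP k. S k x) = ennreal r" "r \<ge> 0" using fin by (cases "SUP k. S k x") auto
      obtain k where k: "real k > max (norm x) ((r + 1) powr (1/q) / z x)" using reals_Archimedean2 by blast
      have "G k x = real k" using k T by (simp add: G_def indicator_def)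
      moreover have "(r + 1) powr (1/q) \<le> real k * z x" using k zx by (simp add: field_simps)
      then have "((r + 1) powr (1/q)) powr q \<le> (real k * z x) powr q" using q by (intro powr_mono2) auto
      then have "r + 1 \<le> (real k * z x) powr q" using q r by (simp add: powr_powr)
      ultimately have "ennreal (r + 1) \<le> S k x" by (simp add: S_def ennreal_leI)
      also have "\<dots> \<le> ennreal r" unfolding r(1)[symmetric] by (rule SUP_upper) simp
      finally show False using r(2) by (simp add: ennreal_le_iff)
    qed
  qed
  have "(\<integral>\<^sup>+x. ennreal ((enn2real (?T x) * z x) powr q) \<partial>lebesgue) \<le> (\<integral>\<^sup>+x. (SUP k. S k x) \<partial>lebesgue)"
  proof (intro nn_integral_mono)
    fix x
    show "ennreal ((enn2real (?T x) * z x) powr q) \<le> (SUP k. S k x)"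
    proof (cases "?T x < \<infinity>")
      case True
      then obtain t where t: "?T x = ennreal t" "t \<ge> 0" by (cases "?T x") auto
      obtain k where k: "real k > max (norm x) t" using reals_Archimedean2 by blast
      have "min (ennreal t) (ennreal (real k)) = ennreal t" using k t(2) by (simp add: min_def ennreal_leI)
      then have "G k x = t" using k t by (simp add: G_def indicator_def)
      then have "ennreal ((enn2real (?T x) * z x) powr q) = S k x" using t by (simp add: S_def)
      also have "\<dots> \<le> (SUP k. S k x)" by (rule SUP_upper) simp
      finally show ?thesis .
    next
      case False
      then have "?T x = \<infinity>" by (simp add: less_top[symmetric])
      then show ?thesis by simp
    qed
  qed
  with SS show "(\<integral>\<^sup>+x. ennreal ((enn2real (?T x) * z x) powr q) \<partial>lebesgue) \<le> ennreal (ker_C powr q)" by (rule order_trans[rotated])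
qed

end

end

section \<open>Luxemburg norms\<close>

abbreviation bump_int :: "real \<Rightarrow> real \<Rightarrow> (real^'n \<Rightarrow> real) \<Rightarrow> (real^'n) set \<Rightarrow> real \<Rightarrow> ennreal" where
  "bump_int r a f Q lam \<equiv> (\<integral>\<^sup>+x\<in>Q. ennreal ((f x / lam) powr r * ln (exp 1 + f x / lam) powr a) \<partial>lebesgue)"

context
  fixes f :: "real^'n \<Rightarrow> real" and r a :: real
  assumes fm [measurable]: "f \<in> borel_measurable lebesgue" and f0: "\<And>x. f x \<ge> 0" and r: "r > 0" and a: "a \<ge> 0"
begin

lemma lux_norm_alt:
  "lux_norm r a f Q = Inf {ennreal lam | lam. lam > 0 \<and> bump_int r a f Q lam \<le> ennreal (measure lebesgue Q)}"
  unfolding lux_norm_def using f0 by (simp add: abs_of_nonneg)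

lemma lux_norm_less:
  assumes "lux_norm r a f Q < ennreal t"
  shows "\<exists>lam>0. lam < t \<and> bump_int r a f Q lam \<le> ennreal (measure lebesgue Q)"
proof -
  obtain y where "y \<in> {ennreal lam | lam. lam > 0 \<and> bump_int r a f Q lam \<le> ennreal (measure lebesgue Q)}" "y < ennreal t"
    using assms unfolding lux_norm_alt Inf_less_iff by blast
  then obtain lam where "lam > 0" "bump_int r a f Q lam \<le> ennreal (measure lebesgue Q)" "ennreal lam < ennreal t" by auto
  then show ?thesis by (auto simp: ennreal_less_iff)
qed

lemma lux_norm_upper:
  "lam > 0 \<Longrightarrow> bump_int r a f Q lam \<le> ennreal (measure lebesgue Q) \<Longrightarrow> lux_norm r a f Q \<le> ennreal lam"
  unfolding lux_norm_alt by (rule Inf_lower) auto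

text \<open>Arbitrarily small parameters are admissible, and each bounds the integral of f^r over
  the cube by lam^r * |Q|, because the logarithmic factor is at least 1.\<close>

lemma lux_norm_zero:
  assumes [measurable]: "Q \<in> sets lebesgue" and z: "lux_norm r a f Q = 0"
  shows "AE x in lebesgue. x \<in> Q \<longrightarrow> f x = 0"
proof -
  define M where "M = measure lebesgue Q"
  have M: "M \<ge> 0" by (simp add: M_def)
  define X where "X = (\<integral>\<^sup>+x\<in>Q. ennreal (f x powr r) \<partial>lebesgue)"
  have bd: "X \<le> ennreal (e powr r * M)" if e: "e > 0" for e
  proof -
    obtain lam where lam: "lam > 0" "lam < e" "bump_int r a f Q lam \<le> ennreal M"
      using lux_norm_less[of Q e] z e unfolding M_def by auto
    have "X \<le> ennreal (lam powr r * M)"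
      unfolding X_def by (rule bump_integral_power[OF fm f0 lam(1) a r _ M lam(3)]) simp
    also have "\<dots> \<le> ennreal (e powr r * M)"
      using lam r M by (intro ennreal_leI mult_right_mono powr_mono2) auto
    finally show ?thesis .
  qed
  have "X = 0"
  proof (rule ccontr)
    assume X0: "X \<noteq> 0"
    have "X < \<infinity>" by (rule le_less_trans[OF bd[of 1]]) auto
    then obtain x where x: "X = ennreal x" "x \<ge> 0" by (cases X) auto
    then have x0: "x > 0" using X0 by (cases "x = 0") auto
    define e where "e = (x / (2 * (M + 1))) powr (1/r)"
    have e: "e > 0" using x0 M by (simp add: e_def)
    have "e powr r * M = x / (2 * (M + 1)) * M" using r x0 M by (simp add: e_def powr_powr)
    also have "\<dots> = x * (M / (2 * (M + 1)))" by simp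
    also have "\<dots> < x * 1" using x0 M by (intro mult_strict_left_mono) (auto simp: divide_less_eq)
    finally have "e powr r * M < x" by simp
    moreover have "x \<le> e powr r * M" using bd[OF e] x M by (simp add: ennreal_le_iff)
    ultimately show False by simp
  qed
  then have "AE x in lebesgue. ennreal (f x powr r) * indicator Q x = 0"
    unfolding X_def by (subst (asm) nn_integral_0_iff_AE) auto
  then show ?thesis by eventually_elim (use f0 in \<open>auto simp: indicator_def ennreal_eq_0_iff\<close>)
qed

text \<open>Enlarging the parameter by a factor \<open>R\<close> lowers the power by R^(-r) and does
  not raise the logarithm. \<open>R\<close> is chosen so that this exactly compensates the ratio of
  the two volumes.\<close>

lemma lux_finite_subset:
  assumes Q: "Q \<subseteq> Q'" "measure lebesgue Q > 0" "measure lebesgue Q \<le> measure lebesgue Q'"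
    and fin: "lux_norm r a f Q' < \<infinity>"
  shows "lux_norm r a f Q < \<infinity>"
proof -
  obtain t where "lux_norm r a f Q' = ennreal t" "t \<ge> 0" using fin by (cases "lux_norm r a f Q'") auto
  then have "lux_norm r a f Q' < ennreal (t + 1)" by (simp add: ennreal_less_iff)
  then obtain lam where lam: "lam > 0" "bump_int r a f Q' lam \<le> ennreal (measure lebesgue Q')"
    using lux_norm_less by blast
  define R where "R = (measure lebesgue Q' / measure lebesgue Q) powr (1/r)"
  have R1: "R \<ge> 1" unfolding R_def using Q r by (intro ge_one_powr_ge_zero) auto
  have Rr: "R powr (- r) * measure lebesgue Q' = measure lebesgue Q"
    using Q r by (simp add: R_def powr_powr powr_minus)
  have "bump_int r a f Q (R * lam) \<le> (\<integral>\<^sup>+x. ennreal (R powr (- r)) * (ennreal ((f x / lam) powr r * ln (exp 1 + f x / lam) powr a) * indicator Q' x) \<partial>lebesgue)"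
  proof (intro nn_integral_mono)
    fix x
    have le: "f x / (R * lam) \<le> f x / lam" using R1 lam f0[of x] by (intro divide_left_mono) auto
    have ge: "f x / (R * lam) \<ge> 0" using R1 lam f0[of x] by simp
    have l1: "0 \<le> ln (exp 1 + f x / (R * lam))"
      using ge by (intro ln_ge_zero) (smt (verit) one_le_exp_iff)
    have "ln (exp 1 + f x / (R * lam)) \<le> ln (exp 1 + f x / lam)"
      using le ge by (subst ln_le_cancel_iff) (auto simp: add_pos_nonneg f0 lam less_imp_le)
    then have "ln (exp 1 + f x / (R * lam)) powr a \<le> ln (exp 1 + f x / lam) powr a"
      using a l1 by (intro powr_mono2) auto
    moreover have "(f x / (R * lam)) powr r = R powr (- r) * (f x / lam) powr r"
      using R1 lam f0[of x] by (simp add: powr_divide powr_mult powr_minus field_simps)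
    ultimately have "(f x / (R * lam)) powr r * ln (exp 1 + f x / (R * lam)) powr a \<le>
       R powr (- r) * ((f x / lam) powr r * ln (exp 1 + f x / lam) powr a)"
      by (simp add: mult.assoc mult_left_mono)
    then have "ennreal ((f x / (R * lam)) powr r * ln (exp 1 + f x / (R * lam)) powr a) \<le>
       ennreal (R powr (- r)) * ennreal ((f x / lam) powr r * ln (exp 1 + f x / lam) powr a)"
      by (simp add: ennreal_mult'[symmetric] ennreal_leI)
    then show "ennreal ((f x / (R * lam)) powr r * ln (exp 1 + f x / (R * lam)) powr a) * indicator Q x \<le>
      ennreal (R powr (- r)) * (ennreal ((f x / lam) powr r * ln (exp 1 + f x / lam) powr a) * indicator Q' x)"
      using Q(1) by (auto simp: indicator_def)
  qed
  also have "\<dots> \<le> ennreal (R powr (- r)) * ennreal (measure lebesgue Q')"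
  proof (cases "Q' \<in> sets lebesgue")
    case True
    then show ?thesis using lam(2) by (subst nn_integral_cmult) (auto intro!: mult_left_mono)
  next
    case False
    then have "measure lebesgue Q' = 0" by (simp add: measure_notin_sets)
    then show ?thesis using Q by simp
  qed
  also have "\<dots> = ennreal (measure lebesgue Q)" by (simp add: ennreal_mult'[symmetric] Rr)
  finally have "lux_norm r a f Q \<le> ennreal (R * lam)" using R1 lam by (intro lux_norm_upper) auto
  then show ?thesis by (rule le_less_trans) simp
qed

end

section \<open>The hypotheses on the pair of weights\<close>

locale two_weight =
  fixes \<alpha> p q s \<delta> :: real and m :: nat and u v :: "real^'n \<Rightarrow> real"
  assumes \<alpha>: "0 < \<alpha>" "\<alpha> < real CARD('n)" and p: "1 < p" "p \<le> s" "s \<le> q" and m: "m \<ge> 1" and \<delta>: "\<delta> > 0"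
    and u: "weight u" and upos: "emeasure lebesgue {x. u x > 0} > 0"
    and v: "weight v" and vpos: "AE x in lebesgue. v x > 0"
    and bumps: "(SUP Q\<in>{Q. cube Q}.
            ennreal (measure lebesgue Q powr (\<alpha> / real CARD('n) + 1/q - 1/p))
          * lux_norm q ((real m + 1 / conj_exp s) * q + \<delta>) (\<lambda>x. u x powr (1/q)) Q
          * lux_norm (conj_exp p) ((real m + 1 / s) * conj_exp p + \<delta>) (\<lambda>x. v x powr (-1/p)) Q)
         < \<infinity>"
begin

lemma u_meas [measurable]: "u \<in> borel_measurable lebesgue" and u0: "u x \<ge> 0"
  and v_meas [measurable]: "v \<in> borel_measurable lebesgue" and v0: "v x \<ge> 0"
  using u v locally_integrable_measurable by (auto simp: weight_def)

lemma qs: "1 < q" "1 < s" "p \<le> q" using p by auto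

lemma u_pos_set: "{x. u x > 0} \<in> sets lebesgue"
proof -
  have "{x \<in> space lebesgue. u x > 0} \<in> sets lebesgue" by measurable
  then show ?thesis by simp
qed

lemma u_pos_ball:
  obtains n :: nat where "emeasure lebesgue ({x. u x > 0} \<inter> cball 0 (real n)) > 0"
proof (rule ccontr)
  assume "\<not> thesis"
  then have z: "emeasure lebesgue ({x. u x > 0} \<inter> cball 0 (real n)) = 0" for n :: nat
    using that by (auto simp: zero_less_iff_neq_zero)
  have "(\<Union>n::nat. {x. u x > 0} \<inter> cball 0 (real n)) \<in> null_sets lebesgue"
    using z u_pos_set by (intro null_sets_UN null_setsI) auto
  moreover have "(\<Union>n::nat. {x. u x > 0} \<inter> cball 0 (real n)) = {x. u x > 0}"
    using real_arch_simple by auto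
  ultimately show False using upos by auto
qed

text \<open>A finite product does not make both norms finite, since 0 * \<infinity> = 0 in
  \<open>ennreal\<close>. Each cube is therefore enlarged until it meets {u > 0} in positive
  measure; there both norms are nonzero, hence both finite, and \<open>lux_finite_subset\<close>
  returns to the original cube.\<close>

lemma bump_dataE: obtains K where "bump_data \<alpha> p q s \<delta> K m (\<lambda>x. v x powr (-1/p)) (\<lambda>x. u x powr (1/q))"
proof -
  let ?a2 = "(real m + 1 / conj_exp s) * q + \<delta>" and ?a1 = "(real m + 1 / s) * conj_exp p + \<delta>"
  define z where "z x = u x powr (1/q)" for x
  define w where "w x = v x powr (-1/p)" for x
  have zm [measurable]: "z \<in> borel_measurable lebesgue" and wm [measurable]: "w \<in> borel_measurable lebesgue"
    unfolding z_def w_def by measurable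
  have z0: "z x \<ge> 0" and w0: "w x \<ge> 0" for x by (auto simp: z_def w_def)
  note cp = conj_exp_props[OF p(1)] and cs = conj_exp_props[OF qs(2)]
  have a1: "?a1 \<ge> 0" and a2: "?a2 \<ge> 0" using cp cs qs \<delta> by (auto intro!: add_nonneg_nonneg mult_nonneg_nonneg)
  have q0: "q > 0" "conj_exp p > 0" using qs cp by auto
  define X where "X Q = measure lebesgue Q powr (\<alpha> / real CARD('n) + 1/q - 1/p)" for Q :: "(real^'n) set"
  define A where "A Q = lux_norm q ?a2 z Q" for Q
  define B where "B Q = lux_norm (conj_exp p) ?a1 w Q" for Q
  define S where "S = (SUP Q\<in>{Q. cube Q}. ennreal (X Q) * A Q * B Q)"
  have "S < \<infinity>" using bumps unfolding S_def X_def A_def B_def z_def w_def by simp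
  then obtain k where k: "S = ennreal k" "k \<ge> 0" by (cases S) auto
  have le: "ennreal (X Q) * A Q * B Q \<le> ennreal k" if "cube Q" for Q
    unfolding k(1)[symmetric] S_def by (rule SUP_upper) (use that in simp)
  have finite: "A Q < \<infinity> \<and> B Q < \<infinity>" if Q: "cube Q" for Q
  proof -
    obtain n0 :: nat where n0: "emeasure lebesgue ({x. u x > 0} \<inter> cball 0 (real n0)) > 0" by (rule u_pos_ball)
    have "bounded (Q \<union> cball 0 (real n0))" using cube_measure_pos(4)[OF Q] by simp
    then obtain R where R: "cube (cbox (- R *\<^sub>R One) (R *\<^sub>R One) :: (real^'n) set)" "Q \<union> cball 0 (real n0) \<subseteq> cbox (- R *\<^sub>R One) (R *\<^sub>R One)"
      using bounded_subset_cube by metis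
    define Q' where "Q' = (cbox (- R *\<^sub>R One) (R *\<^sub>R One) :: (real^'n) set)"
    have Q': "cube Q'" "Q \<subseteq> Q'" "cball 0 (real n0) \<subseteq> Q'" using R by (auto simp: Q'_def)
    note mp = cube_measure_pos[OF Q] and mp' = cube_measure_pos[OF Q'(1)]
    have A0: "A Q' \<noteq> 0"
    proof
      assume "A Q' = 0"
      then have "AE x in lebesgue. x \<in> Q' \<longrightarrow> z x = 0"
        unfolding A_def by (intro lux_norm_zero[OF _ z0 q0(1) a2 mp'(3)]) auto
      then have "AE x in lebesgue. x \<notin> {x. u x > 0} \<inter> cball 0 (real n0)"
        by eventually_elim (use Q'(3) in \<open>auto simp: z_def\<close>)
      then have "{x. u x > 0} \<inter> cball 0 (real n0) \<in> null_sets lebesgue"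
        using u_pos_set by (subst AE_iff_null_sets) auto
      then show False using n0 by auto
    qed
    have B0: "B Q' \<noteq> 0"
    proof
      assume "B Q' = 0"
      then have "AE x in lebesgue. x \<in> Q' \<longrightarrow> w x = 0"
        unfolding B_def by (intro lux_norm_zero[OF _ w0 q0(2) a1 mp'(3)]) auto
      with vpos have "AE x in lebesgue. x \<notin> Q'"
        by eventually_elim (auto simp: w_def)
      then have "Q' \<in> null_sets lebesgue" using mp'(3) by (subst AE_iff_null_sets) auto
      then show False using mp'(1,2) by auto
    qed
    have X0: "ennreal (X Q') \<noteq> 0" using mp'(1) by (simp add: X_def)
    have "ennreal (X Q') * A Q' * B Q' < \<infinity>" by (rule le_less_trans[OF le[OF Q'(1)]]) simp
    then have "A Q' < \<infinity>" "B Q' < \<infinity>"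
      using A0 B0 X0 by (auto simp: ennreal_mult_less_top)
    moreover have "measure lebesgue Q \<le> measure lebesgue Q'"
    proof -
      have "emeasure lebesgue Q \<le> emeasure lebesgue Q'" using Q'(2) mp'(3) by (rule emeasure_mono)
      then show ?thesis unfolding mp(2) mp'(2) by (simp add: ennreal_le_iff)
    qed
    ultimately show ?thesis unfolding A_def B_def
      using lux_finite_subset[OF _ z0 q0(1) a2 Q'(2) mp(1)] lux_finite_subset[OF _ w0 q0(2) a1 Q'(2) mp(1)] by simp
  qed
  have "bump_data \<alpha> p q s \<delta> (k + 1) m w z"
  proof unfold_locales
    fix Q :: "(real^'n) set" assume Q: "cube Q"
    obtain x y where xy: "A Q = ennreal x" "x \<ge> 0" "B Q = ennreal y" "y \<ge> 0"
      using finite[OF Q] by (cases "A Q"; cases "B Q") auto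
    have Xp: "X Q > 0" using cube_measure_pos(1)[OF Q] by (simp add: X_def)
    have kk: "X Q * x * y \<le> k"
      using le[OF Q] xy Xp k by (simp add: ennreal_mult'[symmetric] ennreal_le_iff)
    \<comment> \<open>A norm may be 0 while a parameter has to be positive, so both norms are
      enlarged by \<open>e\<close>, small enough for the product to grow by at most 1. The summand 1
      avoids division by zero.\<close>
    define e where "e = min 1 (1 / (X Q * (x + y + 1)))"
    have pos: "X Q * (x + y + 1) > 0" using Xp xy by simp
    have e: "e > 0" "e \<le> 1" "e * (X Q * (x + y + 1)) \<le> 1"
    proof -
      show "e > 0" "e \<le> 1" using pos by (auto simp: e_def)
      have "e * (X Q * (x + y + 1)) \<le> 1 / (X Q * (x + y + 1)) * (X Q * (x + y + 1))"
        using pos by (intro mult_right_mono) (auto simp: e_def)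
      also have "\<dots> = 1" unfolding times_divide_eq_left mult_1 using pos by (intro divide_self) linarith
      finally show "e * (X Q * (x + y + 1)) \<le> 1" .
    qed
    have "lux_norm q ?a2 z Q < ennreal (x + e)" using xy e unfolding A_def[symmetric] by (simp add: ennreal_less_iff)
    then obtain mu where mu: "mu > 0" "mu < x + e" "bump_int q ?a2 z Q mu \<le> ennreal (measure lebesgue Q)"
      using lux_norm_less[OF zm z0 q0(1) a2] by blast
    have "lux_norm (conj_exp p) ?a1 w Q < ennreal (y + e)" using xy e unfolding B_def[symmetric] by (simp add: ennreal_less_iff)
    then obtain lam where lam: "lam > 0" "lam < y + e" "bump_int (conj_exp p) ?a1 w Q lam \<le> ennreal (measure lebesgue Q)"
      using lux_norm_less[OF wm w0 q0(2) a1] by blast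
    have "X Q * lam * mu \<le> X Q * (y + e) * (x + e)"
      using mu lam Xp xy by (intro mult_mono) auto
    also have "\<dots> = X Q * x * y + e * (X Q * (x + y + e))" by (simp add: algebra_simps)
    also have "\<dots> \<le> k + e * (X Q * (x + y + 1))"
      using kk e Xp by (intro add_mono mult_left_mono) auto
    finally have "X Q * lam * mu \<le> k + 1" using e(3) by linarith
    then show "\<exists>lam>0. \<exists>mu>0. measure lebesgue Q powr (\<alpha> / real CARD('n) + 1 / q - 1 / p) * lam * mu \<le> k + 1 \<and>
        bump_int (conj_exp p) ?a1 w Q lam \<le> ennreal (measure lebesgue Q) \<and> bump_int q ?a2 z Q mu \<le> ennreal (measure lebesgue Q)"
      using mu lam unfolding X_def by blast
  qed (use \<alpha> p m \<delta> k z0 w0 in auto)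
  then show ?thesis using that unfolding w_def z_def by blast
qed

end

section \<open>Bounded kernels and compactness by finite rank approximation\<close>

lemma powr_add_le:
  fixes x y :: real assumes "x \<ge> 0" "y \<ge> 0" "r > 0"
  shows "(x + y) powr r \<le> 2 powr r * (x powr r + y powr r)"
proof -
  have "(x + y) powr r \<le> (2 * max x y) powr r" using assms by (intro powr_mono2) auto
  also have "\<dots> = 2 powr r * max x y powr r" using assms by (simp add: powr_mult)
  also have "max x y powr r \<le> x powr r + y powr r" by (simp add: max_def)
  finally show ?thesis by (simp add: mult_left_mono)
qed

text \<open>Completeness of the weighted space: a Cauchy sequence has a subsequence with geometrically
  decaying differences, which converges almost everywhere, and Fatou's lemma identifies the limit.\<close>

lemma weighted_Lq_complete:
  fixes G :: "nat \<Rightarrow> 'a \<Rightarrow> real" and u :: "'a \<Rightarrow> real"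
  assumes Gm [measurable]: "\<And>j. G j \<in> borel_measurable M" and um [measurable]: "u \<in> borel_measurable M"
    and u0: "\<And>x. u x \<ge> 0" and q: "q > 1"
    and cauchy: "\<And>e. e > 0 \<Longrightarrow> \<exists>J. \<forall>j\<ge>J. \<forall>k\<ge>J. (\<integral>\<^sup>+x. ennreal (\<bar>G j x - G k x\<bar> powr q * u x) \<partial>M) \<le> ennreal e"
  shows "\<exists>g\<in>borel_measurable M. \<forall>e>0. \<exists>J. \<forall>j\<ge>J. (\<integral>\<^sup>+x. ennreal (\<bar>G j x - g x\<bar> powr q * u x) \<partial>M) \<le> ennreal e"
proof -
  define D where "D j k = (\<integral>\<^sup>+x. ennreal (\<bar>G j x - G k x\<bar> powr q * u x) \<partial>M)" for j k
  \<comment> \<open>Two decays are built in: 2^(-q i) cancels the weight 2^(q i) in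
    \<open>S\<close>, and (1/4)^i makes \<open>S\<close> integrable. Where \<open>S\<close> is
    finite and u > 0, the i-th difference is at most a multiple of 2^(-i).\<close>
  have "\<exists>J. \<forall>j\<ge>J. \<forall>k\<ge>J. D j k \<le> ennreal ((1/4) ^ i * 2 powr (- q * real i))" for i :: nat
    unfolding D_def by (rule cauchy) simp
  then obtain J where J: "\<And>i j k. j \<ge> J i \<Longrightarrow> k \<ge> J i \<Longrightarrow> D j k \<le> ennreal ((1/4) ^ i * 2 powr (- q * real i))"
    by metis
  define \<rho> where "\<rho> i = (\<Sum>l\<le>i. J l + 1)" for i
  have \<rho>J: "\<rho> i \<ge> J i" for i
  proof -
    have "J i + 1 \<le> \<rho> i" unfolding \<rho>_def by (rule member_le_sum) auto
    then show ?thesis by simp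
  qed
  have \<rho>m: "\<rho> i < \<rho> (Suc i)" for i by (simp add: \<rho>_def)
  have sm: "strict_mono \<rho>" using \<rho>m by (simp add: strict_mono_Suc_iff)
  define S where "S x = (\<Sum>i. ennreal (2 powr (q * real i)) * ennreal (\<bar>G (\<rho> i) x - G (\<rho> (Suc i)) x\<bar> powr q * u x))" for x
  have "(\<integral>\<^sup>+x. S x \<partial>M) = (\<Sum>i. ennreal (2 powr (q * real i)) * D (\<rho> i) (\<rho> (Suc i)))"
    unfolding S_def D_def by (subst nn_integral_suminf) (auto simp: nn_integral_cmult)
  also have "\<dots> \<le> (\<Sum>i. ennreal ((1/4) ^ i))"
  proof (intro suminf_le)
    fix i
    have "ennreal (2 powr (q * real i)) * D (\<rho> i) (\<rho> (Suc i)) \<le> ennreal (2 powr (q * real i)) * ennreal ((1/4) ^ i * 2 powr (- q * real i))"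
      using \<rho>J[of i] \<rho>m[of i] by (intro mult_left_mono J) auto
    also have "\<dots> = ennreal ((1/4) ^ i)"
      by (simp add: ennreal_mult'[symmetric] powr_minus field_simps)
    finally show "ennreal (2 powr (q * real i)) * D (\<rho> i) (\<rho> (Suc i)) \<le> ennreal ((1/4) ^ i)" .
  qed auto
  also have "\<dots> = ennreal (\<Sum>i. (1/4) ^ i)" by (intro suminf_ennreal2 summable_geometric) auto
  finally have "(\<integral>\<^sup>+x. S x \<partial>M) \<noteq> \<infinity>" by (auto simp: top_unique)
  moreover have "S \<in> borel_measurable M" unfolding S_def by measurable
  ultimately have "AE x in M. S x \<noteq> \<infinity>" by (intro nn_integral_PInf_AE) auto
  \<comment> \<open>Where u = 0 the weighted integrand vanishes, so convergence on {u > 0} is all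
    that is required.\<close>
  then have conv: "AE x in M. u x > 0 \<longrightarrow> convergent (\<lambda>i. G (\<rho> i) x)"
  proof eventually_elim
    fix x assume fin: "S x \<noteq> \<infinity>"
    show "u x > 0 \<longrightarrow> convergent (\<lambda>i. G (\<rho> i) x)"
    proof
      assume ux: "u x > 0"
      obtain t where t: "S x = ennreal t" "t \<ge> 0" using fin by (cases "S x") auto
      have bd: "\<bar>G (\<rho> i) x - G (\<rho> (Suc i)) x\<bar> \<le> (t / u x) powr (1/q) * (1/2) ^ i" for i
      proof -
        let ?d = "\<bar>G (\<rho> i) x - G (\<rho> (Suc i)) x\<bar>"
        have "(\<Sum>i\<in>{i}. ennreal (2 powr (q * real i)) * ennreal (\<bar>G (\<rho> i) x - G (\<rho> (Suc i)) x\<bar> powr q * u x)) \<le> S x"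
          unfolding S_def by (rule sum_le_suminf) auto
        then have "2 powr (q * real i) * (?d powr q * u x) \<le> t"
          unfolding t(1) using t(2) u0 by (simp add: ennreal_mult'[symmetric] ennreal_le_iff)
        then have "(2 ^ i * ?d) powr q \<le> t / u x"
          using ux by (simp add: powr_mult powr_realpow[symmetric] powr_powr field_simps)
        then have "((2 ^ i * ?d) powr q) powr (1/q) \<le> (t / u x) powr (1/q)" using q by (intro powr_mono2) auto
        then have "2 ^ i * ?d \<le> (t / u x) powr (1/q)" using q by (simp add: powr_powr)
        then show ?thesis by (simp add: power_divide field_simps)
      qed
      have "summable (\<lambda>i. G (\<rho> (Suc i)) x - G (\<rho> i) x)"
      proof (rule summable_comparison_test')
        show "summable (\<lambda>i. (t / u x) powr (1/q) * (1/2) ^ i)" by (intro summable_mult summable_geometric) auto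
        show "norm (G (\<rho> (Suc i)) x - G (\<rho> i) x) \<le> (t / u x) powr (1/q) * (1/2) ^ i" for i
          using bd[of i] by (simp add: abs_minus_commute)
      qed
      then have "convergent (\<lambda>n. G (\<rho> n) x - G (\<rho> 0) x)"
        by (simp only: summable_iff_convergent sum_lessThan_telescope[of "\<lambda>i. G (\<rho> i) x"])
      then show "convergent (\<lambda>i. G (\<rho> i) x)" by (simp add: convergent_diff_const_right_iff)
    qed
  qed
  define g where "g x = lim (\<lambda>i. G (\<rho> i) x)" for x
  have gm [measurable]: "g \<in> borel_measurable M" unfolding g_def by measurable
  show ?thesis
  proof (intro bexI[of _ g] allI impI)
    fix e :: real assume e: "e > 0"
    then obtain N where N: "\<And>j k. j \<ge> N \<Longrightarrow> k \<ge> N \<Longrightarrow> D j k \<le> ennreal e"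
      unfolding D_def using cauchy by meson
    have "(\<integral>\<^sup>+x. ennreal (\<bar>G j x - g x\<bar> powr q * u x) \<partial>M) \<le> ennreal e" if j: "j \<ge> N" for j
    proof -
      have "(\<integral>\<^sup>+x. ennreal (\<bar>G j x - g x\<bar> powr q * u x) \<partial>M) \<le> (\<integral>\<^sup>+x. liminf (\<lambda>i. ennreal (\<bar>G j x - G (\<rho> i) x\<bar> powr q * u x)) \<partial>M)"
        using conv
      proof (intro nn_integral_mono_AE, eventually_elim)
        fix x assume c: "u x > 0 \<longrightarrow> convergent (\<lambda>i. G (\<rho> i) x)"
        show "ennreal (\<bar>G j x - g x\<bar> powr q * u x) \<le> liminf (\<lambda>i. ennreal (\<bar>G j x - G (\<rho> i) x\<bar> powr q * u x))"
        proof (cases "u x > 0")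
          case True
          then have "(\<lambda>i. G (\<rho> i) x) \<longlonglongrightarrow> g x" using c by (simp add: g_def convergent_LIMSEQ_iff)
          then have "(\<lambda>i. ennreal (\<bar>G j x - G (\<rho> i) x\<bar> powr q * u x)) \<longlonglongrightarrow> ennreal (\<bar>G j x - g x\<bar> powr q * u x)"
            using q by (intro tendsto_ennrealI tendsto_intros tendsto_powr') auto
          then show ?thesis by (simp add: lim_imp_Liminf)
        next
          case False
          then have "u x = 0" using u0[of x] by simp
          then show ?thesis by simp
        qed
      qed
      also have "\<dots> \<le> liminf (\<lambda>i. D j (\<rho> i))" unfolding D_def by (rule nn_integral_liminf) measurable
      also have "\<dots> \<le> ennreal e"
      proof (rule Liminf_le)
        show "eventually (\<lambda>i. D j (\<rho> i) \<le> ennreal e) sequentially"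
          using j N seq_suble[OF sm] by (intro eventually_sequentiallyI[of N]) (meson order_trans)
      qed simp
      finally show ?thesis .
    qed
    then show "\<exists>J. \<forall>j\<ge>J. (\<integral>\<^sup>+x. ennreal (\<bar>G j x - g x\<bar> powr q * u x) \<partial>M) \<le> ennreal e" by blast
  qed simp
qed

section \<open>Integral operators and bounds for them\<close>

definition joint_meas :: "(real^'n \<Rightarrow> real^'n \<Rightarrow> real) \<Rightarrow> bool" where
  "joint_meas k \<longleftrightarrow> (\<lambda>xy. k (fst xy) (snd xy)) \<in> borel_measurable (lebesgue \<Otimes>\<^sub>M lebesgue)"

lemma joint_meas_section: assumes "joint_meas k" shows "k x \<in> borel_measurable lebesgue"
proof -
  have "(\<lambda>y. (\<lambda>xy. k (fst xy) (snd xy)) (x, y)) \<in> borel_measurable lebesgue"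
    using assms unfolding joint_meas_def by (intro measurable_compose[OF measurable_Pair1']) auto
  then show ?thesis by simp
qed

definition pos_op :: "(real^'n \<Rightarrow> real^'n \<Rightarrow> real) \<Rightarrow> (real^'n \<Rightarrow> real) \<Rightarrow> real^'n \<Rightarrow> ennreal" where
  "pos_op k F x = (\<integral>\<^sup>+y. ennreal (\<bar>k x y\<bar> * \<bar>F y\<bar>) \<partial>lebesgue)"

lemma pos_op_measurable:
  assumes "joint_meas k" and [measurable]: "F \<in> borel_measurable lebesgue"
  shows "pos_op k F \<in> borel_measurable lebesgue"
proof -
  have [measurable]: "(\<lambda>xy. k (fst xy) (snd xy)) \<in> borel_measurable (lebesgue \<Otimes>\<^sub>M lebesgue)"
    using assms(1) by (simp add: joint_meas_def)
  have "(\<lambda>xy. ennreal (\<bar>k (fst xy) (snd xy)\<bar> * \<bar>F (snd xy)\<bar>)) \<in> borel_measurable (lebesgue \<Otimes>\<^sub>M lebesgue)"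
    by measurable
  then show ?thesis unfolding pos_op_def by (intro lebesgue.borel_measurable_nn_integral) (simp add: case_prod_beta')
qed

definition int_op :: "(real^'n \<Rightarrow> real^'n \<Rightarrow> real) \<Rightarrow> (real^'n \<Rightarrow> real) \<Rightarrow> real^'n \<Rightarrow> real" where
  "int_op k F x = (LINT y|lebesgue. k x y * F y)"

lemma int_op_measurable:
  assumes "joint_meas k" and [measurable]: "F \<in> borel_measurable lebesgue"
  shows "int_op k F \<in> borel_measurable lebesgue"
proof -
  have [measurable]: "(\<lambda>xy. k (fst xy) (snd xy)) \<in> borel_measurable (lebesgue \<Otimes>\<^sub>M lebesgue)"
    using assms(1) by (simp add: joint_meas_def)
  have "(\<lambda>xy. k (fst xy) (snd xy) * F (snd xy)) \<in> borel_measurable (lebesgue \<Otimes>\<^sub>M lebesgue)"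
    by measurable
  then show ?thesis unfolding int_op_def by (intro lebesgue.borel_measurable_lebesgue_integral) (simp add: case_prod_beta')
qed

text \<open>The constant in \<open>opb\<close> is the \<open>q\<close>-th power of a bound for the operator norm of the
  operator with kernel \<open>\<bar>k\<bar>\<close>. Finiteness is asserted separately because \<open>enn2real\<close> sends
  infinity to zero.\<close>

definition opb :: "real \<Rightarrow> (real^'n \<Rightarrow> real) \<Rightarrow> real \<Rightarrow> (real^'n \<Rightarrow> real) \<Rightarrow> (real^'n \<Rightarrow> real^'n \<Rightarrow> real) \<Rightarrow> real \<Rightarrow> bool" where
  "opb p v q u k C \<longleftrightarrow> C \<ge> 0 \<and> (\<forall>F A. F \<in> borel_measurable lebesgue \<longrightarrow> A > 0 \<longrightarrow>
     (\<integral>\<^sup>+y. ennreal (\<bar>F y\<bar> powr p * v y) \<partial>lebesgue) \<le> ennreal A \<longrightarrow>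
     (AE x in lebesgue. u x > 0 \<longrightarrow> pos_op k F x < \<infinity>) \<and>
     (\<integral>\<^sup>+x. ennreal (enn2real (pos_op k F x) powr q * u x) \<partial>lebesgue) \<le> ennreal (C * A powr (q/p)))"

lemma opbD:
  assumes "opb p v q u k C" "F \<in> borel_measurable lebesgue" "A > 0" "(\<integral>\<^sup>+y. ennreal (\<bar>F y\<bar> powr p * v y) \<partial>lebesgue) \<le> ennreal A"
  shows "AE x in lebesgue. u x > 0 \<longrightarrow> pos_op k F x < \<infinity>"
    "(\<integral>\<^sup>+x. ennreal (enn2real (pos_op k F x) powr q * u x) \<partial>lebesgue) \<le> ennreal (C * A powr (q/p))"
    "C \<ge> 0"
  using assms unfolding opb_def by blast+

lemma opb_mono:
  assumes k: "opb p v q u k C" and le: "\<And>x y. \<bar>k' x y\<bar> \<le> \<bar>k x y\<bar>" and C: "C \<le> C'" and q: "q > 0" and u0: "\<And>x. u x \<ge> 0"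
  shows "opb p v q u k' C'"
  unfolding opb_def
proof (intro conjI allI impI)
  show "C' \<ge> 0" using k C by (simp add: opb_def)
  fix F :: "real^'a \<Rightarrow> real" and A :: real
  assume F: "F \<in> borel_measurable lebesgue" "A > 0" "(\<integral>\<^sup>+y. ennreal (\<bar>F y\<bar> powr p * v y) \<partial>lebesgue) \<le> ennreal A"
  note D = opbD[OF k F]
  have po: "pos_op k' F x \<le> pos_op k F x" for x
    unfolding pos_op_def using le by (intro nn_integral_mono ennreal_leI mult_right_mono) auto
  show "AE x in lebesgue. u x > 0 \<longrightarrow> pos_op k' F x < \<infinity>"
    using D(1) by eventually_elim (use po le_less_trans in blast)
  have "(\<integral>\<^sup>+x. ennreal (enn2real (pos_op k' F x) powr q * u x) \<partial>lebesgue) \<le> (\<integral>\<^sup>+x. ennreal (enn2real (pos_op k F x) powr q * u x) \<partial>lebesgue)"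
    using D(1)
  proof (intro nn_integral_mono_AE, eventually_elim)
    fix x assume fin: "u x > 0 \<longrightarrow> pos_op k F x < \<infinity>"
    show "ennreal (enn2real (pos_op k' F x) powr q * u x) \<le> ennreal (enn2real (pos_op k F x) powr q * u x)"
    proof (cases "u x > 0")
      case True
      then have "enn2real (pos_op k' F x) \<le> enn2real (pos_op k F x)" using po fin by (intro enn2real_mono) auto
      then show ?thesis using q u0[of x] by (intro ennreal_leI mult_right_mono powr_mono2) auto
    next
      case False
      then show ?thesis using u0[of x] by simp
    qed
  qed
  also have "\<dots> \<le> ennreal (C * A powr (q/p))" by (rule D(2))
  also have "\<dots> \<le> ennreal (C' * A powr (q/p))" using C by (intro ennreal_leI mult_right_mono) auto
  finally show "(\<integral>\<^sup>+x. ennreal (enn2real (pos_op k' F x) powr q * u x) \<partial>lebesgue) \<le> ennreal (C' * A powr (q/p))" .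
qed

lemma opb_scale:
  assumes k: "opb p v q u k C" and jm: "joint_meas k" and um [measurable]: "u \<in> borel_measurable lebesgue"
  shows "opb p v q u (\<lambda>x y. c * k x y) (\<bar>c\<bar> powr q * C)"
  unfolding opb_def
proof (intro conjI allI impI)
  show "\<bar>c\<bar> powr q * C \<ge> 0" using k by (simp add: opb_def)
  fix F :: "real^'a \<Rightarrow> real" and A :: real
  assume F: "F \<in> borel_measurable lebesgue" "A > 0" "(\<integral>\<^sup>+y. ennreal (\<bar>F y\<bar> powr p * v y) \<partial>lebesgue) \<le> ennreal A"
  note D = opbD[OF k F]
  note [measurable] = F(1) joint_meas_section[OF jm] pos_op_measurable[OF jm]
  have po: "pos_op (\<lambda>x y. c * k x y) F x = ennreal \<bar>c\<bar> * pos_op k F x" for x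
    unfolding pos_op_def by (subst nn_integral_cmult[symmetric]) (auto simp: ennreal_mult'[symmetric] abs_mult mult.assoc)
  show "AE x in lebesgue. u x > 0 \<longrightarrow> pos_op (\<lambda>x y. c * k x y) F x < \<infinity>"
    using D(1) by eventually_elim (auto simp: po ennreal_mult_less_top)
  have "(\<integral>\<^sup>+x. ennreal (enn2real (pos_op (\<lambda>x y. c * k x y) F x) powr q * u x) \<partial>lebesgue)
    = (\<integral>\<^sup>+x. ennreal (\<bar>c\<bar> powr q * (enn2real (pos_op k F x) powr q * u x)) \<partial>lebesgue)"
    by (simp add: po enn2real_mult powr_mult mult.assoc)
  also have "\<dots> \<le> (\<integral>\<^sup>+x. ennreal (\<bar>c\<bar> powr q) * ennreal (enn2real (pos_op k F x) powr q * u x) \<partial>lebesgue)"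
    by (intro nn_integral_mono) (simp add: ennreal_mult')
  also have "\<dots> = ennreal (\<bar>c\<bar> powr q) * (\<integral>\<^sup>+x. ennreal (enn2real (pos_op k F x) powr q * u x) \<partial>lebesgue)"
    by (rule nn_integral_cmult) measurable
  also have "\<dots> \<le> ennreal (\<bar>c\<bar> powr q) * ennreal (C * A powr (q/p))" by (intro mult_left_mono D(2)) simp
  finally show "(\<integral>\<^sup>+x. ennreal (enn2real (pos_op (\<lambda>x y. c * k x y) F x) powr q * u x) \<partial>lebesgue) \<le> ennreal (\<bar>c\<bar> powr q * C * A powr (q/p))"
    using D(3) by (simp add: ennreal_mult'[symmetric] mult.assoc)
qed

text \<open>The crude inequality (x + y)^q \<le> 2^q (x^q + y^q) replaces Minkowski's; only
  boundedly many errors are added below.\<close>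

lemma opb_add:
  assumes k1: "opb p v q u k1 C1" and k2: "opb p v q u k2 C2" and jm: "joint_meas k1" "joint_meas k2"
    and q: "q > 0" and u0: "\<And>x. u x \<ge> 0" and um [measurable]: "u \<in> borel_measurable lebesgue"
  shows "opb p v q u (\<lambda>x y. k1 x y + k2 x y) (2 powr q * (C1 + C2))"
  unfolding opb_def
proof (intro conjI allI impI)
  show "2 powr q * (C1 + C2) \<ge> 0" using k1 k2 by (simp add: opb_def)
  fix F :: "real^'a \<Rightarrow> real" and A :: real
  assume F: "F \<in> borel_measurable lebesgue" "A > 0" "(\<integral>\<^sup>+y. ennreal (\<bar>F y\<bar> powr p * v y) \<partial>lebesgue) \<le> ennreal A"
  note D1 = opbD[OF k1 F] and D2 = opbD[OF k2 F]
  note [measurable] = F(1) joint_meas_section[OF jm(1)] joint_meas_section[OF jm(2)]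
    pos_op_measurable[OF jm(1)] pos_op_measurable[OF jm(2)]
  let ?P1 = "pos_op k1 F" and ?P2 = "pos_op k2 F" and ?P = "pos_op (\<lambda>x y. k1 x y + k2 x y) F"
  have po: "?P x \<le> ?P1 x + ?P2 x" for x
  proof -
    have "?P x \<le> (\<integral>\<^sup>+y. ennreal (\<bar>k1 x y\<bar> * \<bar>F y\<bar>) + ennreal (\<bar>k2 x y\<bar> * \<bar>F y\<bar>) \<partial>lebesgue)"
      unfolding pos_op_def
    proof (intro nn_integral_mono)
      fix y
      have "\<bar>k1 x y + k2 x y\<bar> * \<bar>F y\<bar> \<le> (\<bar>k1 x y\<bar> + \<bar>k2 x y\<bar>) * \<bar>F y\<bar>" by (intro mult_right_mono) auto
      then show "ennreal (\<bar>k1 x y + k2 x y\<bar> * \<bar>F y\<bar>) \<le> ennreal (\<bar>k1 x y\<bar> * \<bar>F y\<bar>) + ennreal (\<bar>k2 x y\<bar> * \<bar>F y\<bar>)"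
        by (simp add: ennreal_plus[symmetric] distrib_right ennreal_leI del: ennreal_plus)
    qed
    also have "\<dots> = ?P1 x + ?P2 x" unfolding pos_op_def by (rule nn_integral_add) measurable
    finally show ?thesis .
  qed
  have AEfin: "AE x in lebesgue. u x > 0 \<longrightarrow> ?P1 x + ?P2 x < \<infinity>"
    using D1(1) D2(1) by eventually_elim auto
  then show "AE x in lebesgue. u x > 0 \<longrightarrow> ?P x < \<infinity>"
    by eventually_elim (use po le_less_trans in blast)
  have "(\<integral>\<^sup>+x. ennreal (enn2real (?P x) powr q * u x) \<partial>lebesgue) \<le>
    (\<integral>\<^sup>+x. ennreal (2 powr q) * (ennreal (enn2real (?P1 x) powr q * u x) + ennreal (enn2real (?P2 x) powr q * u x)) \<partial>lebesgue)"
    using AEfin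
  proof (intro nn_integral_mono_AE, eventually_elim)
    fix x assume fin: "u x > 0 \<longrightarrow> ?P1 x + ?P2 x < \<infinity>"
    show "ennreal (enn2real (?P x) powr q * u x) \<le> ennreal (2 powr q) * (ennreal (enn2real (?P1 x) powr q * u x) + ennreal (enn2real (?P2 x) powr q * u x))"
    proof (cases "u x > 0")
      case True
      then have f: "?P1 x < top" "?P2 x < top" using fin by auto
      have "enn2real (?P x) \<le> enn2real (?P1 x + ?P2 x)" using po True fin by (intro enn2real_mono) auto
      also have "\<dots> = enn2real (?P1 x) + enn2real (?P2 x)" using f by (intro enn2real_plus) auto
      finally have "enn2real (?P x) powr q \<le> (enn2real (?P1 x) + enn2real (?P2 x)) powr q" using q by (intro powr_mono2) auto
      also have "\<dots> \<le> 2 powr q * (enn2real (?P1 x) powr q + enn2real (?P2 x) powr q)" using q by (intro powr_add_le) auto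
      finally have "enn2real (?P x) powr q * u x \<le> 2 powr q * (enn2real (?P1 x) powr q + enn2real (?P2 x) powr q) * u x"
        using u0 by (intro mult_right_mono) auto
      then have "ennreal (enn2real (?P x) powr q * u x) \<le> ennreal (2 powr q * (enn2real (?P1 x) powr q * u x + enn2real (?P2 x) powr q * u x))"
        by (intro ennreal_leI) (simp add: algebra_simps)
      also have "\<dots> = ennreal (2 powr q) * (ennreal (enn2real (?P1 x) powr q * u x) + ennreal (enn2real (?P2 x) powr q * u x))"
        using u0[of x] by (simp add: ennreal_mult' ennreal_plus)
      finally show ?thesis .
    next
      case False
      then show ?thesis using u0[of x] by simp
    qed
  qed
  also have "\<dots> = ennreal (2 powr q) * ((\<integral>\<^sup>+x. ennreal (enn2real (?P1 x) powr q * u x) \<partial>lebesgue) + (\<integral>\<^sup>+x. ennreal (enn2real (?P2 x) powr q * u x) \<partial>lebesgue))"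
    by (subst nn_integral_cmult, measurable, subst nn_integral_add, measurable)
  also have "\<dots> \<le> ennreal (2 powr q) * (ennreal (C1 * A powr (q/p)) + ennreal (C2 * A powr (q/p)))"
    by (intro mult_left_mono add_mono D1(2) D2(2)) simp
  also have "\<dots> = ennreal (2 powr q * (C1 + C2) * A powr (q/p))"
    using D1(3) D2(3) by (simp add: ennreal_plus[symmetric] ennreal_mult'[symmetric] algebra_simps del: ennreal_plus)
  finally show "(\<integral>\<^sup>+x. ennreal (enn2real (?P x) powr q * u x) \<partial>lebesgue) \<le> ennreal (2 powr q * (C1 + C2) * A powr (q/p))" .
qed

text \<open>Each bounded sequence has convergent subsequences, and the diagonal sequence is a
  subsequence of every stage from some index on, whence the shift by \<open>Suc n\<close>.\<close>

lemma diagonal_convergent_subseq: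
  fixes c :: "nat \<Rightarrow> nat \<Rightarrow> real"
  assumes "\<And>n. bounded (range (c n))"
  shows "\<exists>r. strict_mono r \<and> (\<forall>n. convergent (\<lambda>j. c n (r j)))"
proof -
  interpret subseqs "\<lambda>n s. convergent (\<lambda>j. c n (s j))"
  proof
    fix n and s :: "nat \<Rightarrow> nat" assume "strict_mono s"
    have "bounded (range (\<lambda>j. c n (s j)))" by (rule bounded_subset[OF assms[of n]]) auto
    then obtain l r where "strict_mono r" "((\<lambda>j. c n (s j)) \<circ> r) \<longlonglongrightarrow> l"
      using bounded_imp_convergent_subsequence by blast
    then show "\<exists>r'. strict_mono r' \<and> convergent (\<lambda>j. c n ((s \<circ> r') j))"
      by (auto simp: convergent_def o_def)
  qed
  have "convergent (\<lambda>j. c n (diagseq j))" for n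
  proof -
    have "convergent (\<lambda>j. c n ((diagseq \<circ> (+) (Suc n)) j))"
    proof (rule diagseq_holds)
      fix r s :: "nat \<Rightarrow> nat" and n assume "strict_mono r" "convergent (\<lambda>j. c n (s j))"
      then show "convergent (\<lambda>j. c n ((s \<circ> r) j))"
        using convergent_subseq_convergent[of "\<lambda>j. c n (s j)" r] by (simp add: o_def)
    qed
    then have "convergent (\<lambda>j. c n (diagseq (j + Suc n)))" by (simp add: add.commute)
    then show ?thesis by (rule convergent_ignore_initial_segment[of "\<lambda>j. c n (diagseq j)" "Suc n", THEN iffD1])
  qed
  then show ?thesis using subseq_diagseq by blast
qed

text \<open>All sets and functions share one bounded carrier and one bound, so on a bounded set of
  inputs the coefficients against \<open>\<psi> i\<close> are bounded uniformly in
  \<open>i\<close>.\<close>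

definition fin_rank :: "(nat \<Rightarrow> (real^'n) set) \<Rightarrow> (nat \<Rightarrow> real^'n \<Rightarrow> real) \<Rightarrow> (real^'n) set \<Rightarrow> real \<Rightarrow> bool" where
  "fin_rank E \<psi> B M \<longleftrightarrow> bounded B \<and> B \<in> sets lebesgue \<and> M \<ge> 0 \<and>
     (\<forall>i. E i \<in> sets lebesgue \<and> E i \<subseteq> B \<and> \<psi> i \<in> borel_measurable lebesgue \<and> (\<forall>y. \<bar>\<psi> i y\<bar> \<le> M * indicator B y))"

definition rank_kernel :: "nat \<Rightarrow> (nat \<Rightarrow> (real^'n) set) \<Rightarrow> (nat \<Rightarrow> real^'n \<Rightarrow> real) \<Rightarrow> real^'n \<Rightarrow> real^'n \<Rightarrow> real" where
  "rank_kernel N E \<psi> x y = (\<Sum>i<N. indicator (E i) x * \<psi> i y)"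

lemma rank_kernel_joint_meas:
  assumes "fin_rank E \<psi> B M" shows "joint_meas (rank_kernel N E \<psi>)"
proof -
  have [measurable]: "\<And>i. E i \<in> sets lebesgue" "\<And>i. \<psi> i \<in> borel_measurable lebesgue"
    using assms by (auto simp: fin_rank_def)
  show ?thesis unfolding joint_meas_def rank_kernel_def by measurable
qed

lemma int_op_le_pos_op:
  assumes jm: "joint_meas k" and F [measurable]: "F \<in> borel_measurable lebesgue" and fin: "pos_op k F x < \<infinity>"
  shows "integrable lebesgue (\<lambda>y. k x y * F y)" "\<bar>int_op k F x\<bar> \<le> enn2real (pos_op k F x)"
proof -
  have [measurable]: "k x \<in> borel_measurable lebesgue" by (rule joint_meas_section[OF jm])
  have eq: "(\<integral>\<^sup>+y. ennreal (norm (k x y * F y)) \<partial>lebesgue) = pos_op k F x"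
    by (simp add: pos_op_def abs_mult)
  show int: "integrable lebesgue (\<lambda>y. k x y * F y)"
    by (rule integrableI_bounded) (use fin eq in auto)
  have "ennreal (norm (int_op k F x)) \<le> pos_op k F x"
    unfolding int_op_def eq[symmetric] by (rule integral_norm_bound_ennreal[OF int])
  then have "enn2real (ennreal (norm (int_op k F x))) \<le> enn2real (pos_op k F x)"
    using fin by (intro enn2real_mono) auto
  then show "\<bar>int_op k F x\<bar> \<le> enn2real (pos_op k F x)" by simp
qed

context two_weight
begin

lemma u_w_bounded_finite:
  assumes "bounded B"
  shows "(\<integral>\<^sup>+x\<in>B. ennreal (u x) \<partial>lebesgue) < \<infinity>" "(\<integral>\<^sup>+x\<in>B. ennreal ((v x powr (-1/p)) powr conj_exp p) \<partial>lebesgue) < \<infinity>"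
proof -
  obtain K where "bump_data \<alpha> p q s \<delta> K m (\<lambda>x. v x powr (-1/p)) (\<lambda>x. u x powr (1/q))" by (rule bump_dataE)
  then interpret bump_data \<alpha> p q s \<delta> K m "\<lambda>x. v x powr (-1/p)" "\<lambda>x. u x powr (1/q)" .
  show "(\<integral>\<^sup>+x\<in>B. ennreal (u x) \<partial>lebesgue) < \<infinity>"
    using z_w_bounded_finite(1)[OF assms] qs u0 by (simp add: powr_powr)
  show "(\<integral>\<^sup>+x\<in>B. ennreal ((v x powr (-1/p)) powr conj_exp p) \<partial>lebesgue) < \<infinity>"
    by (rule z_w_bounded_finite(2)[OF assms])
qed

text \<open>Since v > 0 almost everywhere, the product of \<open>F\<close> and \<open>h\<close> can
  be written as F v^(1/p) times h v^(-1/p).\<close>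

lemma weighted_Hoelder:
  assumes [measurable]: "F \<in> borel_measurable lebesgue" "h \<in> borel_measurable lebesgue"
    and A: "A \<ge> 0" "(\<integral>\<^sup>+y. ennreal (\<bar>F y\<bar> powr p * v y) \<partial>lebesgue) \<le> ennreal A"
    and W: "W \<ge> 0" "(\<integral>\<^sup>+y. ennreal ((\<bar>h y\<bar> * v y powr (-1/p)) powr conj_exp p) \<partial>lebesgue) \<le> ennreal W"
  shows "(\<integral>\<^sup>+y. ennreal (\<bar>h y\<bar> * \<bar>F y\<bar>) \<partial>lebesgue) \<le> ennreal (A powr (1/p) * W powr (1/conj_exp p))"
proof -
  note cp = conj_exp_props[OF p(1)]
  have "(\<integral>\<^sup>+y. ennreal (\<bar>h y\<bar> * \<bar>F y\<bar>) \<partial>lebesgue) = (\<integral>\<^sup>+y. ennreal (\<bar>\<bar>F y\<bar> * v y powr (1/p)\<bar> * \<bar>\<bar>h y\<bar> * v y powr (-1/p)\<bar>) \<partial>lebesgue)"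
    using vpos
  proof (intro nn_integral_cong_AE, eventually_elim)
    fix y assume "v y > 0"
    then have "v y powr (1/p) * v y powr (-1/p) = 1" by (simp add: powr_add[symmetric])
    then have "\<bar>h y\<bar> * \<bar>F y\<bar> = (\<bar>F y\<bar> * v y powr (1/p)) * (\<bar>h y\<bar> * v y powr (-1/p))" by (simp add: mult_ac)
    then show "ennreal (\<bar>h y\<bar> * \<bar>F y\<bar>) = ennreal (\<bar>\<bar>F y\<bar> * v y powr (1/p)\<bar> * \<bar>\<bar>h y\<bar> * v y powr (-1/p)\<bar>)" by simp
  qed
  also have "\<dots> \<le> ennreal (A powr (1/p) * W powr (1/conj_exp p))"
  proof (rule nn_integral_Hoelder[OF _ _ p(1) cp(1,2) A(1) _ W(1)])
    show "(\<integral>\<^sup>+y. ennreal (\<bar>\<bar>F y\<bar> * v y powr (1/p)\<bar> powr p) \<partial>lebesgue) \<le> ennreal A"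
      using A(2) p v0 by (simp add: powr_mult powr_powr)
    show "(\<integral>\<^sup>+y. ennreal (\<bar>\<bar>h y\<bar> * v y powr (-1/p)\<bar> powr conj_exp p) \<partial>lebesgue) \<le> ennreal W" using W(2) by simp
  qed measurable
  finally show ?thesis .
qed

lemma local_L1:
  assumes B: "bounded B" "B \<in> sets lebesgue" and A: "A \<ge> 0"
  shows "\<exists>L. \<forall>F\<in>borel_measurable lebesgue. (\<integral>\<^sup>+y. ennreal (\<bar>F y\<bar> powr p * v y) \<partial>lebesgue) \<le> ennreal A \<longrightarrow>
    (\<integral>\<^sup>+y. ennreal (indicator B y * \<bar>F y\<bar>) \<partial>lebesgue) \<le> ennreal L"
proof -
  note [measurable] = B(2)
  obtain W where W: "(\<integral>\<^sup>+x\<in>B. ennreal ((v x powr (-1/p)) powr conj_exp p) \<partial>lebesgue) = ennreal W" "W \<ge> 0"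
    using u_w_bounded_finite(2)[OF B(1)] by (cases "(\<integral>\<^sup>+x\<in>B. ennreal ((v x powr (-1/p)) powr conj_exp p) \<partial>lebesgue)") auto
  have W': "(\<integral>\<^sup>+y. ennreal ((\<bar>indicator B y\<bar> * v y powr (-1/p)) powr conj_exp p) \<partial>lebesgue) \<le> ennreal W"
    unfolding W(1)[symmetric] using conj_exp_props(1)[OF p(1)] by (intro nn_integral_mono) (auto simp: indicator_def)
  have "(\<integral>\<^sup>+y. ennreal (indicator B y * \<bar>F y\<bar>) \<partial>lebesgue) \<le> ennreal (A powr (1/p) * W powr (1/conj_exp p))"
    if "F \<in> borel_measurable lebesgue" "(\<integral>\<^sup>+y. ennreal (\<bar>F y\<bar> powr p * v y) \<partial>lebesgue) \<le> ennreal A" for F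
    using weighted_Hoelder[OF that(1) _ A that(2) W(2) W'] by simp
  then show ?thesis by blast
qed

lemma fin_rank_coeff:
  assumes fr: "fin_rank E \<psi> B M" and A: "A \<ge> 0"
  obtains L where "\<And>F i. F \<in> borel_measurable lebesgue \<Longrightarrow> (\<integral>\<^sup>+y. ennreal (\<bar>F y\<bar> powr p * v y) \<partial>lebesgue) \<le> ennreal A \<Longrightarrow>
    integrable lebesgue (\<lambda>y. \<psi> i y * F y) \<and> \<bar>LINT y|lebesgue. \<psi> i y * F y\<bar> \<le> L"
proof -
  have B: "bounded B" "B \<in> sets lebesgue" "M \<ge> 0" "\<And>i. \<psi> i \<in> borel_measurable lebesgue" "\<And>i y. \<bar>\<psi> i y\<bar> \<le> M * indicator B y"
    using fr by (auto simp: fin_rank_def)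
  note [measurable] = B(2,4)
  obtain L where L: "\<And>F. F\<in>borel_measurable lebesgue \<Longrightarrow> (\<integral>\<^sup>+y. ennreal (\<bar>F y\<bar> powr p * v y) \<partial>lebesgue) \<le> ennreal A \<Longrightarrow>
    (\<integral>\<^sup>+y. ennreal (indicator B y * \<bar>F y\<bar>) \<partial>lebesgue) \<le> ennreal L"
    using local_L1[OF B(1,2) A] by blast
  have "integrable lebesgue (\<lambda>y. \<psi> i y * F y) \<and> \<bar>LINT y|lebesgue. \<psi> i y * F y\<bar> \<le> M * max 0 L"
    if F: "F \<in> borel_measurable lebesgue" "(\<integral>\<^sup>+y. ennreal (\<bar>F y\<bar> powr p * v y) \<partial>lebesgue) \<le> ennreal A" for F i
  proof -
    note [measurable] = F(1)
    have "(\<integral>\<^sup>+y. ennreal (norm (\<psi> i y * F y)) \<partial>lebesgue) \<le> (\<integral>\<^sup>+y. ennreal M * ennreal (indicator B y * \<bar>F y\<bar>) \<partial>lebesgue)"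
    proof (intro nn_integral_mono)
      fix y
      have "norm (\<psi> i y * F y) \<le> M * indicator B y * \<bar>F y\<bar>" using B(5)[of i y] by (simp add: abs_mult mult_right_mono)
      then show "ennreal (norm (\<psi> i y * F y)) \<le> ennreal M * ennreal (indicator B y * \<bar>F y\<bar>)"
        using B(3) by (simp add: ennreal_mult'[symmetric] ennreal_leI mult.assoc)
    qed
    also have "\<dots> = ennreal M * (\<integral>\<^sup>+y. ennreal (indicator B y * \<bar>F y\<bar>) \<partial>lebesgue)" by (rule nn_integral_cmult) measurable
    also have "\<dots> \<le> ennreal M * ennreal L" by (intro mult_left_mono L F) simp
    also have "\<dots> \<le> ennreal (M * max 0 L)" using B(3) by (simp add: ennreal_mult'[symmetric] ennreal_leI mult_left_mono)
    finally have le: "(\<integral>\<^sup>+y. ennreal (norm (\<psi> i y * F y)) \<partial>lebesgue) \<le> ennreal (M * max 0 L)" .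
    have int: "integrable lebesgue (\<lambda>y. \<psi> i y * F y)"
      by (rule integrableI_bounded) (use le_less_trans[OF le] in auto)
    have "ennreal (norm (LINT y|lebesgue. \<psi> i y * F y)) \<le> ennreal (M * max 0 L)"
      using integral_norm_bound_ennreal[OF int] le by (rule order_trans)
    then show ?thesis using int B(3) by (simp add: ennreal_le_iff)
  qed
  then show ?thesis using that by blast
qed

text \<open>A finite rank image is determined by finitely many bounded coefficients. A diagonal
  subsequence makes the coefficients of all approximations, with errors 1/(l+1), converge at once.
  The images under the original operator are then Cauchy, and completeness provides the
  limit.\<close>

theorem compact_op_of_finite_rank_approx:
  assumes jm: "joint_meas k" and bd: "opb p v q u k C0"
    and approx: "\<And>e. e > 0 \<Longrightarrow> \<exists>N E \<psi> B M C. fin_rank E \<psi> B M \<and> C \<le> e \<and> opb p v q u (\<lambda>x y. k x y - rank_kernel N E \<psi> x y) C"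
  shows "compact_op (int_op k) p v q u"
  unfolding compact_op_def
proof (intro conjI ballI allI impI)
  fix f assume f: "f \<in> wLp p v"
  then have fm: "f \<in> borel_measurable lebesgue" by (simp add: wLp_def)
  obtain A where A: "(\<integral>\<^sup>+y. ennreal (\<bar>f y\<bar> powr p * v y) \<partial>lebesgue) = ennreal A" "A \<ge> 0"
    using f by (cases "\<integral>\<^sup>+y. ennreal (\<bar>f y\<bar> powr p * v y) \<partial>lebesgue") (auto simp: wLp_def)
  have A1: "(\<integral>\<^sup>+y. ennreal (\<bar>f y\<bar> powr p * v y) \<partial>lebesgue) \<le> ennreal (A + 1)" using A by (simp add: ennreal_leI)
  have Ap: "A + 1 > 0" using A by simp
  note D = opbD[OF bd fm Ap A1]
  have "(\<integral>\<^sup>+x. ennreal (\<bar>int_op k f x\<bar> powr q * u x) \<partial>lebesgue) \<le> (\<integral>\<^sup>+x. ennreal (enn2real (pos_op k f x) powr q * u x) \<partial>lebesgue)"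
    using D(1)
  proof (intro nn_integral_mono_AE, eventually_elim)
    fix x assume fin: "u x > 0 \<longrightarrow> pos_op k f x < \<infinity>"
    show "ennreal (\<bar>int_op k f x\<bar> powr q * u x) \<le> ennreal (enn2real (pos_op k f x) powr q * u x)"
    proof (cases "u x > 0")
      case True
      then show ?thesis using int_op_le_pos_op(2)[OF jm fm] fin u0 qs
        by (intro ennreal_leI mult_right_mono powr_mono2) auto
    next
      case False
      then have "u x = 0" using u0[of x] by simp
      then show ?thesis by simp
    qed
  qed
  also have "\<dots> < \<infinity>" by (rule le_less_trans[OF D(2)]) simp
  finally show "int_op k f \<in> wLp q u" using int_op_measurable[OF jm fm] by (simp add: wLp_def)
next
  fix F :: "nat \<Rightarrow> real^'n \<Rightarrow> real"
  assume "(\<forall>k. F k \<in> wLp p v) \<and> bounded (range (\<lambda>k. wnorm p v (F k)))"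
  then have F: "\<And>j. F j \<in> wLp p v" and Fb: "bounded (range (\<lambda>j. wnorm p v (F j)))" by auto
  have Fm [measurable]: "F j \<in> borel_measurable lebesgue" for j using F[of j] by (simp add: wLp_def)
  obtain R where R': "\<forall>x\<in>range (\<lambda>j. wnorm p v (F j)). norm x \<le> R"
    using Fb unfolding bounded_iff by blast
  have R: "wnorm p v (F j) \<le> R" for j using bspec[OF R', of "wnorm p v (F j)"] by auto
  have R0: "R \<ge> 0" using R[of 0] by (rule order_trans[rotated]) (simp add: wnorm_def)
  \<comment> \<open>The summand 1 makes \<open>A\<close> positive, as \<open>opb\<close>
    demands.\<close>
  define A where "A = R powr p + 1"
  have A0: "A > 0" by (simp add: A_def add_nonneg_pos)
  \<comment> \<open>\<open>wnorm\<close> uses the Bochner integral, which is 0 for non-integrable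
    functions. Membership in \<open>wLp\<close> identifies it with the nonnegative integral.\<close>
  have FA: "(\<integral>\<^sup>+y. ennreal (\<bar>F j y\<bar> powr p * v y) \<partial>lebesgue) \<le> ennreal A" for j
  proof -
    let ?g = "\<lambda>y. \<bar>F j y\<bar> powr p * v y"
    have fin: "(\<integral>\<^sup>+y. ennreal (?g y) \<partial>lebesgue) < \<infinity>" using F[of j] by (simp add: wLp_def)
    have int: "integrable lebesgue ?g"
      by (rule integrableI_bounded) (use fin v0 in \<open>auto simp: abs_mult\<close>)
    have eq: "(\<integral>\<^sup>+y. ennreal (?g y) \<partial>lebesgue) = ennreal (LINT y|lebesgue. ?g y)"
      by (rule nn_integral_eq_integral[OF int]) (use v0 in auto)
    have I0: "(LINT y|lebesgue. ?g y) \<ge> 0" using v0 by (intro integral_nonneg_AE) auto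
    have "((LINT y|lebesgue. ?g y) powr (1/p)) powr p \<le> R powr p"
      using R[of j] p by (intro powr_mono2) (auto simp: wnorm_def)
    then have "(LINT y|lebesgue. ?g y) \<le> R powr p" using p I0 by (simp add: powr_powr)
    then show ?thesis unfolding eq A_def by (intro ennreal_leI) simp
  qed
  define App where "App e N E \<psi> B M \<longleftrightarrow> fin_rank E \<psi> B M \<and> (\<exists>C\<le>e. opb p v q u (\<lambda>x y. k x y - rank_kernel N E \<psi> x y) C)" for e N E \<psi> B M
  have "\<exists>N E \<psi> B M. App (1 / real (Suc l)) N E \<psi> B M" for l
    using approx[of "1 / real (Suc l)"] unfolding App_def by fastforce
  then obtain N E \<psi> B M where App: "\<And>l. App (1 / real (Suc l)) (N l) (E l) (\<psi> l) (B l) (M l)" by metis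
  have fr: "fin_rank (E l) (\<psi> l) (B l) (M l)" for l using App by (simp add: App_def)
  define c where "c l i j = (LINT y|lebesgue. \<psi> l i y * F j y)" for l i j
  have coeff: "\<exists>L. \<forall>i j. integrable lebesgue (\<lambda>y. \<psi> l i y * F j y) \<and> \<bar>c l i j\<bar> \<le> L" for l
  proof -
    obtain L where L: "\<And>F i. F \<in> borel_measurable lebesgue \<Longrightarrow> (\<integral>\<^sup>+y. ennreal (\<bar>F y\<bar> powr p * v y) \<partial>lebesgue) \<le> ennreal A \<Longrightarrow>
        integrable lebesgue (\<lambda>y. \<psi> l i y * F y) \<and> \<bar>LINT y|lebesgue. \<psi> l i y * F y\<bar> \<le> L"
      by (rule fin_rank_coeff[OF fr[of l] less_imp_le[OF A0]]) blast
    show ?thesis unfolding c_def by (intro exI[of _ L] allI L Fm FA)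
  qed
  have cint: "integrable lebesgue (\<lambda>y. \<psi> l i y * F j y)" for l i j using coeff[of l] by blast
  have cbd: "\<exists>L. \<forall>j. \<bar>c l i j\<bar> \<le> L" for l i using coeff[of l] by blast
  \<comment> \<open>One index encodes both the approximation and the position of a coefficient in
    it.\<close>
  have "bounded (range (\<lambda>j. c (fst (prod_decode n)) (snd (prod_decode n)) j))" for n
    using cbd[of "fst (prod_decode n)" "snd (prod_decode n)"] by (auto simp: bounded_iff)
  from diagonal_convergent_subseq[of "\<lambda>n j. c (fst (prod_decode n)) (snd (prod_decode n)) j", OF this]
  obtain r where r: "strict_mono r" and rc: "\<And>n. convergent (\<lambda>j. c (fst (prod_decode n)) (snd (prod_decode n)) (r j))" by blast
  have conv: "convergent (\<lambda>j. c l i (r j))" for l i using rc[of "prod_encode (l, i)"] by simp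
  define G where "G j = int_op k (F (r j))" for j
  have Gm [measurable]: "G j \<in> borel_measurable lebesgue" for j unfolding G_def by (rule int_op_measurable[OF jm Fm])
  define Aq where "Aq = A powr (q/p)"
  have Aq0: "Aq > 0" using A0 by (simp add: Aq_def)
  have cauchy: "\<exists>J. \<forall>j\<ge>J. \<forall>i\<ge>J. (\<integral>\<^sup>+x. ennreal (\<bar>G j x - G i x\<bar> powr q * u x) \<partial>lebesgue) \<le> ennreal e" if e: "e > 0" for e
  proof -
    \<comment> \<open>Three terms are separated by applying \<open>powr_add_le\<close>
      twice.\<close>
    define T where "T = 2 powr q * 2 powr q"
    have T0: "T > 0" by (simp add: T_def)
    obtain l where l: "4 * T * Aq / e < real (Suc l)" using reals_Archimedean2 less_trans[OF _ lessI[THEN of_nat_less_iff[THEN iffD2]]] by blast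
    obtain C where C: "C \<le> 1 / real (Suc l)" "opb p v q u (\<lambda>x y. k x y - rank_kernel (N l) (E l) (\<psi> l) x y) C"
      using App[of l] by (auto simp: App_def)
    define kr where "kr = rank_kernel (N l) (E l) (\<psi> l)"
    define kd where "kd x y = k x y - kr x y" for x y
    have jmr: "joint_meas kr" unfolding kr_def by (rule rank_kernel_joint_meas[OF fr])
    have jmd: "joint_meas kd" using jm jmr unfolding joint_meas_def kd_def by (intro borel_measurable_diff)
    have opd: "opb p v q u kd C" using C(2) by (simp add: kd_def[abs_def] kr_def)
    have C0: "C \<ge> 0" using opd by (simp add: opb_def)
    have small1: "T * (2 * (C * Aq)) \<le> e/2"
    proof -
      have "T * (2 * (C * Aq)) \<le> T * (2 * (1 / real (Suc l) * Aq))"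
        using C T0 Aq0 by (intro mult_left_mono mult_right_mono) auto
      also have "\<dots> \<le> e/2" using l e by (simp add: field_simps)
      finally show ?thesis .
    qed
    have Bl: "bounded (B l)" "B l \<in> sets lebesgue" "\<And>i. E l i \<subseteq> B l" using fr[of l] by (auto simp: fin_rank_def)
    note [measurable] = Bl(2)
    obtain U where U: "(\<integral>\<^sup>+x\<in>B l. ennreal (u x) \<partial>lebesgue) = ennreal U" "U \<ge> 0"
      using u_w_bounded_finite(1)[OF Bl(1)] by (cases "\<integral>\<^sup>+x\<in>B l. ennreal (u x) \<partial>lebesgue") auto
    \<comment> \<open>If each of the \<open>N l\<close> coefficients changes by less than \<eta>,
      their total change \<open>d\<close> satisfies d^q * U \<le> e / (2 T), which is the half of
      \<open>e\<close> left to the finite rank part.\<close>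
    define \<eta> where "\<eta> = (e / (2 * T * (U + 1))) powr (1/q) / (real (N l) + 1)"
    have \<eta>0: "\<eta> > 0" using e T0 U by (auto simp: \<eta>_def intro!: divide_pos_pos)
    have "\<exists>J. \<forall>j\<ge>J. \<forall>j'\<ge>J. \<bar>c l i (r j) - c l i (r j')\<bar> < \<eta>" for i
      using convergent_Cauchy[OF conv[of l i]] \<eta>0 unfolding Cauchy_def dist_real_def by blast
    then obtain J where J: "\<And>i j j'. j \<ge> J i \<Longrightarrow> j' \<ge> J i \<Longrightarrow> \<bar>c l i (r j) - c l i (r j')\<bar> < \<eta>" by metis
    define J' where "J' = (\<Sum>i<N l. J i)"
    have JJ: "J i \<le> J'" if "i < N l" for i unfolding J'_def by (rule member_le_sum) (use that in auto)
    show ?thesis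
    proof (intro exI allI impI)
      fix j j' assume jj: "J' \<le> j" "J' \<le> j'"
      let ?Fj = "F (r j)" and ?Fi = "F (r j')"
      define d where "d = (\<Sum>i<N l. \<bar>c l i (r j) - c l i (r j')\<bar>)"
      have d0: "d \<ge> 0" by (simp add: d_def sum_nonneg)
      have "d \<le> (\<Sum>i<N l. \<eta>)" unfolding d_def
      proof (intro sum_mono)
        fix i assume "i \<in> {..<N l}"
        then have "J i \<le> j" "J i \<le> j'" using JJ[of i] jj by auto
        from J[OF this] show "\<bar>c l i (r j) - c l i (r j')\<bar> \<le> \<eta>" by simp
      qed
      also have "\<dots> \<le> (real (N l) + 1) * \<eta>" using \<eta>0 by simp
      also have "\<dots> = (e / (2 * T * (U + 1))) powr (1/q)" by (simp add: \<eta>_def)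
      finally have "d powr q \<le> ((e / (2 * T * (U + 1))) powr (1/q)) powr q" using d0 qs by (intro powr_mono2) auto
      also have "\<dots> = e / (2 * T * (U + 1))" using qs e T0 U by (simp add: powr_powr)
      finally have "d powr q * U \<le> e / (2 * T * (U + 1)) * (U + 1)" using U e T0 by (intro mult_mono) auto
      then have "d powr q * U \<le> e / (2 * T)" using U by simp
      then have small2: "T * (d powr q * U) \<le> e/2" using T0 by (simp add: field_simps)
      have kr_int: "int_op kr (F n) x = (\<Sum>i<N l. indicator (E l i) x * c l i n)" "integrable lebesgue (\<lambda>y. kr x y * F n y)" for n x
      proof -
        have eq: "(\<lambda>y. kr x y * F n y) = (\<lambda>y. \<Sum>i<N l. indicator (E l i) x * (\<psi> l i y * F n y))"
          by (simp add: kr_def rank_kernel_def sum_distrib_right mult.assoc)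
        show "integrable lebesgue (\<lambda>y. kr x y * F n y)" unfolding eq using cint by auto
        show "int_op kr (F n) x = (\<Sum>i<N l. indicator (E l i) x * c l i n)"
          unfolding int_op_def eq c_def using cint by (subst Bochner_Integration.integral_sum) auto
      qed
      \<comment> \<open>The integral is split only where the remainder kernel is integrable against
        the input, which holds almost everywhere on {u > 0}.\<close>
      have dec: "int_op k (F n) x = int_op kd (F n) x + int_op kr (F n) x" if "pos_op kd (F n) x < \<infinity>" for n x
      proof -
        have "(\<lambda>y. k x y * F n y) = (\<lambda>y. kd x y * F n y + kr x y * F n y)" by (simp add: kd_def algebra_simps)
        then show ?thesis unfolding int_op_def
          using int_op_le_pos_op(1)[OF jmd Fm that] kr_int(2)[of x n] by simp
      qed
      note D1 = opbD[OF opd Fm[of "r j"] A0 FA] and D2 = opbD[OF opd Fm[of "r j'"] A0 FA]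
      let ?P1 = "\<lambda>x. enn2real (pos_op kd ?Fj x)" and ?P2 = "\<lambda>x. enn2real (pos_op kd ?Fi x)"
      have [measurable]: "pos_op kd ?Fj \<in> borel_measurable lebesgue" "pos_op kd ?Fi \<in> borel_measurable lebesgue"
        by (rule pos_op_measurable[OF jmd Fm])+
      have "(\<integral>\<^sup>+x. ennreal (\<bar>G j x - G j' x\<bar> powr q * u x) \<partial>lebesgue) \<le>
        (\<integral>\<^sup>+x. ennreal T * (ennreal (?P1 x powr q * u x) + ennreal (?P2 x powr q * u x) + ennreal (d powr q) * (ennreal (u x) * indicator (B l) x)) \<partial>lebesgue)"
        using D1(1) D2(1)
      proof (intro nn_integral_mono_AE, eventually_elim)
        fix x assume fin: "u x > 0 \<longrightarrow> pos_op kd ?Fj x < \<infinity>" "u x > 0 \<longrightarrow> pos_op kd ?Fi x < \<infinity>"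
        show "ennreal (\<bar>G j x - G j' x\<bar> powr q * u x) \<le> ennreal T * (ennreal (?P1 x powr q * u x) + ennreal (?P2 x powr q * u x) + ennreal (d powr q) * (ennreal (u x) * indicator (B l) x))"
        proof (cases "u x > 0")
          case True
          then have fin: "pos_op kd ?Fj x < \<infinity>" "pos_op kd ?Fi x < \<infinity>" using fin by auto
          define I where "I = (indicator (B l) x :: real)"
          have "\<bar>int_op kr ?Fj x - int_op kr ?Fi x\<bar> = \<bar>\<Sum>i<N l. indicator (E l i) x * (c l i (r j) - c l i (r j'))\<bar>"
            unfolding kr_int by (simp add: sum_subtractf right_diff_distrib)
          also have "\<dots> \<le> (\<Sum>i<N l. \<bar>indicator (E l i) x * (c l i (r j) - c l i (r j'))\<bar>)" by (rule sum_abs)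
          also have "\<dots> \<le> (\<Sum>i<N l. I * \<bar>c l i (r j) - c l i (r j')\<bar>)"
            unfolding I_def using Bl(3) by (intro sum_mono) (auto simp: abs_mult indicator_def)
          also have "\<dots> = d * I" by (simp add: d_def sum_distrib_left mult.commute)
          finally have krd: "\<bar>int_op kr ?Fj x - int_op kr ?Fi x\<bar> \<le> d * I" .
          have "\<bar>G j x - G j' x\<bar> \<le> \<bar>int_op kd ?Fj x\<bar> + \<bar>int_op kd ?Fi x\<bar> + \<bar>int_op kr ?Fj x - int_op kr ?Fi x\<bar>"
            unfolding G_def dec[OF fin(1)] dec[OF fin(2)] by linarith
          also have "\<dots> \<le> (?P1 x + ?P2 x) + d * I"
            using krd int_op_le_pos_op(2)[OF jmd Fm fin(1)] int_op_le_pos_op(2)[OF jmd Fm fin(2)] by linarith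
          finally have "\<bar>G j x - G j' x\<bar> powr q \<le> ((?P1 x + ?P2 x) + d * I) powr q" using qs by (intro powr_mono2) auto
          also have "\<dots> \<le> 2 powr q * ((?P1 x + ?P2 x) powr q + (d * I) powr q)"
            using d0 qs by (intro powr_add_le) (auto simp: I_def)
          also have "\<dots> \<le> 2 powr q * (2 powr q * (?P1 x powr q + ?P2 x powr q) + 2 powr q * (d * I) powr q)"
          proof (intro mult_left_mono add_mono)
            show "(?P1 x + ?P2 x) powr q \<le> 2 powr q * (?P1 x powr q + ?P2 x powr q)" using qs by (intro powr_add_le) auto
            have "1 \<le> 2 powr q" using qs by (intro ge_one_powr_ge_zero) auto
            then show "(d * I) powr q \<le> 2 powr q * (d * I) powr q" using mult_right_mono[of 1 "2 powr q" "(d * I) powr q"] by simp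
          qed auto
          also have "(d * I) powr q = d powr q * I" using qs d0 by (auto simp: I_def indicator_def)
          finally have "\<bar>G j x - G j' x\<bar> powr q \<le> T * (?P1 x powr q + ?P2 x powr q + d powr q * I)"
            by (simp add: T_def algebra_simps)
          then have "\<bar>G j x - G j' x\<bar> powr q * u x \<le> T * (?P1 x powr q + ?P2 x powr q + d powr q * I) * u x"
            using u0 by (intro mult_right_mono) auto
          then have "ennreal (\<bar>G j x - G j' x\<bar> powr q * u x) \<le> ennreal (T * (?P1 x powr q * u x + ?P2 x powr q * u x + d powr q * (u x * I)))"
            by (intro ennreal_leI) (simp add: algebra_simps)
          also have "\<dots> = ennreal T * (ennreal (?P1 x powr q * u x) + ennreal (?P2 x powr q * u x) + ennreal (d powr q) * (ennreal (u x) * indicator (B l) x))"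
            using u0[of x] T0 by (auto simp: ennreal_mult' ennreal_plus I_def indicator_def)
          finally show ?thesis .
        next
          case False
          then have "u x = 0" using u0[of x] by simp
          then show ?thesis by simp
        qed
      qed
      also have "\<dots> = ennreal T * ((\<integral>\<^sup>+x. ennreal (?P1 x powr q * u x) \<partial>lebesgue) + (\<integral>\<^sup>+x. ennreal (?P2 x powr q * u x) \<partial>lebesgue)
          + ennreal (d powr q) * (\<integral>\<^sup>+x\<in>B l. ennreal (u x) \<partial>lebesgue))"
        by (simp add: nn_integral_cmult nn_integral_add)
      also have "\<dots> \<le> ennreal T * (ennreal (C * Aq) + ennreal (C * Aq) + ennreal (d powr q) * ennreal U)"
        unfolding U(1) Aq_def by (intro mult_left_mono add_mono D1(2) D2(2)) auto
      also have "\<dots> = ennreal (T * (2 * (C * Aq)) + T * (d powr q * U))"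
        using T0 C0 Aq0 U by (simp add: ennreal_plus[symmetric] ennreal_mult'[symmetric] algebra_simps del: ennreal_plus)
      also have "\<dots> \<le> ennreal e" using small1 small2 by (intro ennreal_leI) linarith
      finally show "(\<integral>\<^sup>+x. ennreal (\<bar>G j x - G j' x\<bar> powr q * u x) \<partial>lebesgue) \<le> ennreal e" .
    qed
  qed
  obtain g where gm [measurable]: "g \<in> borel_measurable lebesgue" and
    g: "\<And>e. e > 0 \<Longrightarrow> \<exists>J. \<forall>j\<ge>J. (\<integral>\<^sup>+x. ennreal (\<bar>G j x - g x\<bar> powr q * u x) \<partial>lebesgue) \<le> ennreal e"
    using weighted_Lq_complete[OF Gm u_meas u0 qs(1) cauchy] by blast
  have gfin: "(\<integral>\<^sup>+x. ennreal (\<bar>g x\<bar> powr q * u x) \<partial>lebesgue) < \<infinity>"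
  proof -
    obtain J where J: "(\<integral>\<^sup>+x. ennreal (\<bar>G J x - g x\<bar> powr q * u x) \<partial>lebesgue) \<le> ennreal 1" using g[of 1] by auto
    note D = opbD[OF bd Fm[of "r J"] A0 FA]
    have GJ: "(\<integral>\<^sup>+x. ennreal (\<bar>G J x\<bar> powr q * u x) \<partial>lebesgue) \<le> ennreal (C0 * A powr (q/p))"
    proof (rule order_trans[OF nn_integral_mono_AE D(2)], use D(1) in eventually_elim)
      fix x assume fin: "u x > 0 \<longrightarrow> pos_op k (F (r J)) x < \<infinity>"
      show "ennreal (\<bar>G J x\<bar> powr q * u x) \<le> ennreal (enn2real (pos_op k (F (r J)) x) powr q * u x)"
      proof (cases "u x > 0")
        case True
        then show ?thesis using int_op_le_pos_op(2)[OF jm Fm] fin u0 qs unfolding G_def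
          by (intro ennreal_leI mult_right_mono powr_mono2) auto
      next
        case False
        then have "u x = 0" using u0[of x] by simp
        then show ?thesis by simp
      qed
    qed
    have "(\<integral>\<^sup>+x. ennreal (\<bar>g x\<bar> powr q * u x) \<partial>lebesgue) \<le>
      (\<integral>\<^sup>+x. ennreal (2 powr q) * (ennreal (\<bar>G J x\<bar> powr q * u x) + ennreal (\<bar>G J x - g x\<bar> powr q * u x)) \<partial>lebesgue)"
    proof (intro nn_integral_mono)
      fix x
      have "\<bar>g x\<bar> powr q \<le> (\<bar>G J x\<bar> + \<bar>G J x - g x\<bar>) powr q" using qs by (intro powr_mono2) auto
      also have "\<dots> \<le> 2 powr q * (\<bar>G J x\<bar> powr q + \<bar>G J x - g x\<bar> powr q)" using qs by (intro powr_add_le) auto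
      finally have "\<bar>g x\<bar> powr q * u x \<le> 2 powr q * (\<bar>G J x\<bar> powr q + \<bar>G J x - g x\<bar> powr q) * u x" using u0 by (intro mult_right_mono) auto
      then have "ennreal (\<bar>g x\<bar> powr q * u x) \<le> ennreal (2 powr q * (\<bar>G J x\<bar> powr q * u x + \<bar>G J x - g x\<bar> powr q * u x))"
        by (intro ennreal_leI) (simp add: algebra_simps)
      also have "\<dots> = ennreal (2 powr q) * (ennreal (\<bar>G J x\<bar> powr q * u x) + ennreal (\<bar>G J x - g x\<bar> powr q * u x))"
        using u0[of x] by (simp add: ennreal_mult' ennreal_plus)
      finally show "ennreal (\<bar>g x\<bar> powr q * u x) \<le> \<dots>" .
    qed
    also have "\<dots> = ennreal (2 powr q) * ((\<integral>\<^sup>+x. ennreal (\<bar>G J x\<bar> powr q * u x) \<partial>lebesgue) + (\<integral>\<^sup>+x. ennreal (\<bar>G J x - g x\<bar> powr q * u x) \<partial>lebesgue))"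
      by (simp add: nn_integral_cmult nn_integral_add)
    also have "\<dots> \<le> ennreal (2 powr q) * (ennreal (C0 * A powr (q/p)) + ennreal 1)"
      by (intro mult_left_mono add_mono GJ J) simp
    also have "\<dots> < \<infinity>" by (simp add: ennreal_mult_less_top)
    finally show ?thesis .
  qed
  have lim: "(\<lambda>j. wnorm q u (\<lambda>x. int_op k (F (r j)) x - g x)) \<longlonglongrightarrow> 0"
  proof (rule LIMSEQ_I)
    fix t :: real assume t: "t > 0"
    define e where "e = (t/2) powr q"
    have e: "e > 0" using t by (simp add: e_def)
    obtain J where J: "\<And>j. j \<ge> J \<Longrightarrow> (\<integral>\<^sup>+x. ennreal (\<bar>G j x - g x\<bar> powr q * u x) \<partial>lebesgue) \<le> ennreal e" using g[OF e] by blast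
    have "norm (wnorm q u (\<lambda>x. int_op k (F (r j)) x - g x) - 0) < t" if "j \<ge> J" for j
    proof -
      let ?g = "\<lambda>x. \<bar>G j x - g x\<bar> powr q * u x"
      have int: "integrable lebesgue ?g"
        by (rule integrableI_bounded) (use le_less_trans[OF J[OF that]] u0 in \<open>auto simp: abs_mult\<close>)
      have "ennreal (LINT x|lebesgue. ?g x) = (\<integral>\<^sup>+x. ennreal (?g x) \<partial>lebesgue)"
        by (rule nn_integral_eq_integral[OF int, symmetric]) (use u0 in auto)
      also have "\<dots> \<le> ennreal e" by (rule J[OF that])
      finally have "(LINT x|lebesgue. ?g x) \<le> e" using e by (simp add: ennreal_le_iff)
      moreover have "(LINT x|lebesgue. ?g x) \<ge> 0" using u0 by (intro integral_nonneg_AE) auto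
      ultimately have "(LINT x|lebesgue. ?g x) powr (1/q) \<le> e powr (1/q)" using qs by (intro powr_mono2) auto
      also have "\<dots> = t/2" using t qs by (simp add: e_def powr_powr)
      finally show ?thesis using t by (simp add: wnorm_def G_def)
    qed
    then show "\<exists>no. \<forall>n\<ge>no. norm (wnorm q u (\<lambda>x. int_op k (F (r n)) x - g x) - 0) < t" by blast
  qed
  show "\<exists>r g. strict_mono r \<and> g \<in> wLp q u \<and> (\<lambda>j. wnorm q u (\<lambda>x. int_op k (F (r j)) x - g x)) \<longlonglongrightarrow> 0"
    using r lim gm gfin by (intro exI[of _ r] exI[of _ g]) (simp add: wLp_def)
qed

end

section \<open>Kernel estimates\<close>

definition comm_kernel :: "real \<Rightarrow> nat \<Rightarrow> (real^'n \<Rightarrow> real) \<Rightarrow> real^'n \<Rightarrow> real^'n \<Rightarrow> real" where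
  "comm_kernel \<alpha> m b x y = (b x - b y) ^ m * norm (x - y) powr (\<alpha> - real CARD('n))"

text \<open>The two forms agree on the diagonal as well: there \<open>0 powr _ = 0\<close> and
  division by zero yields 0.\<close>

lemma frac_comm_eq_int_op:
  fixes b f :: "real^'n \<Rightarrow> real"
  shows "frac_comm \<alpha> m b f = int_op (comm_kernel \<alpha> m b) f"
proof
  fix x :: "real^'n"
  have "t / norm (x - y) powr (real CARD('n) - \<alpha>) = t * norm (x - y) powr (\<alpha> - real CARD('n))" for t y
    using powr_minus_divide[of "norm (x - y)" "real CARD('n) - \<alpha>"] by (simp add: divide_inverse)
  then show "frac_comm \<alpha> m b f x = int_op (comm_kernel \<alpha> m b) f x"
    unfolding frac_comm_def int_op_def comm_kernel_def by (simp add: mult_ac)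
qed

lemma joint_meas_comm_kernel:
  fixes b :: "real^'n \<Rightarrow> real"
  assumes [measurable]: "b \<in> borel_measurable lebesgue" shows "joint_meas (comm_kernel \<alpha> m b)"
  unfolding joint_meas_def comm_kernel_def by measurable

lemma joint_meas_osc_kernel:
  fixes b :: "real^'n \<Rightarrow> real"
  assumes [measurable]: "b \<in> borel_measurable lebesgue" shows "joint_meas (osc_kernel \<alpha> m b)"
  unfolding joint_meas_def by measurable

lemma joint_meas_add: "joint_meas k1 \<Longrightarrow> joint_meas k2 \<Longrightarrow> joint_meas (\<lambda>x y. k1 x y + k2 x y)"
  unfolding joint_meas_def by (rule borel_measurable_add)

lemma joint_meas_diff: "joint_meas k1 \<Longrightarrow> joint_meas k2 \<Longrightarrow> joint_meas (\<lambda>x y. k1 x y - k2 x y)"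
  unfolding joint_meas_def by (rule borel_measurable_diff)

lemma joint_meas_cmult: "joint_meas k \<Longrightarrow> joint_meas (\<lambda>x y. c * k x y)"
  unfolding joint_meas_def by (intro borel_measurable_times borel_measurable_const)

lemma joint_meas_tensor:
  assumes [measurable]: "h \<in> borel_measurable lebesgue" "g \<in> borel_measurable lebesgue"
  shows "joint_meas (\<lambda>x y. h x * g y)"
  unfolding joint_meas_def by measurable

lemma abs_power_diff_le:
  fixes a c R :: real assumes "\<bar>a\<bar> \<le> R" "\<bar>c\<bar> \<le> R"
  shows "\<bar>a ^ Suc m - c ^ Suc m\<bar> \<le> real (Suc m) * \<bar>a - c\<bar> * R ^ m"
proof (induction m)
  case 0
  show ?case by simp
next
  case (Suc m)
  have R: "R \<ge> 0" using assms(1) by linarith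
  have "a ^ Suc (Suc m) - c ^ Suc (Suc m) = a * (a ^ Suc m - c ^ Suc m) + (a - c) * c ^ Suc m" by (simp add: algebra_simps)
  also have "\<bar>\<dots>\<bar> \<le> \<bar>a\<bar> * \<bar>a ^ Suc m - c ^ Suc m\<bar> + \<bar>a - c\<bar> * \<bar>c\<bar> ^ Suc m"
    unfolding abs_mult[symmetric] power_abs[symmetric] by (rule abs_triangle_ineq)
  also have "\<dots> \<le> R * (real (Suc m) * \<bar>a - c\<bar> * R ^ m) + \<bar>a - c\<bar> * R ^ Suc m"
    using Suc.IH assms R by (intro add_mono mult_mono mult_left_mono power_mono) auto
  also have "\<dots> = real (Suc (Suc m)) * \<bar>a - c\<bar> * R ^ Suc m" by (simp add: algebra_simps)
  finally show ?case .
qed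

text \<open>The difference of \<open>m\<close>-th powers contains one factor that is an oscillation
  of b - \<phi>, of size e after normalisation. The other factors are bounded by the normalised
  oscillations of b and b - \<phi>, since \<phi> = b - (b - \<phi>). Bounding products by the larger
  of the two oscillations leaves two kernels of normalised symbols.\<close>

lemma comm_kernel_diff_le:
  fixes b \<phi> :: "real^'n \<Rightarrow> real"
  assumes M: "M > 0" and e: "0 < e" "e \<le> 1" and m: "m \<ge> 1"
  shows "\<bar>comm_kernel \<alpha> m b x y - comm_kernel \<alpha> m \<phi> x y\<bar> \<le>
    (real m * e * (2 * M + 1) ^ (m - 1)) * (osc_kernel \<alpha> m (\<lambda>x. b x / M) x y + osc_kernel \<alpha> m (\<lambda>x. (b x - \<phi> x) / e) x y)"
proof -
  obtain n where n: "m = Suc n" using m by (cases m) auto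
  define a where "a = b x - b y"
  define c where "c = \<phi> x - \<phi> y"
  define a' where "a' = \<bar>b x / M - b y / M\<bar>"
  define d' where "d' = \<bar>(b x - \<phi> x) / e - (b y - \<phi> y) / e\<bar>"
  define t where "t = 1 + max a' d'"
  have aM: "\<bar>a\<bar> = M * a'" using M by (simp add: a_def a'_def diff_divide_distrib[symmetric] abs_divide)
  have de: "\<bar>a - c\<bar> = e * d'" using e by (simp add: a_def c_def d'_def diff_divide_distrib[symmetric] abs_divide algebra_simps)
  have a0: "a' \<ge> 0" "d' \<ge> 0" by (auto simp: a'_def d'_def)
  have t1: "a' \<le> t" "d' \<le> t" "t \<ge> 1" using a0 by (auto simp: t_def)
  have R: "\<bar>a\<bar> \<le> (2 * M + 1) * t" "\<bar>c\<bar> \<le> (2 * M + 1) * t"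
  proof -
    have 1: "M * a' \<le> M * t" using M t1 by (intro mult_left_mono) auto
    have 2: "e * d' \<le> 1 * t" using e t1 a0 by (intro mult_mono) auto
    have 3: "M * t \<ge> 0" "t \<ge> 0" using M t1 by auto
    show "\<bar>a\<bar> \<le> (2 * M + 1) * t" using 1 3 aM by (simp add: algebra_simps)
    have "\<bar>c\<bar> \<le> \<bar>a\<bar> + \<bar>a - c\<bar>" by linarith
    then show "\<bar>c\<bar> \<le> (2 * M + 1) * t" using 1 2 3 aM de by (simp add: algebra_simps)
  qed
  have "\<bar>a ^ m - c ^ m\<bar> \<le> real m * \<bar>a - c\<bar> * ((2 * M + 1) * t) ^ n"
    unfolding n by (rule abs_power_diff_le[OF R])
  also have "\<dots> \<le> real m * (e * t) * ((2 * M + 1) * t) ^ n"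
    unfolding de using e t1 M by (intro mult_right_mono mult_left_mono) auto
  also have "\<dots> = real m * e * (2 * M + 1) ^ n * t ^ m" by (simp add: n power_mult_distrib mult_ac)
  also have "t ^ m \<le> (1 + a') ^ m + (1 + d') ^ m"
    unfolding t_def max_def using a0 by auto
  also have "real m * e * (2 * M + 1) ^ n * ((1 + a') ^ m + (1 + d') ^ m) = real m * e * (2 * M + 1) ^ (m - 1) * ((1 + a') ^ m + (1 + d') ^ m)"
    by (simp add: n)
  finally have le: "\<bar>a ^ m - c ^ m\<bar> \<le> real m * e * (2 * M + 1) ^ (m - 1) * ((1 + a') ^ m + (1 + d') ^ m)"
    using e M by (simp add: mult_left_mono)
  have "\<bar>comm_kernel \<alpha> m b x y - comm_kernel \<alpha> m \<phi> x y\<bar> = \<bar>a ^ m - c ^ m\<bar> * norm (x - y) powr (\<alpha> - real CARD('n))"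
    unfolding comm_kernel_def a_def c_def left_diff_distrib[symmetric] abs_mult by simp
  also have "\<dots> \<le> real m * e * (2 * M + 1) ^ (m - 1) * ((1 + a') ^ m + (1 + d') ^ m) * norm (x - y) powr (\<alpha> - real CARD('n))"
    using le by (intro mult_right_mono) auto
  also have "\<dots> = (real m * e * (2 * M + 1) ^ (m - 1)) * (osc_kernel \<alpha> m (\<lambda>x. b x / M) x y + osc_kernel \<alpha> m (\<lambda>x. (b x - \<phi> x) / e) x y)"
    by (simp add: osc_kernel_def a'_def d'_def algebra_simps)
  finally show ?thesis .
qed

lemma locally_integrable_cmult: "locally_integrable b \<Longrightarrow> locally_integrable (\<lambda>x. b x / M)"
  unfolding locally_integrable_def by (simp add: divide_inverse)

lemma bmo_norm_scale:
  assumes b: "locally_integrable (b :: real^'n \<Rightarrow> real)" and M: "M > 0" and le: "bmo_norm b \<le> ennreal M"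
  shows "bmo_norm (\<lambda>x. b x / M) \<le> 1"
  unfolding bmo_norm_def
proof (rule SUP_least)
  fix Q :: "(real^'n) set" assume "Q \<in> {Q. cube Q}"
  then have Q: "cube Q" by simp
  define X where "X = (1 / measure lebesgue Q) * (LINT x:Q|lebesgue. \<bar>b x - avg b Q\<bar>)"
  have "ennreal X \<le> bmo_norm b" unfolding bmo_norm_def X_def by (rule SUP_upper) (use Q in simp)
  then have "ennreal X \<le> ennreal M" using le by (rule order_trans)
  then have XM: "X \<le> M" using M by (simp add: ennreal_le_iff)
  have av: "avg (\<lambda>x. b x / M) Q = avg b Q / M" by (simp add: avg_def)
  have "(1 / measure lebesgue Q) * (LINT x:Q|lebesgue. \<bar>b x / M - avg (\<lambda>x. b x / M) Q\<bar>) = X / M"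
    unfolding av X_def using M by (simp add: diff_divide_distrib[symmetric] abs_divide)
  moreover have "X / M \<le> 1" using XM M by (simp add: divide_le_eq)
  ultimately show "ennreal ((1 / measure lebesgue Q) * (LINT x:Q|lebesgue. \<bar>b x / M - avg (\<lambda>x. b x / M) Q\<bar>)) \<le> 1"
    by (simp add: ennreal_le_1)
qed

lemma bmo_norm_zero: "bmo_norm (\<lambda>x. 0) \<le> 1" and locally_integrable_zero: "locally_integrable (\<lambda>x. 0)"
  unfolding bmo_norm_def avg_def locally_integrable_def set_lebesgue_integral_def set_integrable_def
  by (auto intro!: SUP_least)

context two_weight
begin

text \<open>With f = |F| v^(1/p) / A^(1/p) and w = v^(-1/p), the product f w is |F| / A^(1/p), which
  reduces the claim to the normalised bound. One constant serves all symbols of norm at most 1; the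
  approximation of \<open>b\<close> relies on this uniformity.\<close>

lemma opb_osc_kernel:
  "\<exists>C. \<forall>b. locally_integrable b \<longrightarrow> bmo_norm b \<le> 1 \<longrightarrow> opb p v q u (osc_kernel \<alpha> m b) C"
proof -
  define w where "w x = v x powr (-1/p)" for x
  define z where "z x = u x powr (1/q)" for x
  obtain K where "bump_data \<alpha> p q s \<delta> K m (\<lambda>x. v x powr (-1/p)) (\<lambda>x. u x powr (1/q))" by (rule bump_dataE)
  then interpret bd: bump_data \<alpha> p q s \<delta> K m w z unfolding w_def z_def .
  have "opb p v q u (osc_kernel \<alpha> m b) (bd.ker_C powr q)" if li: "locally_integrable b" and bn: "bmo_norm b \<le> 1" for b
    unfolding opb_def
  proof (intro conjI allI impI)
    fix F :: "real^'n \<Rightarrow> real" and A :: real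
    assume F [measurable]: "F \<in> borel_measurable lebesgue" and A: "A > 0" and FA: "(\<integral>\<^sup>+y. ennreal (\<bar>F y\<bar> powr p * v y) \<partial>lebesgue) \<le> ennreal A"
    note [measurable] = locally_integrable_measurable[OF li]
    define f where "f y = \<bar>F y\<bar> * v y powr (1/p) / A powr (1/p)" for y
    have [measurable]: "f \<in> borel_measurable lebesgue" unfolding f_def by measurable
    have f0: "f y \<ge> 0" for y by (simp add: f_def)
    have "(\<integral>\<^sup>+y. ennreal (f y powr p) \<partial>lebesgue) = (\<integral>\<^sup>+y. ennreal (1/A) * ennreal (\<bar>F y\<bar> powr p * v y) \<partial>lebesgue)"
      using A p v0 by (intro nn_integral_cong) (simp add: f_def powr_divide powr_mult powr_powr ennreal_mult'[symmetric])
    also have "\<dots> = ennreal (1/A) * (\<integral>\<^sup>+y. ennreal (\<bar>F y\<bar> powr p * v y) \<partial>lebesgue)" by (rule nn_integral_cmult) measurable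
    also have "\<dots> \<le> ennreal (1/A) * ennreal A" by (intro mult_left_mono FA) simp
    also have "\<dots> = ennreal 1" using A by (simp add: ennreal_mult'[symmetric])
    finally have f1: "(\<integral>\<^sup>+y. ennreal (f y powr p) \<partial>lebesgue) \<le> ennreal 1" .
    note sb = bd.strong_bound[OF li bn _ f0 f1]
    let ?T = "bd.Tp b (\<lambda>y. f y * w y)"
    have po: "pos_op (osc_kernel \<alpha> m b) F x = ennreal (A powr (1/p)) * ?T x" for x
    proof -
      have "pos_op (osc_kernel \<alpha> m b) F x = (\<integral>\<^sup>+y. ennreal (A powr (1/p)) * ennreal (osc_kernel \<alpha> m b x y * (f y * w y)) \<partial>lebesgue)"
        unfolding pos_op_def using vpos
      proof (intro nn_integral_cong_AE, eventually_elim)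
        fix y assume "v y > 0"
        then have eq1: "v y powr (1/p) * v y powr (-1/p) = 1" by (simp add: powr_add[symmetric])
        have eq2: "A powr (1/p) * (osc_kernel \<alpha> m b x y * (f y * w y)) = osc_kernel \<alpha> m b x y * \<bar>F y\<bar> * (v y powr (1/p) * v y powr (-1/p))"
          using A by (simp add: f_def w_def)
        have "\<bar>osc_kernel \<alpha> m b x y\<bar> * \<bar>F y\<bar> = A powr (1/p) * (osc_kernel \<alpha> m b x y * (f y * w y))"
          unfolding eq2 eq1 by simp
        then have "ennreal (\<bar>osc_kernel \<alpha> m b x y\<bar> * \<bar>F y\<bar>) = ennreal (A powr (1/p) * (osc_kernel \<alpha> m b x y * (f y * w y)))"
          by (rule arg_cong)
        also have "\<dots> = ennreal (A powr (1/p)) * ennreal (osc_kernel \<alpha> m b x y * (f y * w y))"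
          by (rule ennreal_mult') simp
        finally show "ennreal (\<bar>osc_kernel \<alpha> m b x y\<bar> * \<bar>F y\<bar>) = ennreal (A powr (1/p)) * ennreal (osc_kernel \<alpha> m b x y * (f y * w y))" .
      qed
      also have "\<dots> = ennreal (A powr (1/p)) * ?T x" unfolding bd.Tp_def by (rule nn_integral_cmult) measurable
      finally show ?thesis .
    qed
    have up: "u x > 0 \<Longrightarrow> z x > 0" for x by (simp add: z_def)
    show "AE x in lebesgue. u x > 0 \<longrightarrow> pos_op (osc_kernel \<alpha> m b) F x < \<infinity>"
      using sb(1) by (simp add: po) (auto elim!: eventually_mono simp: ennreal_mult_less_top up)
    have "(\<integral>\<^sup>+x. ennreal (enn2real (pos_op (osc_kernel \<alpha> m b) F x) powr q * u x) \<partial>lebesgue)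
      = (\<integral>\<^sup>+x. ennreal (A powr (q/p)) * ennreal ((enn2real (?T x) * z x) powr q) \<partial>lebesgue)"
      using qs u0 by (intro nn_integral_cong) (simp add: po enn2real_mult powr_mult powr_powr z_def ennreal_mult'[symmetric] mult_ac)
    also have "\<dots> = ennreal (A powr (q/p)) * (\<integral>\<^sup>+x. ennreal ((enn2real (?T x) * z x) powr q) \<partial>lebesgue)"
      by (rule nn_integral_cmult) measurable
    also have "\<dots> \<le> ennreal (A powr (q/p)) * ennreal (bd.ker_C powr q)" by (intro mult_left_mono sb(2)) simp_all
    also have "\<dots> = ennreal (bd.ker_C powr q * A powr (q/p))" by (simp add: ennreal_mult'[symmetric] mult.commute)
    finally show "(\<integral>\<^sup>+x. ennreal (enn2real (pos_op (osc_kernel \<alpha> m b) F x) powr q * u x) \<partial>lebesgue) \<le> ennreal (bd.ker_C powr q * A powr (q/p))" .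
  qed simp
  then show ?thesis by blast
qed

text \<open>Such an operator multiplies \<open>h\<close> by a number, which Hoelder's inequality in
  \<open>y\<close> controls.\<close>

lemma opb_tensor:
  assumes h [measurable]: "h \<in> borel_measurable lebesgue" and g [measurable]: "g \<in> borel_measurable lebesgue"
    and H: "H \<ge> 0" "(\<integral>\<^sup>+x. ennreal (\<bar>h x\<bar> powr q * u x) \<partial>lebesgue) \<le> ennreal H"
    and W: "W \<ge> 0" "(\<integral>\<^sup>+y. ennreal ((\<bar>g y\<bar> * v y powr (-1/p)) powr conj_exp p) \<partial>lebesgue) \<le> ennreal W"
  shows "opb p v q u (\<lambda>x y. h x * g y) (H * W powr (q / conj_exp p))"
  unfolding opb_def
proof (intro conjI allI impI)
  show "H * W powr (q / conj_exp p) \<ge> 0" using H by simp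
  fix F :: "real^'n \<Rightarrow> real" and A :: real
  assume F [measurable]: "F \<in> borel_measurable lebesgue" and A: "A > 0" and FA: "(\<integral>\<^sup>+y. ennreal (\<bar>F y\<bar> powr p * v y) \<partial>lebesgue) \<le> ennreal A"
  define I where "I = (\<integral>\<^sup>+y. ennreal (\<bar>g y\<bar> * \<bar>F y\<bar>) \<partial>lebesgue)"
  have Ile: "I \<le> ennreal (A powr (1/p) * W powr (1/conj_exp p))"
    unfolding I_def by (rule weighted_Hoelder) (use A FA W in auto)
  then have "I < \<infinity>" by (rule le_less_trans) simp
  then obtain i where i: "I = ennreal i" "i \<ge> 0" by (cases I) auto
  have ile: "i \<le> A powr (1/p) * W powr (1/conj_exp p)" using Ile i by (simp add: ennreal_le_iff)
  have po: "pos_op (\<lambda>x y. h x * g y) F x = ennreal (\<bar>h x\<bar> * i)" for x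
  proof -
    have "pos_op (\<lambda>x y. h x * g y) F x = (\<integral>\<^sup>+y. ennreal \<bar>h x\<bar> * ennreal (\<bar>g y\<bar> * \<bar>F y\<bar>) \<partial>lebesgue)"
      unfolding pos_op_def by (simp add: ennreal_mult'[symmetric] abs_mult mult.assoc)
    also have "\<dots> = ennreal \<bar>h x\<bar> * I" unfolding I_def by (rule nn_integral_cmult) measurable
    finally show ?thesis using i by (simp add: ennreal_mult')
  qed
  show "AE x in lebesgue. u x > 0 \<longrightarrow> pos_op (\<lambda>x y. h x * g y) F x < \<infinity>" by (simp add: po)
  have "(\<integral>\<^sup>+x. ennreal (enn2real (pos_op (\<lambda>x y. h x * g y) F x) powr q * u x) \<partial>lebesgue)
    = (\<integral>\<^sup>+x. ennreal (i powr q) * ennreal (\<bar>h x\<bar> powr q * u x) \<partial>lebesgue)"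
    using i by (intro nn_integral_cong) (simp add: po powr_mult, subst ennreal_mult'[symmetric], auto simp: mult_ac)
  also have "\<dots> = ennreal (i powr q) * (\<integral>\<^sup>+x. ennreal (\<bar>h x\<bar> powr q * u x) \<partial>lebesgue)" by (rule nn_integral_cmult) measurable
  also have "\<dots> \<le> ennreal ((A powr (1/p) * W powr (1/conj_exp p)) powr q) * ennreal H"
    using ile i qs H by (intro mult_mono ennreal_leI powr_mono2) auto
  also have "\<dots> = ennreal (H * W powr (q / conj_exp p) * A powr (q/p))"
    using H W A by (simp add: ennreal_mult'[symmetric] powr_mult powr_powr mult_ac)
  finally show "(\<integral>\<^sup>+x. ennreal (enn2real (pos_op (\<lambda>x y. h x * g y) F x) powr q * u x) \<partial>lebesgue) \<le> ennreal (H * W powr (q / conj_exp p) * A powr (q/p))" .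
qed

end

section \<open>Decay at infinity\<close>

lemma nn_integral_tail_small:
  fixes G :: "'a::euclidean_space \<Rightarrow> ennreal"
  assumes [measurable]: "G \<in> borel_measurable lebesgue"
    and fin: "(\<integral>\<^sup>+x. G x * indicator {x. norm x > R1} x \<partial>lebesgue) < \<infinity>" and e: "e > 0"
  shows "\<exists>R\<ge>max 1 R0. (\<integral>\<^sup>+x. G x * indicator {x. norm x > R} x \<partial>lebesgue) \<le> ennreal e"
proof -
  define f where "f N x = G x * indicator {x. norm x > R1 + real N} x" for N :: nat and x :: 'a
  have [measurable]: "{x::'a. norm x > t} \<in> sets lebesgue" for t
  proof -
    have "open {x::'a. norm x > t}" by (rule open_Collect_less) (auto intro!: continuous_intros)
    then show ?thesis by simp
  qed
  have [measurable]: "f N \<in> borel_measurable lebesgue" for N unfolding f_def by measurable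
  have "(\<lambda>N. \<integral>\<^sup>+x. f N x \<partial>lebesgue) \<longlonglongrightarrow> (\<integral>\<^sup>+x. 0 \<partial>(lebesgue :: 'a measure))"
  proof (rule nn_integral_dominated_convergence[where w="\<lambda>x. G x * indicator {x. norm x > R1} x"])
    show "AE x in lebesgue. f N x \<le> G x * indicator {x. norm x > R1} x" for N
      by (rule AE_I2) (auto simp: f_def indicator_def)
    show "AE x in lebesgue. (\<lambda>N. f N x) \<longlonglongrightarrow> 0"
    proof (rule AE_I2)
      fix x :: 'a
      obtain K :: nat where K: "norm x - R1 < real K" using reals_Archimedean2 by blast
      show "(\<lambda>N. f N x) \<longlonglongrightarrow> 0"
        by (rule tendsto_eventually, rule eventually_sequentiallyI[of K]) (use K in \<open>auto simp: f_def indicator_def\<close>)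
    qed
  qed (use fin in auto)
  then have "(\<lambda>N. \<integral>\<^sup>+x. f N x \<partial>lebesgue) \<longlonglongrightarrow> 0" by simp
  then have "eventually (\<lambda>N. (\<integral>\<^sup>+x. f N x \<partial>lebesgue) < ennreal e) sequentially"
    using e by (intro order_tendstoD(2)) auto
  then obtain N where N: "(\<integral>\<^sup>+x. f N x \<partial>lebesgue) < ennreal e" by (auto simp: eventually_sequentially)
  define R where "R = max (max 1 R0) (R1 + real N)"
  have "(\<integral>\<^sup>+x. G x * indicator {x. norm x > R} x \<partial>lebesgue) \<le> (\<integral>\<^sup>+x. f N x \<partial>lebesgue)"
    unfolding f_def R_def by (intro nn_integral_mono) (auto simp: indicator_def)
  also have "\<dots> \<le> ennreal e" using N by simp
  finally show ?thesis by (intro exI[of _ R]) (auto simp: R_def)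
qed

context two_weight
begin

text \<open>t^(p'-1) * w^p' with w = v^(-1/p) is the extremal function of Hoelder's inequality: its
  weighted p-th power is (t w)^p', which is also its product with \<open>t\<close>. It serves as
  test function in \<open>tail_u\<close> and \<open>tail_w\<close>.\<close>

lemma weight_dual:
  assumes "v y > 0" "t \<ge> 0"
  shows "(t powr (conj_exp p - 1) * (v y powr (-1/p)) powr conj_exp p) powr p * v y = (t * v y powr (-1/p)) powr conj_exp p"
proof -
  have e1: "(conj_exp p - 1) * p = conj_exp p" using p by (simp add: conj_exp_def field_simps)
  have "(v y powr (-1/p)) powr (conj_exp p * p) * v y = v y powr (- conj_exp p + 1)"
    unfolding powr_add using assms p by (simp add: powr_powr)
  also have "- conj_exp p + 1 = -1/p * conj_exp p" using e1 p by (simp add: field_simps)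
  finally have e2: "(v y powr (-1/p)) powr (conj_exp p * p) * v y = (v y powr (-1/p)) powr conj_exp p" by (simp add: powr_powr)
  have "(t powr (conj_exp p - 1) * (v y powr (-1/p)) powr conj_exp p) powr p * v y = t powr ((conj_exp p - 1) * p) * ((v y powr (-1/p)) powr (conj_exp p * p) * v y)"
    using assms by (simp add: powr_mult powr_powr)
  then show ?thesis unfolding e1 e2 using assms by (simp add: powr_mult)
qed

text \<open>For b = 0 the oscillation factor is 1, so the bound for normalised symbols contains the
  one for I_\<alpha>.\<close>

lemma frac_kernel_bounded: obtains C where "opb p v q u (\<lambda>x y. norm (x - y) powr (- (real CARD('n) - \<alpha>))) C"
proof -
  obtain C where "\<forall>b. locally_integrable b \<longrightarrow> bmo_norm b \<le> 1 \<longrightarrow> opb p v q u (osc_kernel \<alpha> m b) C"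
    using opb_osc_kernel by blast
  then have "opb p v q u (osc_kernel \<alpha> m (\<lambda>x. 0)) C" using bmo_norm_zero locally_integrable_zero by blast
  then show ?thesis using that by (simp add: osc_kernel_def[abs_def])
qed

lemma gt_set [measurable]: "{x::real^'n. norm x > t} \<in> sets lebesgue"
proof -
  have "open {x::real^'n. norm x > t}" by (rule open_Collect_less) (auto intro!: continuous_intros)
  then show ?thesis by simp
qed

text \<open>Test I_\<alpha> on v^(-p'/p) restricted to the unit ball. For |x| > 1 and y in the ball,
  |x - y| \<le> 2 |x|, so the image at x is at least a positive multiple of |x|^(\<alpha> - n), and
  boundedness controls its integral against \<open>u\<close>.\<close>

lemma tail_u:
  "(\<integral>\<^sup>+x. ennreal ((norm x powr (- (real CARD('n) - \<alpha>))) powr q * u x) * indicator {x. norm x > 1} x \<partial>lebesgue) < \<infinity>"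
proof -
  let ?\<beta> = "real CARD('n) - \<alpha>" and ?p' = "conj_exp p"
  note cp = conj_exp_props[OF p(1)]
  define K where "K = cball (0::real^'n) 1"
  have [measurable]: "K \<in> sets lebesgue" by (simp add: K_def)
  obtain C where C: "opb p v q u (\<lambda>x y. norm (x - y) powr (- ?\<beta>)) C" by (rule frac_kernel_bounded)
  define F where "F y = indicator K y powr (?p' - 1) * (v y powr (-1/p)) powr ?p'" for y
  have Fm [measurable]: "F \<in> borel_measurable lebesgue" unfolding F_def by measurable
  have F0: "F y \<ge> 0" for y by (simp add: F_def)
  define I where "I = (\<integral>\<^sup>+y\<in>K. ennreal ((v y powr (-1/p)) powr ?p') \<partial>lebesgue)"
  have "I < \<infinity>" unfolding I_def K_def by (rule u_w_bounded_finite(2)) simp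
  then obtain a where a: "I = ennreal a" "a \<ge> 0" by (cases I) auto
  have "I \<noteq> 0"
  proof
    assume "I = 0"
    then have "AE y in lebesgue. ennreal ((v y powr (-1/p)) powr ?p') * indicator K y = 0"
      unfolding I_def by (subst (asm) nn_integral_0_iff_AE) auto
    with vpos have "AE y in lebesgue. y \<notin> K"
      by eventually_elim (auto simp: indicator_def ennreal_eq_0_iff)
    then have "K \<in> null_sets lebesgue" by (subst AE_iff_null_sets) auto
    then have "negligible K" by (simp add: negligible_iff_null_sets)
    then show False using negligible_imp_measure0[of K] content_cball_pos[of 1 "0::real^'n"] by (simp add: K_def)
  qed
  then have a0: "a > 0" using a by (cases "a = 0") auto
  have FI: "(\<integral>\<^sup>+y. ennreal (\<bar>F y\<bar> powr p * v y) \<partial>lebesgue) = I"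
    unfolding I_def using vpos
  proof (intro nn_integral_cong_AE, eventually_elim)
    fix y assume "v y > 0"
    then have "\<bar>F y\<bar> powr p * v y = (indicator K y * v y powr (-1/p)) powr ?p'"
      unfolding F_def abs_of_nonneg[OF mult_nonneg_nonneg[OF powr_ge_zero powr_ge_zero]] by (intro weight_dual) auto
    then show "ennreal (\<bar>F y\<bar> powr p * v y) = ennreal ((v y powr (-1/p)) powr ?p') * indicator K y"
      using cp by (auto simp: indicator_def)
  qed
  note D = opbD[OF C Fm a0, unfolded FI a(1), OF order_refl]
  have low: "ennreal ((2 * norm x) powr (- ?\<beta>) * a) \<le> pos_op (\<lambda>x y. norm (x - y) powr (- ?\<beta>)) F x" if x: "norm x > 1" for x
  proof -
    have "ennreal ((2 * norm x) powr (- ?\<beta>) * a) = ennreal ((2 * norm x) powr (- ?\<beta>)) * I"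
      by (simp add: a(1) ennreal_mult')
    also have "\<dots> = (\<integral>\<^sup>+y. ennreal ((2 * norm x) powr (- ?\<beta>)) * (ennreal ((v y powr (-1/p)) powr ?p') * indicator K y) \<partial>lebesgue)"
      unfolding I_def by (rule nn_integral_cmult[symmetric]) measurable
    also have "\<dots> \<le> pos_op (\<lambda>x y. norm (x - y) powr (- ?\<beta>)) F x"
      unfolding pos_op_def
    proof (intro nn_integral_mono)
      fix y
      show "ennreal ((2 * norm x) powr (- ?\<beta>)) * (ennreal ((v y powr (-1/p)) powr ?p') * indicator K y) \<le> ennreal (\<bar>norm (x - y) powr (- ?\<beta>)\<bar> * \<bar>F y\<bar>)"
      proof (cases "y \<in> K")
        case True
        then have y: "norm y \<le> 1" by (simp add: K_def)
        have "norm (x - y) \<le> 2 * norm x" using norm_triangle_ineq4[of x y] x y by linarith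
        moreover have "norm (x - y) > 0" using x y by auto
        ultimately have "(2 * norm x) powr (- ?\<beta>) \<le> norm (x - y) powr (- ?\<beta>)" using \<alpha> by (intro powr_mono2') auto
        then have "(2 * norm x) powr (- ?\<beta>) * ((v y powr (-1/p)) powr ?p') \<le> norm (x - y) powr (- ?\<beta>) * ((v y powr (-1/p)) powr ?p')"
          by (intro mult_right_mono) auto
        then show ?thesis using True F0[of y] by (simp add: F_def ennreal_mult'[symmetric] ennreal_leI)
      qed auto
    qed
    finally show ?thesis .
  qed
  define c where "c = (2 powr (- ?\<beta>) * a) powr q"
  have c0: "c > 0" using a0 by (simp add: c_def)
  have "ennreal c * (\<integral>\<^sup>+x. ennreal ((norm x powr (- ?\<beta>)) powr q * u x) * indicator {x. norm x > 1} x \<partial>lebesgue)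
    = (\<integral>\<^sup>+x. ennreal c * (ennreal ((norm x powr (- ?\<beta>)) powr q * u x) * indicator {x. norm x > 1} x) \<partial>lebesgue)"
    by (rule nn_integral_cmult[symmetric]) measurable
  also have "\<dots> \<le> (\<integral>\<^sup>+x. ennreal (enn2real (pos_op (\<lambda>x y. norm (x - y) powr (- ?\<beta>)) F x) powr q * u x) \<partial>lebesgue)"
    using D(1)
  proof (intro nn_integral_mono_AE, eventually_elim)
    fix x assume fin: "u x > 0 \<longrightarrow> pos_op (\<lambda>x y. norm (x - y) powr (- ?\<beta>)) F x < \<infinity>"
    show "ennreal c * (ennreal ((norm x powr (- ?\<beta>)) powr q * u x) * indicator {x. norm x > 1} x) \<le> ennreal (enn2real (pos_op (\<lambda>x y. norm (x - y) powr (- ?\<beta>)) F x) powr q * u x)"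
    proof (cases "u x > 0 \<and> norm x > 1")
      case True
      then have "enn2real (ennreal ((2 * norm x) powr (- ?\<beta>) * a)) \<le> enn2real (pos_op (\<lambda>x y. norm (x - y) powr (- ?\<beta>)) F x)"
        using low[of x] fin by (intro enn2real_mono) auto
      then have "((2 * norm x) powr (- ?\<beta>) * a) powr q \<le> enn2real (pos_op (\<lambda>x y. norm (x - y) powr (- ?\<beta>)) F x) powr q"
        using a0 qs by (intro powr_mono2) auto
      moreover have "((2 * norm x) powr (- ?\<beta>) * a) powr q = c * (norm x powr (- ?\<beta>)) powr q"
        using a0 by (simp add: c_def powr_mult mult_ac)
      ultimately have "c * (norm x powr (- ?\<beta>)) powr q * u x \<le> enn2real (pos_op (\<lambda>x y. norm (x - y) powr (- ?\<beta>)) F x) powr q * u x"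
        using u0 by (intro mult_right_mono) auto
      then show ?thesis using True c0 by (simp add: ennreal_mult'[symmetric] ennreal_leI mult.assoc)
    next
      case False
      then show ?thesis using u0[of x] by (auto simp: indicator_def)
    qed
  qed
  also have "\<dots> < \<infinity>" by (rule le_less_trans[OF D(2)]) simp
  finally show ?thesis using c0 by (auto simp: ennreal_mult_less_top)
qed

text \<open>The dual of \<open>tail_u\<close>, obtained without an adjoint operator: test functions
  on annuli have images bounded below on a ball of positive \<open>u\<close>-mass. For the mass
  \<open>a\<close> of the annulus this says that a^q is at most a constant times a^(q/p), which
  bounds \<open>a\<close> uniformly in the outer radius.\<close>

lemma tail_w:
  "\<exists>R1. (\<integral>\<^sup>+y. ennreal ((norm y powr (- (real CARD('n) - \<alpha>)) * v y powr (-1/p)) powr conj_exp p) * indicator {y. norm y > R1} y \<partial>lebesgue) < \<infinity>"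
proof -
  let ?\<beta> = "real CARD('n) - \<alpha>" and ?p' = "conj_exp p"
  note cp = conj_exp_props[OF p(1)]
  obtain C where C: "opb p v q u (\<lambda>x y. norm (x - y) powr (- ?\<beta>)) C" by (rule frac_kernel_bounded)
  obtain n0 :: nat where n0: "emeasure lebesgue ({x. u x > 0} \<inter> cball 0 (real n0)) > 0" by (rule u_pos_ball)
  define R1 where "R1 = max 1 (real n0)"
  have R1: "R1 \<ge> 1" by (simp add: R1_def)
  define K where "K = cball (0::real^'n) R1"
  have [measurable]: "K \<in> sets lebesgue" by (simp add: K_def)
  define UU where "UU = (\<integral>\<^sup>+x\<in>K. ennreal (u x) \<partial>lebesgue)"
  have "UU < \<infinity>" unfolding UU_def K_def by (rule u_w_bounded_finite(1)) simp
  then obtain U where U: "UU = ennreal U" "U \<ge> 0" by (cases UU) auto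
  have "UU \<noteq> 0"
  proof
    assume "UU = 0"
    then have "AE x in lebesgue. ennreal (u x) * indicator K x = 0"
      unfolding UU_def by (subst (asm) nn_integral_0_iff_AE) auto
    then have "AE x in lebesgue. x \<notin> {x. u x > 0} \<inter> cball 0 (real n0)"
      by eventually_elim (auto simp: indicator_def ennreal_eq_0_iff K_def R1_def)
    then have "{x. u x > 0} \<inter> cball 0 (real n0) \<in> null_sets lebesgue" using u_pos_set by (subst AE_iff_null_sets) auto
    then show False using n0 by auto
  qed
  then have Up: "U > 0" using U by (cases "U = 0") auto
  \<comment> \<open>The solution for \<open>a\<close> of 2^(-\<beta> q) * a^q * U \<le> C * a^(q/p),
    by q - q/p = q/p'.\<close>
  define Bd where "Bd = (C * 2 powr (?\<beta> * q) / U) powr (?p' / q)"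
  \<comment> \<open>The outer radius keeps the mass finite, as is needed before dividing by one of
    its powers.\<close>
  define X where "X N y = ennreal ((norm y powr (- ?\<beta>) * v y powr (-1/p)) powr ?p') * indicator {y. R1 < norm y \<and> norm y \<le> real N} y" for N :: nat and y :: "real^'n"
  have sets_ann [measurable]: "{y::real^'n. R1 < norm y \<and> norm y \<le> real N} \<in> sets lebesgue" for N :: nat
  proof -
    have "{y::real^'n. R1 < norm y \<and> norm y \<le> real N} = {y. norm y > R1} \<inter> cball 0 (real N)" by auto
    then show ?thesis by simp
  qed
  have [measurable]: "X N \<in> borel_measurable lebesgue" for N unfolding X_def by measurable
  have XB: "(\<integral>\<^sup>+y. X N y \<partial>lebesgue) \<le> ennreal Bd" for N
  proof -
    define t where "t y = norm y powr (- ?\<beta>) * indicator {y. R1 < norm y \<and> norm y \<le> real N} y" for y :: "real^'n"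
    have [measurable]: "t \<in> borel_measurable lebesgue" unfolding t_def by measurable
    have t0: "t y \<ge> 0" for y by (simp add: t_def)
    have t1: "t y \<le> indicator (cball 0 (real N)) y" for y
    proof -
      have "norm y powr (- ?\<beta>) \<le> 1" if "norm y > R1"
        using that R1 \<alpha> powr_mono2'[of "- ?\<beta>" 1 "norm y"] by simp
      then show ?thesis by (auto simp: t_def indicator_def)
    qed
    have Xt: "X N y = ennreal ((t y * v y powr (-1/p)) powr ?p')" for y
      using cp by (auto simp: X_def t_def indicator_def)
    have "(\<integral>\<^sup>+y. X N y \<partial>lebesgue) \<le> (\<integral>\<^sup>+y\<in>cball 0 (real N). ennreal ((v y powr (-1/p)) powr ?p') \<partial>lebesgue)"
    proof (intro nn_integral_mono)
      fix y
      have "(t y * v y powr (-1/p)) powr ?p' \<le> (indicator (cball 0 (real N)) y * v y powr (-1/p)) powr ?p'"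
        using t0[of y] t1[of y] cp by (intro powr_mono2 mult_right_mono) auto
      then show "X N y \<le> ennreal ((v y powr (-1/p)) powr ?p') * indicator (cball 0 (real N)) y"
        using cp unfolding Xt by (auto simp: indicator_def intro!: ennreal_leI)
    qed
    also have "\<dots> < \<infinity>" by (rule u_w_bounded_finite(2)) simp
    finally obtain a where a: "(\<integral>\<^sup>+y. X N y \<partial>lebesgue) = ennreal a" "a \<ge> 0"
      by (cases "\<integral>\<^sup>+y. X N y \<partial>lebesgue") auto
    show ?thesis
    proof (cases "a = 0")
      case True
      then show ?thesis using a by simp
    next
      case False
      then have a0: "a > 0" using a by simp
      define F where "F y = t y powr (?p' - 1) * (v y powr (-1/p)) powr ?p'" for y
      have Fm [measurable]: "F \<in> borel_measurable lebesgue" unfolding F_def by measurable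
      have F0: "F y \<ge> 0" for y by (simp add: F_def)
      have FI: "(\<integral>\<^sup>+y. ennreal (\<bar>F y\<bar> powr p * v y) \<partial>lebesgue) = ennreal a"
        unfolding a(1)[symmetric] Xt using vpos
      proof (intro nn_integral_cong_AE, eventually_elim)
        fix y assume "v y > 0"
        then show "ennreal (\<bar>F y\<bar> powr p * v y) = ennreal ((t y * v y powr (-1/p)) powr ?p')"
          unfolding F_def abs_of_nonneg[OF mult_nonneg_nonneg[OF powr_ge_zero powr_ge_zero]]
          using t0[of y] by (subst weight_dual) auto
      qed
      note D = opbD[OF C Fm a0, unfolded FI, OF order_refl]
      have low: "ennreal (2 powr (- ?\<beta>) * a) \<le> pos_op (\<lambda>x y. norm (x - y) powr (- ?\<beta>)) F x" if x: "x \<in> K" for x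
      proof -
        have "ennreal (2 powr (- ?\<beta>) * a) = ennreal (2 powr (- ?\<beta>)) * (\<integral>\<^sup>+y. X N y \<partial>lebesgue)"
          by (simp add: a(1) ennreal_mult')
        also have "\<dots> = (\<integral>\<^sup>+y. ennreal (2 powr (- ?\<beta>)) * X N y \<partial>lebesgue)" by (rule nn_integral_cmult[symmetric]) measurable
        also have "\<dots> \<le> pos_op (\<lambda>x y. norm (x - y) powr (- ?\<beta>)) F x"
          unfolding pos_op_def
        proof (intro nn_integral_mono)
          fix y
          show "ennreal (2 powr (- ?\<beta>)) * X N y \<le> ennreal (\<bar>norm (x - y) powr (- ?\<beta>)\<bar> * \<bar>F y\<bar>)"
          proof (cases "R1 < norm y \<and> norm y \<le> real N")
            case True
            have xn: "norm x \<le> R1" using x by (simp add: K_def)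
            have "norm (x - y) \<le> 2 * norm y" using norm_triangle_ineq4[of x y] xn True by linarith
            moreover have "norm (x - y) > 0" using xn True by auto
            ultimately have "(2 * norm y) powr (- ?\<beta>) \<le> norm (x - y) powr (- ?\<beta>)" using \<alpha> by (intro powr_mono2') auto
            then have "2 powr (- ?\<beta>) * t y \<le> norm (x - y) powr (- ?\<beta>)" using True by (simp add: t_def powr_mult)
            then have "2 powr (- ?\<beta>) * t y * F y \<le> norm (x - y) powr (- ?\<beta>) * F y" using F0 by (intro mult_right_mono) auto
            moreover have "t y * F y = (t y * v y powr (-1/p)) powr ?p'"
              using t0[of y] powr_mult_base[of "t y" "?p' - 1"] by (simp add: F_def powr_mult mult.assoc[symmetric])
            ultimately have "2 powr (- ?\<beta>) * (t y * v y powr (-1/p)) powr ?p' \<le> norm (x - y) powr (- ?\<beta>) * F y" by (simp add: mult.assoc)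
            then show ?thesis unfolding Xt using F0[of y] by (simp add: ennreal_mult'[symmetric] ennreal_leI)
          qed (simp add: X_def)
        qed
        finally show ?thesis .
      qed
      have "ennreal ((2 powr (- ?\<beta>) * a) powr q * U) = ennreal ((2 powr (- ?\<beta>) * a) powr q) * (\<integral>\<^sup>+x\<in>K. ennreal (u x) \<partial>lebesgue)"
        unfolding UU_def[symmetric] U(1) by (simp add: ennreal_mult')
      also have "\<dots> = (\<integral>\<^sup>+x. ennreal ((2 powr (- ?\<beta>) * a) powr q) * (ennreal (u x) * indicator K x) \<partial>lebesgue)"
        by (rule nn_integral_cmult[symmetric]) measurable
      also have "\<dots> \<le> (\<integral>\<^sup>+x. ennreal (enn2real (pos_op (\<lambda>x y. norm (x - y) powr (- ?\<beta>)) F x) powr q * u x) \<partial>lebesgue)"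
        using D(1)
      proof (intro nn_integral_mono_AE, eventually_elim)
        fix x assume fin: "u x > 0 \<longrightarrow> pos_op (\<lambda>x y. norm (x - y) powr (- ?\<beta>)) F x < \<infinity>"
        show "ennreal ((2 powr (- ?\<beta>) * a) powr q) * (ennreal (u x) * indicator K x) \<le> ennreal (enn2real (pos_op (\<lambda>x y. norm (x - y) powr (- ?\<beta>)) F x) powr q * u x)"
        proof (cases "u x > 0 \<and> x \<in> K")
          case True
          then have "enn2real (ennreal (2 powr (- ?\<beta>) * a)) \<le> enn2real (pos_op (\<lambda>x y. norm (x - y) powr (- ?\<beta>)) F x)"
            using low[of x] fin by (intro enn2real_mono) auto
          then have "(2 powr (- ?\<beta>) * a) powr q \<le> enn2real (pos_op (\<lambda>x y. norm (x - y) powr (- ?\<beta>)) F x) powr q"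
            using a0 qs by (intro powr_mono2) auto
          then have "(2 powr (- ?\<beta>) * a) powr q * u x \<le> enn2real (pos_op (\<lambda>x y. norm (x - y) powr (- ?\<beta>)) F x) powr q * u x"
            using u0 by (intro mult_right_mono) auto
          then show ?thesis using True by (simp add: ennreal_mult'[symmetric] ennreal_leI)
        next
          case False
          then show ?thesis using u0[of x] by (auto simp: indicator_def)
        qed
      qed
      also have "\<dots> \<le> ennreal (C * a powr (q/p))" by (rule D(2))
      finally have "(2 powr (- ?\<beta>) * a) powr q * U \<le> C * a powr (q/p)"
        using D(3) by (subst (asm) ennreal_le_iff) auto
      moreover have "(2 powr (- ?\<beta>) * a) powr q = 2 powr (- ?\<beta> * q) * a powr q" using a0 by (simp add: powr_mult powr_powr)
      moreover have "a powr q = a powr (q/?p') * a powr (q/p)"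
      proof -
        have "q/?p' + q/p = q * (1/p + 1/?p')" by (simp add: algebra_simps)
        then have "q/?p' + q/p = q" using cp(2) by simp
        then show ?thesis by (simp add: powr_add[symmetric])
      qed
      ultimately have "(2 powr (- ?\<beta> * q) * a powr (q/?p') * U) * a powr (q/p) \<le> C * a powr (q/p)" by (simp add: mult_ac)
      then have "2 powr (- ?\<beta> * q) * a powr (q/?p') * U \<le> C"
        by (rule mult_right_le_imp_le) (use a0 in auto)
      moreover define P where "P = (2::real) powr (?\<beta> * q)"
      moreover define P' where "P' = (2::real) powr (- ?\<beta> * q)"
      ultimately have le: "P' * a powr (q/?p') * U \<le> C" by simp
      have PP: "P * P' = 1" unfolding P_def P'_def powr_add[symmetric] by (simp add: algebra_simps)
      have "P \<ge> 0" by (simp add: P_def)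
      from mult_left_mono[OF le this] have "(P * P') * (a powr (q/?p') * U) \<le> C * P"
        by (simp only: mult_ac)
      then have "a powr (q/?p') * U \<le> C * 2 powr (?\<beta> * q)" unfolding PP by (simp add: P_def)
      then have "a powr (q/?p') \<le> C * 2 powr (?\<beta> * q) / U" using Up by (simp add: pos_le_divide_eq)
      then have "(a powr (q/?p')) powr (?p'/q) \<le> Bd" unfolding Bd_def using qs cp by (intro powr_mono2) auto
      then have "a \<le> Bd" using a0 qs cp by (simp add: powr_powr)
      then show ?thesis unfolding a(1) by (rule ennreal_leI)
    qed
  qed
  have inc: "incseq X"
    by (auto simp: incseq_def le_fun_def X_def indicator_def)
  have "(\<integral>\<^sup>+y. ennreal ((norm y powr (- ?\<beta>) * v y powr (-1/p)) powr ?p') * indicator {y. norm y > R1} y \<partial>lebesgue) = (\<integral>\<^sup>+y. (SUP N. X N y) \<partial>lebesgue)"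
  proof (intro nn_integral_cong antisym)
    fix y :: "real^'n"
    obtain N :: nat where N: "norm y \<le> real N" using real_arch_simple by blast
    have "ennreal ((norm y powr (- ?\<beta>) * v y powr (-1/p)) powr ?p') * indicator {y. norm y > R1} y = X N y"
      using N by (auto simp: X_def indicator_def)
    also have "\<dots> \<le> (SUP N. X N y)" by (rule SUP_upper) simp
    finally show "ennreal ((norm y powr (- ?\<beta>) * v y powr (-1/p)) powr ?p') * indicator {y. norm y > R1} y \<le> (SUP N. X N y)" .
    show "(SUP N. X N y) \<le> ennreal ((norm y powr (- ?\<beta>) * v y powr (-1/p)) powr ?p') * indicator {y. norm y > R1} y"
      by (rule SUP_least) (auto simp: X_def indicator_def)
  qed
  also have "\<dots> = (SUP N. \<integral>\<^sup>+y. X N y \<partial>lebesgue)" by (rule nn_integral_monotone_convergence_SUP[OF inc]) simp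
  also have "\<dots> \<le> ennreal Bd" by (rule SUP_least) (rule XB)
  finally have "(\<integral>\<^sup>+y. ennreal ((norm y powr (- ?\<beta>) * v y powr (-1/p)) powr ?p') * indicator {y. norm y > R1} y \<partial>lebesgue) < \<infinity>"
    by (rule le_less_trans) simp
  then show ?thesis by blast
qed

end

section \<open>Approximation by finite rank kernels\<close>

definition cutoff :: "real \<Rightarrow> real^'n \<Rightarrow> real" where
  "cutoff R x = max 0 (min 1 (2 - norm x / R))"

lemma cutoff_props:
  assumes "R > 0"
  shows "0 \<le> cutoff R x" "cutoff R x \<le> 1" "norm x \<le> R \<Longrightarrow> cutoff R x = 1" "norm x > 2 * R \<Longrightarrow> cutoff R x = 0"
  using assms by (auto simp: cutoff_def max_def min_def field_simps)

text \<open>Flattening the singularity by \<open>max\<close> keeps the kernel continuous, and the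
  cutoffs give it compact support; together they provide the uniform continuity on which finite rank
  approximation rests.\<close>

definition trunc_kernel :: "real \<Rightarrow> nat \<Rightarrow> (real^'n \<Rightarrow> real) \<Rightarrow> real \<Rightarrow> real \<Rightarrow> real^'n \<Rightarrow> real^'n \<Rightarrow> real" where
  "trunc_kernel \<alpha> m \<phi> R \<eta> x y =
     cutoff R x * cutoff R y * ((\<phi> x - \<phi> y) ^ m * max (norm (x - y)) \<eta> powr (\<alpha> - real CARD('n)))"

lemma continuous_cutoff: "R \<noteq> 0 \<Longrightarrow> continuous_on UNIV (cutoff R :: real^'n \<Rightarrow> real)"
  unfolding cutoff_def by (intro continuous_intros) auto

lemma continuous_trunc_kernel:
  fixes \<phi> :: "real^'n \<Rightarrow> real"
  assumes "continuous_on UNIV \<phi>" "R > 0" "\<eta> > 0"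
  shows "continuous_on UNIV (\<lambda>xy. trunc_kernel \<alpha> m \<phi> R \<eta> (fst xy) (snd xy))"
proof -
  have c: "continuous_on UNIV (\<lambda>xy :: (real^'n) \<times> (real^'n). g (fst xy))" "continuous_on UNIV (\<lambda>xy :: (real^'n) \<times> (real^'n). g (snd xy))"
    if "continuous_on UNIV g" for g :: "real^'n \<Rightarrow> real"
    by (auto intro!: continuous_on_compose2[OF that] continuous_intros)
  note cc = c[OF assms(1)] c[OF continuous_cutoff[of R]]
  have "continuous_on UNIV (\<lambda>xy :: (real^'n) \<times> (real^'n). max (norm (fst xy - snd xy)) \<eta> powr (\<alpha> - real CARD('n)))"
    using assms by (intro continuous_on_powr' continuous_intros) (auto simp: max_def)
  then show ?thesis unfolding trunc_kernel_def using cc assms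
    by (intro continuous_on_mult continuous_on_power continuous_on_diff) auto
qed

lemma joint_meas_trunc_kernel:
  fixes \<phi> :: "real^'n \<Rightarrow> real"
  assumes [measurable]: "\<phi> \<in> borel_measurable lebesgue" shows "joint_meas (trunc_kernel \<alpha> m \<phi> R \<eta>)"
  unfolding joint_meas_def trunc_kernel_def cutoff_def by measurable

context two_weight
begin

definition apx :: "(real^'n \<Rightarrow> real^'n \<Rightarrow> real) \<Rightarrow> bool" where
  "apx k \<longleftrightarrow> (\<forall>e>0. \<exists>N E \<psi> B M C. fin_rank E \<psi> B M \<and> C \<le> e \<and> opb p v q u (\<lambda>x y. k x y - rank_kernel N E \<psi> x y) C)"

lemma apx_closed:
  assumes jm: "joint_meas k"
    and ap: "\<And>e. e > 0 \<Longrightarrow> \<exists>k2 C. apx k2 \<and> joint_meas k2 \<and> C \<le> e \<and> opb p v q u (\<lambda>x y. k x y - k2 x y) C"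
  shows "apx k"
  unfolding apx_def
proof (intro allI impI)
  fix e :: real assume e: "e > 0"
  define c where "c = e / (2 * 2 powr q)"
  have c: "c > 0" using e by (simp add: c_def)
  obtain k2 C where k2: "apx k2" "joint_meas k2" "C \<le> c" "opb p v q u (\<lambda>x y. k x y - k2 x y) C" using ap[OF c] by blast
  obtain N E \<psi> B M C' where fr: "fin_rank E \<psi> B M" "C' \<le> c" "opb p v q u (\<lambda>x y. k2 x y - rank_kernel N E \<psi> x y) C'"
    using k2(1) c unfolding apx_def by blast
  have "opb p v q u (\<lambda>x y. (k x y - k2 x y) + (k2 x y - rank_kernel N E \<psi> x y)) (2 powr q * (C + C'))"
    by (rule opb_add[OF k2(4) fr(3)])
       (use joint_meas_diff[OF jm k2(2)] joint_meas_diff[OF k2(2) rank_kernel_joint_meas[OF fr(1)]] qs u0 in auto)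
  moreover have "2 powr q * (C + C') \<le> e"
  proof -
    have "2 powr q * (C + C') \<le> 2 powr q * (c + c)" using k2(3) fr(2) by (intro mult_left_mono add_mono) auto
    also have "\<dots> = e" by (simp add: c_def)
    finally show ?thesis .
  qed
  ultimately show "\<exists>N E \<psi> B M C. fin_rank E \<psi> B M \<and> C \<le> e \<and> opb p v q u (\<lambda>x y. k x y - rank_kernel N E \<psi> x y) C"
    using fr(1) by (intro exI[of _ N] exI[of _ E] exI[of _ \<psi>] exI[of _ B] exI[of _ M] exI[of _ "2 powr q * (C + C')"]) simp
qed

text \<open>On a bounded set \<open>u\<close> and v^(-p'/p) have finite integrals, so a small
  multiple of the indicator kernel has a small bound. Kernel errors that are uniformly small on a
  bounded set are thereby small as operators.\<close>

lemma bounded_tensor_small: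
  assumes S: "bounded S" "S \<in> sets lebesgue" and e: "e > 0"
  shows "\<exists>t>0. \<exists>C\<le>e. opb p v q u (\<lambda>x y. t * indicator S x * indicator S y) C"
proof -
  note [measurable] = S(2)
  note cp = conj_exp_props[OF p(1)]
  obtain U where U: "(\<integral>\<^sup>+x\<in>S. ennreal (u x) \<partial>lebesgue) = ennreal U" "U \<ge> 0"
    using u_w_bounded_finite(1)[OF S(1)] by (cases "\<integral>\<^sup>+x\<in>S. ennreal (u x) \<partial>lebesgue") auto
  obtain W where W: "(\<integral>\<^sup>+x\<in>S. ennreal ((v x powr (-1/p)) powr conj_exp p) \<partial>lebesgue) = ennreal W" "W \<ge> 0"
    using u_w_bounded_finite(2)[OF S(1)] by (cases "(\<integral>\<^sup>+x\<in>S. ennreal ((v x powr (-1/p)) powr conj_exp p) \<partial>lebesgue)") auto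
  define t where "t = (e / (U * W powr (q / conj_exp p) + 1)) powr (1/q)"
  have D: "U * W powr (q / conj_exp p) + 1 > 0" using U by (intro add_nonneg_pos mult_nonneg_nonneg) auto
  have t: "t > 0" "t powr q = e / (U * W powr (q / conj_exp p) + 1)" using e D qs by (auto simp: t_def powr_powr)
  have "opb p v q u (\<lambda>x y. (t * indicator S x) * indicator S y) (t powr q * U * W powr (q / conj_exp p))"
  proof (rule opb_tensor)
    have "(\<integral>\<^sup>+x. ennreal (\<bar>t * indicator S x\<bar> powr q * u x) \<partial>lebesgue) = (\<integral>\<^sup>+x. ennreal (t powr q) * (ennreal (u x) * indicator S x) \<partial>lebesgue)"
      using t qs by (intro nn_integral_cong) (auto simp: indicator_def ennreal_mult')
    also have "\<dots> = ennreal (t powr q) * ennreal U" unfolding U(1)[symmetric] by (rule nn_integral_cmult) measurable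
    finally show "(\<integral>\<^sup>+x. ennreal (\<bar>t * indicator S x\<bar> powr q * u x) \<partial>lebesgue) \<le> ennreal (t powr q * U)" by (simp add: ennreal_mult')
    have "(\<integral>\<^sup>+y. ennreal ((\<bar>indicator S y\<bar> * v y powr (-1/p)) powr conj_exp p) \<partial>lebesgue) = ennreal W"
      unfolding W(1)[symmetric] using cp by (intro nn_integral_cong) (auto simp: indicator_def)
    then show "(\<integral>\<^sup>+y. ennreal ((\<bar>indicator S y\<bar> * v y powr (-1/p)) powr conj_exp p) \<partial>lebesgue) \<le> ennreal W" by simp
  qed (use U W in auto)
  moreover have "t powr q * U * W powr (q / conj_exp p) \<le> e"
  proof -
    have "t powr q * U * W powr (q / conj_exp p) = e * ((U * W powr (q / conj_exp p)) / (U * W powr (q / conj_exp p) + 1))"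
      by (simp add: t(2))
    also have "\<dots> \<le> e * 1" using e D by (intro mult_left_mono) (auto simp: divide_le_eq_1)
    finally show ?thesis by simp
  qed
  ultimately show ?thesis using t(1) by blast
qed

context
  fixes \<phi> :: "real^'n \<Rightarrow> real"
  assumes cont: "continuous_on UNIV \<phi>" and cpt: "compact (closure {x. \<phi> x \<noteq> 0})"
begin

lemma phi_meas [measurable]: "\<phi> \<in> borel_measurable lebesgue"
  using borel_measurable_continuous_onI[OF cont] by (intro measurable_completion) simp

lemma phi_bounds:
  obtains R0 M where "R0 \<ge> 1" "M \<ge> 0" "\<And>x. norm x > R0 \<Longrightarrow> \<phi> x = 0" "\<And>x. \<bar>\<phi> x\<bar> \<le> M"
proof -
  have "bounded (closure {x. \<phi> x \<noteq> 0})" using cpt by (rule compact_imp_bounded)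
  then obtain R where R: "\<And>x. x \<in> closure {x. \<phi> x \<noteq> 0} \<Longrightarrow> norm x \<le> R" unfolding bounded_iff by blast
  have z: "\<phi> x = 0" if "norm x > max 1 R" for x
    using R[of x] that closure_subset[of "{x. \<phi> x \<noteq> 0}"] by force
  have "compact (\<phi> ` cball 0 (max 1 R))"
    by (intro compact_continuous_image continuous_on_subset[OF cont]) auto
  then obtain M where M: "\<And>y. y \<in> \<phi> ` cball 0 (max 1 R) \<Longrightarrow> norm y \<le> M"
    using compact_imp_bounded bounded_iff by metis
  have "\<bar>\<phi> x\<bar> \<le> max 0 M" for x
  proof (cases "norm x > max 1 R")
    case True
    then show ?thesis using z by simp
  next
    case False
    then have "\<phi> x \<in> \<phi> ` cball 0 (max 1 R)" by (intro imageI) (simp only: mem_cball_0 not_less)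
    then show ?thesis using M[of "\<phi> x"] by simp
  qed
  then show ?thesis using that[of "max 1 R" "max 0 M"] z by simp
qed

lemma phi_uniform:
  assumes "e > 0" shows "\<exists>\<eta>>0. \<forall>x y. norm (x - y) < \<eta> \<longrightarrow> \<bar>\<phi> x - \<phi> y\<bar> < e"
proof -
  obtain R0 M where R0: "R0 \<ge> 1" "\<And>x. norm x > R0 \<Longrightarrow> \<phi> x = 0" using phi_bounds by metis
  have "uniformly_continuous_on (cball 0 (R0 + 1)) \<phi>"
    by (intro compact_uniformly_continuous continuous_on_subset[OF cont]) auto
  then obtain d where d: "d > 0" "\<And>x y. x \<in> cball 0 (R0 + 1) \<Longrightarrow> y \<in> cball 0 (R0 + 1) \<Longrightarrow> dist y x < d \<Longrightarrow> dist (\<phi> y) (\<phi> x) < e"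
    using assms unfolding uniformly_continuous_on_def by metis
  have "\<bar>\<phi> x - \<phi> y\<bar> < e" if xy: "norm (x - y) < min d 1" for x y
  proof (cases "norm x \<le> R0 + 1 \<and> norm y \<le> R0 + 1")
    case True
    then show ?thesis using d(2)[of y x] xy by (simp add: dist_norm)
  next
    case False
    have "norm x \<le> norm y + norm (x - y)" "norm y \<le> norm x + norm (x - y)"
      using norm_triangle_sub[of x y] norm_triangle_sub[of y x] by (auto simp: norm_minus_commute)
    then have "norm x > R0" "norm y > R0" using False xy by auto
    then show ?thesis using R0(2) assms by simp
  qed
  then show ?thesis using d(1) by (intro exI[of _ "min d 1"]) auto
qed

text \<open>Freezing \<open>x\<close> at the corner of its cell yields a finite rank kernel. Uniform
  continuity on a compact product makes the error uniformly small for fine cells, and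
  \<open>bounded_tensor_small\<close> turns this into a small operator bound.\<close>

lemma apx_trunc_kernel:
  assumes R: "R > 0" and \<eta>: "\<eta> > 0" shows "apx (trunc_kernel \<alpha> m \<phi> R \<eta>)"
  unfolding apx_def
proof (intro allI impI)
  fix e :: real assume e: "e > 0"
  obtain R0 M where M: "M \<ge> 0" "\<And>x. \<bar>\<phi> x\<bar> \<le> M" using phi_bounds by metis
  let ?k = "trunc_kernel \<alpha> m \<phi> R \<eta>"
  have kz: "?k x y = 0" if "norm x > 2 * R \<or> norm y > 2 * R" for x y
    using that cutoff_props(4)[OF R] by (auto simp: trunc_kernel_def)
  define MM where "MM = (2 * M) ^ m * \<eta> powr (\<alpha> - real CARD('n))"
  have MM: "\<bar>?k x y\<bar> \<le> MM" for x y
  proof -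
    have "\<bar>\<phi> x - \<phi> y\<bar> \<le> 2 * M" using M(2)[of x] M(2)[of y] by linarith
    then have "\<bar>\<phi> x - \<phi> y\<bar> ^ m \<le> (2 * M) ^ m" by (intro power_mono) auto
    moreover have "max (norm (x - y)) \<eta> powr (\<alpha> - real CARD('n)) \<le> \<eta> powr (\<alpha> - real CARD('n))"
      using \<alpha> \<eta> by (intro powr_mono2') auto
    ultimately have "\<bar>\<phi> x - \<phi> y\<bar> ^ m * max (norm (x - y)) \<eta> powr (\<alpha> - real CARD('n)) \<le> MM"
      unfolding MM_def by (intro mult_mono) (use M in auto)
    moreover have "cutoff R x * cutoff R y \<le> 1" using cutoff_props(1,2)[OF R] by (intro mult_le_one) auto
    ultimately have "cutoff R x * cutoff R y * (\<bar>\<phi> x - \<phi> y\<bar> ^ m * max (norm (x - y)) \<eta> powr (\<alpha> - real CARD('n))) \<le> 1 * MM"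
      using cutoff_props(1)[OF R] by (intro mult_mono) auto
    then show ?thesis by (simp add: trunc_kernel_def abs_mult power_abs abs_of_nonneg[OF cutoff_props(1)[OF R]])
  qed
  define n where "n = real CARD('n)"
  have n0: "n > 0" by (simp add: n_def)
  \<comment> \<open>Points of one cell are at distance at most n * side \<le> n, so cells meeting
    the ball of radius 2 R, outside which the kernel vanishes, stay in \<open>S\<close>.\<close>
  define S where "S = cball (0::real^'n) (2 * R + n)"
  have S: "bounded S" "S \<in> sets lebesgue" "compact S" by (auto simp: S_def)
  obtain t C where t: "t > 0" "C \<le> e" "opb p v q u (\<lambda>x y. t * indicator S x * indicator S y) C"
    using bounded_tensor_small[OF S(1,2) e] by blast
  have "uniformly_continuous_on (S \<times> S) (\<lambda>xy. ?k (fst xy) (snd xy))"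
    by (intro compact_uniformly_continuous continuous_on_subset[OF continuous_trunc_kernel[OF cont R \<eta>]] compact_Times S) auto
  then obtain d where d: "d > 0" "\<And>z z'. z \<in> S \<times> S \<Longrightarrow> z' \<in> S \<times> S \<Longrightarrow> dist z' z < d \<Longrightarrow>
      dist (?k (fst z') (snd z')) (?k (fst z) (snd z)) < t"
    using t(1) unfolding uniformly_continuous_on_def by metis
  interpret dyadic_grid "0 :: real^'n" 1 by unfold_locales simp
  obtain j where j: "n / d < 2 ^ j" using real_arch_pow[of 2 "n / d"] by auto
  have sd: "side c = 1 / 2 ^ j" "n * side c < d" "n * side c \<le> n" if "fst c = j" for c
  proof -
    show s: "side c = 1 / 2 ^ j" using that by (simp add: side_def)
    show "n * side c < d" unfolding s using j d by (simp add: field_simps)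
    show "n * side c \<le> n" unfolding s using n0 by (simp add: divide_le_eq)
  qed
  define DD where "DD = {c. fst c = j \<and> cell c \<inter> cball 0 (2 * R) \<noteq> {}}"
  have finD: "finite DD" unfolding DD_def by (rule finite_cells_meeting) simp
  have inS: "x \<in> S" if "c \<in> DD" "x \<in> cell c" for c x
  proof -
    have cj: "fst c = j" "cell c \<inter> cball 0 (2 * R) \<noteq> {}" using that(1) unfolding DD_def by blast+
    then obtain x0 where x0: "x0 \<in> cell c" "norm x0 \<le> 2 * R" by auto
    have "norm (x - x0) \<le> n * side c" using dist_cell[OF that(2) x0(1)] by (simp add: n_def)
    also have "\<dots> \<le> n" by (rule sd(3)[OF cj(1)])
    finally have "norm (x - x0) \<le> n" .
    then have "norm x \<le> 2 * R + n" using norm_triangle_sub[of x x0] x0(2) by linarith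
    then show ?thesis by (simp add: S_def)
  qed
  obtain h where h: "bij_betw h {0..<card DD} DD" using ex_bij_betw_nat_finite[OF finD] by blast
  define N where "N = card DD"
  define E where "E i = (if i < N then cell (h i) else {})" for i
  define \<psi> where "\<psi> i = (if i < N then ?k (corner (h i)) else (\<lambda>y. 0))" for i
  have hD: "h i \<in> DD" if "i < N" for i using h that by (auto simp: bij_betw_def N_def)
  have jm: "joint_meas ?k" by (rule joint_meas_trunc_kernel) simp
  have fr: "fin_rank E \<psi> S MM"
    unfolding fin_rank_def
  proof (intro conjI allI)
    show "MM \<ge> 0" using M by (simp add: MM_def)
    fix i
    show "E i \<in> sets lebesgue" by (simp add: E_def)
    show "E i \<subseteq> S" using inS[OF hD[of i]] by (cases "i < N") (auto simp: E_def)
    show "\<psi> i \<in> borel_measurable lebesgue" unfolding \<psi>_def using joint_meas_section[OF jm] by auto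
    fix y
    show "\<bar>\<psi> i y\<bar> \<le> MM * indicator S y"
    proof (cases "y \<in> S")
      case True
      then show ?thesis using MM M(1) by (auto simp: \<psi>_def MM_def)
    next
      case False
      then have "norm y > 2 * R" using n0 by (auto simp: S_def)
      then show ?thesis using kz False by (auto simp: \<psi>_def)
    qed
  qed (use S in auto)
  have rk: "rank_kernel N E \<psi> x y = (\<Sum>c\<in>DD. indicator (cell c) x * ?k (corner c) y)" for x y
  proof -
    have "rank_kernel N E \<psi> x y = (\<Sum>i<N. indicator (cell (h i)) x * ?k (corner (h i)) y)"
      unfolding rank_kernel_def by (intro sum.cong) (auto simp: E_def \<psi>_def)
    also have "\<dots> = (\<Sum>c\<in>DD. indicator (cell c) x * ?k (corner c) y)"
      using h unfolding N_def lessThan_atLeast0 by (rule sum.reindex_bij_betw)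
    finally show ?thesis .
  qed
  have diff: "\<bar>?k x y - rank_kernel N E \<psi> x y\<bar> \<le> \<bar>t * indicator S x * indicator S y\<bar>" for x y
  proof (cases "\<exists>c\<in>DD. x \<in> cell c")
    case True
    then obtain c where c: "c \<in> DD" "x \<in> cell c" by blast
    have "rank_kernel N E \<psi> x y = (\<Sum>c'\<in>{c}. indicator (cell c') x * ?k (corner c') y)"
      unfolding rk
    proof (rule sum.mono_neutral_right[OF finD])
      show "\<forall>c'\<in>DD - {c}. indicator (cell c') x * ?k (corner c') y = 0"
      proof
        fix c' assume "c' \<in> DD - {c}"
        then have "x \<notin> cell c'" using cell_unique[OF c(2), of c'] c(1) by (auto simp: DD_def)
        then show "indicator (cell c') x * ?k (corner c') y = 0" by simp
      qed
    qed (use c in auto)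
    then have req: "rank_kernel N E \<psi> x y = ?k (corner c) y" using c by simp
    have xS: "x \<in> S" "corner c \<in> S" using inS c corner_in_cell by blast+
    show ?thesis
    proof (cases "y \<in> S")
      case True
      have "norm (x - corner c) \<le> n * side c" using dist_cell[OF c(2) corner_in_cell] by (simp add: n_def)
      also have "\<dots> < d" using sd(2)[of c] c by (simp add: DD_def)
      finally have "dist (x, y) (corner c, y) < d" by (simp add: dist_Pair_Pair dist_norm)
      then have "dist (?k x y) (?k (corner c) y) < t" using d(2)[of "(corner c, y)" "(x, y)"] xS True by simp
      then show ?thesis unfolding req using xS True t(1) by (simp add: dist_real_def)
    next
      case False
      then have "norm y > 2 * R" using n0 by (auto simp: S_def)
      then show ?thesis unfolding req using kz by simp
    qed
  next
    case False
    then have "rank_kernel N E \<psi> x y = 0" unfolding rk by (intro sum.neutral) auto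
    moreover have "norm x > 2 * R"
    proof (rule ccontr)
      assume "\<not> norm x > 2 * R"
      then have "x \<in> cell (cell_at j x) \<inter> cball 0 (2 * R)" by simp
      then have "cell (cell_at j x) \<inter> cball 0 (2 * R) \<noteq> {}" by blast
      then have "cell_at j x \<in> DD" by (simp add: DD_def)
      then show False using False mem_cell_at[of x j] by blast
    qed
    ultimately show ?thesis using kz by simp
  qed
  have "opb p v q u (\<lambda>x y. ?k x y - rank_kernel N E \<psi> x y) C"
    by (rule opb_mono[OF t(3) diff order_refl]) (use qs u0 in auto)
  then show "\<exists>N E \<psi> B M C. fin_rank E \<psi> B M \<and> C \<le> e \<and> opb p v q u (\<lambda>x y. ?k x y - rank_kernel N E \<psi> x y) C"
    using fr t(2) by blast
qed

text \<open>The error has three parts. Near the diagonal the power of \<phi> x - \<phi> y is small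
  by uniform continuity, leaving a small multiple of the kernel of I_\<alpha> (\<open>?K1\<close>).
  Where the cutoffs act and the kernel does not vanish, one variable is far away and the other near
  the support of \<phi>, so 1/|x - y| is at most twice the inverse norm of the far variable; the
  tensor kernels \<open>?K2\<close> and \<open>?K3\<close> that result are small by the tail
  estimates.\<close>

lemma apx_comm_kernel_phi: "apx (comm_kernel \<alpha> m \<phi>)"
proof (rule apx_closed)
  show jmc: "joint_meas (comm_kernel \<alpha> m \<phi>)" by (rule joint_meas_comm_kernel) simp
  fix e :: real assume e: "e > 0"
  let ?\<beta> = "real CARD('n) - \<alpha>" and ?p' = "conj_exp p"
  have \<beta>: "?\<beta> > 0" using \<alpha> by simp
  note cp = conj_exp_props[OF p(1)]
  obtain R0 M where R0: "R0 \<ge> 1" "M \<ge> 0" "\<And>x. norm x > R0 \<Longrightarrow> \<phi> x = 0" "\<And>x. \<bar>\<phi> x\<bar> \<le> M" using phi_bounds by metis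
  define T where "T = (2::real) powr q"
  have T1: "T \<ge> 1" unfolding T_def using qs by (intro ge_one_powr_ge_zero) auto
  define D where "D = (2 * M) ^ m * 2 powr ?\<beta>"
  have D0: "D \<ge> 0" using R0 by (simp add: D_def)
  \<comment> \<open>Three errors of size \<open>c\<close> pass through \<open>opb_add\<close> at
    most twice, each time at the cost of \<open>T\<close>; the 4 leaves room for the three.\<close>
  define c where "c = e / (4 * T * T)"
  have c0: "c > 0" using e T1 by (simp add: c_def)
  obtain CI where CI: "opb p v q u (\<lambda>x y. norm (x - y) powr (- ?\<beta>)) CI" by (rule frac_kernel_bounded)
  have CI0: "CI \<ge> 0" using CI by (simp add: opb_def)
  define \<epsilon> where "\<epsilon> = (c / (CI + 1)) powr (1/q)"
  have \<epsilon>: "\<epsilon> > 0" using c0 CI0 by (simp add: \<epsilon>_def)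
  obtain \<eta> where \<eta>: "\<eta> > 0" "\<And>x y. norm (x - y) < \<eta> \<Longrightarrow> \<bar>\<phi> x - \<phi> y\<bar> < min 1 \<epsilon>"
    using phi_uniform[of "min 1 \<epsilon>"] \<epsilon> by auto
  let ?K1 = "\<lambda>x y :: real^'n. \<epsilon> * norm (x - y) powr (- ?\<beta>)"
  have jmI: "joint_meas (\<lambda>x y :: real^'n. norm (x - y) powr (- ?\<beta>))" unfolding joint_meas_def by measurable
  have K1: "opb p v q u ?K1 (\<bar>\<epsilon>\<bar> powr q * CI)" by (rule opb_scale[OF CI jmI]) simp
  have K1c: "\<bar>\<epsilon>\<bar> powr q * CI \<le> c"
  proof -
    have "\<bar>\<epsilon>\<bar> powr q * CI = c * (CI / (CI + 1))" using \<epsilon> c0 CI0 qs by (simp add: \<epsilon>_def powr_powr)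
    also have "\<dots> \<le> c * 1" using c0 CI0 by (intro mult_left_mono) (auto simp: divide_le_eq_1)
    finally show ?thesis by simp
  qed
  define Bq where "Bq = cball (0::real^'n) R0"
  have Bq: "bounded Bq" "Bq \<in> sets lebesgue" by (auto simp: Bq_def)
  note [measurable] = Bq(2)
  obtain U where U: "(\<integral>\<^sup>+x\<in>Bq. ennreal (u x) \<partial>lebesgue) = ennreal U" "U \<ge> 0"
    using u_w_bounded_finite(1)[OF Bq(1)] by (cases "\<integral>\<^sup>+x\<in>Bq. ennreal (u x) \<partial>lebesgue") auto
  obtain W where W: "(\<integral>\<^sup>+x\<in>Bq. ennreal ((v x powr (-1/p)) powr ?p') \<partial>lebesgue) = ennreal W" "W \<ge> 0"
    using u_w_bounded_finite(2)[OF Bq(1)] by (cases "(\<integral>\<^sup>+x\<in>Bq. ennreal ((v x powr (-1/p)) powr ?p') \<partial>lebesgue)") auto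
  define Dq where "Dq = D powr q"
  \<comment> \<open>The tail sizes \<open>w1\<close> and \<open>u1\<close> are those for which the
    constants of \<open>opb_tensor\<close> for \<open>?K2\<close> and \<open>?K3\<close> come out at
    most \<open>c\<close>.\<close>
  define w1 where "w1 = (c / (Dq * U + 1)) powr (?p' / q)"
  define u1 where "u1 = c / (Dq * W powr (q / ?p') + 1)"
  have den: "Dq * U + 1 > 0" "Dq * W powr (q / ?p') + 1 > 0"
    using U by (auto simp: Dq_def intro!: add_nonneg_pos mult_nonneg_nonneg)
  have w1: "w1 > 0" and u1: "u1 > 0" using c0 den by (auto simp: w1_def u1_def)
  obtain R1 where R1: "(\<integral>\<^sup>+y. ennreal ((norm y powr (- ?\<beta>) * v y powr (-1/p)) powr ?p') * indicator {y. norm y > R1} y \<partial>lebesgue) < \<infinity>"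
    using tail_w by blast
  have "\<exists>R\<ge>max 1 (2 * R0). (\<integral>\<^sup>+y. ennreal ((norm y powr (- ?\<beta>) * v y powr (-1/p)) powr ?p') * indicator {y. norm y > R} y \<partial>lebesgue) \<le> ennreal w1"
    by (rule nn_integral_tail_small[OF _ R1 w1]) measurable
  then obtain Ra where Ra: "Ra \<ge> 2 * R0" "(\<integral>\<^sup>+y. ennreal ((norm y powr (- ?\<beta>) * v y powr (-1/p)) powr ?p') * indicator {y. norm y > Ra} y \<partial>lebesgue) \<le> ennreal w1"
    by auto
  have "\<exists>R\<ge>max 1 Ra. (\<integral>\<^sup>+x. ennreal ((norm x powr (- ?\<beta>)) powr q * u x) * indicator {x. norm x > R} x \<partial>lebesgue) \<le> ennreal u1"
    by (rule nn_integral_tail_small[OF _ tail_u u1]) measurable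
  then obtain R where R: "R \<ge> 1" "R \<ge> Ra" "(\<integral>\<^sup>+x. ennreal ((norm x powr (- ?\<beta>)) powr q * u x) * indicator {x. norm x > R} x \<partial>lebesgue) \<le> ennreal u1"
    by auto
  \<comment> \<open>If one point has norm above R \<ge> 2 R0 and the other norm at most R0, their
    distance is at least half the norm of the far one.\<close>
  have R2: "R \<ge> 2 * R0" using R Ra by simp
  define far where "far x = indicator {x. norm x > R} x * norm x powr (- ?\<beta>)" for x :: "real^'n"
  have far_m [measurable]: "far \<in> borel_measurable lebesgue" unfolding far_def by measurable
  have far0: "far x \<ge> 0" for x by (simp add: far_def)
  let ?K2 = "\<lambda>x y. (D * indicator Bq x) * far y" and ?K3 = "\<lambda>x y. (D * far x) * indicator Bq y"
  have K2: "opb p v q u ?K2 ((Dq * U) * w1 powr (q / ?p'))"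
  proof (rule opb_tensor)
    have "(\<integral>\<^sup>+x. ennreal (\<bar>D * indicator Bq x\<bar> powr q * u x) \<partial>lebesgue) = (\<integral>\<^sup>+x. ennreal Dq * (ennreal (u x) * indicator Bq x) \<partial>lebesgue)"
      using D0 qs by (intro nn_integral_cong) (auto simp: indicator_def ennreal_mult' Dq_def)
    also have "\<dots> = ennreal Dq * ennreal U" unfolding U(1)[symmetric] by (rule nn_integral_cmult) measurable
    finally show "(\<integral>\<^sup>+x. ennreal (\<bar>D * indicator Bq x\<bar> powr q * u x) \<partial>lebesgue) \<le> ennreal (Dq * U)" by (simp add: ennreal_mult' Dq_def)
    have "(\<integral>\<^sup>+y. ennreal ((\<bar>far y\<bar> * v y powr (-1/p)) powr ?p') \<partial>lebesgue) \<le> (\<integral>\<^sup>+y. ennreal ((norm y powr (- ?\<beta>) * v y powr (-1/p)) powr ?p') * indicator {y. norm y > Ra} y \<partial>lebesgue)"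
      using R cp by (intro nn_integral_mono) (auto simp: far_def indicator_def)
    then show "(\<integral>\<^sup>+y. ennreal ((\<bar>far y\<bar> * v y powr (-1/p)) powr ?p') \<partial>lebesgue) \<le> ennreal w1" using Ra(2) by (rule order_trans)
  qed (use U w1 in \<open>auto simp: Dq_def\<close>)
  have K2c: "(Dq * U) * w1 powr (q / ?p') \<le> c"
  proof -
    have "w1 powr (q / ?p') = c / (Dq * U + 1)" using c0 den cp qs by (simp add: w1_def powr_powr)
    then have "(Dq * U) * w1 powr (q / ?p') = c * ((Dq * U) / (Dq * U + 1))" by simp
    also have "\<dots> \<le> c * 1" using c0 den by (intro mult_left_mono) (auto simp: divide_le_eq_1)
    finally show ?thesis by simp
  qed
  have K3: "opb p v q u ?K3 ((Dq * u1) * W powr (q / ?p'))"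
  proof (rule opb_tensor)
    have "(\<integral>\<^sup>+x. ennreal (\<bar>D * far x\<bar> powr q * u x) \<partial>lebesgue) = (\<integral>\<^sup>+x. ennreal Dq * (ennreal ((norm x powr (- ?\<beta>)) powr q * u x) * indicator {x. norm x > R} x) \<partial>lebesgue)"
    proof (intro nn_integral_cong)
      fix x :: "real^'n"
      show "ennreal (\<bar>D * far x\<bar> powr q * u x) = ennreal Dq * (ennreal ((norm x powr (- ?\<beta>)) powr q * u x) * indicator {x. norm x > R} x)"
      proof (cases "norm x > R")
        case True
        then have "\<bar>D * far x\<bar> powr q * u x = Dq * ((norm x powr (- ?\<beta>)) powr q * u x)"
          using D0 by (simp add: far_def Dq_def powr_mult abs_mult)
        also have "ennreal \<dots> = ennreal Dq * ennreal ((norm x powr (- ?\<beta>)) powr q * u x)" by (rule ennreal_mult') (simp add: Dq_def)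
        finally show ?thesis using True by simp
      next
        case False
        then show ?thesis by (simp add: far_def)
      qed
    qed
    also have "\<dots> = ennreal Dq * (\<integral>\<^sup>+x. ennreal ((norm x powr (- ?\<beta>)) powr q * u x) * indicator {x. norm x > R} x \<partial>lebesgue)" by (rule nn_integral_cmult) measurable
    also have "\<dots> \<le> ennreal Dq * ennreal u1" by (intro mult_left_mono R(3)) simp
    finally show "(\<integral>\<^sup>+x. ennreal (\<bar>D * far x\<bar> powr q * u x) \<partial>lebesgue) \<le> ennreal (Dq * u1)" by (simp add: ennreal_mult' Dq_def)
    have "(\<integral>\<^sup>+y. ennreal ((\<bar>indicator Bq y\<bar> * v y powr (-1/p)) powr ?p') \<partial>lebesgue) = ennreal W"
      unfolding W(1)[symmetric] using cp by (intro nn_integral_cong) (auto simp: indicator_def)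
    then show "(\<integral>\<^sup>+y. ennreal ((\<bar>indicator Bq y\<bar> * v y powr (-1/p)) powr ?p') \<partial>lebesgue) \<le> ennreal W" by simp
  qed (use W u1 in \<open>auto simp: Dq_def\<close>)
  have K3c: "(Dq * u1) * W powr (q / ?p') \<le> c"
  proof -
    have "(Dq * u1) * W powr (q / ?p') = c * ((Dq * W powr (q / ?p')) / (Dq * W powr (q / ?p') + 1))" by (simp add: u1_def)
    also have "\<dots> \<le> c * 1" using c0 den by (intro mult_left_mono) (auto simp: divide_le_eq_1)
    finally show ?thesis by simp
  qed
  have j1: "joint_meas ?K1" by (rule joint_meas_cmult[OF jmI])
  have j2: "joint_meas ?K2" by (rule joint_meas_tensor) measurable
  have j3: "joint_meas ?K3" by (rule joint_meas_tensor) measurable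
  define CC where "CC = 2 powr q * (2 powr q * (\<bar>\<epsilon>\<bar> powr q * CI + (Dq * U) * w1 powr (q / ?p')) + (Dq * u1) * W powr (q / ?p'))"
  have sum: "opb p v q u (\<lambda>x y. (?K1 x y + ?K2 x y) + ?K3 x y) CC"
    unfolding CC_def
    by (rule opb_add[OF opb_add[OF K1 K2 j1 j2] K3 joint_meas_add[OF j1 j2] j3]) (use qs u0 in auto)
  have CCe: "CC \<le> e"
  proof -
    have "CC \<le> T * (T * (c + c) + c)"
      unfolding CC_def T_def[symmetric] using T1 K1c K2c K3c by (intro mult_left_mono add_mono) auto
    also have "\<dots> \<le> T * (T * (c + c) + T * c)"
      using T1 c0 by (intro mult_left_mono add_mono) auto
    also have "\<dots> = 3 * (T * T * c)" by (simp add: algebra_simps)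
    also have "T * T * c = e / 4" using T1 by (simp add: c_def)
    finally show ?thesis using e by simp
  qed
  have diff: "\<bar>comm_kernel \<alpha> m \<phi> x y - trunc_kernel \<alpha> m \<phi> R \<eta> x y\<bar> \<le> \<bar>(?K1 x y + ?K2 x y) + ?K3 x y\<bar>" for x y
  proof -
    let ?d = "norm (x - y)" and ?f = "(\<phi> x - \<phi> y) ^ m"
    have nn: "?K1 x y \<ge> 0" "?K2 x y \<ge> 0" "?K3 x y \<ge> 0" using \<epsilon> D0 far0 by auto
    have "\<bar>comm_kernel \<alpha> m \<phi> x y - trunc_kernel \<alpha> m \<phi> R \<eta> x y\<bar> \<le> ?K1 x y + (?K2 x y + ?K3 x y)"
    proof (cases "x = y")
      \<comment> \<open>The flattened kernel does not vanish on the diagonal through its power of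
        the distance, but because m \<ge> 1.\<close>
      case True
      then show ?thesis using nn m by (simp add: comm_kernel_def trunc_kernel_def power_0_left)
    next
      case False
      then have d0: "?d > 0" by simp
      define A where "A = ?d powr (- ?\<beta>)"
      define B where "B = max ?d \<eta> powr (- ?\<beta>)"
      define ct where "ct = cutoff R x * cutoff R y"
      have BA: "0 \<le> B" "B \<le> A" unfolding A_def B_def using d0 \<beta> by (auto intro!: powr_mono2')
      have chi: "0 \<le> ct" "ct \<le> 1" unfolding ct_def using cutoff_props(1,2)[of R x] cutoff_props(1,2)[of R y] R(1)
        by (auto intro!: mult_le_one mult_nonneg_nonneg)
      have e1: "comm_kernel \<alpha> m \<phi> x y = ?f * A" "trunc_kernel \<alpha> m \<phi> R \<eta> x y = ct * (?f * B)"
        by (simp_all add: comm_kernel_def trunc_kernel_def A_def B_def ct_def)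
      \<comment> \<open>The first term is the error of flattening the singularity, the second that
        of the cutoffs.\<close>
      have "?f * A - ct * (?f * B) = ?f * (A - B) + (1 - ct) * (?f * B)" by (simp add: algebra_simps)
      also have "\<bar>\<dots>\<bar> \<le> \<bar>?f\<bar> * (A - B) + (1 - ct) * (\<bar>?f\<bar> * B)"
        using BA chi by (intro order_trans[OF abs_triangle_ineq]) (simp add: abs_mult)
      also have "\<dots> \<le> ?K1 x y + (?K2 x y + ?K3 x y)"
      proof (rule add_mono)
        show "\<bar>?f\<bar> * (A - B) \<le> ?K1 x y"
        proof (cases "?d < \<eta>")
          case True
          have s: "\<bar>\<phi> x - \<phi> y\<bar> \<le> \<epsilon>" "\<bar>\<phi> x - \<phi> y\<bar> \<le> 1" using \<eta>(2)[OF True] by auto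
          obtain k where k: "m = Suc k" using m by (cases m) auto
          have "\<bar>?f\<bar> = \<bar>\<phi> x - \<phi> y\<bar> * \<bar>\<phi> x - \<phi> y\<bar> ^ k" by (simp add: k power_abs abs_mult)
          also have "\<dots> \<le> \<epsilon> * 1" using s by (intro mult_mono power_le_one) auto
          finally have "\<bar>?f\<bar> * (A - B) \<le> \<epsilon> * A" using BA \<epsilon> by (intro mult_mono) auto
          then show ?thesis by (simp add: A_def)
        next
          case False
          then have "A = B" by (simp add: A_def B_def max_def)
          then show ?thesis using nn by simp
        qed
        show "(1 - ct) * (\<bar>?f\<bar> * B) \<le> ?K2 x y + ?K3 x y"
        proof (cases "ct = 1 \<or> \<phi> x = \<phi> y")
          case True
          then show ?thesis using nn m by (auto simp: power_0_left)
        next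
          case False
          have far: "norm x > R \<or> norm y > R"
            using False cutoff_props(3)[of R] R unfolding ct_def by (metis less_eq_real_def linorder_not_le mult_1 order_less_le_trans zero_less_one)
          have near: "norm x \<le> R0 \<or> norm y \<le> R0" using False R0(3)[of x] R0(3)[of y] by force
          have "\<bar>\<phi> x - \<phi> y\<bar> \<le> 2 * M" using R0(4)[of x] R0(4)[of y] by linarith
          then have fM: "\<bar>?f\<bar> \<le> (2 * M) ^ m" unfolding power_abs by (intro power_mono) auto
          have "(1 - ct) * (\<bar>?f\<bar> * B) \<le> 1 * ((2 * M) ^ m * A)"
            using chi BA fM R0(2) by (intro mult_mono) auto
          then have le: "(1 - ct) * (\<bar>?f\<bar> * B) \<le> (2 * M) ^ m * A" by simp
          have half: "A \<le> 2 powr ?\<beta> * norm z powr (- ?\<beta>)" if z: "norm z > R" "norm z \<le> 2 * ?d" for z :: "real^'n"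
          proof -
            have "?d powr (- ?\<beta>) \<le> (norm z / 2) powr (- ?\<beta>)" using z R \<beta> by (intro powr_mono2') auto
            also have "\<dots> = 2 powr ?\<beta> * norm z powr (- ?\<beta>)"
              using powr_minus_divide[of 2 "- ?\<beta>"] by (simp add: powr_divide)
            finally show ?thesis by (simp add: A_def)
          qed
          consider "norm x > R" "norm y \<le> R0" | "norm y > R" "norm x \<le> R0"
            using far near R2 R0(1) by linarith
          then show ?thesis
          proof cases
            case 1
            have "norm x \<le> norm y + ?d" using norm_triangle_sub[of x y] by simp
            then have "norm x \<le> 2 * ?d" using 1 R2 by linarith
            then have "(2 * M) ^ m * A \<le> (2 * M) ^ m * (2 powr ?\<beta> * norm x powr (- ?\<beta>))" using half[of x] 1 R0(2) by (intro mult_left_mono) auto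
            then have "(2 * M) ^ m * A \<le> ?K3 x y" using 1 by (simp add: D_def far_def Bq_def mult_ac)
            then show ?thesis using le nn by linarith
          next
            case 2
            have "norm y \<le> norm x + ?d" using norm_triangle_sub[of y x] by (simp add: norm_minus_commute)
            then have "norm y \<le> 2 * ?d" using 2 R2 by linarith
            then have "(2 * M) ^ m * A \<le> (2 * M) ^ m * (2 powr ?\<beta> * norm y powr (- ?\<beta>))" using half[of y] 2 R0(2) by (intro mult_left_mono) auto
            then have "(2 * M) ^ m * A \<le> ?K2 x y" using 2 by (simp add: D_def far_def Bq_def mult_ac)
            then show ?thesis using le nn by linarith
          qed
        qed
      qed
      finally show ?thesis unfolding e1 .
    qed
    then show ?thesis using nn by simp
  qed
  have "opb p v q u (\<lambda>x y. comm_kernel \<alpha> m \<phi> x y - trunc_kernel \<alpha> m \<phi> R \<eta> x y) CC"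
    by (rule opb_mono[OF sum diff order_refl]) (use qs u0 in auto)
  moreover have "apx (trunc_kernel \<alpha> m \<phi> R \<eta>)" using R \<eta> by (intro apx_trunc_kernel) auto
  moreover have "joint_meas (trunc_kernel \<alpha> m \<phi> R \<eta>)" by (rule joint_meas_trunc_kernel) simp
  ultimately show "\<exists>k2 C. apx k2 \<and> joint_meas k2 \<and> C \<le> e \<and> opb p v q u (\<lambda>x y. comm_kernel \<alpha> m \<phi> x y - k2 x y) C"
    using CCe by blast
qed

lemma phi_locally_integrable: "locally_integrable \<phi>"
  unfolding locally_integrable_def set_integrable_def
proof (intro allI impI)
  fix K :: "(real^'n) set" assume K: "compact K"
  obtain R0 M where M: "\<And>x. \<bar>\<phi> x\<bar> \<le> M" using phi_bounds by metis
  show "integrable lebesgue (\<lambda>x. indicator K x *\<^sub>R \<phi> x)"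
  proof (rule integrableI_bounded_set_indicator[where B=M])
    show "K \<in> sets lebesgue" using K by (simp add: lmeasurable_compact fmeasurableD)
    have "emeasure lebesgue K = ennreal (measure lebesgue K)"
      using K lmeasurable_compact by (intro emeasure_eq_measure2) auto
    then show "emeasure lebesgue K < \<infinity>" by simp
  qed (use M in auto)
qed

end

section \<open>Symbols in BMO and CMO\<close>

lemma opb_comm_kernel:
  assumes b: "b \<in> BMO" shows "\<exists>C. opb p v q u (comm_kernel \<alpha> m b) C"
proof -
  have li: "locally_integrable b" and fin: "bmo_norm b < \<infinity>" using b by (auto simp: BMO_def)
  obtain r where r: "bmo_norm b = ennreal r" "r \<ge> 0" using fin by (cases "bmo_norm b") auto
  \<comment> \<open>The summand 1 keeps the divisor positive when the norm of \<open>b\<close> is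
    0.\<close>
  define M where "M = r + 1"
  have M: "M > 0" "bmo_norm b \<le> ennreal M" using r by (auto simp: M_def ennreal_leI)
  obtain C where C: "\<And>b. locally_integrable b \<Longrightarrow> bmo_norm b \<le> 1 \<Longrightarrow> opb p v q u (osc_kernel \<alpha> m b) C"
    using opb_osc_kernel by blast
  have lb: "locally_integrable (\<lambda>x. b x / M)" by (rule locally_integrable_cmult[OF li])
  note [measurable] = locally_integrable_measurable[OF lb]
  have "opb p v q u (\<lambda>x y. M ^ m * osc_kernel \<alpha> m (\<lambda>x. b x / M) x y) (\<bar>M ^ m\<bar> powr q * C)"
    by (rule opb_scale[OF C[OF lb bmo_norm_scale[OF li M]] joint_meas_osc_kernel]) auto
  moreover have "\<bar>comm_kernel \<alpha> m b x y\<bar> \<le> \<bar>M ^ m * osc_kernel \<alpha> m (\<lambda>x. b x / M) x y\<bar>" for x y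
  proof -
    have "\<bar>b x - b y\<bar> = M * \<bar>b x / M - b y / M\<bar>" using M(1) by (simp add: diff_divide_distrib[symmetric] abs_divide)
    also have "\<dots> \<le> M * (1 + \<bar>b x / M - b y / M\<bar>)" using M(1) by (intro mult_left_mono) auto
    finally have "\<bar>b x - b y\<bar> ^ m \<le> (M * (1 + \<bar>b x / M - b y / M\<bar>)) ^ m" by (intro power_mono) auto
    then have "\<bar>b x - b y\<bar> ^ m * norm (x - y) powr (\<alpha> - real CARD('n)) \<le> M ^ m * (1 + \<bar>b x / M - b y / M\<bar>) ^ m * norm (x - y) powr (\<alpha> - real CARD('n))"
      unfolding power_mult_distrib by (intro mult_right_mono) auto
    then show ?thesis using M(1) by (simp add: comm_kernel_def osc_kernel_def abs_mult power_abs mult.assoc)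
  qed
  ultimately have "opb p v q u (comm_kernel \<alpha> m b) (\<bar>M ^ m\<bar> powr q * C)"
    by (rule opb_mono[OF _ _ order_refl]) (use qs u0 in auto)
  then show ?thesis by blast
qed

text \<open>b - \<phi> is small in BMO, not pointwise. Divided by its small norm bound it is a
  normalised symbol with the same constant \<open>C\<close>, and \<open>comm_kernel_diff_le\<close>
  returns the small factor in front.\<close>

lemma apx_comm_kernel:
  assumes b: "b \<in> CMO" shows "apx (comm_kernel \<alpha> m b)"
proof (rule apx_closed)
  have li: "locally_integrable b" and fin: "bmo_norm b < \<infinity>" using b by (auto simp: CMO_def BMO_def)
  note [measurable] = locally_integrable_measurable[OF li]
  show jmb: "joint_meas (comm_kernel \<alpha> m b)" by (rule joint_meas_comm_kernel) simp
  obtain r where r: "bmo_norm b = ennreal r" "r \<ge> 0" using fin by (cases "bmo_norm b") auto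
  define M where "M = r + 1"
  have M: "M > 0" "bmo_norm b \<le> ennreal M" using r by (auto simp: M_def ennreal_leI)
  obtain C where C: "\<And>b. locally_integrable b \<Longrightarrow> bmo_norm b \<le> 1 \<Longrightarrow> opb p v q u (osc_kernel \<alpha> m b) C"
    using opb_osc_kernel by blast
  fix e :: real assume e: "e > 0"
  have C0: "C \<ge> 0" using C[OF locally_integrable_zero bmo_norm_zero] by (simp add: opb_def)
  define Z where "Z = 2 powr q * (C + C) + 1"
  have Z: "Z > 0" using C0 by (simp add: Z_def add_nonneg_pos)
  define \<mu> where "\<mu> = real m * (2 * M + 1) ^ (m - 1)"
  have \<mu>: "\<mu> > 0" using m M by (simp add: \<mu>_def)
  \<comment> \<open>The distance from \<open>b\<close> to \<phi> is chosen so that the factor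
    \<kappa> = t * \<mu> has \<open>q\<close>-th power at most e / Z. The minimum with 1 is demanded
    by \<open>comm_kernel_diff_le\<close>.\<close>
  define t where "t = min 1 ((e / Z) powr (1/q) / \<mu>)"
  have t: "0 < t" "t \<le> 1" using e Z \<mu> by (auto simp: t_def)
  define \<kappa> where "\<kappa> = real m * t * (2 * M + 1) ^ (m - 1)"
  have \<kappa>t: "\<kappa> = t * \<mu>" by (simp add: \<kappa>_def \<mu>_def)
  have \<kappa>0: "\<kappa> \<ge> 0" using t \<mu> by (simp add: \<kappa>t)
  have "t * \<mu> \<le> (e / Z) powr (1/q) / \<mu> * \<mu>" using \<mu> by (intro mult_right_mono) (auto simp: t_def)
  then have "\<kappa> \<le> (e / Z) powr (1/q)" using \<mu> by (simp add: \<kappa>t)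
  then have "\<kappa> powr q \<le> ((e / Z) powr (1/q)) powr q" using \<kappa>0 qs by (intro powr_mono2) auto
  then have "\<kappa> powr q \<le> e / Z" using e Z qs by (simp add: powr_powr)
  then have "\<kappa> powr q * Z \<le> e" using Z by (simp add: pos_le_divide_eq)
  moreover have "\<kappa> powr q * (2 powr q * (C + C)) \<le> \<kappa> powr q * Z" by (intro mult_left_mono) (auto simp: Z_def)
  ultimately have small: "\<bar>\<kappa>\<bar> powr q * (2 powr q * (C + C)) \<le> e" using \<kappa>0 by simp
  obtain \<phi> where \<phi>: "\<phi> \<in> Cc_infty" "bmo_norm (\<lambda>x. b x - \<phi> x) < ennreal t"
    using b t(1) unfolding CMO_def by blast
  have "continuous_on UNIV (pd_iter [] \<phi>)" using \<phi>(1) unfolding Cc_infty_def smooth_def by blast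
  then have cont: "continuous_on UNIV \<phi>" by simp
  have cpt: "compact (closure {x. \<phi> x \<noteq> 0})" using \<phi>(1) by (simp add: Cc_infty_def)
  have lp: "locally_integrable \<phi>" by (rule phi_locally_integrable[OF cont cpt])
  note [measurable] = locally_integrable_measurable[OF lp]
  have ld: "locally_integrable (\<lambda>x. b x - \<phi> x)"
    using li lp unfolding locally_integrable_def by auto
  have l1: "locally_integrable (\<lambda>x. b x / M)" by (rule locally_integrable_cmult[OF li])
  have l2: "locally_integrable (\<lambda>x. (b x - \<phi> x) / t)" by (rule locally_integrable_cmult[OF ld])
  have o1: "opb p v q u (osc_kernel \<alpha> m (\<lambda>x. b x / M)) C" by (rule C[OF l1 bmo_norm_scale[OF li M]])
  have o2: "opb p v q u (osc_kernel \<alpha> m (\<lambda>x. (b x - \<phi> x) / t)) C"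
    by (rule C[OF l2 bmo_norm_scale[OF ld t(1) less_imp_le[OF \<phi>(2)]]])
  have j1: "joint_meas (osc_kernel \<alpha> m (\<lambda>x. b x / M))" and j2: "joint_meas (osc_kernel \<alpha> m (\<lambda>x. (b x - \<phi> x) / t))"
    by (rule joint_meas_osc_kernel, measurable)+
  have "opb p v q u (\<lambda>x y. \<kappa> * (osc_kernel \<alpha> m (\<lambda>x. b x / M) x y + osc_kernel \<alpha> m (\<lambda>x. (b x - \<phi> x) / t) x y)) (\<bar>\<kappa>\<bar> powr q * (2 powr q * (C + C)))"
    by (rule opb_scale[OF opb_add[OF o1 o2 j1 j2] joint_meas_add[OF j1 j2]]) (use qs u0 in auto)
  moreover have "\<bar>comm_kernel \<alpha> m b x y - comm_kernel \<alpha> m \<phi> x y\<bar> \<le> \<bar>\<kappa> * (osc_kernel \<alpha> m (\<lambda>x. b x / M) x y + osc_kernel \<alpha> m (\<lambda>x. (b x - \<phi> x) / t) x y)\<bar>" for x y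
    using comm_kernel_diff_le[OF M(1) t m, of \<alpha> b x y \<phi>] unfolding \<kappa>_def by linarith
  ultimately have "opb p v q u (\<lambda>x y. comm_kernel \<alpha> m b x y - comm_kernel \<alpha> m \<phi> x y) e"
    by (rule opb_mono[OF _ _ small]) (use qs u0 in auto)
  moreover have "apx (comm_kernel \<alpha> m \<phi>)" by (rule apx_comm_kernel_phi[OF cont cpt])
  moreover have "joint_meas (comm_kernel \<alpha> m \<phi>)" by (rule joint_meas_comm_kernel) simp
  ultimately show "\<exists>k2 C. apx k2 \<and> joint_meas k2 \<and> C \<le> e \<and> opb p v q u (\<lambda>x y. comm_kernel \<alpha> m b x y - k2 x y) C" by blast
qed

end

theorem theorem1p6:
  fixes \<alpha> p q s \<delta> :: real and m :: nat
    and b u v :: "real^'n \<Rightarrow> real"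
  assumes "0 < \<alpha>" and "\<alpha> < real CARD('n)"
    and "1 < p" and "p \<le> q"
    and "m \<ge> 1"
    and "b \<in> CMO"
    and "p \<le> s" and "s \<le> q" and "\<delta> > 0"
    and "weight u" and "emeasure lebesgue {x. u x > 0} > 0"
    and "weight v" and "AE x in lebesgue. v x > 0"
    and "(SUP Q\<in>{Q. cube Q}.
            ennreal (measure lebesgue Q powr (\<alpha> / real CARD('n) + 1/q - 1/p))
          * lux_norm q ((real m + 1 / conj_exp s) * q + \<delta>) (\<lambda>x. u x powr (1/q)) Q
          * lux_norm (conj_exp p) ((real m + 1 / s) * conj_exp p + \<delta>) (\<lambda>x. v x powr (-1/p)) Q)
         < \<infinity>"
  shows "compact_op (frac_comm \<alpha> m b) p v q u"
proof -
  interpret two_weight \<alpha> p q s \<delta> m u v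
    by unfold_locales (use assms in auto)
  have b: "b \<in> BMO" "locally_integrable b" using assms(6) by (auto simp: CMO_def BMO_def)
  \<comment> \<open>A bound for the commutator itself places the images and their limit in
    \<open>wLp q u\<close>.\<close>
  obtain C where C: "opb p v q u (comm_kernel \<alpha> m b) C" using opb_comm_kernel[OF b(1)] by blast
  have "compact_op (int_op (comm_kernel \<alpha> m b)) p v q u"
    by (rule compact_op_of_finite_rank_approx[OF joint_meas_comm_kernel[OF locally_integrable_measurable[OF b(2)]] C])
       (use apx_comm_kernel[OF assms(6)] in \<open>auto simp: apx_def\<close>)
  moreover have "frac_comm \<alpha> m b = int_op (comm_kernel \<alpha> m b)" by (rule ext) (rule frac_comm_eq_int_op)
  ultimately show ?thesis by simp
qed

end
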